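(* Let $p$ be an odd prime, $n\ge p$, with $n_2>1$. Suppose that $\mathfrak t,\mathfrak a\in[\mathfrak t_n]$ have the same shape and set $\mathfrak s:=f(\mathfrak t)\in\mathrm{Std}(\mathrm{Par}_{n_2}^{\le2})$. Then for $i=1,2,\dots,n_2$ we have in $\mathsf{TL}_n^{\mathbb Q}$ $$\mathfrak L_if_{\mathfrak t\mathfrak a}=c_{\mathfrak s}(i)f_{\mathfrak t\mathfrak a}\qquad\text{and}\qquad f_{\mathfrak a\mathfrak t}\mathfrak L_i=c_{\mathfrak s}(i)f_{\mathfrak a\mathfrak t}.$$
   Context: **Algebra and tableaux.** $\mathsf{TL}_n^{\Bbbk}$ is the unital $\Bbbk$-algebra on $u_1,\dots,u_{n-1}$ with $u_i^2=2u_i$, $u_iu_ju_i=u_i$ for $|i-j|=1$, $u_iu_j=u_ju_i$ for $|i-j|>1$; equivalently, the algebra with basis non-crossing matchings of $n$ top and $n$ bottom points, $D_1D_2$ being $D_1$ on top of $D_2$ with loops replaced by $2$. $\mathrm{Par}_n^{\le2}$: partitions of $n$ with at most two columns; $\mathrm{Std}(\lambda)$: standard $\lambda$-tableaux; $\mathrm{Std}(\mathrm{Par}_n^{\le2})=\bigcup_\lambda\mathrm{Std}(\lambda)$. Content: $c_{\mathfrak t}(i)=c-r$ if $i$ is in row $r$, column $c$ of $\mathfrak t$. $\mathfrak s\trianglelefteq\mathfrak t$ means that for each $m$ the shape of $\mathfrak s$ restricted to entries $\le m$ is dominated by that of $\mathfrak t$ restricted to entries $\le m$. $\mathfrak S_n$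 acts on tableaux by permuting entries; $s_k=(k,k+1)$. **Idempotents.** $\Phi:\mathbb Q\mathfrak S_n\to\mathsf{TL}_n^{\mathbb Q}$ is the homomorphism $s_i\mapsto u_i-1$; $L_1=0$, $L_i=\sum_{j<i}(j,i)$, $\mathbf L_i=\Phi(L_i)$. With $\mathcal C$ the set of all contents $c_{\mathfrak s}(i)$ ($\mathfrak s\in\mathrm{Std}(\mathrm{Par}_n^{\le2})$, $1\le i\le n$), $\mathbb E_{\mathfrak t}=\prod_{c\in\mathcal C}\prod_{i:\,c\ne c_{\mathfrak t}(i)}\frac{\mathbf L_i-c}{c_{\mathfrak t}(i)-c}\in\mathsf{TL}_n^{\mathbb Q}$; these form a complete set of orthogonal primitive idempotents. **Basis $f_{\mathfrak s\mathfrak t}$.** For $\mathfrak t\in\mathrm{Std}(\lambda)$, $\lambda\in\mathrm{Par}_n^{\le2}$, the half-diagram $C_{\mathfrak t}$ has $n$ bottom points: going through $1,\dots,n$ in increasing order, raise a vertical line from $i$ if $i$ is in the first column of $\mathfrak t$, and join $i$ to the nearest still vacant line to its left if $i$ is in the second column. For $\mathfrak s,\mathfrak t\in\mathrm{Std}(\lambda)$, $C_{\mathfrak s\mathfrak t}$ is the diagram obtained by placing the horizontal reflection of $C_{\mathfrak s}$ on top of $C_{\mathfrak t}$. Put $f_{\mathfrak s\mathfrak t}:=\mathbb E_{\mathfrak s}C_{\mathfrak s\mathfrak t}\mathbb E_{\mathfrak t}$; these form a $\mathbb Q$-basis of $\mathsf{TL}_n^{\mathbb Q}$. **Classes.** $p$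 is an odd prime, $n\ge p$, and $n=(p-1)+n_1$, $n_1=pn_2+r_0$ with $0\le r_0<p$. $\mathfrak t_n$ is the one-column standard tableau with $n$ boxes; $[\mathfrak t_n]=\{\mathfrak s\in\mathrm{Std}(\mathrm{Par}_n^{\le2})\mid c_{\mathfrak s}(i)\equiv c_{\mathfrak t_n}(i)\bmod p\ \forall i\}$; $\mathbf e:=\sum_{\mathfrak s\in[\mathfrak t_n]}\mathbb E_{\mathfrak s}$, which lies in $\mathsf{TL}_n^{\mathbb Z_{(p)}}$ ($\mathbb Z_{(p)}$ is the localization of $\mathbb Z$ at $p$). **Blocks and $f$.** For $1\le j\le n_2$, $B_j=\{jp,jp+1,\dots,(j+1)p-1\}$. For $\mathfrak s\in[\mathfrak t_n]$ the numbers of each $B_j$ all lie in one column of $\mathfrak s$, and $f(\mathfrak s)\in\mathrm{Std}(\mathrm{Par}_{n_2}^{\le2})$ is the tableau having $j$ in the first column iff $B_j$ lies in the first column of $\mathfrak s$. **KLR elements.** For $1\le k<n$, $\psi_k\in\mathsf{TL}_n^{\mathbb Z_{(p)}}$ is the image under $\Phi$ of the KLR generator $\psi_k$ of $\mathbb Z_{(p)}\mathfrak S_n$ given by the Hu–Mathas isomorphism; it is the unique element of $\mathsf{TL}_n^{\mathbb Q}$ whose left multiplication is as follows. For $\mathfrak s,\mathfrak a\in\mathrm{Std}(\lambda)$, $\lambda\in\mathrm{Par}_n^{\le2}$, put $\mathfrak t=\mathfrak ss_k$, $r=c_{\mathfrak s}(k)-c_{\mathfrak s}(k+1)$, and let $\alpha=1$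 if $\mathfrak t$ is standard with $\mathfrak t\lhd\mathfrak s$, $\alpha=(r^2-1)/r^2$ if $\mathfrak t$ is standard with $\mathfrak t\rhd\mathfrak s$. Let $\beta=0$ if $\mathfrak t$ is not standard; otherwise $\beta=\frac{\alpha}{1-r}$ if $r\equiv0$, $\beta=\alpha r$ if $r\equiv1$, $\beta=\frac{\alpha r}{1-r}$ otherwise (congruences mod $p$). Then $\psi_kf_{\mathfrak s\mathfrak a}=\beta f_{\mathfrak t\mathfrak a}-\delta\frac1rf_{\mathfrak s\mathfrak a}$, where $\delta=1$ if $r\equiv0\bmod p$ and $\delta=0$ otherwise (the term $\beta f_{\mathfrak t\mathfrak a}$ is $0$ if $\mathfrak t$ is not standard). **$\mathbb U_i$, $\iota_{KLR}$, $\mathfrak L_i$.** For $1\le i<n_2$ let $I=(i+1)p-1$, $\Psi_j=\psi_{I-j+1}\psi_{I-j+3}\cdots\psi_{I+j-3}\psi_{I+j-1}$ ($j$ factors) for $1\le j\le p$, and $\mathbb U_i=\mathbf e\,\Psi_1\cdots\Psi_{p-1}\Psi_p\Psi_{p-1}\cdots\Psi_1\,\mathbf e$. Assume $n_2>1$. There is an injective (non-unital) algebra homomorphism $\iota_{KLR}:\mathsf{TL}_{n_2}^{\mathbb Z_{(p)}}\to\mathsf{TL}_n^{\mathbb Z_{(p)}}$ with $1\mapsto\mathbf e$, $u_i\mapsto\mathbb U_i$. The Jucys-Murphy elements of the small algebra, $\Phi(L_i)\in\mathsf{TL}_{n_2}^{\mathbb Z_{(p)}}$ (where now $\Phi:\mathbb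 Z_{(p)}\mathfrak S_{n_2}\to\mathsf{TL}_{n_2}^{\mathbb Z_{(p)}}$, $s_i\mapsto u_i-1$, and $L_1=0$, $L_i=\sum_{j<i}(j,i)$, $1\le i\le n_2$), are viewed in $\mathsf{TL}_n^{\mathbb Q}$ via $\iota_{KLR}$; the resulting elements are denoted $\mathfrak L_i$. Explicitly $\mathfrak L_1=0$, $\mathfrak L_{i+1}=(\mathbb U_i-\mathbf e)\mathfrak L_i(\mathbb U_i-\mathbf e)+\mathbb U_i-\mathbf e$. *)

theory Defs
  imports
    Complex_Main
    "HOL-Number_Theory.Cong"
    "HOL-Library.Disjoint_Sets"
    "HOL-Library.FuncSet"
    "HOL-Combinatorics.Transposition"
    "HOL-Algebra.Module"
begin

section \<open>The Temperley-Lieb algebra as a diagram algebra\<close>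

text \<open>
  A point is a pair (level, index): level 0 is the top row and level 1 the bottom row of a
  diagram. A diagram is the set of its strands, each strand being a two-element set of points.
\<close>

type_synonym point = "nat \<times> nat"
type_synonym diagram = "point set set"

definition points :: "nat \<Rightarrow> point set" where
  "points n = {0, 1} \<times> {1..n}"

text \<open>Position of a point when walking around the boundary: along the top row from left to
  right, then along the bottom row from right to left.\<close>

definition boundary_pos :: "nat \<Rightarrow> point \<Rightarrow> nat" where
  "boundary_pos n x = (if fst x = 0 then snd x else 2 * n + 1 - snd x)"

definition noncrossing :: "nat \<Rightarrow> diagram \<Rightarrow> bool" where
  "noncrossing n D \<longleftrightarrow> \<not> (\<exists>a b c d. {a, b} \<in> D \<and> {c, d} \<in> D \<and>
     boundary_pos n a < boundary_pos n c \<and> boundary_pos n c < boundary_pos n b \<and>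
     boundary_pos n b < boundary_pos n d)"

definition diagrams :: "nat \<Rightarrow> diagram set" where
  "diagrams n = {D. partition_on (points n) D \<and> (\<forall>e\<in>D. card e = 2) \<and> noncrossing n D}"

text \<open>Placing \<open>D1\<close> on top of \<open>D2\<close> gives a graph on three levels 0, 1, 2, where level 1 is the
  row along which the two diagrams are glued.\<close>

definition stacked :: "diagram \<Rightarrow> diagram \<Rightarrow> diagram" where
  "stacked D1 D2 = D1 \<union> (\<lambda>e. (\<lambda>(l, i). (Suc l, i)) ` e) ` D2"

definition connected_in :: "diagram \<Rightarrow> (point \<times> point) set" where
  "connected_in G = {(x, y). {x, y} \<in> G}\<^sup>*"

text \<open>Only connections between the outer levels 0 and 2 survive; level 2 becomes level 1.\<close>

definition glue :: "diagram \<Rightarrow> diagram \<Rightarrow> diagram" where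
  "glue D1 D2 = {{(l div 2, i), (l' div 2, i')} | l i l' i'.
     l \<in> {0, 2} \<and> l' \<in> {0, 2} \<and> (l, i) \<noteq> (l', i') \<and>
     ((l, i), (l', i')) \<in> connected_in (stacked D1 D2)}"

text \<open>Loops are the connected components lying entirely in the middle level.\<close>

definition loops :: "nat \<Rightarrow> diagram \<Rightarrow> diagram \<Rightarrow> nat" where
  "loops n D1 D2 = card {K. (\<exists>i\<in>{1..n}. K = connected_in (stacked D1 D2) `` {(1, i)}) \<and>
     K \<subseteq> {1} \<times> {1..n}}"

definition diag_elem :: "diagram \<Rightarrow> diagram \<Rightarrow> 'k::comm_ring_1" where
  "diag_elem D = (\<lambda>D'. if D' = D then 1 else 0)"

definition id_diagram :: "nat \<Rightarrow> diagram" where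
  "id_diagram n = {{(0, j), (1, j)} | j. j \<in> {1..n}}"

definition TL :: "nat \<Rightarrow> ('k::comm_ring_1, diagram \<Rightarrow> 'k) module" where
  "TL n = \<lparr>carrier = {x. \<forall>D. D \<notin> diagrams n \<longrightarrow> x D = 0},
     mult = (\<lambda>x y D. \<Sum>(D1, D2) \<in> {(D1, D2) \<in> diagrams n \<times> diagrams n. glue D1 D2 = D}.
               2 ^ loops n D1 D2 * x D1 * y D2),
     one = diag_elem (id_diagram n),
     zero = (\<lambda>D. 0),
     add = (\<lambda>x y D. x D + y D),
     smult = (\<lambda>c x D. c * x D)\<rparr>"

abbreviation TLQ :: "nat \<Rightarrow> (rat, diagram \<Rightarrow> rat) module" where
  "TLQ \<equiv> TL"

definition tl_u :: "nat \<Rightarrow> nat \<Rightarrow> diagram \<Rightarrow> 'k::comm_ring_1" where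
  "tl_u n i = diag_elem ({{(0, i), (0, Suc i)}, {(1, i), (1, Suc i)}} \<union>
     {{(0, j), (1, j)} | j. j \<in> {1..n} - {i, Suc i}})"

definition list_prod :: "('a, 'm) monoid_scheme \<Rightarrow> 'a list \<Rightarrow> 'a" where
  "list_prod R xs = foldr (\<lambda>x y. x \<otimes>\<^bsub>R\<^esub> y) xs \<one>\<^bsub>R\<^esub>"

section \<open>Two-column partitions and standard tableaux\<close>

text \<open>A partition is the function sending a row index \<open>r \<ge> 1\<close> to the length of row \<open>r\<close>
  (and 0 to 0). A tableau is the function sending an entry \<open>i\<close> to the box (row, column)
  containing it; rows and columns are counted from 1.\<close>

type_synonym shape = "nat \<Rightarrow> nat"
type_synonym tableau = "nat \<Rightarrow> nat \<times> nat"

definition Par2 :: "nat \<Rightarrow> shape set" where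
  "Par2 n = {\<mu>. \<mu> 0 = 0 \<and> (\<forall>r\<ge>1. \<mu> (Suc r) \<le> \<mu> r) \<and> finite {r. \<mu> r \<noteq> 0} \<and>
     (\<Sum>r | \<mu> r \<noteq> 0. \<mu> r) = n \<and> (\<forall>r. \<mu> r \<le> 2)}"

definition young_diagram :: "shape \<Rightarrow> (nat \<times> nat) set" where
  "young_diagram \<mu> = {(r, c). 1 \<le> r \<and> 1 \<le> c \<and> c \<le> \<mu> r}"

definition Std :: "nat \<Rightarrow> shape \<Rightarrow> tableau set" where
  "Std n \<mu> = {t \<in> extensional {1..n}. bij_betw t {1..n} (young_diagram \<mu>) \<and>
     (\<forall>i\<in>{1..n}. \<forall>j\<in>{1..n}.
        (fst (t i) = fst (t j) \<and> snd (t i) < snd (t j) \<longrightarrow> i < j) \<and>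
        (snd (t i) = snd (t j) \<and> fst (t i) < fst (t j) \<longrightarrow> i < j))}"

definition StdPar2 :: "nat \<Rightarrow> tableau set" where
  "StdPar2 n = (\<Union>\<mu>\<in>Par2 n. Std n \<mu>)"

definition content :: "tableau \<Rightarrow> nat \<Rightarrow> int" where
  "content t i = int (snd (t i)) - int (fst (t i))"

definition shape_upto :: "tableau \<Rightarrow> nat \<Rightarrow> shape" where
  "shape_upto t m = (\<lambda>r. card {i \<in> {1..m}. fst (t i) = r})"

definition dominated_by :: "shape \<Rightarrow> shape \<Rightarrow> bool" where
  "dominated_by \<mu> \<nu> \<longleftrightarrow> (\<forall>k. (\<Sum>r=1..k. \<mu> r) \<le> (\<Sum>r=1..k. \<nu> r))"

definition tab_le :: "nat \<Rightarrow> tableau \<Rightarrow> tableau \<Rightarrow> bool" where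
  "tab_le n s t \<longleftrightarrow> (\<forall>m\<in>{1..n}. dominated_by (shape_upto s m) (shape_upto t m))"

definition tab_less :: "nat \<Rightarrow> tableau \<Rightarrow> tableau \<Rightarrow> bool" where
  "tab_less n s t \<longleftrightarrow> tab_le n s t \<and> s \<noteq> t"

text \<open>The tableau obtained from \<open>s\<close> by exchanging the entries \<open>k\<close> and \<open>k + 1\<close>.\<close>

definition swap_tab :: "nat \<Rightarrow> tableau \<Rightarrow> tableau" where
  "swap_tab k s = s \<circ> Transposition.transpose k (Suc k)"

section \<open>Jucys-Murphy elements and seminormal idempotents\<close>

text \<open>The homomorphism from the group algebra of the symmetric group is determined by sending
  the simple transposition \<open>s_k\<close> to \<open>u_k - 1\<close>. We evaluate it on words in the simple
  transpositions, and on the transposition \<open>(j, i)\<close> through the word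
  \<open>s_j \<dots> s_{i-2} s_{i-1} s_{i-2} \<dots> s_j\<close>.\<close>

definition Phi_word :: "nat \<Rightarrow> nat list \<Rightarrow> diagram \<Rightarrow> rat" where
  "Phi_word n ks = list_prod (TLQ n) (map (\<lambda>k. tl_u n k \<ominus>\<^bsub>TLQ n\<^esub> \<one>\<^bsub>TLQ n\<^esub>) ks)"

definition transp_word :: "nat \<Rightarrow> nat \<Rightarrow> nat list" where
  "transp_word j i = [j..<i] @ rev [j..<i - 1]"

lemma transp_word_correct:
  assumes "j < i"
  shows "foldr (\<lambda>k g. Transposition.transpose k (Suc k) \<circ> g) (transp_word j i) id
           = Transposition.transpose j i"
proof -
  have comp: "foldr (\<lambda>k g. Transposition.transpose k (Suc k) \<circ> g) ks h
      = foldr (\<lambda>k g. Transposition.transpose k (Suc k) \<circ> g) ks id \<circ> h" for ks and h :: "nat \<Rightarrow> nat"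
    by (induction ks) (simp_all add: comp_assoc)
  have "foldr (\<lambda>k g. Transposition.transpose k (Suc k) \<circ> g) (transp_word j (Suc (j + d))) id
           = Transposition.transpose j (Suc (j + d))" for d
  proof (induction d arbitrary: j)
    case 0
    show ?case by (simp add: transp_word_def)
  next
    case (Suc d)
    have w: "transp_word j (Suc (j + Suc d)) = j # transp_word (Suc j) (Suc (Suc j + d)) @ [j]"
      by (simp add: transp_word_def upt_conv_Cons del: upt_Suc)
    have "Transposition.transpose j (Suc j) \<circ> Transposition.transpose (Suc j) (Suc (Suc j + d))
        \<circ> Transposition.transpose j (Suc j) = Transposition.transpose j (Suc (j + Suc d))"
      by (auto simp: fun_eq_iff Transposition.transpose_def)
    moreover have "foldr (\<lambda>k g. Transposition.transpose k (Suc k) \<circ> g) (j # ks @ [j]) id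
        = Transposition.transpose j (Suc j)
          \<circ> foldr (\<lambda>k g. Transposition.transpose k (Suc k) \<circ> g) ks id
          \<circ> Transposition.transpose j (Suc j)" for ks
      using comp[of ks "Transposition.transpose j (Suc j)"] by (simp add: fun_eq_iff)
    ultimately show ?case
      unfolding w using Suc.IH[of "Suc j"] by metis
  qed
  from this[of "i - Suc j"] assms show ?thesis by simp
qed

definition JM :: "nat \<Rightarrow> nat \<Rightarrow> diagram \<Rightarrow> rat" where
  "JM n i = (\<Oplus>\<^bsub>TLQ n\<^esub> j\<in>{1..<i}. Phi_word n (transp_word j i))"

definition contents :: "nat \<Rightarrow> int set" where
  "contents n = {content s i | s i. s \<in> StdPar2 n \<and> i \<in> {1..n}}"

definition idem :: "nat \<Rightarrow> tableau \<Rightarrow> diagram \<Rightarrow> rat" where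
  "idem n t = list_prod (TLQ n)
     [inverse (of_int (content t i - c)) \<odot>\<^bsub>TLQ n\<^esub>
        (JM n i \<ominus>\<^bsub>TLQ n\<^esub> (of_int c \<odot>\<^bsub>TLQ n\<^esub> \<one>\<^bsub>TLQ n\<^esub>)).
      c \<leftarrow> sorted_list_of_set (contents n), i \<leftarrow> [1..<Suc n], c \<noteq> content t i]"

section \<open>The seminormal basis\<close>

text \<open>State of the construction of the half-diagram of \<open>t\<close> after the entries \<open>1, \<dots>, m\<close>:
  the set of arcs, and the set of vertical lines that are still vacant.\<close>

fun half_diagram :: "tableau \<Rightarrow> nat \<Rightarrow> (nat \<times> nat) set \<times> nat set" where
  "half_diagram t 0 = ({}, {})"
| "half_diagram t (Suc m) = (let (A, V) = half_diagram t m in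
     if snd (t (Suc m)) = 1 then (A, insert (Suc m) V)
     else (insert (Max V, Suc m) A, V - {Max V}))"

text \<open>The vertical lines of the two half-diagrams are joined from left to right.\<close>

definition cup_cap :: "nat \<Rightarrow> tableau \<Rightarrow> tableau \<Rightarrow> diagram" where
  "cup_cap n s t =
     {{(0, i), (0, j)} | i j. (i, j) \<in> fst (half_diagram s n)} \<union>
     {{(1, i), (1, j)} | i j. (i, j) \<in> fst (half_diagram t n)} \<union>
     {{(0, i), (1, j)} | i j. (i, j) \<in> set (zip (sorted_list_of_set (snd (half_diagram s n)))
                                                (sorted_list_of_set (snd (half_diagram t n))))}"

definition f_basis :: "nat \<Rightarrow> tableau \<Rightarrow> tableau \<Rightarrow> diagram \<Rightarrow> rat" where
  "f_basis n s t = idem n s \<otimes>\<^bsub>TLQ n\<^esub> diag_elem (cup_cap n s t) \<otimes>\<^bsub>TLQ n\<^esub> idem n t"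

section \<open>The residue class of the one-column tableau\<close>

definition one_column :: "nat \<Rightarrow> tableau" where
  "one_column n = restrict (\<lambda>i. (i, 1)) {1..n}"

definition col_class :: "nat \<Rightarrow> nat \<Rightarrow> tableau set" where
  "col_class p n = {s \<in> StdPar2 n.
     \<forall>i\<in>{1..n}. [content s i = content (one_column n) i] (mod int p)}"

definition e_idem :: "nat \<Rightarrow> nat \<Rightarrow> diagram \<Rightarrow> rat" where
  "e_idem p n = (\<Oplus>\<^bsub>TLQ n\<^esub> s\<in>col_class p n. idem n s)"

definition block :: "nat \<Rightarrow> nat \<Rightarrow> nat set" where
  "block p j = {j * p..Suc j * p - 1}"

definition f_map :: "nat \<Rightarrow> nat \<Rightarrow> tableau \<Rightarrow> tableau" where
  "f_map p n2 s = (THE v. v \<in> StdPar2 n2 \<and>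
     (\<forall>j\<in>{1..n2}. snd (v j) = 1 \<longleftrightarrow> (\<forall>b\<in>block p j. snd (s b) = 1)))"

section \<open>KLR elements\<close>

definition axial_dist :: "tableau \<Rightarrow> nat \<Rightarrow> int" where
  "axial_dist s k = content s k - content s (Suc k)"

definition klr_alpha :: "nat \<Rightarrow> nat \<Rightarrow> tableau \<Rightarrow> rat" where
  "klr_alpha n k s = (let r = of_int (axial_dist s k); t = swap_tab k s in
     if tab_less n t s then 1
     else if tab_less n s t then (r\<^sup>2 - 1) / r\<^sup>2
     else 0)"

definition klr_beta :: "nat \<Rightarrow> nat \<Rightarrow> nat \<Rightarrow> tableau \<Rightarrow> rat" where
  "klr_beta p n k s = (let r = axial_dist s k; \<alpha> = klr_alpha n k s in
     if swap_tab k s \<notin> StdPar2 n then 0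
     else if [r = 0] (mod int p) then \<alpha> / (1 - of_int r)
     else if [r = 1] (mod int p) then \<alpha> * of_int r
     else \<alpha> * of_int r / (1 - of_int r))"

definition klr_delta :: "nat \<Rightarrow> nat \<Rightarrow> tableau \<Rightarrow> rat" where
  "klr_delta p k s = (if [axial_dist s k = 0] (mod int p) then 1 else 0)"

definition klr_psi :: "nat \<Rightarrow> nat \<Rightarrow> nat \<Rightarrow> diagram \<Rightarrow> rat" where
  "klr_psi p n k = (THE x. x \<in> carrier (TLQ n) \<and>
     (\<forall>\<mu>\<in>Par2 n. \<forall>s\<in>Std n \<mu>. \<forall>a\<in>Std n \<mu>.
        x \<otimes>\<^bsub>TLQ n\<^esub> f_basis n s a =
          (klr_beta p n k s \<odot>\<^bsub>TLQ n\<^esub> f_basis n (swap_tab k s) a) \<ominus>\<^bsub>TLQ n\<^esub>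
          ((klr_delta p k s * (1 / of_int (axial_dist s k))) \<odot>\<^bsub>TLQ n\<^esub> f_basis n s a)))"

section \<open>The elements generating the small Temperley-Lieb algebra\<close>

text \<open>With \<open>I = (i + 1) p - 1\<close>, the factors are \<open>\<psi>_{I-j+1}, \<psi>_{I-j+3}, \<dots>, \<psi>_{I+j-1}\<close>.\<close>

definition Psi :: "nat \<Rightarrow> nat \<Rightarrow> nat \<Rightarrow> nat \<Rightarrow> diagram \<Rightarrow> rat" where
  "Psi p n i j = (let I = (i + 1) * p - 1 in
     list_prod (TLQ n) (map (\<lambda>m. klr_psi p n (I + 1 + 2 * m - j)) [0..<j]))"

definition bigU :: "nat \<Rightarrow> nat \<Rightarrow> nat \<Rightarrow> diagram \<Rightarrow> rat" where
  "bigU p n i = list_prod (TLQ n)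
     ([e_idem p n] @ map (Psi p n i) [1..<Suc p] @ map (Psi p n i) (rev [1..<p]) @ [e_idem p n])"

text \<open>Images of the Jucys-Murphy elements of the small algebra under the homomorphism
  sending 1 to \<open>e_idem p n\<close> and \<open>u_i\<close> to \<open>bigU p n i\<close>. They are indexed from 1; the value at
  0 is a dummy.\<close>

primrec frakL :: "nat \<Rightarrow> nat \<Rightarrow> nat \<Rightarrow> diagram \<Rightarrow> rat" where
  "frakL p n 0 = \<zero>\<^bsub>TLQ n\<^esub>"
| "frakL p n (Suc i) = (if i = 0 then \<zero>\<^bsub>TLQ n\<^esub>
     else let S = bigU p n i \<ominus>\<^bsub>TLQ n\<^esub> e_idem p n in
       (S \<otimes>\<^bsub>TLQ n\<^esub> frakL p n i \<otimes>\<^bsub>TLQ n\<^esub> S) \<oplus>\<^bsub>TLQ n\<^esub> S)"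

end

theory Submission
  imports Defs
begin

text \<open>
  Entries in the first and second column are up and down steps, so standard two-column tableaux are
  lattice paths. The Temperley-Lieb relations alone yield, by Wenzl's recursion, matrix units indexed
  by pairs of paths of equal length and final height, on which the Jucys-Murphy elements act by
  contents; hence the diagonal ones are the idempotents, and \<open>f_basis\<close> is a nonzero
  multiple \<open>x(s) y(t)\<close> of the unit at \<open>(s, t)\<close>. That the diagram algebra satisfies these relations
  and is associative is read off from colourings of the strands with two colours.

  The paths in the class of the one-column tableau consist of constant blocks of \<open>p\<close> steps after
  \<open>p - 1\<close> up steps, up to an incomplete last block. On two adjacent different blocks the diamond
  of KLR generators turns one order of the blocks step by step into the other. All factors but the
  middle ones act by a nonzero multiple of a swap, and the product of all coefficients collapses: with
  \<open>m - 1\<close> the height of the block path before the two blocks, \<open>bigU\<close> acts with diagonal entries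
  \<open>(m + 1) / m\<close> and \<open>(m - 1) / m\<close>, as the generator \<open>u_i\<close> of the small algebra does. Therefore the elements
  \<open>frakL\<close> act by the contents of the block tableau.
\<close>

text \<open>\<open>TL n\<close> is a record on a carrier, where ring calculations are laborious. Its
  elements are therefore turned into left multiplications on the space of all functions on sets of
  strands; a right unit makes this faithful. The unit diagram becomes an idempotent operator that is
  not the identity, so the abstract algebra below has no unit and carries an explicit
  \<open>I\<close>. One small computation gives the content eigenvalues for the large and for the
  small algebra: if \<open>S\<close> is an involution at \<open>v\<close>,
  \<open>S v = v / d + x\<close>, and \<open>L\<close> has eigenvalues \<open>a\<close> at
  \<open>v\<close> and \<open>a + d\<close> at \<open>x\<close>, then \<open>S L S + S\<close> has
  eigenvalue \<open>a + d\<close> at \<open>v\<close>. Off-diagonal coefficients need not be known;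
  for the diamonds only the product of two opposite ones enters, to make \<open>S\<close> an
  involution. On the flanks of a diamond opposite coefficients at one height multiply to 1 except in
  rows 1 and p - 1, where the KLR normalisation drops a denominator; this is where p(m + 1), p(m -
  1) and p m arise. Right multiplication is not calculated separately: it is read off from the left
  action on all diagonal units, which is zero outside the class because of the factor
  \<open>e_idem\<close>.\<close>

section \<open>Algebras over the rationals without a distinguished unit\<close>

class rat_algebra = Rings.ring +
  fixes scl :: "rat \<Rightarrow> 'a \<Rightarrow> 'a" (infixr "*\<^sub>Q" 75)
  assumes scl_add_right: "c *\<^sub>Q (x + y) = c *\<^sub>Q x + c *\<^sub>Q y"
    and scl_add_left: "(c + d) *\<^sub>Q x = c *\<^sub>Q x + d *\<^sub>Q x"
    and scl_scl [simp]: "c *\<^sub>Q d *\<^sub>Q x = (c * d) *\<^sub>Q x"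
    and scl_one [simp]: "1 *\<^sub>Q x = x"
    and scl_mult_left [simp]: "(c *\<^sub>Q x) * y = c *\<^sub>Q (x * y)"
    and scl_mult_right [simp]: "x * (c *\<^sub>Q y) = c *\<^sub>Q (x * y)"
begin

lemma scl_zero_left [simp]: "0 *\<^sub>Q x = 0"
  using scl_add_left[of 0 0 x] by simp

lemma scl_zero_right [simp]: "c *\<^sub>Q 0 = 0"
  using scl_add_right[of c 0 0] by simp

lemma scl_minus_left: "(- c) *\<^sub>Q x = - (c *\<^sub>Q x)"
  using scl_add_left[of c "- c" x] by (simp add: eq_neg_iff_add_eq_0 add.commute)

lemma scl_minus_right: "c *\<^sub>Q (- x) = - (c *\<^sub>Q x)"
  using scl_add_right[of c x "- x"] by (simp add: eq_neg_iff_add_eq_0 add.commute)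

lemma scl_diff_left: "(c - d) *\<^sub>Q x = c *\<^sub>Q x - d *\<^sub>Q x"
  using scl_add_left[of c "- d" x] by (simp add: scl_minus_left)

lemma scl_diff_right: "c *\<^sub>Q (x - y) = c *\<^sub>Q x - c *\<^sub>Q y"
  using scl_add_right[of c x "- y"] by (simp add: scl_minus_right)

lemma scl_sum_right: "c *\<^sub>Q (\<Sum>i\<in>A. f i) = (\<Sum>i\<in>A. c *\<^sub>Q f i)"
  by (induction A rule: infinite_finite_induct) (simp_all add: scl_add_right)

lemma scl_cancel: "c \<noteq> 0 \<Longrightarrow> c *\<^sub>Q x = c *\<^sub>Q y \<Longrightarrow> x = y"
proof -
  assume c: "c \<noteq> 0" and h: "c *\<^sub>Q x = c *\<^sub>Q y"
  have "inverse c *\<^sub>Q c *\<^sub>Q x = inverse c *\<^sub>Q c *\<^sub>Q y" using h by metis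
  then show "x = y" using c by simp
qed

end

lemma comm3:
  fixes x y z a :: "'a::semigroup_mult"
  assumes "x * a = a * x" and "y * a = a * y" and "z * a = a * z"
  shows "(x * y * z) * a = a * (x * y * z)"
  by (metis assms mult.assoc)

text \<open>Rewriting \<open>L * (S * v)\<close> as \<open>(a + d) S v - v\<close> eliminates
  \<open>x\<close>, so the action of \<open>S\<close> on \<open>x\<close> never enters. This is the
  inductive step for the recursion s L s + s of Jucys-Murphy elements, with \<open>d\<close> the
  difference of the contents of two consecutive entries.\<close>

lemma jm_step:
  fixes S L v x :: "'a::rat_algebra"
  assumes "S * (S * v) = v" and "S * v = (1 / d) *\<^sub>Q v + x" and "L * v = a *\<^sub>Q v"
    and "L * x = (a + d) *\<^sub>Q x" and "d \<noteq> 0"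
  shows "(S * L * S + S) * v = (a + d) *\<^sub>Q v"
proof -
  have x: "x = S * v - (1 / d) *\<^sub>Q v" using assms(2) by simp
  have "L * (S * v) = (a / d) *\<^sub>Q v + (a + d) *\<^sub>Q x"
    by (simp add: assms(2,3,4) distrib_left)
  also have "\<dots> = (a / d) *\<^sub>Q v + (a + d) *\<^sub>Q (S * v) - ((a + d) / d) *\<^sub>Q v"
    by (simp add: x scl_diff_right)
  also have "\<dots> = (a + d) *\<^sub>Q (S * v) - v"
  proof -
    have "(a + d) / d = a / d + 1" using assms(5) by (simp add: field_simps)
    then show ?thesis by (simp add: scl_add_left algebra_simps)
  qed
  finally have "S * (L * (S * v)) = (a + d) *\<^sub>Q v - S * v"
    by (simp add: right_diff_distrib assms(1))
  then show ?thesis by (simp add: distrib_right mult.assoc)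
qed

section \<open>Two-row lattice paths\<close>

text \<open>A path lists its steps with the most recent one first, so that truncation is \<^const>\<open>tl\<close>;
  \<^const>\<open>True\<close> is an up step (an entry in the first column of a tableau).\<close>

primrec ht :: "bool list \<Rightarrow> int" where
  "ht [] = 0"
| "ht (b # p) = (if b then 1 else -1) + ht p"

primrec valid :: "bool list \<Rightarrow> bool" where
  "valid [] = True"
| "valid (b # p) = (valid p \<and> 0 \<le> ht (b # p))"

definition Paths :: "nat \<Rightarrow> bool list set" where
  "Paths n = {p. valid p \<and> length p = n}"

text \<open>The dimension of the irreducible sl2-module of highest weight \<open>h\<close>;
  equivalently the Chebyshev value in Wenzl's recursion at loop value 2.\<close>

definition w :: "int \<Rightarrow> rat" where
  "w h = of_int h + 1"

lemma w_pos: "0 \<le> h \<Longrightarrow> w h > 0"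
  by (simp add: w_def add_nonneg_pos)

lemma w_neq_0 [simp]: "0 \<le> h \<Longrightarrow> w h \<noteq> 0"
  using w_pos[of h] by simp

lemma ht_append: "ht (xs @ ys) = ht xs + ht ys"
  by (induction xs) auto

lemma ht_nonneg [simp]: "valid p \<Longrightarrow> 0 \<le> ht p"
  by (cases p) auto

lemma ht_le_length: "ht p \<le> int (length p)"
  by (induction p) auto

lemma even_length_ht: "even (int (length p) - ht p)"
proof (induction p)
  case (Cons b p)
  then show ?case by (cases b) (auto simp: algebra_simps)
qed simp

lemma ht_eq_length: "ht p = int (length p) \<longleftrightarrow> p = replicate (length p) True"
proof (induction p)
  case (Cons b p)
  then show ?case using ht_le_length[of p] by (cases b) auto
qed simp

lemma valid_appendD: "valid (xs @ ys) \<Longrightarrow> valid ys"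
  by (induction xs) auto

lemma valid_append_cong: "valid (xs @ p) \<Longrightarrow> valid q \<Longrightarrow> ht p = ht q \<Longrightarrow> valid (xs @ q)"
  by (induction xs) (auto simp: ht_append)

lemma finite_Paths [simp]: "finite (Paths n)"
proof (rule finite_subset)
  show "Paths n \<subseteq> {p. set p \<subseteq> UNIV \<and> length p = n}" by (auto simp: Paths_def)
  show "finite {p :: bool list. set p \<subseteq> UNIV \<and> length p = n}"
    by (rule finite_lists_length_eq) simp
qed

text \<open>Read in time: \<open>m\<close> short peaks on the ground, then \<open>k\<close> up
  steps. These paths have the least area for their length and height; their half-diagrams have the
  arcs {1,2}, {3,4}, ..., and all other paths arise from them by turning valleys into peaks.\<close>

definition low :: "nat \<Rightarrow> nat \<Rightarrow> bool list" where
  "low m k = replicate k True @ concat (replicate m [False, True])"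

lemma low_0 [simp]: "low 0 k = replicate k True"
  by (simp add: low_def)

lemma ht_replicate [simp]: "ht (replicate k b) = (if b then int k else - int k)"
  by (induction k) auto

lemma ht_low [simp]: "ht (low m k) = int k"
proof -
  have "ht (concat (replicate m [False, True])) = 0" by (induction m) auto
  then show ?thesis by (simp add: low_def ht_append)
qed

lemma length_low [simp]: "length (low m k) = k + 2 * m"
  by (induction m) (auto simp: low_def)

lemma valid_low [simp]: "valid (low m k)"
proof -
  have a: "valid (concat (replicate m [False, True])) \<and> ht (concat (replicate m [False, True])) = 0"
    by (induction m) auto
  then have "valid (replicate k True @ q)" if "valid q" for q
    using that by (induction k) (auto simp: ht_append)
  then show ?thesis using a by (auto simp: low_def)
qed

text \<open>A representative of height \<open>k\<close> through which matrix units are routed. The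
  choice is arbitrary, as \<open>Jp\<close> shows. Because of \<open>nat\<close> and
  \<open>div\<close> it is meaningful under the assumptions of the lemma \<open>can\<close>.\<close>

definition can :: "nat \<Rightarrow> int \<Rightarrow> bool list" where
  "can l k = low ((l - nat k) div 2) (nat k)"

lemma can:
  assumes "0 \<le> k" and "k \<le> int l" and "even (int l - k)"
  shows "can l k \<in> Paths l" and "ht (can l k) = k"
proof -
  have "nat k + 2 * ((l - nat k) div 2) = l"
  proof -
    have "even (l - nat k)" using assms by (metis even_diff_nat nat_0_le even_of_nat_iff int_ops(6) nat_le_iff of_nat_diff)
    then show ?thesis using assms by (auto simp: nat_le_iff)
  qed
  then show "can l k \<in> Paths l" by (simp add: can_def Paths_def)
  show "ht (can l k) = k" using assms by (simp add: can_def)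
qed

lemma can_Cons:
  assumes "b # p \<in> Paths (Suc n)" and "ht (b # p) < int n"
  shows "can (n - 1) (ht (b # p)) \<in> Paths (n - 1)" and "ht (can (n - 1) (ht (b # p))) = ht (b # p)"
    and "1 \<le> n"
proof -
  have 1: "0 \<le> ht (b # p)" "length (b # p) = Suc n" using assms(1) ht_nonneg unfolding Paths_def by blast+
  show n: "1 \<le> n" using 1 assms(2) by linarith
  have ev: "even (int (Suc n) - ht (b # p))" using even_length_ht[of "b # p"] 1(2) by metis
  have 2: "even (int (n - 1) - ht (b # p))"
  proof -
    have "int (Suc n) - ht (b # p) = (int (n - 1) - ht (b # p)) + 2" using n by (simp add: of_nat_diff)
    then show ?thesis using ev by (metis dvd_add_left_iff dvd_refl)
  qed
  have 3: "ht (b # p) \<le> int (n - 1)" using assms(2) n by (simp add: of_nat_diff)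
  show "can (n - 1) (ht (b # p)) \<in> Paths (n - 1)" "ht (can (n - 1) (ht (b # p))) = ht (b # p)"
    using can[OF 1(1) 3 2] by auto
qed

text \<open>This says that the corresponding standard tableaux have the same shape.\<close>

definition pr :: "nat \<Rightarrow> bool list \<Rightarrow> bool list \<Rightarrow> bool" where
  "pr n p q \<longleftrightarrow> p \<in> Paths n \<and> q \<in> Paths n \<and> ht p = ht q"

lemma pr_sym: "pr n p q \<Longrightarrow> pr n q p"
  by (simp add: pr_def)

lemma pr_refl: "p \<in> Paths n \<Longrightarrow> pr n p p"
  by (simp add: pr_def)

lemma pr_trans: "pr n p q \<Longrightarrow> pr n q r \<Longrightarrow> pr n p r"
  by (simp add: pr_def)

definition ext :: "bool list \<Rightarrow> bool set" where
  "ext p = {b. 0 \<le> ht (b # p)}"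

lemma finite_ext [simp]: "finite (ext p)"
  by (rule finite_subset[OF subset_UNIV]) simp

lemma ext_cong: "ht p = ht q \<Longrightarrow> ext p = ext q"
  by (simp add: ext_def)

lemma True_ext: "valid p \<Longrightarrow> True \<in> ext p"
  by (simp add: ext_def)

lemma pr_ext: "pr n p q \<Longrightarrow> b \<in> ext p \<Longrightarrow> pr (Suc n) (b # p) (b # q)"
  by (auto simp: pr_def Paths_def ext_def)

text \<open>Length and height have equal parity, so a height of at least \<open>n\<close> is already
  \<open>n + 1\<close>. The top height is attained by a single path, which is why the units below
  are defined by just two cases.\<close>

lemma top_path:
  assumes "p \<in> Paths (Suc n)" and "\<not> ht p < int n"
  shows "p = replicate (Suc n) True"
proof -
  have l: "length p = Suc n" using assms(1) by (simp add: Paths_def)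
  have "even (int (Suc n) - ht p)" "ht p \<le> int (Suc n)"
    using even_length_ht[of p] ht_le_length[of p] unfolding l .
  then have "ht p = int (length p)" using assms(2) l by presburger
  then show ?thesis using ht_eq_length[of p] l by simp
qed

section \<open>Wenzl's matrix units from the Temperley-Lieb relations\<close>

text \<open>\<open>I\<close> is a unit for the generators but not for the whole ring: in the
  intended model the algebra is a corner of a larger ring of operators.\<close>

locale tl_relations =
  fixes N :: nat and u :: "nat \<Rightarrow> 'a::rat_algebra" and I :: 'a
  assumes I_I [simp]: "I * I = I"
    and I_u [simp]: "1 \<le> k \<Longrightarrow> k < N \<Longrightarrow> I * u k = u k"
    and u_I [simp]: "1 \<le> k \<Longrightarrow> k < N \<Longrightarrow> u k * I = u k"
    and u_u: "1 \<le> k \<Longrightarrow> k < N \<Longrightarrow> u k * u k = 2 *\<^sub>Q u k"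
    and u_up: "1 \<le> k \<Longrightarrow> Suc k < N \<Longrightarrow> u k * (u (Suc k) * u k) = u k"
    and u_down: "1 \<le> k \<Longrightarrow> Suc k < N \<Longrightarrow> u (Suc k) * (u k * u (Suc k)) = u (Suc k)"
    and u_comm: "1 \<le> k \<Longrightarrow> Suc k < l \<Longrightarrow> l < N \<Longrightarrow> u k * u l = u l * u k"
begin

text \<open>Matrix units for the seminormal form, following Wenzl: below the top height, a unit of
  length \<open>n + 1\<close> is obtained by routing two units of length \<open>n\<close> through \<open>u\<^sub>n\<close>.\<close>

primrec E :: "nat \<Rightarrow> bool list \<Rightarrow> bool list \<Rightarrow> 'a" where
  "E 0 p q = I"
| "E (Suc n) p q = (let k = ht p; r = can (n - 1) k in
     if k < int n then (w k / w (ht (tl p))) *\<^sub>Q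
       (E n (tl p) ((\<not> hd p) # r) * u n * E n ((\<not> hd q) # r) (tl q))
     else E n (tl p) (tl p) - (if n = 0 then 0 else
       (w (k - 2) / w (k - 1)) *\<^sub>Q (E n (tl p) (tl p) * u n * E n (tl p) (tl p))))"

definition e :: "bool list \<Rightarrow> bool list \<Rightarrow> 'a" where
  "e p q = E (length p) p q"

lemma e_Nil [simp]: "e [] [] = I"
  by (simp add: e_def)

lemma e_low:
  assumes "pr (Suc n) (b # p) (c # q)" and "ht (b # p) < int n"
  shows "e (b # p) (c # q) = (w (ht (b # p)) / w (ht p)) *\<^sub>Q
    (e p ((\<not> b) # can (n - 1) (ht (b # p))) * u n * e ((\<not> c) # can (n - 1) (ht (b # p))) q)"
proof -
  have 1: "can (n - 1) (ht (b # p)) \<in> Paths (n - 1)" "1 \<le> n"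
    using can_Cons[of b p n] assms unfolding pr_def by auto
  have 2: "length p = n" "length q = n" using assms(1) by (auto simp: pr_def Paths_def)
  have 3: "length (can (n - 1) (ht (b # p))) = n - 1" using 1 by (simp add: Paths_def)
  show ?thesis unfolding e_def using assms(2) 1(2) 2 3 by (simp add: Let_def)
qed

text \<open>The correction term of the recursion is itself the diagonal unit at
  \<open>False # p\<close>, as \<open>can\<close> picks the all-up path there. So the top unit, the
  Jones-Wenzl projection, is what the truncated unit leaves once its only other extension is
  removed. For \<open>n = 0\<close> there is no other extension.\<close>

lemma e_top:
  assumes "p = replicate n True"
  shows "e (True # p) (True # p) = e p p - (if n = 0 then 0 else e (False # p) (False # p))"
proof (cases n)
  case 0
  then show ?thesis using assms by (simp add: e_def)
next
  case (Suc m)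
  have pr: "pr (Suc n) (False # p) (False # p)"
    unfolding pr_def Paths_def using assms Suc by (auto intro!: valid_low[of 0 "Suc m", simplified])
  have c: "can m (int m) = replicate m True" by (simp add: can_def)
  have "e (False # p) (False # p) = (w (int n - 1) / w (int n)) *\<^sub>Q (e p p * u n * e p p)"
    using e_low[OF pr] assms Suc c by simp
  moreover have "e (True # p) (True # p)
      = e p p - (w (int n - 1) / w (int n)) *\<^sub>Q (e p p * u n * e p p)"
    using assms Suc by (simp add: e_def Let_def)
  ultimately show ?thesis using Suc by simp
qed

text \<open>Five properties obtained by one induction on the length: multiplication of units
  (\<open>Mp\<close>), splitting over the next step (\<open>Tp\<close>), commutation with later
  generators (\<open>Cp\<close>), the partial trace against the next generator (\<open>Ep\<close>)
  and freedom of the routing path (\<open>Jp\<close>). \<open>Cp\<close> holds outright;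
  \<open>Jp n\<close> comes from \<open>Mp (Suc n)\<close> and \<open>Tp n\<close> and feeds the
  next instances of the other three.\<close>

definition Mp :: "nat \<Rightarrow> bool" where
  "Mp n \<longleftrightarrow> (\<forall>p q r s. pr n p q \<longrightarrow> pr n r s \<longrightarrow> e p q * e r s = (if q = r then e p s else 0))"

definition Tp :: "nat \<Rightarrow> bool" where
  "Tp n \<longleftrightarrow> (\<forall>p q. pr n p q \<longrightarrow> e p q = (\<Sum>b\<in>ext p. e (b # p) (b # q)))"

definition Cp :: "nat \<Rightarrow> bool" where
  "Cp n \<longleftrightarrow> (\<forall>p q m. pr n p q \<longrightarrow> n < m \<longrightarrow> m < N \<longrightarrow> e p q * u m = u m * e p q)"

definition Ep :: "nat \<Rightarrow> bool" where
  "Ep n \<longleftrightarrow> (\<forall>b c p q. pr (Suc n) (b # p) (c # q) \<longrightarrow> Suc n < N \<longrightarrow>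
     u (Suc n) * (e (b # p) (c # q) * u (Suc n)) =
       (if b = c then (w (ht (b # p)) / w (ht p)) *\<^sub>Q (e p q * u (Suc n)) else 0))"

definition Jp :: "nat \<Rightarrow> bool" where
  "Jp n \<longleftrightarrow> (\<forall>b c p q r. pr (Suc (Suc n)) (b # p) (c # q) \<longrightarrow> r \<in> Paths n \<longrightarrow> ht r = ht (b # p) \<longrightarrow>
     e (b # p) (c # q) = (w (ht r) / w (ht p)) *\<^sub>Q
       (e p ((\<not> b) # r) * (u (Suc n) * e ((\<not> c) # r) q)))"

lemma MpD: "Mp n \<Longrightarrow> pr n p q \<Longrightarrow> pr n r s \<Longrightarrow> e p q * e r s = (if q = r then e p s else 0)"
  unfolding Mp_def by blast

lemma MpD': "Mp n \<Longrightarrow> pr n p q \<Longrightarrow> pr n r s \<Longrightarrow> e p q * (e r s * x) = (if q = r then e p s * x else 0)"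
  using MpD[of n p q r s] by (metis mult.assoc mult_zero_left)

lemma TpD: "Tp n \<Longrightarrow> pr n p q \<Longrightarrow> e p q = (\<Sum>b\<in>ext p. e (b # p) (b # q))"
  unfolding Tp_def by blast

lemma CpD: "Cp n \<Longrightarrow> pr n p q \<Longrightarrow> n < m \<Longrightarrow> m < N \<Longrightarrow> e p q * u m = u m * e p q"
  unfolding Cp_def by blast

lemma EpD: "Ep n \<Longrightarrow> pr (Suc n) (b # p) (c # q) \<Longrightarrow> Suc n < N \<Longrightarrow>
     u (Suc n) * (e (b # p) (c # q) * u (Suc n)) =
       (if b = c then (w (ht (b # p)) / w (ht p)) *\<^sub>Q (e p q * u (Suc n)) else 0)"
  unfolding Ep_def by blast

lemma JpD: "Jp n \<Longrightarrow> pr (Suc (Suc n)) (b # p) (c # q) \<Longrightarrow> r \<in> Paths n \<Longrightarrow> ht r = ht (b # p) \<Longrightarrow>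
     e (b # p) (c # q) = (w (ht r) / w (ht p)) *\<^sub>Q
       (e p ((\<not> b) # r) * (u (Suc n) * e ((\<not> c) # r) q))"
  unfolding Jp_def by blast

text \<open>Once the shorter unit is split by one step, a single summand matches.\<close>

lemma trunc_left:
  assumes "Mp (Suc n)" and "Tp n" and "pr n r r0" and "pr (Suc n) (y # s) q"
  shows "e r r0 * e (y # s) q = (if r0 = s then e (y # r) q else 0)"
proof -
  have "e r r0 * e (y # s) q = (\<Sum>b\<in>ext r. e (b # r) (b # r0) * e (y # s) q)"
    unfolding TpD[OF assms(2,3)] by (rule sum_distrib_right)
  also have "\<dots> = (\<Sum>b\<in>ext r. if b = y then (if r0 = s then e (y # r) q else 0) else 0)"
    by (rule sum.cong) (auto simp: MpD[OF assms(1) pr_ext[OF assms(3)] assms(4)])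
  also have "\<dots> = (if r0 = s then e (y # r) q else 0)"
    using assms(3,4) by (auto simp: sum.delta ext_def pr_def Paths_def)
  finally show ?thesis .
qed

lemma trunc_right:
  assumes "Mp (Suc n)" and "Tp n" and "pr n r r0" and "pr (Suc n) q (y # s)"
  shows "e q (y # s) * e r r0 = (if s = r then e q (y # r0) else 0)"
proof -
  have "e q (y # s) * e r r0 = (\<Sum>b\<in>ext r. e q (y # s) * e (b # r) (b # r0))"
    unfolding TpD[OF assms(2,3)] by (rule sum_distrib_left)
  also have "\<dots> = (\<Sum>b\<in>ext r. if b = y then (if s = r then e q (y # r0) else 0) else 0)"
    by (rule sum.cong) (auto simp: MpD[OF assms(1,4) pr_ext[OF assms(3)]])
  also have "\<dots> = (if s = r then e q (y # r0) else 0)"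
    using assms(3,4) by (auto simp: sum.delta ext_def pr_def Paths_def)
  finally show ?thesis .
qed

lemma pr_flip_left: "pr (Suc n) (b # p) (c # q) \<Longrightarrow> r \<in> Paths m \<Longrightarrow> n = Suc m \<Longrightarrow> ht r = ht (b # p)
   \<Longrightarrow> pr n p ((\<not> b) # r)"
  using ht_nonneg[of p] by (cases b) (auto simp: pr_def Paths_def simp del: ht_nonneg)

lemma pr_flip_right: "pr (Suc n) (b # p) (c # q) \<Longrightarrow> r \<in> Paths m \<Longrightarrow> n = Suc m \<Longrightarrow> ht r = ht (b # p)
   \<Longrightarrow> pr n ((\<not> c) # r) q"
  using ht_nonneg[of p] ht_nonneg[of q]
  by (cases b; cases c) (auto simp: pr_def Paths_def simp del: ht_nonneg)

text \<open>A unit between two routing paths of equal length and height commutes with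
  \<open>u (Suc n)\<close>. To the left of the generator it changes the routing path from
  \<open>r\<close> to \<open>r0\<close>, to the right from \<open>r0\<close> to
  \<open>r\<close>.\<close>

lemma Jp_step:
  assumes M: "Mp (Suc n)" and T: "Tp n" and C: "Cp n" and N: "Suc n < N"
  shows "Jp n"
  unfolding Jp_def
proof (intro allI impI)
  fix b c p q r
  assume a: "pr (Suc (Suc n)) (b # p) (c # q)" "r \<in> Paths n" "ht r = ht (b # p)"
  have lt: "ht (b # p) < int (Suc n)"
    using a(2,3) ht_le_length[of r] by (simp add: Paths_def)
  define r0 where "r0 = can n (ht (b # p))"
  have bp: "b # p \<in> Paths (Suc (Suc n))" using a(1) by (simp add: pr_def)
  have r0: "r0 \<in> Paths n" "ht r0 = ht (b # p)"
    using can_Cons[OF bp lt] by (simp_all add: r0_def)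
  have rr: "pr n r r0" using a r0 by (simp add: pr_def)
  have pl: "pr (Suc n) p ((\<not> b) # r)" "pr (Suc n) ((\<not> c) # r0) q"
    using pr_flip_left[OF a(1) a(2)] a(3) pr_flip_right[OF a(1) r0(1)] r0(2) by auto
  have X: "e p ((\<not> b) # r) * e r r0 = e p ((\<not> b) # r0)"
    using trunc_right[OF M T rr pl(1)] by simp
  have Y: "e r r0 * e ((\<not> c) # r0) q = e ((\<not> c) # r) q"
    using trunc_left[OF M T rr pl(2)] by simp
  have "e p ((\<not> b) # r0) * (u (Suc n) * e ((\<not> c) # r0) q)
      = e p ((\<not> b) # r) * ((e r r0 * u (Suc n)) * e ((\<not> c) # r0) q)"
    by (simp add: X[symmetric] mult.assoc)
  also have "\<dots> = e p ((\<not> b) # r) * (u (Suc n) * (e r r0 * e ((\<not> c) # r0) q))"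
    using CpD[OF C rr _ N] by (simp add: mult.assoc)
  finally show "e (b # p) (c # q) = (w (ht r) / w (ht p)) *\<^sub>Q
       (e p ((\<not> b) # r) * (u (Suc n) * e ((\<not> c) # r) q))"
    using e_low[OF a(1) lt] Y a(3) by (simp add: r0_def mult.assoc)
qed

text \<open>A unit of length \<open>n\<close> involves only generators of index below
  \<open>n\<close>, and these are all far from \<open>m\<close>.\<close>

lemma Cp: "Cp n"
proof (induction n)
  case 0
  then show ?case by (auto simp: Cp_def pr_def Paths_def)
next
  case (Suc n)
  have L: "e (b # p) (c # q) * u m = u m * e (b # p) (c # q)"
    if a: "pr (Suc n) (b # p) (c # q)" and m: "Suc n < m" "m < N" and lt: "ht (b # p) < int n" for b p c q m
  proof -
    define r where "r = can (n - 1) (ht (b # p))"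
    have bp: "b # p \<in> Paths (Suc n)" using a by (simp add: pr_def)
    obtain n' where n: "n = Suc n'" using can_Cons(3)[OF bp lt] by (cases n) auto
    have r: "r \<in> Paths n'" "ht r = ht (b # p)" using can_Cons[OF bp lt] by (simp_all add: r_def n)
    have "e p ((\<not> b) # r) * u m = u m * e p ((\<not> b) # r)"
      by (rule CpD[OF Suc pr_flip_left[OF a r(1) n r(2)]]) (use m in auto)
    moreover have "e ((\<not> c) # r) q * u m = u m * e ((\<not> c) # r) q"
      by (rule CpD[OF Suc pr_flip_right[OF a r(1) n r(2)]]) (use m in auto)
    moreover have "u n * u m = u m * u n" using u_comm[of n m] m n by simp
    ultimately show ?thesis
      unfolding e_low[OF a lt] r_def[symmetric] scl_mult_left scl_mult_right
      by (simp only: comm3)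
  qed
  show ?case unfolding Cp_def
  proof (intro allI impI)
    fix p q m assume a: "pr (Suc n) p q" and m: "Suc n < m" "m < N"
    obtain b p' c q' where pq: "p = b # p'" "q = c # q'"
      using a unfolding pr_def Paths_def by (cases p; cases q) auto
    show "e p q * u m = u m * e p q"
    proof (cases "ht p < int n")
      case True
      then show ?thesis using L a m unfolding pq by blast
    next
      case False
      have "p = replicate (Suc n) True" "q = replicate (Suc n) True"
        using top_path[of p n] top_path[of q n] a False by (auto simp: pr_def)
      then have pt: "p = True # replicate n True" "q = True # replicate n True" by auto
      have "e (replicate n True) (replicate n True) * u m = u m * e (replicate n True) (replicate n True)"
        by (rule CpD[OF Suc]) (use m in \<open>auto simp: pr_def Paths_def intro!: valid_low[of 0 n, simplified]\<close>)
      moreover have "n \<noteq> 0 \<Longrightarrow> e (False # replicate n True) (False # replicate n True) * u m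
        = u m * e (False # replicate n True) (False # replicate n True)"
        by (rule L) (use m in \<open>auto simp: pr_def Paths_def intro!: valid_low[of 0 n, simplified]\<close>)
      ultimately show ?thesis
        unfolding pt e_top[OF refl] by (simp add: left_diff_distrib right_diff_distrib)
    qed
  qed
qed

lemma not_low:
  assumes "pr (Suc n) (b # p) (c # q)" and "\<not> ht (b # p) < int n"
  shows "b" and "c" and "p = replicate n True" and "q = replicate n True"
proof -
  have "b # p = replicate (Suc n) True" "c # q = replicate (Suc n) True"
    using top_path[of "b # p" n] top_path[of "c # q" n] assms unfolding pr_def by auto
  then show "b" "c" "p = replicate n True" "q = replicate n True" by auto
qed

lemma pr_top: "pr n (replicate n True) (replicate n True)"
  by (auto simp: pr_def Paths_def intro!: valid_low[of 0 n, simplified])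

lemma pr_top_False: "n \<noteq> 0 \<Longrightarrow> pr (Suc n) (False # replicate n True) (False # replicate n True)"
  by (auto simp: pr_def Paths_def intro!: valid_low[of 0 n, simplified])

lemma Ep_0: "Ep 0"
proof -
  have "u (Suc 0) * (I * u (Suc 0)) = 2 *\<^sub>Q u (Suc 0)" if "Suc 0 < N"
    using that u_u[of 1] by simp
  moreover have "e [True] [True] = I" using e_top[of "[]" 0] by simp
  ultimately show ?thesis
    by (auto simp: Ep_def pr_def Paths_def w_def split: if_splits)
qed

text \<open>Below the top both routing units commute with the new generator, so
  \<open>u_down\<close> collapses the sandwich and leaves a product of units, which is a Kronecker
  delta in \<open>b\<close> and \<open>c\<close>. At the top the unit is a difference, whose first
  term closes a loop.\<close>

lemma Ep_step:
  assumes M: "Mp (Suc n)" and J: "Jp n"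
  shows "Ep (Suc n)"
  unfolding Ep_def
proof (intro allI impI)
  fix b c p q
  assume a: "pr (Suc (Suc n)) (b # p) (c # q)" and N: "Suc (Suc n) < N"
  let ?u = "u (Suc (Suc n))" and ?v = "u (Suc n)"
  have L: "?u * (e (b # p) (c # q) * ?u) =
       (if b = c then (w (ht (b # p)) / w (ht p)) *\<^sub>Q (e p q * ?u) else 0)"
    if a: "pr (Suc (Suc n)) (b # p) (c # q)" and lt: "ht (b # p) < int (Suc n)" for b c p q
  proof -
    define r where "r = can n (ht (b # p))"
    have bp: "b # p \<in> Paths (Suc (Suc n))" using a by (simp add: pr_def)
    have r: "r \<in> Paths n" "ht r = ht (b # p)" using can_Cons[OF bp lt] by (simp_all add: r_def)
    have X: "pr (Suc n) p ((\<not> b) # r)" "pr (Suc n) ((\<not> c) # r) q"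
      using pr_flip_left[OF a r(1) refl r(2)] pr_flip_right[OF a r(1) refl r(2)] .
    have cX: "?u * e p ((\<not> b) # r) = e p ((\<not> b) # r) * ?u"
      using CpD[OF Cp X(1)] N by simp
    have cY: "e ((\<not> c) # r) q * ?u = ?u * e ((\<not> c) # r) q"
      using CpD[OF Cp X(2)] N by simp
    have "?u * ((e p ((\<not> b) # r) * (?v * e ((\<not> c) # r) q)) * ?u)
        = e p ((\<not> b) # r) * ((?u * (?v * ?u)) * e ((\<not> c) # r) q)"
      by (simp add: mult.assoc cY) (simp add: mult.assoc[symmetric] cX)
    also have "\<dots> = e p ((\<not> b) # r) * (e ((\<not> c) # r) q * ?u)"
      using u_down[of "Suc n"] N by (simp add: cY)
    also have "\<dots> = (if b = c then e p q * ?u else 0)"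
      using MpD'[OF M X] by auto
    finally show ?thesis
      using JpD[OF J a r] r by (simp add: mult.assoc)
  qed
  show "?u * (e (b # p) (c # q) * ?u) =
       (if b = c then (w (ht (b # p)) / w (ht p)) *\<^sub>Q (e p q * ?u) else 0)"
  proof (cases "ht (b # p) < int (Suc n)")
    case True
    then show ?thesis using L[OF a] by simp
  next
    case False
    define t where "t = replicate (Suc n) True"
    have bc: "b" "c" "p = t" "q = t" using not_low[OF a False] by (auto simp: t_def)
    have "?u * (e t t * ?u) = 2 *\<^sub>Q (e t t * ?u)"
    proof -
      have "?u * e t t = e t t * ?u" unfolding t_def
        by (rule CpD[OF Cp pr_top, symmetric]) (use N in auto)
      then have "?u * (e t t * ?u) = e t t * (?u * ?u)" by (simp add: mult.assoc[symmetric])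
      then show ?thesis using u_u[of "Suc (Suc n)"] N by simp
    qed
    moreover have "?u * (e (False # t) (False # t) * ?u) = (w (int n) / w (int (Suc n))) *\<^sub>Q (e t t * ?u)"
      using L[OF pr_top_False[of "Suc n", folded t_def]] by (simp add: t_def)
    ultimately have "?u * (e (True # t) (True # t) * ?u) = (2 - w (int n) / w (int (Suc n))) *\<^sub>Q (e t t * ?u)"
      unfolding e_top[OF t_def] by (simp add: left_diff_distrib right_diff_distrib scl_diff_left)
    \<comment> \<open>Loop value 2 minus the partial trace of the removed unit: this is the
      Chebyshev recursion w(h + 1) = 2 w(h) - w(h - 1).\<close>
    moreover have "2 - w (int n) / w (int (Suc n)) = w (int (Suc (Suc n))) / w (int (Suc n))"
      by (simp add: w_def field_simps)
    ultimately show ?thesis using bc by (simp add: t_def)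
  qed
qed

lemma Mp_0: "Mp 0"
  by (auto simp: Mp_def pr_def Paths_def)

lemma Paths_1: "Paths (Suc 0) = {[True]}"
  by (auto simp: Paths_def length_Suc_conv split: if_splits)

lemma Mp_1: "Mp (Suc 0)"
  using e_top[of "[]" 0] by (auto simp: Mp_def pr_def Paths_1)

text \<open>Two routed units multiplied together contain a partial trace \<open>u * e * u\<close> in
  the middle, which \<open>Ep\<close> evaluates. Its factor \<open>w (ht r) / w (ht x)\<close>
  cancels one of the two normalising quotients; this is the purpose of Wenzl's
  normalisation.\<close>

lemma Mp_low:
  assumes M: "Mp (Suc n)" and T: "Tp n" and J: "Jp n" and En: "Ep n" and N: "Suc n < N"
    and a: "pr (Suc (Suc n)) (b # p) (c # q)" "ht (b # p) < int (Suc n)"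
    and d: "pr (Suc (Suc n)) (d # r) (f # s)" "ht (d # r) < int (Suc n)"
  shows "e (b # p) (c # q) * e (d # r) (f # s) = (if c # q = d # r then e (b # p) (f # s) else 0)"
proof -
  define x where "x = can n (ht (b # p))"
  define y where "y = can n (ht (d # r))"
  have bp: "b # p \<in> Paths (Suc (Suc n))" "d # r \<in> Paths (Suc (Suc n))" using a d by (simp_all add: pr_def)
  have x: "x \<in> Paths n" "ht x = ht (b # p)" using can_Cons[OF bp(1) a(2)] by (simp_all add: x_def)
  have y: "y \<in> Paths n" "ht y = ht (d # r)" using can_Cons[OF bp(2) d(2)] by (simp_all add: y_def)
  have X: "pr (Suc n) p ((\<not> b) # x)" "pr (Suc n) ((\<not> c) # x) q"
    using pr_flip_left[OF a(1) x(1) refl x(2)] pr_flip_right[OF a(1) x(1) refl x(2)] .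
  have Y: "pr (Suc n) r ((\<not> d) # y)" "pr (Suc n) ((\<not> f) # y) s"
    using pr_flip_left[OF d(1) y(1) refl y(2)] pr_flip_right[OF d(1) y(1) refl y(2)] .
  let ?u = "u (Suc n)"
  have E1: "e (b # p) (c # q) * e (d # r) (f # s) =
      (w (ht x) / w (ht p) * (w (ht y) / w (ht r))) *\<^sub>Q
      (e p ((\<not> b) # x) * (?u * ((e ((\<not> c) # x) q * e r ((\<not> d) # y)) * (?u * e ((\<not> f) # y) s))))"
    unfolding JpD[OF J a(1) x] JpD[OF J d(1) y] by (simp add: mult.assoc mult.commute[where 'a=rat])
  show ?thesis
  proof (cases "q = r")
    case False
    then show ?thesis unfolding E1 using MpD[OF M X(2) Y(1)] by simp
  next
    case qr: True
    have pXY: "pr (Suc n) ((\<not> c) # x) ((\<not> d) # y)" using X Y qr by (simp add: pr_def)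
    have E2: "?u * (e ((\<not> c) # x) ((\<not> d) # y) * ?u) =
       (if c = d then (w (ht ((\<not> c) # x)) / w (ht x)) *\<^sub>Q (e x y * ?u) else 0)"
      using EpD[OF En pXY N] by (cases c; cases d) simp_all
    have E3: "e (b # p) (c # q) * e (d # r) (f # s) =
      (w (ht x) / w (ht p) * (w (ht y) / w (ht r))) *\<^sub>Q
      (e p ((\<not> b) # x) * ((?u * (e ((\<not> c) # x) ((\<not> d) # y) * ?u)) * e ((\<not> f) # y) s))"
      unfolding E1 using MpD[OF M X(2) Y(1)] qr by (simp add: mult.assoc)
    show ?thesis
    proof (cases "c = d")
      case False
      then show ?thesis unfolding E3 E2 by simp
    next
      case cd: True
      have k: "ht (d # r) = ht (b # p)" using a(1) cd qr by (simp add: pr_def)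
      \<comment> \<open>\<open>can\<close> depends on the height only, so equal heights give
        literally the same routing path.\<close>
      have yx: "y = x" by (simp only: x_def y_def k)
      have g: "ht ((\<not> c) # x) = ht r" using X(2) qr by (simp add: pr_def)
      have t: "e p ((\<not> b) # x) * (e x x * z) = e p ((\<not> b) # x) * z" for z
        using trunc_right[OF M T pr_refl[OF x(1)] X(1)] by (metis mult.assoc)
      have hx: "0 \<le> ht x" "0 \<le> ht r" using x(1) Y(1) by (auto simp: Paths_def pr_def)
      have pf: "pr (Suc (Suc n)) (b # p) (f # s)" using a d cd qr by (simp add: pr_def)
      have "e (b # p) (c # q) * e (d # r) (f # s) =
          (w (ht x) / w (ht p) * (w (ht y) / w (ht r)) * (w (ht r) / w (ht x))) *\<^sub>Q
          (e p ((\<not> b) # x) * (?u * e ((\<not> f) # y) s))"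
        unfolding E3 E2 g using cd by (simp add: mult.assoc yx t del: ht.simps)
      also have "w (ht x) / w (ht p) * (w (ht y) / w (ht r)) * (w (ht r) / w (ht x)) = w (ht x) / w (ht p)"
        using hx by (simp add: yx)
      finally show ?thesis using JpD[OF J pf x] cd qr yx by simp
    qed
  qed
qed

text \<open>The top unit is a truncated unit minus one low unit, and a truncated unit acts on low
  units by comparing truncations. Hence every product involving the top unit reduces to
  \<open>Mp_low\<close>.\<close>

lemma Mp_step:
  assumes M: "Mp (Suc n)" and T: "Tp n" and J: "Jp n" and En: "Ep n" and N: "Suc n < N"
  shows "Mp (Suc (Suc n))"
  unfolding Mp_def
proof (intro allI impI)
  fix p' q' r' s'
  assume pp: "pr (Suc (Suc n)) p' q'" "pr (Suc (Suc n)) r' s'"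
  obtain b p c q where 1: "p' = b # p" "q' = c # q"
    using pp(1) unfolding pr_def Paths_def by (cases p'; cases q') auto
  obtain d r f s where 2: "r' = d # r" "s' = f # s"
    using pp(2) unfolding pr_def Paths_def by (cases r'; cases s') auto
  note a = pp(1)[unfolded 1] and d = pp(2)[unfolded 2]
  note low = Mp_low[OF M T J En N]
  define t where "t = replicate (Suc n) True"
  have t: "pr (Suc n) t t" "pr (Suc (Suc n)) (False # t) (False # t)" "ht (False # t) < int (Suc n)"
    using pr_top[of "Suc n"] pr_top_False[of "Suc n"] by (simp_all add: t_def)
  have top: "e (True # t) (True # t) = e t t - e (False # t) (False # t)"
    using e_top[OF t_def] by simp
  have absl: "e t t * e (d # r) (f # s) = (if t = r then e (d # r) (f # s) else 0)"
    if d: "pr (Suc (Suc n)) (d # r) (f # s)" "ht (d # r) < int (Suc n)" for d r f s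
  proof -
    define y where "y = can n (ht (d # r))"
    have dr: "d # r \<in> Paths (Suc (Suc n))" using d by (simp add: pr_def)
    have y: "y \<in> Paths n" "ht y = ht (d # r)" using can_Cons[OF dr d(2)] by (simp_all add: y_def)
    show ?thesis unfolding JpD[OF J d(1) y]
      using MpD'[OF M t(1) pr_flip_left[OF d(1) y(1) refl y(2)]] by simp
  qed
  have absr: "e (d # r) (f # s) * e t t = (if s = t then e (d # r) (f # s) else 0)"
    if d: "pr (Suc (Suc n)) (d # r) (f # s)" "ht (d # r) < int (Suc n)" for d r f s
  proof -
    define y where "y = can n (ht (d # r))"
    have dr: "d # r \<in> Paths (Suc (Suc n))" using d by (simp add: pr_def)
    have y: "y \<in> Paths n" "ht y = ht (d # r)" using can_Cons[OF dr d(2)] by (simp_all add: y_def)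
    show ?thesis unfolding JpD[OF J d(1) y]
      using MpD[OF M pr_flip_right[OF d(1) y(1) refl y(2)] t(1)] by (simp add: mult.assoc)
  qed
  consider "ht (b # p) < int (Suc n)" "ht (d # r) < int (Suc n)"
    | "ht (b # p) < int (Suc n)" "\<not> ht (d # r) < int (Suc n)"
    | "\<not> ht (b # p) < int (Suc n)" "ht (d # r) < int (Suc n)"
    | "\<not> ht (b # p) < int (Suc n)" "\<not> ht (d # r) < int (Suc n)" by blast
  then show "e p' q' * e r' s' = (if q' = r' then e p' s' else 0)"
  proof cases
    case 1
    then show ?thesis using low[OF a _ d] by (simp add: \<open>p' = b # p\<close> \<open>q' = c # q\<close> 2)
  next
    case c2: 2
    have dd: "d" "f" "r = t" "s = t" using not_low[OF d c2(2)] by (simp_all add: t_def)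
    have "ht (c # q) < int (Suc n)" using a c2(1) by (simp add: pr_def)
    then have cq: "c # q \<noteq> True # t" using d dd by (auto simp: t_def)
    have "e (b # p) (c # q) * e (True # t) (True # t) = 0"
      unfolding top right_diff_distrib absr[OF a c2(1)] low[OF a c2(1) t(2,3)] using cq by auto
    then show ?thesis using cq dd by (auto simp: 1 2)
  next
    case c3: 3
    have dd: "b" "c" "p = t" "q = t" using not_low[OF a c3(1)] by (simp_all add: t_def)
    have dr: "d # r \<noteq> True # t" using c3(2) by (auto simp: t_def)
    have "e (True # t) (True # t) * e (d # r) (f # s) = 0"
      unfolding top left_diff_distrib absl[OF d c3(2)] low[OF t(2,3) d c3(2)] using dr by auto
    then show ?thesis using dr dd by (auto simp: 1 2)
  next
    case c4: 4
    have dd: "b" "c" "p = t" "q = t" "d" "f" "r = t" "s = t"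
      using not_low[OF a c4(1)] not_low[OF d c4(2)] by (simp_all add: t_def)
    have "e (True # t) (True # t) * e (True # t) (True # t) = e (True # t) (True # t)"
      unfolding top left_diff_distrib right_diff_distrib
      using absl[OF t(2,3)] absr[OF t(2,3)] low[OF t(2,3) t(2,3)] MpD[OF M t(1) t(1)] by simp
    then show ?thesis using dd by (auto simp: 1 2)
  qed
qed

end

context tl_relations
begin

text \<open>The generator commutes with the idempotent \<open>e x x\<close>; splitting the latter on
  both sides turns every summand into a unit routed through \<open>x\<close>. This is the seminormal
  form of the generator on paths through \<open>x\<close>, a matrix of rank one.\<close>

lemma u_expand:
  assumes M: "Mp m" and T: "Tp m" and J: "Jp m" and N: "Suc m < N" and x: "x \<in> Paths m"
  shows "u (Suc m) * e x x = (\<Sum>b\<in>ext x. \<Sum>c\<in>ext x. (w (ht (b # x)) / w (ht x)) *\<^sub>Q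
            e ((\<not> b) # b # x) ((\<not> c) # c # x))"
proof -
  have xx: "pr m x x" using x by (rule pr_refl)
  have hx: "0 \<le> ht x" using x by (simp add: Paths_def)
  have J': "(w (ht (b # x)) / w (ht x)) *\<^sub>Q e ((\<not> b) # b # x) ((\<not> c) # c # x)
      = e (b # x) (b # x) * (u (Suc m) * e (c # x) (c # x))" if "b \<in> ext x" "c \<in> ext x" for b c
  proof -
    have "pr (Suc (Suc m)) ((\<not> b) # b # x) ((\<not> c) # c # x)"
      using that x hx by (auto simp: pr_def Paths_def ext_def)
    moreover have "0 \<le> ht (b # x)" using that(1) by (simp add: ext_def)
    ultimately show ?thesis
      using JpD[OF J _ x, of "\<not> b" "b # x" "\<not> c" "c # x"] hx by (auto simp del: ht_nonneg)
  qed
  have "u (Suc m) * e x x = e x x * (u (Suc m) * e x x)"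
  proof -
    have "e x x * (u (Suc m) * e x x) = u (Suc m) * (e x x * e x x)"
      using CpD[OF Cp xx _ N] by (simp add: mult.assoc[symmetric])
    also have "e x x * e x x = e x x" using MpD[OF M xx xx] by simp
    finally show ?thesis by simp
  qed
  also have "\<dots> = (\<Sum>b\<in>ext x. \<Sum>c\<in>ext x. e (b # x) (b # x) * (u (Suc m) * e (c # x) (c # x)))"
    unfolding TpD[OF T xx] sum_distrib_left[of "u (Suc m)"] by (rule sum_product)
  also have "\<dots> = (\<Sum>b\<in>ext x. \<Sum>c\<in>ext x. (w (ht (b # x)) / w (ht x)) *\<^sub>Q
            e ((\<not> b) # b # x) ((\<not> c) # c # x))"
    by (intro sum.cong refl J'[symmetric])
  finally show ?thesis .
qed

lemma Tp_0: "Tp 0"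
proof -
  have "ext [] = {True}" by (auto simp: ext_def split: if_splits)
  moreover have "e [True] [True] = I" using e_top[of "[]" 0] by simp
  ultimately show ?thesis by (auto simp: Tp_def pr_def Paths_def)
qed

text \<open>Paths of one length and height are linked by units, so it suffices to split one unit.
  Let \<open>x\<close> have the height of \<open>p\<close> but be two steps shorter. Its one or two
  detours \<open>(\<not> b) # b # x\<close> give a small matrix algebra with units
  \<open>\<epsilon>\<close>, and the relation \<open>u_up\<close>, read inside it, is the splitting
  identity.\<close>

lemma Tp_low:
  assumes M: "Mp (Suc (Suc m))" "Mp m" and T: "Tp (Suc m)" "Tp m" and J: "Jp m" "Jp (Suc m)"
    and N: "Suc (Suc m) < N" and pq: "pr (Suc (Suc m)) p q" and lt: "ht p < int (Suc m)"
  shows "e p q = (\<Sum>b\<in>ext p. e (b # p) (b # q))"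
proof -
  define x where "x = can m (ht p)"
  obtain b0 p0 where p0: "p = b0 # p0" using pq unfolding pr_def Paths_def by (cases p) auto
  have x: "x \<in> Paths m" "ht x = ht p"
    using can_Cons[of b0 p0 "Suc m"] pq lt by (simp_all add: x_def p0 pr_def)
  have xx: "pr m x x" and hx: "0 \<le> ht x" using x(1) by (simp_all add: pr_def Paths_def)
  let ?L = "Suc (Suc m)"
  define \<epsilon> where "\<epsilon> b c = e ((\<not> b) # b # x) ((\<not> c) # c # x)" for b c
  define \<alpha> where "\<alpha> b = w (ht (b # x)) / w (ht x)" for b
  have Px: "(\<not> b) # b # x \<in> Paths ?L" "ht ((\<not> b) # b # x) = ht p" if "b \<in> ext x" for b
    using that x hx by (auto simp: Paths_def ext_def)
  have pr\<epsilon>: "pr ?L ((\<not> b) # b # x) ((\<not> c) # c # x)" if "b \<in> ext x" "c \<in> ext x" for b c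
    using Px[OF that(1)] Px[OF that(2)] by (simp add: pr_def)
  have \<alpha>0: "\<alpha> b \<noteq> 0" if "b \<in> ext x" for b
    using that hx w_neq_0[of "ht (b # x)"] by (simp add: \<alpha>_def ext_def)
  \<comment> \<open>In the units \<open>\<epsilon>\<close> this is a matrix with constant rows
    \<open>\<alpha> b\<close>, hence of rank one.\<close>
  define Y where "Y = u (Suc m) * e x x"
  have Y: "Y = (\<Sum>b\<in>ext x. \<Sum>c\<in>ext x. \<alpha> b *\<^sub>Q \<epsilon> b c)"
    using u_expand[OF M(2) T(2) J(1) _ x(1)] N by (simp add: Y_def \<epsilon>_def \<alpha>_def)
  have \<epsilon>\<epsilon>: "\<epsilon> a b * \<epsilon> c d = (if b = c then \<epsilon> a d else 0)"
    if "a \<in> ext x" "b \<in> ext x" "c \<in> ext x" "d \<in> ext x" for a b c d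
    unfolding \<epsilon>_def using MpD[OF M(1) pr\<epsilon>[OF that(1,2)] pr\<epsilon>[OF that(3,4)]] by simp
  have bY: "\<epsilon> b b * Y = \<alpha> b *\<^sub>Q (\<Sum>c\<in>ext x. \<epsilon> b c)" if b: "b \<in> ext x" for b
  proof -
    have "\<epsilon> b b * Y = (\<Sum>b'\<in>ext x. \<Sum>c\<in>ext x. \<alpha> b' *\<^sub>Q (\<epsilon> b b * \<epsilon> b' c))"
      unfolding Y by (simp add: sum_distrib_left)
    also have "\<dots> = (\<Sum>b'\<in>ext x. if b' = b then (\<Sum>c\<in>ext x. \<alpha> b *\<^sub>Q \<epsilon> b c) else 0)"
      by (rule sum.cong) (auto simp: \<epsilon>\<epsilon> b)
    finally show ?thesis using b by (simp add: sum.delta scl_sum_right)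
  qed
  have Yb: "Y * \<epsilon> b b = (\<Sum>c\<in>ext x. \<alpha> c *\<^sub>Q \<epsilon> c b)" if b: "b \<in> ext x" for b
  proof -
    have "Y * \<epsilon> b b = (\<Sum>b'\<in>ext x. \<Sum>c\<in>ext x. \<alpha> b' *\<^sub>Q (\<epsilon> b' c * \<epsilon> b b))"
      unfolding Y by (simp add: sum_distrib_right)
    also have "\<dots> = (\<Sum>b'\<in>ext x. \<Sum>c\<in>ext x. if c = b then \<alpha> b' *\<^sub>Q \<epsilon> b' b else 0)"
      by (intro sum.cong) (auto simp: \<epsilon>\<epsilon> b)
    finally show ?thesis using b by (simp add: sum.delta)
  qed
  have YuY: "Y * (u ?L * Y) = Y"
  proof -
    have c1: "e x x * u ?L = u ?L * e x x" using CpD[OF Cp xx _ N] by simp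
    have c2: "e x x * u (Suc m) = u (Suc m) * e x x" using CpD[OF Cp xx, of "Suc m"] N by simp
    have ee: "e x x * e x x = e x x" using MpD[OF M(2) xx xx] by simp
    have "Y * (u ?L * Y) = u (Suc m) * ((e x x * u ?L) * (u (Suc m) * e x x))"
      by (simp add: Y_def mult.assoc)
    also have "\<dots> = u (Suc m) * (u ?L * ((e x x * u (Suc m)) * e x x))"
      by (simp add: c1 mult.assoc)
    also have "\<dots> = (u (Suc m) * (u ?L * u (Suc m))) * e x x"
      by (simp add: c2 mult.assoc ee)
    also have "\<dots> = Y" using u_up[of "Suc m"] N by (simp add: Y_def)
    finally show ?thesis .
  qed
  \<comment> \<open>A unit of length \<open>Suc m\<close> commutes with the last generator and tells
    the two detours apart.\<close>
  have off: "\<epsilon> b c' * (u ?L * \<epsilon> b' c) = 0"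
    if bc: "b \<in> ext x" "c' \<in> ext x" "b' \<in> ext x" "c \<in> ext x" "c' \<noteq> b'" for b c' b' c
  proof -
    have cc: "pr (Suc m) (c' # x) (c' # x)" using pr_ext[OF xx bc(2)] .
    have A: "\<epsilon> b c' * e (c' # x) (c' # x) = \<epsilon> b c'"
      unfolding \<epsilon>_def using trunc_right[OF M(1) T(1) cc pr\<epsilon>[OF bc(1,2)]] by simp
    have "\<epsilon> b c' * (u ?L * \<epsilon> b' c) = (\<epsilon> b c' * e (c' # x) (c' # x)) * (u ?L * \<epsilon> b' c)"
      unfolding A ..
    also have "\<dots> = \<epsilon> b c' * ((e (c' # x) (c' # x) * u ?L) * \<epsilon> b' c)"
      by (simp only: mult.assoc)
    also have "\<dots> = \<epsilon> b c' * (u ?L * (e (c' # x) (c' # x) * \<epsilon> b' c))"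
      using CpD[OF Cp cc _ N] by (simp add: mult.assoc)
    also have "e (c' # x) (c' # x) * \<epsilon> b' c = 0"
      unfolding \<epsilon>_def using trunc_left[OF M(1) T(1) cc pr\<epsilon>[OF bc(3,4)]] bc(5) by auto
    finally show ?thesis by simp
  qed
  \<comment> \<open>The entry at \<open>b\<close>, \<open>c\<close> of the identity
    \<open>YuY\<close>: by \<open>off\<close> only equal middle indices contribute, and the row
    factor \<open>\<alpha> b\<close> cancels.\<close>
  have key: "(\<Sum>c'\<in>ext x. \<alpha> c' *\<^sub>Q (\<epsilon> b c' * (u ?L * \<epsilon> c' c))) = \<epsilon> b c"
    if b: "b \<in> ext x" and c: "c \<in> ext x" for b c
  proof -
    have "\<alpha> b *\<^sub>Q \<epsilon> b c = (\<epsilon> b b * Y) * \<epsilon> c c"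
      unfolding bY[OF b] using b c by (simp add: sum_distrib_right \<epsilon>\<epsilon> sum.delta)
    also have "\<dots> = (\<epsilon> b b * Y) * (u ?L * (Y * \<epsilon> c c))"
    proof -
      have "(\<epsilon> b b * Y) * (u ?L * (Y * \<epsilon> c c)) = \<epsilon> b b * ((Y * (u ?L * Y)) * \<epsilon> c c)"
        by (simp add: mult.assoc)
      then show ?thesis by (simp only: YuY mult.assoc)
    qed
    also have "\<dots> = \<alpha> b *\<^sub>Q (\<Sum>c'\<in>ext x. \<Sum>b'\<in>ext x. \<alpha> b' *\<^sub>Q (\<epsilon> b c' * (u ?L * \<epsilon> b' c)))"
      unfolding bY[OF b] Yb[OF c] sum_distrib_left[of "u ?L"] scl_mult_left sum_product scl_mult_right ..
    also have "\<dots> = \<alpha> b *\<^sub>Q (\<Sum>c'\<in>ext x. \<Sum>b'\<in>ext x. if b' = c' then \<alpha> c' *\<^sub>Q (\<epsilon> b c' * (u ?L * \<epsilon> c' c)) else 0)"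
      by (intro arg_cong[where f = "scl (\<alpha> b)"] sum.cong refl) (auto simp: off b c)
    also have "\<dots> = \<alpha> b *\<^sub>Q (\<Sum>c'\<in>ext x. \<alpha> c' *\<^sub>Q (\<epsilon> b c' * (u ?L * \<epsilon> c' c)))"
      by (simp add: sum.delta)
    finally show ?thesis by (rule scl_cancel[OF \<alpha>0[OF b], symmetric])
  qed
  have T0: "True \<in> ext x" using x(1) by (simp add: True_ext Paths_def)
  have ep: "ext p = ext x" by (rule ext_cong) (simp add: x)
  \<comment> \<open>The detour used as transit between \<open>p\<close> and \<open>q\<close>; up and
    then down is always possible.\<close>
  let ?t = "False # True # x"
  have pt: "pr ?L p ?t" "pr ?L ?t q" using Px[OF T0] pq by (auto simp: pr_def)
  have "(\<Sum>b\<in>ext p. e (b # p) (b # q))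
      = (\<Sum>b\<in>ext x. \<alpha> b *\<^sub>Q (e p ((\<not> b) # b # x) * (u ?L * e ((\<not> b) # b # x) q)))"
    unfolding ep
  proof (rule sum.cong[OF refl])
    fix b assume b: "b \<in> ext x"
    have "pr (Suc ?L) (b # p) (b # q)" using pr_ext[OF pq, of b] b ep by simp
    moreover have "b # x \<in> Paths (Suc m)" using pr_ext[OF xx b] by (simp add: pr_def)
    ultimately show "e (b # p) (b # q) = \<alpha> b *\<^sub>Q (e p ((\<not> b) # b # x) * (u ?L * e ((\<not> b) # b # x) q))"
      using JpD[OF J(2), of b p b q "b # x"] x(2) by (simp add: \<alpha>_def)
  qed
  also have "\<dots> = (\<Sum>b\<in>ext x. \<alpha> b *\<^sub>Q (e p ?t * ((\<epsilon> True b * (u ?L * \<epsilon> b True)) * e ?t q)))"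
  proof (rule sum.cong[OF refl])
    fix b assume b: "b \<in> ext x"
    have A: "e p ?t * \<epsilon> True b = e p ((\<not> b) # b # x)"
      unfolding \<epsilon>_def using MpD[OF M(1) pt(1) pr\<epsilon>[OF T0 b]] by simp
    have B: "\<epsilon> b True * e ?t q = e ((\<not> b) # b # x) q"
      unfolding \<epsilon>_def using MpD[OF M(1) pr\<epsilon>[OF b T0]] pt(2) by simp
    show "\<alpha> b *\<^sub>Q (e p ((\<not> b) # b # x) * (u ?L * e ((\<not> b) # b # x) q))
        = \<alpha> b *\<^sub>Q (e p ?t * ((\<epsilon> True b * (u ?L * \<epsilon> b True)) * e ?t q))"
      unfolding A[symmetric] B[symmetric] by (simp only: mult.assoc)
  qed
  also have "\<dots> = e p ?t * ((\<Sum>b\<in>ext x. \<alpha> b *\<^sub>Q (\<epsilon> True b * (u ?L * \<epsilon> b True))) * e ?t q)"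
    by (simp add: sum_distrib_left sum_distrib_right)
  also have "\<dots> = e p ?t * (e ?t ?t * e ?t q)"
    unfolding key[OF T0 T0] by (simp add: \<epsilon>_def)
  also have "\<dots> = e p q"
    using MpD[OF M(1) _ pt(2), of ?t ?t] MpD[OF M(1) pt] pt by (simp add: pr_def)
  finally show ?thesis by simp
qed

lemma Tp_step:
  assumes M: "Mp (Suc n)" "n = Suc m \<Longrightarrow> Mp m" and T: "Tp n" "n = Suc m \<Longrightarrow> Tp m"
    and J: "n = Suc m \<Longrightarrow> Jp m" "Jp n" and N: "Suc n < N" and m: "m = n - 1"
  shows "Tp (Suc n)"
  unfolding Tp_def
proof (intro allI impI)
  fix p q assume pq: "pr (Suc n) p q"
  show "e p q = (\<Sum>b\<in>ext p. e (b # p) (b # q))"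
  proof (cases "ht p < int n")
    case False
    define t where "t = replicate (Suc n) True"
    have p: "p = t" "q = t"
      using top_path[of p n] top_path[of q n] False pq by (auto simp: t_def pr_def)
    have "ext t = {True, False}" by (auto simp: ext_def t_def)
    then show ?thesis using e_top[OF t_def] by (simp add: p)
  next
    case True
    then have "n \<noteq> 0" using pq ht_nonneg[of p] by (auto simp: pr_def Paths_def simp del: ht_nonneg)
    then have n: "n = Suc m" using m by simp
    show ?thesis
      using Tp_low[of m p q] M(1) M(2)[OF n] T(1) T(2)[OF n] J(1)[OF n] J(2) N pq True unfolding n by blast
  qed
qed

text \<open>Two consecutive lengths of \<open>Mp\<close> are kept, and the last conjunct remembers
  the previous length for the splitting step. \<open>Jp\<close> appears there only for the
  predecessor, since it involves a generator whose index exceeds the length by one.\<close>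

lemma all_levels: "n < N \<Longrightarrow> Mp n \<and> Mp (Suc n) \<and> Tp n \<and> Ep n \<and> (\<forall>m. n = Suc m \<longrightarrow> Mp m \<and> Tp m \<and> Jp m)"
proof (induction n)
  case 0
  then show ?case using Mp_0 Mp_1 Tp_0 Ep_0 by simp
next
  case (Suc n)
  then have IH: "Mp n" "Mp (Suc n)" "Tp n" "Ep n" and IH': "n = Suc m \<Longrightarrow> Mp m \<and> Tp m \<and> Jp m" for m
    by simp_all
  have J: "Jp n" using Jp_step IH Cp Suc.prems by blast
  have "Mp (Suc (Suc n))" using Mp_step IH J Suc.prems by blast
  moreover have "Tp (Suc n)" by (rule Tp_step[where m = "n - 1"]) (use IH(2,3) IH' J Suc.prems in \<open>simp_all only:\<close>)
  moreover have "Ep (Suc n)" using Ep_step IH J by blast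
  ultimately show ?case using IH J by simp
qed

end

section \<open>Action of the generators on matrix units\<close>

context tl_relations
begin

lemma Mp_all: "n \<le> N \<Longrightarrow> Mp n"
  using Mp_0 all_levels by (cases n) auto

lemma mult_e: "n \<le> N \<Longrightarrow> pr n p q \<Longrightarrow> pr n r s \<Longrightarrow> e p q * e r s = (if q = r then e p s else 0)"
  by (rule MpD[OF Mp_all])

lemma mult_e': "n \<le> N \<Longrightarrow> pr n p q \<Longrightarrow> pr n r s \<Longrightarrow> e p q * (e r s * x) = (if q = r then e p s * x else 0)"
  using mult_e[of n p q r s] by (metis mult.assoc mult_zero_left)

lemma e_split: "n < N \<Longrightarrow> pr n p q \<Longrightarrow> e p q = (\<Sum>b\<in>ext p. e (b # p) (b # q))"
  using TpD all_levels by blast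

lemma e_units_left: "n < N \<Longrightarrow> pr n p q \<Longrightarrow> pr (Suc n) (b # r) z \<Longrightarrow>
    e p q * e (b # r) z = (if q = r then e (b # p) z else 0)"
  using trunc_left[of n p q b r z] all_levels by blast

lemma e_units_right: "n < N \<Longrightarrow> pr n p q \<Longrightarrow> pr (Suc n) z (b # r) \<Longrightarrow>
    e z (b # r) * e p q = (if r = p then e z (b # q) else 0)"
  using trunc_right[of n p q z b r] all_levels by blast

lemma pr_append: "pr m p q \<Longrightarrow> pr (length xs + m) (xs @ q) z \<Longrightarrow> pr (length xs + m) (xs @ p) z"
  using valid_append_cong[of xs q p] by (auto simp: pr_def Paths_def ht_append)

text \<open>Insert the diagonal unit of the path without its last step; by induction the short unit
  acts on that one, and \<open>e_units_left\<close> transfers the result.\<close>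

lemma e_prefix_left:
  assumes "pr m p q" and "n = length xs + m" and "n \<le> N" and "pr n (xs @ r) z" and "length r = m"
  shows "e p q * e (xs @ r) z = (if q = r then e (xs @ p) z else 0)"
  using assms
proof (induction xs arbitrary: n z)
  case Nil
  have "pr m r z" using Nil by simp
  then show ?case using mult_e[of m p q r z] Nil by simp
next
  case (Cons b xs)
  let ?w = "xs @ r" and ?n = "length xs + m"
  have n: "n = Suc ?n" using Cons.prems(2) by simp
  have bw: "pr n (b # ?w) z" using Cons.prems(4) by simp
  have ww: "pr ?n ?w ?w" using bw by (auto simp: pr_def Paths_def n)
  have "e p q * e (b # ?w) z = (e p q * e ?w ?w) * e (b # ?w) z"
    using e_units_left[OF _ ww bw[unfolded n]] Cons.prems(3) n by (simp add: mult.assoc)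
  also have "e p q * e ?w ?w = (if q = r then e (xs @ p) ?w else 0)"
    by (rule Cons.IH) (use Cons.prems ww n in auto)
  also have "(if q = r then e (xs @ p) ?w else 0) * e (b # ?w) z = (if q = r then e (b # xs @ p) z else 0)"
  proof (cases "q = r")
    case True
    have "pr ?n (xs @ p) ?w" using pr_append[OF Cons.prems(1), of xs ?w] ww True by simp
    then show ?thesis using e_units_left[OF _ _ bw[unfolded n]] Cons.prems(3) n True by simp
  qed simp
  finally show ?case by simp
qed

lemma e_prefix_right:
  assumes "pr m p q" and "n = length xs + m" and "n \<le> N" and "pr n z (xs @ r)" and "length r = m"
  shows "e z (xs @ r) * e p q = (if r = p then e z (xs @ q) else 0)"
  using assms
proof (induction xs arbitrary: n z)
  case Nil
  have "pr m z r" using Nil by simp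
  then show ?case using mult_e[of m z r p q] Nil by simp
next
  case (Cons b xs)
  let ?w = "xs @ r" and ?n = "length xs + m"
  have n: "n = Suc ?n" using Cons.prems(2) by simp
  have bw: "pr n z (b # ?w)" using Cons.prems(4) by simp
  have ww: "pr ?n ?w ?w" using bw by (auto simp: pr_def Paths_def n)
  have "e z (b # ?w) * e p q = e z (b # ?w) * (e ?w ?w * e p q)"
    using e_units_right[OF _ ww bw[unfolded n]] Cons.prems(3) n by (simp add: mult.assoc[symmetric])
  also have "e ?w ?w * e p q = (if r = p then e ?w (xs @ q) else 0)"
    by (rule Cons.IH) (use Cons.prems ww n in auto)
  also have "e z (b # ?w) * (if r = p then e ?w (xs @ q) else 0) = (if r = p then e z (b # xs @ q) else 0)"
  proof (cases "r = p")
    case True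
    have "pr ?n ?w (xs @ q)"
      using pr_append[OF pr_sym[OF Cons.prems(1)], of xs ?w] ww True by (auto intro: pr_sym)
    then show ?thesis using e_units_right[OF _ _ bw[unfolded n]] Cons.prems(3) n True by simp
  qed simp
  finally show ?case by simp
qed

lemma I_e [simp]: "n \<le> N \<Longrightarrow> pr n p q \<Longrightarrow> I * e p q = e p q"
  using e_prefix_left[of 0 "[]" "[]" n p "[]" q] by (simp add: pr_def Paths_def)

lemma e_I [simp]: "n \<le> N \<Longrightarrow> pr n p q \<Longrightarrow> e p q * I = e p q"
  using e_prefix_right[of 0 "[]" "[]" n q p "[]"] by (simp add: pr_def Paths_def)

lemma Paths_Suc: "Paths (Suc n) = (\<Union>p\<in>Paths n. (\<lambda>b. b # p) ` ext p)"
proof (rule Set.set_eqI)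
  fix q show "q \<in> Paths (Suc n) \<longleftrightarrow> q \<in> (\<Union>p\<in>Paths n. (\<lambda>b. b # p) ` ext p)"
    by (cases q) (auto simp: Paths_def ext_def image_iff)
qed

lemma sum_e: "n \<le> N \<Longrightarrow> (\<Sum>p\<in>Paths n. e p p) = I"
proof (induction n)
  case 0
  have "Paths 0 = {[]}" by (auto simp: Paths_def)
  then show ?case by simp
next
  case (Suc n)
  have "(\<Sum>p\<in>Paths (Suc n). e p p) = (\<Sum>p\<in>Paths n. \<Sum>q\<in>(\<lambda>b. b # p) ` ext p. e q q)"
    unfolding Paths_Suc by (rule sum.UNION_disjoint) auto
  also have "\<dots> = (\<Sum>p\<in>Paths n. e p p)"
  proof (rule sum.cong[OF refl])
    fix p assume "p \<in> Paths n"
    then have "e p p = (\<Sum>b\<in>ext p. e (b # p) (b # p))" using e_split[of n p p] Suc.prems by (simp add: pr_refl)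
    then show "(\<Sum>q\<in>(\<lambda>b. b # p) ` ext p. e q q) = e p p"
      by (simp add: sum.reindex inj_on_def)
  qed
  finally show ?case using Suc by simp
qed

lemma pr_two: "pr n (xs @ c # b # ys) z \<Longrightarrow> c \<noteq> b \<Longrightarrow> b' \<in> ext ys \<Longrightarrow> pr n (xs @ (\<not> b') # b' # ys) z"
  using valid_append_cong[of xs "c # b # ys" "(\<not> b') # b' # ys"] valid_appendD[of xs "c # b # ys"]
  by (auto simp: pr_def Paths_def ht_append ext_def)

text \<open>The coefficient depends on the new steps and not on the old ones: the seminormal matrix
  has rank one, and this normalisation of the units puts all weight on the target. For
  multiplication from the right, in \<open>e_u\<close>, the weight lies on the source.\<close>

lemma u_e:
  assumes n: "n \<le> N" and p: "pr n (xs @ c # b # ys) z" and k: "k = Suc (length ys)"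
  shows "u k * e (xs @ c # b # ys) z = (if b = c then 0 else
    (\<Sum>b'\<in>ext ys. (w (ht (b' # ys)) / w (ht ys)) *\<^sub>Q e (xs @ (\<not> b') # b' # ys) z))"
proof -
  let ?m = "length ys" and ?p = "xs @ c # b # ys"
  have len: "n = length xs + Suc (Suc ?m)" using p by (auto simp: pr_def Paths_def)
  have N: "Suc ?m < N" using len n by simp
  have v: "valid (c # b # ys)" using p valid_appendD unfolding pr_def Paths_def by blast
  have ys: "ys \<in> Paths ?m" using v by (simp add: Paths_def)
  have kp: "k < N" "1 \<le> k" using k len n by simp_all
  have lev: "Mp ?m" "Tp ?m" "Jp ?m" using all_levels[of ?m] all_levels[of "Suc ?m"] N by auto
  have "e ys ys * e ?p z = e ?p z"
    using e_prefix_left[OF pr_refl[OF ys], of n "xs @ [c, b]" ys z] p n len by simp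
  then have "u k * e ?p z = (u k * e ys ys) * e ?p z" by (simp add: mult.assoc)
  also have "\<dots> = (\<Sum>b'\<in>ext ys. \<Sum>c'\<in>ext ys. (w (ht (b' # ys)) / w (ht ys)) *\<^sub>Q
            (e ((\<not> b') # b' # ys) ((\<not> c') # c' # ys) * e ?p z))"
    unfolding k u_expand[OF lev N ys] by (simp add: sum_distrib_right)
  also have "\<dots> = (\<Sum>b'\<in>ext ys. \<Sum>c'\<in>ext ys. if c' = b then (if b = c then 0 else
      (w (ht (b' # ys)) / w (ht ys)) *\<^sub>Q e (xs @ (\<not> b') # b' # ys) z) else 0)"
  proof (intro sum.cong refl)
    fix b' c' assume b': "b' \<in> ext ys" and c': "c' \<in> ext ys"
    have pp: "pr (Suc (Suc ?m)) ((\<not> b') # b' # ys) ((\<not> c') # c' # ys)"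
      using ys b' c' by (auto simp: pr_def Paths_def ext_def)
    have "e ((\<not> b') # b' # ys) ((\<not> c') # c' # ys) * e ?p z =
        (if (\<not> c') # c' # ys = c # b # ys then e (xs @ (\<not> b') # b' # ys) z else 0)"
      by (rule e_prefix_left[OF pp len n p]) simp
    then show "(w (ht (b' # ys)) / w (ht ys)) *\<^sub>Q (e ((\<not> b') # b' # ys) ((\<not> c') # c' # ys) * e ?p z)
      = (if c' = b then (if b = c then 0 else
         (w (ht (b' # ys)) / w (ht ys)) *\<^sub>Q e (xs @ (\<not> b') # b' # ys) z) else 0)"
      by auto
  qed
  also have "\<dots> = (if b = c then 0 else
    (\<Sum>b'\<in>ext ys. (w (ht (b' # ys)) / w (ht ys)) *\<^sub>Q e (xs @ (\<not> b') # b' # ys) z))"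
    using v by (auto simp: sum.delta ext_def)
  finally show ?thesis .
qed

lemma e_u:
  assumes n: "n \<le> N" and p: "pr n z (xs @ c # b # ys)" and k: "k = Suc (length ys)"
  shows "e z (xs @ c # b # ys) * u k = (if b = c then 0 else
    (w (ht (b # ys)) / w (ht ys)) *\<^sub>Q (\<Sum>b'\<in>ext ys. e z (xs @ (\<not> b') # b' # ys)))"
proof -
  let ?m = "length ys" and ?p = "xs @ c # b # ys"
  have len: "n = length xs + Suc (Suc ?m)" using p by (auto simp: pr_def Paths_def)
  have N: "Suc ?m < N" using len n by simp
  have v: "valid (c # b # ys)" using p valid_appendD unfolding pr_def Paths_def by blast
  have ys: "ys \<in> Paths ?m" using v by (simp add: Paths_def)
  have lev: "Mp ?m" "Tp ?m" "Jp ?m" using all_levels[of ?m] all_levels[of "Suc ?m"] N by auto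
  have "e z ?p * e ys ys = e z ?p"
    using e_prefix_right[OF pr_refl[OF ys], of n "xs @ [c, b]" z ys] p n len by simp
  then have "e z ?p * u k = e z ?p * (u k * e ys ys)"
    using CpD[OF Cp pr_refl[OF ys], of k] N k by (metis lessI mult.assoc)
  also have "\<dots> = (\<Sum>b'\<in>ext ys. \<Sum>c'\<in>ext ys. (w (ht (b' # ys)) / w (ht ys)) *\<^sub>Q
            (e z ?p * e ((\<not> b') # b' # ys) ((\<not> c') # c' # ys)))"
    unfolding k u_expand[OF lev N ys] by (simp add: sum_distrib_left)
  also have "\<dots> = (\<Sum>b'\<in>ext ys. if b' = b then \<Sum>c'\<in>ext ys. (if b = c then 0 else
      (w (ht (b # ys)) / w (ht ys)) *\<^sub>Q e z (xs @ (\<not> c') # c' # ys)) else 0)"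
  proof (intro sum.cong refl)
    fix b' assume b': "b' \<in> ext ys"
    have "(w (ht (b' # ys)) / w (ht ys)) *\<^sub>Q (e z ?p * e ((\<not> b') # b' # ys) ((\<not> c') # c' # ys))
      = (if b' = b then (if b = c then 0 else
         (w (ht (b # ys)) / w (ht ys)) *\<^sub>Q e z (xs @ (\<not> c') # c' # ys)) else 0)"
      if c': "c' \<in> ext ys" for c'
    proof -
      have pp: "pr (Suc (Suc ?m)) ((\<not> b') # b' # ys) ((\<not> c') # c' # ys)"
        using ys b' c' by (auto simp: pr_def Paths_def ext_def)
      have "e z ?p * e ((\<not> b') # b' # ys) ((\<not> c') # c' # ys) =
          (if c # b # ys = (\<not> b') # b' # ys then e z (xs @ (\<not> c') # c' # ys) else 0)"
        by (rule e_prefix_right[OF pp len n p]) simp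
      then show ?thesis by auto
    qed
    then show "(\<Sum>c'\<in>ext ys. (w (ht (b' # ys)) / w (ht ys)) *\<^sub>Q (e z ?p * e ((\<not> b') # b' # ys) ((\<not> c') # c' # ys)))
      = (if b' = b then \<Sum>c'\<in>ext ys. (if b = c then 0 else
         (w (ht (b # ys)) / w (ht ys)) *\<^sub>Q e z (xs @ (\<not> c') # c' # ys)) else 0)"
      by (simp cong: sum.cong)
  qed
  also have "\<dots> = (if b = c then 0 else
    (w (ht (b # ys)) / w (ht ys)) *\<^sub>Q (\<Sum>b'\<in>ext ys. e z (xs @ (\<not> b') # b' # ys)))"
    using v by (auto simp: sum.delta ext_def scl_sum_right)
  finally show ?thesis .
qed

end

section \<open>Jucys-Murphy elements\<close>

text \<open>Content of the entry added by the step \<open>b\<close> to the path \<open>ys\<close>.\<close>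

definition step_content :: "bool \<Rightarrow> bool list \<Rightarrow> int" where
  "step_content b ys = (if b then - int (count_list ys True) else 1 - int (count_list ys False))"

lemma ht_count: "ht ys = int (count_list ys True) - int (count_list ys False)"
  by (induction ys) auto

context tl_relations
begin

text \<open>Jucys-Murphy elements through conjugation rather than as sums of transpositions;
  \<open>JM_eq\<close> identifies the two. Index 0 is a dummy.\<close>

primrec L :: "nat \<Rightarrow> 'a" where
  "L 0 = 0"
| "L (Suc k) = (if k = 0 then 0 else (u k - I) * L k * (u k - I) + (u k - I))"

lemma s_s: "1 \<le> k \<Longrightarrow> k < N \<Longrightarrow> (u k - I) * (u k - I) = I"
proof -
  assume a: "1 \<le> k" "k < N"
  have "(2::rat) = 1 + 1" by simp
  then have "2 *\<^sub>Q u k = u k + u k" using scl_add_left[of 1 1 "u k"] by (simp only: scl_one)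
  then show ?thesis using a u_u[OF a] by (simp add: left_diff_distrib right_diff_distrib)
qed

text \<open>The later steps \<open>xs\<close> stay arbitrary in the induction, because the second
  component of \<open>S * v\<close> differs from \<open>v\<close> in two adjacent steps and its
  eigenvalue is needed one position earlier.\<close>

lemma L_e:
  assumes n: "n \<le> N" and p: "pr n (xs @ b # ys) z"
  shows "L (Suc (length ys)) * e (xs @ b # ys) z = of_int (step_content b ys) *\<^sub>Q e (xs @ b # ys) z"
  using p
proof (induction ys arbitrary: xs b)
  case Nil
  have "valid [b]" using Nil valid_appendD unfolding pr_def Paths_def by blast
  then have "b" by (simp split: if_splits)
  then show ?case by (simp add: step_content_def)
next
  case (Cons b0 ys)
  let ?k = "Suc (length ys)" and ?v = "e (xs @ b # b0 # ys) z"
  let ?S = "u ?k - I"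
  have v: "valid (b # b0 # ys)" using Cons.prems valid_appendD unfolding pr_def Paths_def by blast
  have k: "1 \<le> ?k" "?k < N" using Cons.prems n by (auto simp: pr_def Paths_def)
  have Iv: "I * ?v = ?v" using I_e n Cons.prems by blast
  have SS: "?S * (?S * ?v) = ?v"
    using s_s[OF k] by (simp add: mult.assoc[symmetric] Iv)
  have Lv: "L ?k * ?v = of_int (step_content b0 ys) *\<^sub>Q ?v"
    using Cons.IH[of "xs @ [b]" b0] Cons.prems by simp
  have Sv: "?S * ?v = (if b0 = b then 0 else
    (\<Sum>b'\<in>ext ys. (w (ht (b' # ys)) / w (ht ys)) *\<^sub>Q e (xs @ (\<not> b') # b' # ys) z)) - ?v"
    using u_e[OF n Cons.prems refl] Iv by (simp add: left_diff_distrib)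
  define d :: rat where "d = of_int (step_content b (b0 # ys) - step_content b0 ys)"
  have LS: "L (Suc ?k) = ?S * L ?k * ?S + ?S" by simp
  have h: "ht ys = int (count_list ys True) - int (count_list ys False)" by (rule ht_count)
  have hp: "0 \<le> ht ys" "0 \<le> ht (b0 # ys)" using v by auto
  have "(?S * L ?k * ?S + ?S) * ?v = (of_int (step_content b0 ys) + d) *\<^sub>Q ?v"
  proof (cases "b = b0")
    case True
    \<comment> \<open>Two equal steps are killed by the generator, so \<open>?S\<close> acts by -1
      and the second component is zero.\<close>
    have d: "d = -1" using True by (simp add: d_def step_content_def)
    show ?thesis
      by (rule jm_step[OF SS _ Lv, of d 0]) (use Sv True d in \<open>simp_all add: scl_minus_left\<close>)
  next
    case False
    \<comment> \<open>If the other step would fall below zero, this component is absent; then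
      \<open>ht ys = 0\<close> and \<open>d = 1\<close>.\<close>
    define x where "x = (if (\<not> b0) \<in> ext ys then (w (ht ((\<not> b0) # ys)) / w (ht ys)) *\<^sub>Q
      e (xs @ b0 # (\<not> b0) # ys) z else 0)"
    have b0: "b0 \<in> ext ys" using hp by (simp add: ext_def)
    have b: "b = (\<not> b0)" using False by auto
    have sum2: "(\<Sum>b'\<in>ext ys. f b') = f b0 + (if (\<not> b0) \<in> ext ys then f (\<not> b0) else 0)" for f :: "bool \<Rightarrow> 'a"
    proof -
      have "ext ys = insert b0 (if (\<not> b0) \<in> ext ys then {\<not> b0} else {})"
        using b0 by (cases b0) (auto, (metis (full_types))+)
      then show ?thesis by (smt (verit) add_0_right finite.emptyI finite.insertI insert_absorb insert_not_empty
            singleton_iff sum.empty sum.insert)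
    qed
    have d: "d = (if b0 then of_int (ht ys) + 1 else - (of_int (ht ys) + 1))"
      using b by (auto simp: d_def step_content_def h)
    have h0: "of_int (ht ys) + 1 \<noteq> (0::rat)" using w_neq_0[OF hp(1)] by (simp add: w_def)
    have dw: "1 / d = w (ht (b0 # ys)) / w (ht ys) - 1"
      using h0 unfolding d by (simp add: w_def field_simps)
    have "?S * ?v = (w (ht (b0 # ys)) / w (ht ys)) *\<^sub>Q ?v + x - ?v"
      unfolding Sv sum2 x_def using b by simp
    then have Sv': "?S * ?v = (1 / d) *\<^sub>Q ?v + x" unfolding dw by (simp add: scl_diff_left)
    have Lx: "L ?k * x = (of_int (step_content b0 ys) + d) *\<^sub>Q x"
    proof (cases "(\<not> b0) \<in> ext ys")
      case True
      have "pr n (xs @ b0 # (\<not> b0) # ys) z" using pr_two[OF Cons.prems _ True] b by simp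
      then have "L ?k * e (xs @ b0 # (\<not> b0) # ys) z = of_int (step_content (\<not> b0) ys) *\<^sub>Q e (xs @ b0 # (\<not> b0) # ys) z"
        using Cons.IH[of "xs @ [b0]" "\<not> b0"] by simp
      moreover have "of_int (step_content b0 ys) + d = of_int (step_content (\<not> b0) ys)"
        using b by (simp add: d_def step_content_def)
      ultimately show ?thesis using True by (simp add: x_def mult.commute)
    qed (simp add: x_def)
    have "d \<noteq> 0" using h0 d by auto
    then show ?thesis by (rule jm_step[OF SS Sv' Lv Lx])
  qed
  then show ?case unfolding LS d_def by simp
qed

end

section \<open>Compressing the cellular basis\<close>

text \<open>For two-column tableaux comparing all heights is the reverse of dominance: a larger
  height means more entries in the first column, hence a longer and less dominant shape.\<close>

definition path_le :: "bool list \<Rightarrow> bool list \<Rightarrow> bool" where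
  "path_le p q \<longleftrightarrow> (\<forall>i. ht (drop i p) \<le> ht (drop i q))"

lemma path_le_refl: "path_le p p"
  by (simp add: path_le_def)

lemma path_le_raise:
  assumes "path_le (xs @ (\<not> b') # b' # ys) (xs2 @ True # False # ys2)"
    and "length xs = length xs2" and "length ys = length ys2"
  shows "path_le (xs @ (\<not> b) # b # ys) (xs2 @ False # True # ys2)"
  unfolding path_le_def
proof
  fix i
  note le = assms(1)[unfolded path_le_def, rule_format]
  have y: "ht ys \<le> ht ys2" using le[of "length xs + 2"] assms(2) by simp
  consider "i \<le> length xs" | "i = length xs + 1" | k where "i = length xs + 2 + k"
    by (metis One_nat_def Suc_1 add.assoc add.commute le_Suc_ex not_less_eq_eq plus_1_eq_Suc
        linorder_not_le less_Suc_eq_le nat_less_le)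
  then show "ht (drop i (xs @ (\<not> b) # b # ys)) \<le> ht (drop i (xs2 @ False # True # ys2))"
  proof cases
    case 1
    then show ?thesis using le[of i] assms(2) by (auto simp: ht_append split: if_splits)
  next
    case 2
    then show ?thesis using y assms(2) by simp
  next
    case 3
    then show ?thesis using le[of i] assms(2) by simp
  qed
qed

lemma not_path_le_raise: "\<not> path_le (xs @ False # True # ys) (xs @ True # False # ys)"
  unfolding path_le_def not_all by (rule exI[of _ "length xs + 1"]) simp

primrec area :: "bool list \<Rightarrow> int" where
  "area [] = 0"
| "area (b # p) = ht (b # p) + area p"

lemma area_nonneg: "valid p \<Longrightarrow> 0 \<le> area p"
  by (induction p) auto

lemma area_append: "ht p = ht q \<Longrightarrow> area (xs @ p) - area p = area (xs @ q) - area q"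
  by (induction xs) (auto simp: ht_append)

lemma area_raise: "area (xs @ False # True # ys) = area (xs @ True # False # ys) + 2"
  using area_append[of "False # True # ys" "True # False # ys" xs] by simp

lemma low_Suc: "low (Suc m) 0 = False # True # low m 0"
  by (simp add: low_def)

lemma low_eq_append: "low m k = replicate k True @ low m 0"
  by (simp add: low_def)

lemma no_high_peak:
  assumes "valid p" and "\<And>xs ys. p = xs @ False # True # ys \<Longrightarrow> ht ys = 0"
  shows "\<exists>m k. p = low m k"
  using assms
proof (induction p)
  case Nil
  then show ?case by (metis low_0 replicate_0)
next
  case (Cons b p)
  have "\<exists>m k. p = low m k"
    by (rule Cons.IH) (use Cons.prems(1) Cons.prems(2)[of "b # _"] in auto)
  then obtain m k where p: "p = low m k" by blast
  show ?case
  proof (cases b)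
    case True
    then have "b # p = low m (Suc k)" by (simp add: p low_def)
    then show ?thesis by blast
  next
    case False
    then have "k \<noteq> 0" using Cons.prems(1) p by auto
    then obtain k' where k: "k = Suc k'" by (cases k) auto
    then have "b # p = [] @ False # True # low m k'" using False by (simp add: p low_def)
    then have "ht (low m k') = 0" using Cons.prems(2) by blast
    then have "k' = 0" unfolding ht_low by simp
    then have "b # p = low (Suc m) 0" using False k by (simp add: p low_def)
    then show ?thesis by blast
  qed
qed

text \<open>A path that is not \<open>low\<close> has a peak whose foot is above the ground; cutting
  it down to a valley keeps the path valid and lowers the area by 2. On half-diagrams the reverse
  move is multiplication by one generator, so this induction follows the way the cellular basis is
  generated.\<close>

lemma path_induct [consumes 1, case_names low raise]:
  assumes "s \<in> Paths n"
    and low: "\<And>m j. j + 2 * m = n \<Longrightarrow> P (low m j)"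
    and raise: "\<And>xs ys. xs @ True # False # ys \<in> Paths n \<Longrightarrow> P (xs @ True # False # ys) \<Longrightarrow> P (xs @ False # True # ys)"
  shows "P s"
  using assms(1)
proof (induction "nat (area s)" arbitrary: s rule: less_induct)
  case less
  show ?case
  proof (cases "\<exists>xs ys. s = xs @ False # True # ys \<and> ht ys \<noteq> 0")
    case True
    then obtain xs ys where s: "s = xs @ False # True # ys" and h: "ht ys \<noteq> 0" by blast
    have v: "valid (xs @ False # True # ys)" using less.prems s by (simp add: Paths_def)
    then have vy: "valid ys" using valid_appendD by fastforce
    then have "1 \<le> ht ys" using h ht_nonneg[OF vy] by linarith
    then have "valid (xs @ True # False # ys)" using valid_append_cong[OF v, of "True # False # ys"] vy by simp
    then have t: "xs @ True # False # ys \<in> Paths n" using less.prems s by (simp add: Paths_def)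
    have "nat (area (xs @ True # False # ys)) < nat (area s)"
      using area_raise[of xs ys] area_nonneg[of "xs @ True # False # ys"] t unfolding s Paths_def by auto
    then show ?thesis using raise[OF t] less.hyps t s by blast
  next
    case False
    then obtain m j where s: "s = low m j" using no_high_peak[of s] less.prems unfolding Paths_def by blast
    then have "j + 2 * m = n" using less.prems by (simp add: Paths_def)
    then show ?thesis using low s by blast
  qed
qed

lemma pr_raise: "pr n (xs @ True # False # ys) a \<Longrightarrow> pr n (xs @ False # True # ys) a"
  using valid_append_cong[of xs "True # False # ys" "False # True # ys"] valid_appendD[of xs "True # False # ys"]
  by (auto simp: pr_def Paths_def ht_append)

lemma can_Paths:
  assumes "a \<in> Paths n"
  shows "can n (ht a) \<in> Paths n" and "ht (can n (ht a)) = ht a"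
proof -
  have "0 \<le> ht a" "ht a \<le> int n" "even (int n - ht a)"
    using assms ht_le_length[of a] even_length_ht[of a] by (auto simp: Paths_def)
  from can[OF this] show "can n (ht a) \<in> Paths n" and "ht (can n (ht a)) = ht a" .
qed

section \<open>Triangularity of the cellular basis against the matrix units\<close>

text \<open>These laws determine \<open>C\<close> on pairs of paths of equal height: the
  \<open>low\<close> elements are products of u_1, u_3, u_5, ..., and raising a valley in either
  label multiplies by a generator on that side. Nothing else about half-diagrams enters the
  compression.\<close>

locale tl_cellular = tl_relations +
  fixes C :: "bool list \<Rightarrow> bool list \<Rightarrow> 'a"
  assumes C_left: "pr N (xs @ True # False # ys) a \<Longrightarrow>
      C (xs @ False # True # ys) a = u (Suc (length ys)) * C (xs @ True # False # ys) a"
    and C_right: "pr N s (xs @ True # False # ys) \<Longrightarrow>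
      C s (xs @ False # True # ys) = C s (xs @ True # False # ys) * u (Suc (length ys))"
    and C_top: "C (replicate N True) (replicate N True) = I"
    and C_low_left: "j + 2 * Suc m = N \<Longrightarrow> C (low (Suc m) j) (low (Suc m) j)
      = u (Suc (2 * m)) * C (low m (j + 2)) (low m (j + 2))"
begin

lemma split_at:
  assumes "q \<in> Paths N" and "Suc (Suc l) \<le> N"
  obtains xs c b ys where "q = xs @ c # b # ys" and "length ys = l"
proof -
  let ?d = "drop (N - Suc (Suc l)) q"
  have "length ?d = Suc (Suc l)" using assms by (simp add: Paths_def)
  then obtain c b ys where d: "?d = c # b # ys" "length ys = l" by (metis length_Suc_conv)
  show ?thesis using that[of "take (N - Suc (Suc l)) q" c b ys] d by (metis append_take_drop_id)
qed

lemma ext_low: "ext (low m 0) = {True}"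
  by (auto simp: ext_def split: if_splits)

text \<open>The element is a product of \<open>m\<close> generators on disjoint neighbouring pairs.
  On the ground a valley is impossible, so a generator is diagonal there: w(1) / w(0) = 2 on a short
  peak and 0 on two up steps.\<close>

lemma low_cell_left:
  assumes "j + 2 * m = N" and "q \<in> Paths N"
  shows "e q q * C (low m j) (low m j) = (if \<exists>xs. q = xs @ low m 0 then 2 ^ m *\<^sub>Q e q q else 0)"
  using assms
proof (induction m arbitrary: j q)
  case 0
  then show ?case using C_top e_I[OF order_refl pr_refl, of q] by simp
next
  case (Suc m)
  obtain xs c b ys where q: "q = xs @ c # b # ys" and l: "length ys = 2 * m"
    by (rule split_at[OF Suc.prems(2), of "2 * m"]) (use Suc.prems(1) in auto)
  let ?C = "C (low m (j + 2)) (low m (j + 2))"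
  have qq: "pr N q q" using Suc.prems(2) by (rule pr_refl)
  have IH: "e r r * ?C = (if \<exists>xs. r = xs @ low m 0 then 2 ^ m *\<^sub>Q e r r else 0)" if "r \<in> Paths N" for r
    by (rule Suc.IH) (use Suc.prems that in auto)
  have IH': "e q r * ?C = (if \<exists>xs. r = xs @ low m 0 then 2 ^ m *\<^sub>Q e q r else 0)" if r: "pr N q r" for r
  proof -
    have qr: "e q r * e r r = e q r" using mult_e[of N q r r r] r by (simp add: pr_def)
    then have "e q r * ?C = e q r * (e r r * ?C)" by (simp add: mult.assoc[symmetric])
    also have "e r r * ?C = (if \<exists>xs. r = xs @ low m 0 then 2 ^ m *\<^sub>Q e r r else 0)"
      by (rule IH) (use r in \<open>simp add: pr_def\<close>)
    finally show ?thesis using qr by auto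
  qed
  have suf: "(\<exists>zs. xs @ c' # b' # ys = zs @ low m 0) \<longleftrightarrow> ys = low m 0" for c' b'
  proof
    assume "\<exists>zs. xs @ c' # b' # ys = zs @ low m 0"
    then obtain zs where "(xs @ [c', b']) @ ys = zs @ low m 0" by auto
    then show "ys = low m 0" using l by (subst (asm) append_eq_append_conv) auto
  next
    assume "ys = low m 0"
    then show "\<exists>zs. xs @ c' # b' # ys = zs @ low m 0" by (intro exI[of _ "xs @ [c', b']"]) simp
  qed
  have suf2: "(\<exists>zs. xs @ c # b # ys = zs @ low (Suc m) 0) \<longleftrightarrow> c = False \<and> b = True \<and> ys = low m 0"
  proof
    assume "\<exists>zs. xs @ c # b # ys = zs @ low (Suc m) 0"
    then obtain zs where "xs @ c # b # ys = zs @ low (Suc m) 0" by auto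
    then have "c # b # ys = low (Suc m) 0" using l by (subst (asm) append_eq_append_conv) auto
    then show "c = False \<and> b = True \<and> ys = low m 0" by (simp add: low_Suc)
  qed (auto simp: low_Suc)
  have v: "valid (c # b # ys)" using Suc.prems(2) q valid_appendD unfolding Paths_def by blast
  have qu: "e q q * u (Suc (2 * m)) = (if b = c then 0 else
    (w (ht (b # ys)) / w (ht ys)) *\<^sub>Q (\<Sum>b'\<in>ext ys. e q (xs @ (\<not> b') # b' # ys)))"
    using e_u[of N q xs c b ys "Suc (2 * m)"] qq l unfolding q by simp
  have "e q q * C (low (Suc m) j) (low (Suc m) j) = (e q q * u (Suc (2 * m))) * ?C"
    using C_low_left[of j m] Suc.prems(1) by (simp add: mult.assoc)
  also have "\<dots> = (if b = c then 0 else
    (w (ht (b # ys)) / w (ht ys)) *\<^sub>Q (\<Sum>b'\<in>ext ys. e q (xs @ (\<not> b') # b' # ys) * ?C))"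
    unfolding qu by (simp add: sum_distrib_right)
  also have "\<dots> = (if b \<noteq> c \<and> ys = low m 0 then
    (w (ht (b # ys)) / w (ht ys) * 2 ^ m) *\<^sub>Q (\<Sum>b'\<in>ext ys. e q (xs @ (\<not> b') # b' # ys)) else 0)"
  proof (cases "b = c")
    case False
    have "e q (xs @ (\<not> b') # b' # ys) * ?C = (if ys = low m 0 then 2 ^ m *\<^sub>Q e q (xs @ (\<not> b') # b' # ys) else 0)"
      if b': "b' \<in> ext ys" for b'
    proof -
      have pp: "pr N q (xs @ (\<not> b') # b' # ys)" using pr_two[of N xs c b ys q b'] qq False b' by (simp add: q pr_sym)
      show ?thesis unfolding IH'[OF pp] suf ..
    qed
    then show ?thesis using False by (simp add: scl_sum_right[symmetric] cong: sum.cong)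
  qed simp
  also have "\<dots> = (if \<exists>xs. q = xs @ low (Suc m) 0 then 2 ^ Suc m *\<^sub>Q e q q else 0)"
  proof (cases "b \<noteq> c \<and> ys = low m 0")
    case True
    then have "b" using v by (auto split: if_splits)
    then have bc: "b = True" "c = False" using True by auto
    have "\<exists>xs. q = xs @ low (Suc m) 0" using suf2 bc True unfolding q by simp
    moreover have "(\<Sum>b'\<in>ext ys. e q (xs @ (\<not> b') # b' # ys)) = e q q"
      using True bc by (simp add: ext_low) (simp add: q)
    moreover have "w (ht (b # ys)) / w (ht ys) * 2 ^ m = 2 ^ Suc m" using True bc by (simp add: w_def)
    ultimately show ?thesis using True by simp
  next
    case False
    have "\<not> (b \<and> \<not> c) \<or> ys \<noteq> low m 0" using False by auto
    then have "\<not> (\<exists>zs. q = zs @ low (Suc m) 0)" unfolding q using suf2 by simp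
    then show ?thesis using False by auto
  qed
  finally show ?case .
qed

text \<open>By completeness of the units, \<open>low_cell_left\<close> already writes the element as
  a combination of diagonal units, and these act equally from both sides.\<close>

lemma low_cell_right:
  assumes "j + 2 * m = N" and "q \<in> Paths N"
  shows "C (low m j) (low m j) * e q q = (if \<exists>xs. q = xs @ low m 0 then 2 ^ m *\<^sub>Q e q q else 0)"
proof -
  let ?C = "C (low m j) (low m j)"
  have "I * ?C = ?C"
  proof (cases m)
    case 0
    then show ?thesis using assms(1) C_top by simp
  next
    case (Suc m')
    then show ?thesis using C_low_left[of j m'] assms(1) I_u[of "Suc (2 * m')"] by (simp add: mult.assoc[symmetric])
  qed
  then have "?C = (\<Sum>r\<in>Paths N. e r r) * ?C" unfolding sum_e[OF order_refl] ..
  also have "\<dots> = (\<Sum>r\<in>Paths N. e r r * ?C)" by (rule sum_distrib_right)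
  also have "\<dots> = (\<Sum>r\<in>Paths N. if \<exists>xs. r = xs @ low m 0 then 2 ^ m *\<^sub>Q e r r else 0)"
    by (intro sum.cong refl low_cell_left assms)
  finally have C: "?C = (\<Sum>r\<in>Paths N. if \<exists>xs. r = xs @ low m 0 then 2 ^ m *\<^sub>Q e r r else 0)" .
  have "?C * e q q = (\<Sum>r\<in>Paths N. (if \<exists>xs. r = xs @ low m 0 then 2 ^ m *\<^sub>Q e r r else 0) * e q q)"
    unfolding C by (rule sum_distrib_right)
  also have "\<dots> = (\<Sum>r\<in>Paths N. if r = q then (if \<exists>xs. q = xs @ low m 0 then 2 ^ m *\<^sub>Q e q q else 0) else 0)"
    by (intro sum.cong refl) (auto simp: mult_e[OF order_refl pr_refl pr_refl] assms(2))
  finally show ?thesis using assms(2) by (simp add: sum.delta)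
qed

lemma suffix_low:
  assumes "pr N q (low m j)" and "j + 2 * m = N"
  shows "(\<exists>xs. q = xs @ low m 0) \<longleftrightarrow> q = low m j"
proof
  assume "\<exists>xs. q = xs @ low m 0"
  then obtain xs where q: "q = xs @ low m 0" by blast
  then have "length xs = j" "ht xs = int j" using assms by (auto simp: pr_def Paths_def ht_append)
  then have "xs = replicate j True" using ht_eq_length[of xs] by simp
  then show "q = low m j" unfolding q low_eq_append[of m j] by simp
next
  assume "q = low m j"
  then show "\<exists>xs. q = xs @ low m 0" using low_eq_append by blast
qed

text \<open>Raising a valley of the label multiplies by a generator. Applied to a unit at
  \<open>q\<close>, this generator yields units at paths that differ from \<open>q\<close> in two
  steps only, and \<open>path_le_raise\<close> carries the vanishing over. At the new label the
  diagonal part dies, because the peak is not below the valley, and the off-diagonal part keeps the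
  coefficient nonzero.\<close>

lemma cell_right:
  assumes l: "j + 2 * m = N" and a: "a \<in> Paths N" "ht a = int j"
  shows "(\<forall>q. pr N q a \<longrightarrow> \<not> path_le q a \<longrightarrow> C (low m j) a * e q q = 0) \<and>
    (\<exists>y. y \<noteq> 0 \<and> C (low m j) a * e a a = y *\<^sub>Q e (low m j) a)"
  using a
proof (induction a rule: path_induct)
  case (low m' j')
  then have m: "m' = m" "j' = j" using l by auto
  have lP: "low m j \<in> Paths N" using l by (simp add: Paths_def)
  have "C (low m j) (low m j) * e q q = 0" if q: "pr N q (low m j)" "\<not> path_le q (low m j)" for q
    using low_cell_right[OF l, of q] suffix_low[OF q(1) l] q path_le_refl by (auto simp: pr_def)
  moreover have "C (low m j) (low m j) * e (low m j) (low m j) = 2 ^ m *\<^sub>Q e (low m j) (low m j)"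
    using low_cell_right[OF l lP] low_eq_append[of m j] by metis
  ultimately show ?case unfolding m by (metis power_not_zero zero_neq_numeral)
next
  case (raise xs ys)
  let ?l = "low m j" and ?a = "xs @ True # False # ys" and ?b = "xs @ False # True # ys"
  have hta: "ht ?a = int j" using raise.prems by (simp add: ht_append)
  have la: "pr N ?l ?a" using raise.hyps hta l by (simp add: pr_def Paths_def)
  have ab: "pr N ?b ?a" using pr_raise pr_refl raise.hyps by blast
  note bb = pr_trans[OF ab pr_sym[OF ab]]
  have IH: "C ?l ?a * e q q = 0" if "pr N q ?a" "\<not> path_le q ?a" for q
    using raise.IH hta that by blast
  obtain y where y: "y \<noteq> 0" "C ?l ?a * e ?a ?a = y *\<^sub>Q e ?l ?a" using raise.IH hta by blast
  have IH0: "C ?l ?a * e q z = 0" if "pr N q ?a" "\<not> path_le q ?a" "pr N q z" for q z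
  proof -
    have "C ?l ?a * e q z = (C ?l ?a * e q q) * e q z"
      using mult_e[of N q q q z] that by (simp add: mult.assoc pr_def)
    then show ?thesis using IH that by simp
  qed
  have Cb: "C ?l ?b = C ?l ?a * u (Suc (length ys))" using C_right[OF la] .
  have "C ?l ?b * e q q = 0" if q: "pr N q ?b" "\<not> path_le q ?b" for q
  proof -
    have "Suc (Suc (length ys)) \<le> N" "q \<in> Paths N" using raise.hyps q by (auto simp: Paths_def pr_def)
    then obtain xs' c b ys' where q': "q = xs' @ c # b # ys'" "length ys' = length ys"
      using split_at[of q "length ys"] by metis
    then have lx: "length xs' = length xs" using q by (auto simp: pr_def Paths_def)
    have qq: "pr N q q" using q by (simp add: pr_def)
    have "u (Suc (length ys)) * e q q = (if b = c then 0 else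
      (\<Sum>b'\<in>ext ys'. (w (ht (b' # ys')) / w (ht ys')) *\<^sub>Q e (xs' @ (\<not> b') # b' # ys') q))"
      using u_e[of N xs' c b ys' q "Suc (length ys)"] qq q' by simp
    moreover have "C ?l ?a * e (xs' @ (\<not> b') # b' # ys') q = 0" if b': "b' \<in> ext ys'" "b \<noteq> c" for b'
    proof (rule IH0)
      show p: "pr N (xs' @ (\<not> b') # b' # ys') q" using pr_two[of N xs' c b ys' q b'] qq q' b' by auto
      show "pr N (xs' @ (\<not> b') # b' # ys') ?a" using p q ab pr_trans by blast
      show "\<not> path_le (xs' @ (\<not> b') # b' # ys') ?a"
      proof
        assume "path_le (xs' @ (\<not> b') # b' # ys') ?a"
        then have "path_le (xs' @ (\<not> b) # b # ys') ?b" by (rule path_le_raise[OF _ lx q'(2)])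
        moreover have "c = (\<not> b)" using b'(2) by auto
        ultimately show False using q(2) q'(1) by simp
      qed
    qed
    ultimately show ?thesis unfolding Cb by (simp add: mult.assoc sum_distrib_left)
  qed
  moreover have "C ?l ?b * e ?b ?b = (w (ht (False # ys)) / w (ht ys) * y) *\<^sub>Q e ?l ?b
      \<and> w (ht (False # ys)) / w (ht ys) * y \<noteq> 0"
  proof -
    have v: "valid (False # ys)" using raise.hyps valid_appendD[of "xs @ [True]" "False # ys"] by (simp add: Paths_def)
    have e: "ext ys = {True, False}" using v by (auto simp: ext_def)
    have "u (Suc (length ys)) * e ?b ?b = (w (ht (True # ys)) / w (ht ys)) *\<^sub>Q e ?b ?b
        + (w (ht (False # ys)) / w (ht ys)) *\<^sub>Q e ?a ?b"
      using u_e[OF order_refl bb refl] unfolding e by simp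
    moreover have "C ?l ?a * e ?b ?b = 0" using IH0[OF ab not_path_le_raise bb] .
    moreover have "C ?l ?a * e ?a ?b = y *\<^sub>Q e ?l ?b"
    proof -
      have "e ?a ?a * e ?a ?b = e ?a ?b"
        using mult_e[of N ?a ?a ?a ?b] ab raise.hyps by (simp add: pr_def)
      then have "C ?l ?a * e ?a ?b = (C ?l ?a * e ?a ?a) * e ?a ?b" by (simp add: mult.assoc)
      also have "\<dots> = y *\<^sub>Q e ?l ?b" unfolding y(2)
        using mult_e[OF order_refl la pr_sym[OF ab]] by simp
      finally show ?thesis .
    qed
    ultimately have "C ?l ?b * e ?b ?b = (w (ht (False # ys)) / w (ht ys) * y) *\<^sub>Q e ?l ?b"
      unfolding Cb by (simp add: mult.assoc distrib_left)
    moreover have "w (ht (False # ys)) / w (ht ys) * y \<noteq> 0"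
      using v y(1) w_neq_0[of "ht ys"] w_neq_0[of "ht (False # ys)"] by auto
    ultimately show ?thesis by blast
  qed
  ultimately show ?case by blast
qed

text \<open>The triangularity of \<open>cell_right\<close> on the other side. The second half is
  formulated relative to the \<open>low\<close> label with a factor independent of \<open>a\<close>;
  this makes the compressed coefficient split as \<open>x s * y a\<close> in
  \<open>cell_compress\<close>.\<close>

lemma cell_left:
  assumes "s \<in> Paths N"
  shows "(\<forall>a q. pr N s a \<longrightarrow> pr N q s \<longrightarrow> \<not> path_le q s \<longrightarrow> e q q * C s a = 0) \<and>
    (\<exists>x. x \<noteq> 0 \<and> (\<forall>a. pr N s a \<longrightarrow>
      e s s * C s a = x *\<^sub>Q (e s (can N (ht s)) * C (can N (ht s)) a)))"
  using assms
proof (induction s rule: path_induct)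
  case (low m j)
  have c: "can N (int j) = low m j" using low by (auto simp: can_def)
  have lP: "low m j \<in> Paths N" using low by (simp add: Paths_def)
  have "e q q * C (low m j) a = 0" if "pr N (low m j) a" and q: "pr N q (low m j)" "\<not> path_le q (low m j)" for a q
  proof -
    have "a \<in> Paths N" "ht a = int j" using that by (auto simp: pr_def)
    \<comment> \<open>The right label is reached from the \<open>low\<close> one by generators
      multiplied on the right, which preserve an annihilation on the left.\<close>
    then show ?thesis
    proof (induction a rule: path_induct)
      case (low m' j')
      then have m: "m' = m" "j' = j" using \<open>j + 2 * m = N\<close> by auto
      then show ?case using low_cell_left[OF low.hyps(1), of q] suffix_low[OF q(1)] q path_le_refl low
        by (auto simp: pr_def)
    next
      case (raise xs ys)
      have "ht (xs @ True # False # ys) = int j" using raise.prems by (simp add: ht_append)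
      then have "pr N (low m j) (xs @ True # False # ys)" "e q q * C (low m j) (xs @ True # False # ys) = 0"
        using raise lP by (auto simp: pr_def)
      then show ?case using C_right[of "low m j" xs ys] by (simp add: mult.assoc[symmetric])
    qed
  qed
  moreover have "\<exists>x. x \<noteq> 0 \<and> (\<forall>a. pr N (low m j) a \<longrightarrow>
      e (low m j) (low m j) * C (low m j) a = x *\<^sub>Q (e (low m j) (can N (ht (low m j))) * C (can N (ht (low m j))) a))"
    by (rule exI[of _ 1]) (simp add: c)
  ultimately show ?case by blast
next
  case (raise xs ys)
  let ?a = "xs @ True # False # ys" and ?b = "xs @ False # True # ys"
  let ?k = "Suc (length ys)"
  have htab: "ht ?b = ht ?a" by (simp add: ht_append)
  have ab: "pr N ?b ?a" using pr_raise pr_refl raise.hyps by blast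
  note bb = pr_trans[OF ab pr_sym[OF ab]]
  have IH: "e z q * C ?a a = 0" if "pr N ?a a" "pr N q ?a" "\<not> path_le q ?a" "pr N z q" for z a q
  proof -
    have "e z q * C ?a a = e z q * (e q q * C ?a a)"
      using mult_e[of N z q q q] that by (simp add: mult.assoc[symmetric] pr_def)
    then show ?thesis using raise.IH that by simp
  qed
  obtain x where x: "x \<noteq> 0" "\<And>a. pr N ?a a \<Longrightarrow>
      e ?a ?a * C ?a a = x *\<^sub>Q (e ?a (can N (ht ?a)) * C (can N (ht ?a)) a)" using raise.IH by blast
  have l: "pr N ?a (can N (ht ?a))" using can_Paths[OF raise.hyps(1)] raise.hyps(1) by (simp add: pr_def)
  have "e q q * C ?b a = 0" if a: "pr N ?b a" and q: "pr N q ?b" "\<not> path_le q ?b" for a q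
  proof -
    have aa: "pr N ?a a" using pr_trans[OF pr_sym[OF ab] a] .
    have "Suc (Suc (length ys)) \<le> N" "q \<in> Paths N" using raise.hyps q by (auto simp: Paths_def pr_def)
    then obtain xs' c b ys' where q': "q = xs' @ c # b # ys'" "length ys' = length ys"
      using split_at[of q "length ys"] by metis
    then have lx: "length xs' = length xs" using q by (auto simp: pr_def Paths_def)
    have qq: "pr N q q" using q by (simp add: pr_def)
    have "e q q * u ?k = (if b = c then 0 else
      (w (ht (b # ys')) / w (ht ys')) *\<^sub>Q (\<Sum>b'\<in>ext ys'. e q (xs' @ (\<not> b') # b' # ys')))"
      using e_u[of N q xs' c b ys' ?k] qq q' by simp
    moreover have "e q (xs' @ (\<not> b') # b' # ys') * C ?a a = 0" if b': "b' \<in> ext ys'" "b \<noteq> c" for b'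
    proof (rule IH[OF aa])
      have p: "pr N (xs' @ (\<not> b') # b' # ys') q" using pr_two[of N xs' c b ys' q b'] qq q' b' by auto
      then show "pr N q (xs' @ (\<not> b') # b' # ys')" by (rule pr_sym)
      show "pr N (xs' @ (\<not> b') # b' # ys') ?a" using p q ab pr_trans by blast
      show "\<not> path_le (xs' @ (\<not> b') # b' # ys') ?a"
      proof
        assume "path_le (xs' @ (\<not> b') # b' # ys') ?a"
        then have "path_le (xs' @ (\<not> b) # b # ys') ?b" by (rule path_le_raise[OF _ lx q'(2)])
        moreover have "c = (\<not> b)" using b'(2) by auto
        ultimately show False using q(2) q'(1) by simp
      qed
    qed
    ultimately show ?thesis unfolding C_left[OF aa] by (simp add: mult.assoc[symmetric] sum_distrib_right)
  qed
  moreover have "\<exists>x'. x' \<noteq> 0 \<and> (\<forall>a. pr N ?b a \<longrightarrow>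
      e ?b ?b * C ?b a = x' *\<^sub>Q (e ?b (can N (ht ?b)) * C (can N (ht ?b)) a))"
  proof -
    have v: "valid (False # ys)" using raise.hyps valid_appendD[of "xs @ [True]" "False # ys"] by (simp add: Paths_def)
    have e: "ext ys = {True, False}" using v by (auto simp: ext_def)
    let ?c = "w (ht (True # ys)) / w (ht ys)"
    have c0: "?c \<noteq> 0" using v w_neq_0[of "ht ys"] w_neq_0[of "ht (True # ys)"] by auto
    have "e ?b ?b * C ?b a = (?c * x) *\<^sub>Q (e ?b (can N (ht ?b)) * C (can N (ht ?b)) a)" if a: "pr N ?b a" for a
    proof -
      have aa: "pr N ?a a" using pr_trans[OF pr_sym[OF ab] a] .
      have "e ?b ?b * u ?k = ?c *\<^sub>Q (e ?b ?b + e ?b ?a)"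
        using e_u[OF order_refl bb refl] unfolding e by simp
      then have "e ?b ?b * C ?b a = ?c *\<^sub>Q (e ?b ?b * C ?a a + e ?b ?a * C ?a a)"
        unfolding C_left[OF aa] by (simp add: mult.assoc[symmetric] distrib_right)
      also have "e ?b ?b * C ?a a = 0" using IH[OF aa ab not_path_le_raise bb] .
      also have "e ?b ?a * C ?a a = e ?b ?a * (e ?a ?a * C ?a a)"
        using mult_e[of N ?b ?a ?a ?a] ab raise.hyps by (simp add: mult.assoc[symmetric] pr_def)
      also have "\<dots> = x *\<^sub>Q (e ?b (can N (ht ?a)) * C (can N (ht ?a)) a)"
        unfolding x(2)[OF aa] using mult_e'[OF order_refl ab l] by simp
      finally show ?thesis by (simp add: htab)
    qed
    then show ?thesis using c0 x(1) by (intro exI[of _ "?c * x"]) auto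
  qed
  ultimately show ?case by blast
qed

lemma cell_compress:
  obtains x y where "\<And>s a. pr N s a \<Longrightarrow> e s s * (C s a * e a a) = (x s * y a) *\<^sub>Q e s a"
    and "\<And>s. s \<in> Paths N \<Longrightarrow> x s \<noteq> 0" and "\<And>a. a \<in> Paths N \<Longrightarrow> y a \<noteq> 0"
proof -
  obtain x where x: "\<And>s. s \<in> Paths N \<Longrightarrow> x s \<noteq> 0" "\<And>s a. pr N s a \<Longrightarrow>
      e s s * C s a = x s *\<^sub>Q (e s (can N (ht s)) * C (can N (ht s)) a)"
  proof -
    have "\<forall>s\<in>Paths N. \<exists>x. x \<noteq> 0 \<and> (\<forall>a. pr N s a \<longrightarrow>
        e s s * C s a = x *\<^sub>Q (e s (can N (ht s)) * C (can N (ht s)) a))"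
      using cell_left by blast
    from bchoice[OF this] obtain x where "\<forall>s\<in>Paths N. x s \<noteq> 0 \<and> (\<forall>a. pr N s a \<longrightarrow>
        e s s * C s a = x s *\<^sub>Q (e s (can N (ht s)) * C (can N (ht s)) a))" by blast
    moreover have "s \<in> Paths N" if "pr N s a" for s a using that by (simp add: pr_def)
    ultimately show ?thesis using that by blast
  qed
  note can = can_Paths
  have "\<exists>y. y \<noteq> 0 \<and> C (can N (ht a)) a * e a a = y *\<^sub>Q e (can N (ht a)) a" if a: "a \<in> Paths N" for a
  proof -
    define j where "j = nat (ht a)"
    define m where "m = (N - j) div 2"
    have c: "can N (ht a) = low m j" by (simp add: can_def m_def j_def)
    have "j + 2 * m = N" using can(1)[OF a] by (simp add: c Paths_def)
    moreover have "ht a = int j" using a by (simp add: j_def Paths_def)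
    ultimately show ?thesis using cell_right[of j m a] a unfolding c by blast
  qed
  then obtain y where y: "\<And>a. a \<in> Paths N \<Longrightarrow> y a \<noteq> 0"
    "\<And>a. a \<in> Paths N \<Longrightarrow> C (can N (ht a)) a * e a a = y a *\<^sub>Q e (can N (ht a)) a" by metis
  have "e s s * (C s a * e a a) = (x s * y a) *\<^sub>Q e s a" if sa: "pr N s a" for s a
  proof -
    have h: "ht s = ht a" "a \<in> Paths N" "s \<in> Paths N" using sa by (simp_all add: pr_def)
    have p: "pr N s (can N (ht a))" "pr N (can N (ht a)) a" using can[OF h(2)] h by (simp_all add: pr_def)
    have "e s s * (C s a * e a a) = x s *\<^sub>Q (e s (can N (ht a)) * (C (can N (ht a)) a * e a a))"
      using x(2)[OF sa] h by (simp add: mult.assoc[symmetric])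
    also have "\<dots> = (x s * y a) *\<^sub>Q (e s (can N (ht a)) * e (can N (ht a)) a)"
      unfolding y(2)[OF h(2)] by simp
    finally show ?thesis using mult_e[OF order_refl p] by simp
  qed
  then show ?thesis using that x(1) y(1) by blast
qed

end

section \<open>The diamonds of KLR generators\<close>

text \<open>Axial distance for the step \<open>b\<close> followed by its opposite, starting from
  height \<open>h\<close>; as a list this is \<open>(\<not> b) # b # ys\<close>.\<close>

definition axial :: "bool \<Rightarrow> int \<Rightarrow> int" where
  "axial b h = (if b then - (h + 1) else h + 1)"

text \<open>The KLR coefficient \<open>\<beta>\<close> as a function of the height alone. If
  \<open>b\<close> is an up step, the pair is a peak and its swap a valley, which is more dominant;
  this selects the second form of \<open>\<alpha>\<close>.\<close>

definition swap_coeff :: "nat \<Rightarrow> bool \<Rightarrow> int \<Rightarrow> rat" where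
  "swap_coeff p b h = (let r = axial b h; q = of_int r; \<alpha> = (if b then (q\<^sup>2 - 1) / q\<^sup>2 else 1) in
     if [r = 0] (mod int p) then \<alpha> / (1 - q)
     else if [r = 1] (mod int p) then \<alpha> * q else \<alpha> * q / (1 - q))"

definition stay_coeff :: "nat \<Rightarrow> bool \<Rightarrow> int \<Rightarrow> rat" where
  "stay_coeff p b h = (if [axial b h = 0] (mod int p) then - (1 / of_int (axial b h)) else 0)"

definition zigzag :: "nat \<Rightarrow> bool \<Rightarrow> bool list" where
  "zigzag j b = concat (replicate j [b, \<not> b])"

text \<open>\<open>T\<close> records which pairs of \<open>zigzag j (\<not> b)\<close> have been
  swapped.\<close>

definition pairs :: "bool list \<Rightarrow> bool \<Rightarrow> bool list" where
  "pairs T b = concat (map (\<lambda>t. if t then [b, \<not> b] else [\<not> b, b]) T)"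

lemma zigzag_simps [simp]: "zigzag 0 b = []" "zigzag (Suc j) b = b # (\<not> b) # zigzag j b"
  by (simp_all add: zigzag_def)

lemma zigzag_Suc': "zigzag (Suc j) b = zigzag j b @ [b, \<not> b]"
  by (induction j) simp_all

lemma zigzag_inner: "(\<not> b) # zigzag j b @ [b] = zigzag (Suc j) (\<not> b)"
  by (induction j) simp_all

lemma length_zigzag [simp]: "length (zigzag j b) = 2 * j"
  by (induction j) simp_all

lemma ht_zigzag [simp]: "ht (zigzag j b) = 0"
  by (induction j) simp_all

lemma pairs_append: "pairs (T @ [t]) b = pairs T b @ (if t then [b, \<not> b] else [\<not> b, b])"
  by (simp add: pairs_def)

lemma pairs_Nil [simp]: "pairs [] b = []"
  by (simp add: pairs_def)

lemma length_pairs [simp]: "length (pairs T b) = 2 * length T"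
  by (induction T) (auto simp: pairs_def)

lemma ht_pairs [simp]: "ht (pairs T b) = 0"
  by (induction T) (auto simp: pairs_def)

lemma pairs_replicate: "pairs (replicate j t) b = zigzag j (if t then b else \<not> b)"
  by (induction j) (auto simp: pairs_def)

lemma valid_pairs: "valid Y \<Longrightarrow> 0 \<le> ht (b # Y) \<Longrightarrow> 0 \<le> ht ((\<not> b) # Y) \<Longrightarrow> valid (pairs T b @ Y)"
proof (induction T)
  case (Cons t T)
  have "ht (pairs T b @ Y) = ht Y" by (simp add: ht_append)
  moreover have "pairs (t # T) b = (if t then [b, \<not> b] else [\<not> b, b]) @ pairs T b" by (simp add: pairs_def)
  ultimately show ?case using Cons by (cases t; cases b) (auto simp del: ht_nonneg)
qed simp

lemma sum_snoc:
  fixes g :: "bool list \<Rightarrow> 'a::comm_monoid_add"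
  shows "(\<Sum>T | length T = Suc j. g T) = (\<Sum>T | length T = j. g (T @ [True]) + g (T @ [False]))"
proof -
  have fin: "finite {T :: bool list. length T = k}" for k
    using finite_lists_length_eq[of "UNIV :: bool set" k] by simp
  have "{T :: bool list. length T = Suc j} = (\<lambda>T. T @ [True]) ` {T. length T = j} \<union> (\<lambda>T. T @ [False]) ` {T. length T = j}"
  proof (rule Set.set_eqI)
    fix T :: "bool list"
    show "T \<in> {T. length T = Suc j} \<longleftrightarrow> T \<in> (\<lambda>T. T @ [True]) ` {T. length T = j} \<union> (\<lambda>T. T @ [False]) ` {T. length T = j}"
      by (cases T rule: rev_cases) auto
  qed
  also have "sum g \<dots> = sum g ((\<lambda>T. T @ [True]) ` {T. length T = j}) + sum g ((\<lambda>T. T @ [False]) ` {T. length T = j})"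
    by (rule sum.union_disjoint) (use fin in auto)
  finally show ?thesis by (simp add: sum.reindex inj_on_def sum.distrib)
qed

section \<open>Rows of KLR generators on zigzag paths\<close>

text \<open>\<open>v q\<close> stands for the seminormal basis element with left label
  \<open>q\<close> and a fixed right label. Sending invalid lists to zero makes the swap formula
  uniform: a swap that leaves the set of paths simply contributes nothing.\<close>

locale klr_action =
  fixes p n :: nat and v :: "bool list \<Rightarrow> 'a::rat_algebra" and psi :: "nat \<Rightarrow> 'a"
  assumes odd_p: "odd p" and p3: "3 \<le> p"
    and v_invalid: "\<not> valid q \<Longrightarrow> v q = 0"
    and psi_same: "xs @ b # b # ys \<in> Paths n \<Longrightarrow> psi (Suc (length ys)) * v (xs @ b # b # ys) = 0"
    and psi_swap: "xs @ (\<not> b) # b # ys \<in> Paths n \<Longrightarrow>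
      psi (Suc (length ys)) * v (xs @ (\<not> b) # b # ys) =
        swap_coeff p b (ht ys) *\<^sub>Q v (xs @ b # (\<not> b) # ys) + stay_coeff p b (ht ys) *\<^sub>Q v (xs @ (\<not> b) # b # ys)"
begin

definition act :: "nat list \<Rightarrow> 'a \<Rightarrow> 'a" where
  "act ks x = foldr (\<lambda>k y. psi k * y) ks x"

text \<open>The indices of one row of the diamond above a base of length \<open>l\<close>; with
  spacing two, the generators act on disjoint pairs.\<close>

definition pos :: "nat \<Rightarrow> nat \<Rightarrow> nat list" where
  "pos l j = map (\<lambda>m. Suc (l + 2 * m)) [0..<j]"

lemma act_simps [simp]: "act [] x = x" "act (k # ks) x = psi k * act ks x"
  by (simp_all add: act_def)

lemma act_0 [simp]: "act ks 0 = 0"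
  by (induction ks) simp_all

lemma act_add: "act ks (x + y) = act ks x + act ks y"
  by (induction ks) (simp_all add: distrib_left)

lemma act_scl: "act ks (c *\<^sub>Q x) = c *\<^sub>Q act ks x"
  by (induction ks) simp_all

lemma act_sum: "act ks (\<Sum>i\<in>A. f i) = (\<Sum>i\<in>A. act ks (f i))"
  by (induction A rule: infinite_finite_induct) (simp_all add: act_add)

lemma pos_Suc: "pos l (Suc j) = Suc l # pos (l + 2) j"
  unfolding pos_def by (simp add: upt_conv_Cons map_Suc_upt[symmetric] del: upt_Suc)

lemma pos_0 [simp]: "pos l 0 = []"
  by (simp add: pos_def)

text \<open>All the factors act independently, each of them either swapping its pair or not.\<close>

lemma act_pairs:
  assumes "X @ zigzag j (\<not> b) @ Y \<in> Paths n"
  shows "act (pos (length Y) j) (v (X @ zigzag j (\<not> b) @ Y)) =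
    (\<Sum>T | length T = j. prod_list (map (\<lambda>t. if t then swap_coeff p b (ht Y) else stay_coeff p b (ht Y)) T)
       *\<^sub>Q v (X @ pairs T b @ Y))"
  using assms
proof (induction j arbitrary: Y)
  case 0
  have "{T :: bool list. length T = 0} = {[]}" by auto
  then show ?case by simp
next
  case (Suc j)
  let ?s = "swap_coeff p b (ht Y)" and ?d = "stay_coeff p b (ht Y)"
  let ?wt = "\<lambda>T. prod_list (map (\<lambda>t. if t then ?s else ?d) T)"
  let ?Y = "(\<not> b) # b # Y"
  have h: "ht ?Y = ht Y" by simp
  have e: "X @ zigzag (Suc j) (\<not> b) @ Y = X @ zigzag j (\<not> b) @ ?Y" by (simp add: zigzag_Suc' del: zigzag_simps)
  have P: "X @ zigzag j (\<not> b) @ ?Y \<in> Paths n" using Suc.prems unfolding e .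
  have vY: "valid ?Y" using P valid_appendD[of "X @ zigzag j (\<not> b)" ?Y] by (simp add: Paths_def)
  have "act (pos (length Y) (Suc j)) (v (X @ zigzag (Suc j) (\<not> b) @ Y))
      = psi (Suc (length Y)) * act (pos (length ?Y) j) (v (X @ zigzag j (\<not> b) @ ?Y))"
    unfolding e by (simp add: pos_Suc)
  also have "act (pos (length ?Y) j) (v (X @ zigzag j (\<not> b) @ ?Y)) = (\<Sum>T | length T = j. ?wt T *\<^sub>Q v (X @ pairs T b @ ?Y))"
    using Suc.IH[OF P] unfolding h .
  also have "psi (Suc (length Y)) * \<dots> = (\<Sum>T | length T = j. ?wt T *\<^sub>Q (psi (Suc (length Y)) * v (X @ pairs T b @ ?Y)))"
    by (simp add: sum_distrib_left)
  also have "\<dots> = (\<Sum>T | length T = j. ?wt (T @ [True]) *\<^sub>Q v (X @ pairs (T @ [True]) b @ Y)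
       + ?wt (T @ [False]) *\<^sub>Q v (X @ pairs (T @ [False]) b @ Y))"
  proof (rule sum.cong[OF refl])
    fix T :: "bool list" assume T: "T \<in> {T. length T = j}"
    let ?q = "X @ pairs T b @ ?Y"
    have l: "length ?q = n" using P T by (simp add: Paths_def)
    have "psi (Suc (length Y)) * v ?q = ?s *\<^sub>Q v (X @ pairs T b @ b # (\<not> b) # Y) + ?d *\<^sub>Q v ?q"
    proof (cases "valid ?q")
      case True
      then show ?thesis using psi_swap[of "X @ pairs T b" b Y] l by (simp add: Paths_def)
    next
      case False
      \<comment> \<open>Validity of the swapped path would allow both neighbours of the base height,
        and then every pattern of pairs would be valid. So both sides of the formula are zero
        here.\<close>
      have "\<not> valid (X @ pairs T b @ b # (\<not> b) # Y)"
      proof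
        assume a: "valid (X @ pairs T b @ b # (\<not> b) # Y)"
        then have "valid ((X @ pairs T b) @ b # (\<not> b) # Y)" by simp
        then have "valid (b # (\<not> b) # Y)" by (rule valid_appendD)
        then have "0 \<le> ht ((\<not> b) # ?Y)" "0 \<le> ht (b # ?Y)" using vY by (cases b; simp)+
        then have "valid (pairs T b @ ?Y)" by (intro valid_pairs vY)
        then have "valid ?q" using valid_append_cong[OF a, of "pairs T b @ ?Y"] by (simp add: ht_append)
        then show False using False by simp
      qed
      then show ?thesis using False by (simp add: v_invalid)
    qed
    then show "?wt T *\<^sub>Q (psi (Suc (length Y)) * v ?q) = ?wt (T @ [True]) *\<^sub>Q v (X @ pairs (T @ [True]) b @ Y)
       + ?wt (T @ [False]) *\<^sub>Q v (X @ pairs (T @ [False]) b @ Y)"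
      by (simp add: pairs_append scl_add_right)
  qed
  also have "\<dots> = (\<Sum>T | length T = Suc j. ?wt T *\<^sub>Q v (X @ pairs T b @ Y))"
    by (rule sum_snoc[symmetric])
  finally show ?case .
qed

lemma finite_bool_lists: "finite {T :: bool list. length T = k}"
  using finite_lists_length_eq[of "UNIV :: bool set" k] by simp

text \<open>With a vanishing stay coefficient only the pattern in which all pairs are swapped
  survives in \<open>act_pairs\<close>.\<close>

lemma act_flip:
  assumes "X @ zigzag j (\<not> b) @ Y \<in> Paths n" and "stay_coeff p b (ht Y) = 0"
  shows "act (pos (length Y) j) (v (X @ zigzag j (\<not> b) @ Y)) = swap_coeff p b (ht Y) ^ j *\<^sub>Q v (X @ zigzag j b @ Y)"
proof -
  let ?wt = "\<lambda>T. prod_list (map (\<lambda>t. if t then swap_coeff p b (ht Y) else stay_coeff p b (ht Y)) T)"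
  have z: "?wt T = 0" if "T \<noteq> replicate j True" "length T = j" for T
  proof -
    have "False \<in> set T" using that by (metis (full_types) replicate_eqI)
    then show ?thesis using assms(2) by (auto simp: prod_list_zero_iff)
  qed
  have "(\<Sum>T | length T = j. ?wt T *\<^sub>Q v (X @ pairs T b @ Y))
      = (\<Sum>T | length T = j. if T = replicate j True then swap_coeff p b (ht Y) ^ j *\<^sub>Q v (X @ zigzag j b @ Y) else 0)"
    by (intro sum.cong refl) (auto simp: z pairs_replicate)
  then show ?thesis using act_pairs[OF assms(1)] finite_bool_lists by (simp add: sum.delta)
qed

text \<open>The span of the vectors whose path has the initial part \<open>W\<close>. Generators
  beyond \<open>W\<close> preserve it whatever their coefficients are, which avoids computing
  them.\<close>

inductive_set Sp :: "bool list \<Rightarrow> 'a set" for W where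
  Sp_0: "0 \<in> Sp W"
| Sp_v: "length (X @ W) = n \<Longrightarrow> v (X @ W) \<in> Sp W"
| Sp_add: "x \<in> Sp W \<Longrightarrow> y \<in> Sp W \<Longrightarrow> x + y \<in> Sp W"
| Sp_scl: "x \<in> Sp W \<Longrightarrow> c *\<^sub>Q x \<in> Sp W"

lemma psi_invalid_cases:
  assumes "xs @ c # b # ys \<in> Paths n"
  shows "\<exists>\<beta> \<delta>. psi (Suc (length ys)) * v (xs @ c # b # ys) = \<beta> *\<^sub>Q v (xs @ b # c # ys) + \<delta> *\<^sub>Q v (xs @ c # b # ys)"
proof (cases "c = b")
  case True
  have "psi (Suc (length ys)) * v (xs @ c # b # ys) = 0 *\<^sub>Q v (xs @ b # c # ys) + 0 *\<^sub>Q v (xs @ c # b # ys)"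
    using psi_same assms True by simp
  then show ?thesis by blast
next
  case False
  then have "c = (\<not> b)" by auto
  then show ?thesis using psi_swap[of xs b ys] assms by blast
qed

lemma psi_Sp:
  assumes "x \<in> Sp W" and k: "length W < k" "k < n"
  shows "psi k * x \<in> Sp W"
  using assms(1)
proof induction
  case (Sp_v X)
  show ?case
  proof (cases "valid (X @ W)")
    case True
    define d where "d = length X - Suc (k - length W)"
    have "length (drop d X) = Suc (Suc (k - Suc (length W)))" using Sp_v k by (simp add: d_def)
    then obtain c b ys where dr: "drop d X = c # b # ys" and l: "length ys = k - Suc (length W)"
      by (metis length_Suc_conv)
    define xs where "xs = take d X"
    have X: "X @ W = xs @ c # b # (ys @ W)" using dr append_take_drop_id[of d X] unfolding xs_def by (metis append.assoc append_Cons)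
    have kk: "k = Suc (length (ys @ W))" using l k by simp
    have "xs @ c # b # (ys @ W) \<in> Paths n" using True Sp_v X by (simp add: Paths_def)
    then obtain \<beta> \<delta> where "psi k * v (X @ W) = \<beta> *\<^sub>Q v (xs @ b # c # (ys @ W)) + \<delta> *\<^sub>Q v (X @ W)"
      using psi_invalid_cases[of xs c b "ys @ W"] X kk by auto
    moreover have "v ((xs @ b # c # ys) @ W) \<in> Sp W"
      by (rule Sp.Sp_v) (use X Sp_v in \<open>simp add: arg_cong[OF X, of length]\<close>)
    ultimately show ?thesis using Sp.Sp_v[OF Sp_v] by (simp add: Sp.Sp_add Sp.Sp_scl)
  qed (simp add: v_invalid Sp_0)
qed (simp_all add: Sp_0 Sp_add Sp_scl distrib_left)

lemma act_Sp: "x \<in> Sp W \<Longrightarrow> (\<And>k. k \<in> set ks \<Longrightarrow> length W < k \<and> k < n) \<Longrightarrow> act ks x \<in> Sp W"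
  by (induction ks) (simp_all add: psi_Sp)

lemma Sp_kill: "x \<in> Sp (b # b # ys) \<Longrightarrow> psi (Suc (length ys)) * x = 0"
proof (induction rule: Sp.induct)
  case (Sp_v X)
  then show ?case
    by (cases "valid (X @ b # b # ys)") (simp_all add: v_invalid psi_same Paths_def)
qed (simp_all add: distrib_left)

text \<open>Where two neighbouring pairs have opposite orientation, the adjoining steps are equal,
  and the generator straddling them kills the vector. The factors applied before it concern later
  steps of the path; they stay inside the span \<open>Sp\<close> and so cannot prevent this.\<close>

lemma act_mixed:
  assumes "length T = Suc j" and "\<nexists>t. T = replicate (Suc j) t" and "length (X @ pairs T b @ Y) = n"
  shows "act (pos (Suc (length Y)) j) (v (X @ pairs T b @ Y)) = 0"
  using assms
proof (induction j arbitrary: T Y)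
  case 0
  then show ?case by (auto simp: length_Suc_conv)
next
  case (Suc j)
  obtain T' t where T: "T = T' @ [t]" using Suc.prems(1) by (cases T rule: rev_cases) auto
  let ?pt = "if t then [b, \<not> b] else [\<not> b, b]"
  have l': "length T' = Suc j" using Suc.prems(1) T by simp
  have e: "X @ pairs T b @ Y = X @ pairs T' b @ (?pt @ Y)" unfolding T pairs_append by simp
  have pos: "pos (Suc (length Y)) (Suc j) = Suc (Suc (length Y)) # pos (Suc (length (?pt @ Y))) j"
    by (simp add: pos_Suc)
  \<comment> \<open>With the earliest pair split off: if the other pairs are not all alike, they
    vanish by induction; otherwise the change of orientation happens at the split.\<close>
  show ?case
  proof (cases "\<exists>s. T' = replicate (Suc j) s")
    case False
    have "act (pos (Suc (length (?pt @ Y))) j) (v (X @ pairs T' b @ (?pt @ Y))) = 0"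
      by (rule Suc.IH[OF l' False]) (use Suc.prems(3) e in simp)
    then show ?thesis unfolding e pos by simp
  next
    case True
    then obtain s where s: "T' = replicate (Suc j) s" by blast
    have st: "t = (\<not> s)"
    proof -
      have "t \<noteq> s"
      proof
        assume "t = s"
        then have "T = replicate (Suc (Suc j)) s" unfolding T s using replicate_append_same[of j s] by simp
        then show False using Suc.prems(2) by blast
      qed
      then show ?thesis by auto
    qed
    define d where "d = (if s then b else \<not> b)"
    let ?W = "(\<not> d) # (\<not> d) # d # Y"
    have T'': "T' = replicate j s @ [s]" unfolding s by (simp add: replicate_append_same)
    have f: "X @ pairs T b @ Y = (X @ pairs (replicate j s) b @ [d]) @ ?W"
      unfolding e T'' pairs_append st d_def by simp
    have n: "n = length X + 2 * Suc (Suc j) + length Y" using Suc.prems by simp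
    have "v ((X @ pairs (replicate j s) b @ [d]) @ ?W) \<in> Sp ?W" by (rule Sp_v) (simp add: n)
    then have "act (pos (Suc (length (?pt @ Y))) j) (v (X @ pairs T b @ Y)) \<in> Sp ?W"
      unfolding f by (rule act_Sp) (auto simp: pos_def n)
    then show ?thesis unfolding pos using Sp_kill[of _ "\<not> d" "d # Y"] by simp
  qed
qed

text \<open>In the widest row both coefficients may be nonzero, so all patterns occur; the next
  narrower row annihilates those that mix swapped and unswapped pairs.\<close>

lemma act_middle:
  assumes "X @ zigzag (Suc j) (\<not> b) @ Y \<in> Paths n"
  shows "act (pos (Suc (length Y)) j) (act (pos (length Y) (Suc j)) (v (X @ zigzag (Suc j) (\<not> b) @ Y))) =
    act (pos (Suc (length Y)) j) (swap_coeff p b (ht Y) ^ Suc j *\<^sub>Q v (X @ zigzag (Suc j) b @ Y)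
      + stay_coeff p b (ht Y) ^ Suc j *\<^sub>Q v (X @ zigzag (Suc j) (\<not> b) @ Y))"
proof -
  let ?wt = "\<lambda>T. prod_list (map (\<lambda>t. if t then swap_coeff p b (ht Y) else stay_coeff p b (ht Y)) T)"
  let ?g = "\<lambda>T. ?wt T *\<^sub>Q act (pos (Suc (length Y)) j) (v (X @ pairs T b @ Y))"
  let ?r = "\<lambda>t. replicate (Suc j) t"
  have l: "length (X @ pairs T b @ Y) = n" if "length T = Suc j" for T using assms that by (simp add: Paths_def)
  have "act (pos (Suc (length Y)) j) (act (pos (length Y) (Suc j)) (v (X @ zigzag (Suc j) (\<not> b) @ Y)))
    = (\<Sum>T | length T = Suc j. ?g T)"
    unfolding act_pairs[OF assms] act_sum act_scl ..
  also have "\<dots> = (\<Sum>T\<in>{?r True, ?r False}. ?g T)"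
  proof (rule sum.mono_neutral_right)
    show "\<forall>T\<in>{T. length T = Suc j} - {?r True, ?r False}. ?g T = 0"
    proof
      fix T assume T: "T \<in> {T. length T = Suc j} - {?r True, ?r False}"
      then have "\<nexists>t. T = ?r t" by (metis (full_types) DiffD2 insertCI)
      then show "?g T = 0" using act_mixed[of T j X b Y] l[of T] T by simp
    qed
  qed (use finite_bool_lists in auto)
  also have "\<dots> = ?g (?r True) + ?g (?r False)" by (subst sum.insert) auto
  also have "?wt (?r t) = (if t then swap_coeff p b (ht Y) else stay_coeff p b (ht Y)) ^ Suc j" for t
    by (induction j) auto
  finally show ?thesis unfolding pairs_replicate act_add act_scl by simp
qed

lemma valid_zigzag: "valid Y \<Longrightarrow> 0 \<le> ht ((\<not> b) # Y) \<Longrightarrow> valid (zigzag j b @ Y)"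
proof (induction j)
  case (Suc j)
  have "ht (zigzag j b @ Y) = ht Y" by (simp add: ht_append)
  then show ?case using Suc ht_nonneg[OF Suc.prems(1)] by (cases b) (auto simp del: ht_nonneg)
qed simp

lemma valid_replicate: "valid W \<Longrightarrow> b \<or> int k \<le> ht W \<Longrightarrow> valid (replicate k b @ W)"
proof (induction k)
  case (Suc k)
  have "valid (replicate k b @ W)" using Suc by auto
  moreover have "0 \<le> ht (b # replicate k b @ W)"
    using Suc.prems(2) ht_nonneg[OF Suc.prems(1)] by (cases b) (auto simp: ht_append simp del: ht_nonneg)
  ultimately show ?case by simp
qed simp

end

section \<open>The diamond on two adjacent blocks and its coefficients\<close>

text \<open>\<open>ys\<close> is the path before the two blocks and \<open>xs\<close> what follows
  them. \<open>valid_xs\<close> speaks of all paths with the height of \<open>ys\<close>, since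
  either order of two opposite blocks returns to this height.\<close>

locale klr_diamond = klr_action p n v psi
  for p n :: nat and v :: "bool list \<Rightarrow> 'a::rat_algebra" and psi :: "nat \<Rightarrow> 'a" +
  fixes xs ys :: "bool list" and m :: int
  assumes m: "1 \<le> m" and ht_ys: "ht ys = int p * m - 1" and valid_ys: "valid ys"
    and valid_xs: "\<And>q. valid q \<Longrightarrow> ht q = ht ys \<Longrightarrow> valid (xs @ q)"
    and len: "length xs + 2 * p + length ys = n"
begin

text \<open>The path after \<open>j\<close> rows: the inner \<open>2 * j\<close> steps of the two
  blocks have become a zigzag. \<open>state b 0\<close> is a \<open>b\<close>-block followed by its
  opposite. Row \<open>j\<close> meets a single height only, that of
  \<open>base b j\<close>.\<close>

definition state :: "bool \<Rightarrow> nat \<Rightarrow> bool list" where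
  "state b j = xs @ replicate (p - j) (\<not> b) @ zigzag j b @ replicate (p - j) b @ ys"

definition base :: "bool \<Rightarrow> nat \<Rightarrow> bool list" where
  "base b j = replicate (p - j) b @ ys"

definition top :: "bool \<Rightarrow> nat \<Rightarrow> bool list" where
  "top b j = xs @ replicate (p - j) (\<not> b)"

definition step :: "nat \<Rightarrow> 'a \<Rightarrow> 'a" where
  "step j x = act (pos (length ys + p - j) j) x"

definition dia :: "'a \<Rightarrow> 'a" where
  "dia x = foldr step ([1..<Suc p] @ rev [1..<p]) x"

lemma ht_ys_ge: "int p - 1 \<le> ht ys"
proof -
  have "int p * 1 \<le> int p * m" using m by (intro mult_left_mono) auto
  then show ?thesis using ht_ys by simp
qed

lemma state_eq: "state b j = top b j @ zigzag j b @ base b j"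
  by (simp add: state_def top_def base_def)

text \<open>The adjoining end steps of the two constant runs join the zigzag and reverse its
  orientation; in this form the next row acts on the same path.\<close>

lemma state_pred: "j < p \<Longrightarrow> state b j = top b (Suc j) @ zigzag (Suc j) (\<not> b) @ base b (Suc j)"
proof -
  assume j: "j < p"
  then have pj: "p - j = Suc (p - Suc j)" by simp
  have "replicate (p - j) (\<not> b) = replicate (p - Suc j) (\<not> b) @ [\<not> b]" "replicate (p - j) b = [b] @ replicate (p - Suc j) b"
    unfolding pj by (simp_all add: replicate_append_same)
  then have "state b j = top b (Suc j) @ ((\<not> b) # zigzag j b @ [b]) @ base b (Suc j)"
    by (simp add: state_def top_def base_def)
  then show ?thesis unfolding zigzag_inner .
qed

lemma length_base: "j \<le> p \<Longrightarrow> length (base b j) = length ys + p - j"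
  by (simp add: base_def)

lemma ht_base: "ht (base b j) = ht ys + (if b then int (p - j) else - int (p - j))"
  by (simp add: base_def ht_append)

lemma length_state: "j \<le> p \<Longrightarrow> length (state b j) = n"
  using len by (simp add: state_def)

text \<open>The state with \<open>j = 0\<close> and a down block first is excluded: for
  \<open>m = 1\<close> that block would descend from height \<open>p - 1\<close> to -1.\<close>

lemma state_Paths:
  assumes "1 \<le> j \<or> b" and "j \<le> p"
  shows "b \<or> j \<noteq> 0 \<Longrightarrow> j < p \<Longrightarrow> state b j \<in> Paths n"
proof -
  assume j: "j < p"
  have h: "int (p - j) \<le> ht ys \<or> b" using ht_ys_ge assms j by (auto simp: of_nat_diff)
  have 1: "valid (base b j)" unfolding base_def by (rule valid_replicate[OF valid_ys]) (use h in auto)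
  have "0 \<le> ht ((\<not> b) # base b j)" using ht_base[of b j] h j ht_nonneg[OF valid_ys]
    by (cases b) (auto simp: of_nat_diff simp del: ht_nonneg)
  then have 2: "valid (zigzag j b @ base b j)" by (rule valid_zigzag[OF 1])
  have h2: "ht (zigzag j b @ base b j) = ht (base b j)" by (simp add: ht_append)
  have "valid (replicate (p - j) (\<not> b) @ zigzag j b @ base b j)"
    by (rule valid_replicate[OF 2], unfold h2 ht_base) (use ht_nonneg[OF valid_ys] in auto)
  moreover have "ht (replicate (p - j) (\<not> b) @ zigzag j b @ base b j) = ht ys"
    by (simp add: ht_append ht_base)
  ultimately have "valid (state b j)" using valid_xs by (simp add: state_def base_def)
  then show ?thesis using length_state assms by (simp add: Paths_def)
qed

lemma step_down:
  assumes "state b j \<in> Paths n" and "j < p" and "stay_coeff p b (ht (base b (Suc j))) = 0"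
  shows "step (Suc j) (v (state b j)) = swap_coeff p b (ht (base b (Suc j))) ^ Suc j *\<^sub>Q v (state b (Suc j))"
proof -
  have "length ys + p - Suc j = length (base b (Suc j))" using length_base assms(2) by simp
  then show ?thesis unfolding step_def state_pred[OF assms(2)] state_eq[of b "Suc j"]
    using act_flip[OF assms(1)[unfolded state_pred[OF assms(2)]] assms(3)] by simp
qed

lemma step_up:
  assumes "state b (Suc j) \<in> Paths n" and "j < p" and "stay_coeff p (\<not> b) (ht (base b (Suc j))) = 0"
  shows "step (Suc j) (v (state b (Suc j))) = swap_coeff p (\<not> b) (ht (base b (Suc j))) ^ Suc j *\<^sub>Q v (state b j)"
proof -
  have "length ys + p - Suc j = length (base b (Suc j))" using length_base assms(2) by simp
  then show ?thesis unfolding step_def state_pred[OF assms(2)] state_eq[of b "Suc j"]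
    using act_flip[of "top b (Suc j)" "Suc j" "\<not> b" "base b (Suc j)"] assms(1)[unfolded state_eq[of b "Suc j"]] assms(3)
    by simp
qed

lemma step_0 [simp]: "step j 0 = 0"
  by (simp add: step_def)

lemma step_scl: "step j (c *\<^sub>Q x) = c *\<^sub>Q step j x"
  by (simp add: step_def act_scl)

lemma step_add: "step j (x + y) = step j x + step j y"
  by (simp add: step_def act_add)

lemma foldr_step_scl: "foldr step ks (c *\<^sub>Q x) = c *\<^sub>Q foldr step ks x"
  by (induction ks) (simp_all add: step_scl)

lemma foldr_step_add: "foldr step ks (x + y) = foldr step ks x + foldr step ks y"
  by (induction ks) (simp_all add: step_add)

definition stay0 :: "bool \<Rightarrow> bool" where
  "stay0 b \<longleftrightarrow> (\<forall>j c. 1 \<le> j \<longrightarrow> j < p \<longrightarrow> stay_coeff p c (ht (base b j)) = 0)"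

lemma go_down:
  assumes "state b 0 \<in> Paths n" and "stay0 b" and "k < p"
  shows "foldr step (rev [1..<Suc k]) (v (state b 0)) =
    (\<Prod>j\<in>{1..k}. swap_coeff p b (ht (base b j)) ^ j) *\<^sub>Q v (state b k)"
  using assms(3)
proof (induction k)
  case (Suc k)
  have "state b k \<in> Paths n" using assms(1) state_Paths[of k b] Suc.prems by (cases k) auto
  then have "step (Suc k) (v (state b k)) = swap_coeff p b (ht (base b (Suc k))) ^ Suc k *\<^sub>Q v (state b (Suc k))"
    using step_down Suc.prems assms(2) by (simp add: stay0_def)
  moreover have "rev [1..<Suc (Suc k)] = Suc k # rev [1..<Suc k]" by simp
  ultimately show ?case using Suc by (simp add: step_scl mult.commute del: upt_Suc)
qed simp

lemma go_up:
  assumes "stay0 b" and "k < p"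
  shows "foldr step [1..<Suc k] (v (state b k)) =
    (\<Prod>j\<in>{1..k}. swap_coeff p (\<not> b) (ht (base b j)) ^ j) *\<^sub>Q v (state b 0)"
  using assms(2)
proof (induction k)
  case (Suc k)
  have "state b (Suc k) \<in> Paths n" using state_Paths[of "Suc k" b] Suc.prems by auto
  then have "step (Suc k) (v (state b (Suc k))) = swap_coeff p (\<not> b) (ht (base b (Suc k))) ^ Suc k *\<^sub>Q v (state b k)"
    using step_up Suc.prems assms(1) by (simp add: stay0_def)
  moreover have "[1..<Suc (Suc k)] = [1..<Suc k] @ [Suc k]" by simp
  ultimately show ?case using Suc by (simp add: foldr_step_scl mult.commute del: upt_Suc)
qed simp

text \<open>The first flank swaps in every row, the middle row branches, and the second flank
  returns along the state that resulted. Hence the returning product runs over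
  \<open>base (\<not> b)\<close> in one term, and over \<open>base b\<close> with the opposite
  coefficients in the other.\<close>

lemma dia_state:
  assumes b0: "state b 0 \<in> Paths n" and st: "stay0 True" "stay0 False"
  shows "dia (v (state b 0)) =
     ((\<Prod>j\<in>{1..<p}. swap_coeff p b (ht (base b j)) ^ j) * swap_coeff p b (ht ys) ^ p
       * (\<Prod>j\<in>{1..<p}. swap_coeff p b (ht (base (\<not> b) j)) ^ j)) *\<^sub>Q v (state (\<not> b) 0)
     + ((\<Prod>j\<in>{1..<p}. swap_coeff p b (ht (base b j)) ^ j) * stay_coeff p b (ht ys) ^ p
       * (\<Prod>j\<in>{1..<p}. swap_coeff p (\<not> b) (ht (base b j)) ^ j)) *\<^sub>Q v (state b 0)"
proof -
  define k where "k = p - 1"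
  have p: "p = Suc k" and k: "k < p" "1 \<le> k" using p3 by (simp_all add: k_def)
  have sb: "stay0 c" for c using st by (cases c) auto
  have Sk: "state b k \<in> Paths n" using state_Paths[of k b] k by auto
  have kk: "{1..<p} = {1..k}" using p by auto
  obtain k' where k': "k = Suc k'" using k(2) by (cases k) auto
  have base_p: "base b p = ys" by (simp add: base_def)
  have Sk_eq: "state b k = top b p @ zigzag (Suc k) (\<not> b) @ ys"
    using state_pred[OF k(1), of b] by (simp add: p[symmetric] base_p)
  \<comment> \<open>At its widest the diamond is symmetric: swapping all \<open>p\<close> pairs of
    \<open>state b k\<close> leads to the state of the opposite block order.\<close>
  have flip: "top b p @ zigzag (Suc k) b @ ys = state (\<not> b) k"
    using state_pred[OF k(1), of "\<not> b"] by (simp add: p[symmetric] top_def base_def)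
  define A where "A = (\<Prod>j\<in>{1..k}. swap_coeff p b (ht (base b j)) ^ j)"
  have down: "foldr step (rev [1..<p]) (v (state b 0)) = A *\<^sub>Q v (state b k)"
    using go_down[OF b0 sb k(1)] p by (simp add: A_def)
  have mid: "step k (step p (v (state b k))) =
      step k (swap_coeff p b (ht ys) ^ p *\<^sub>Q v (state (\<not> b) k) + stay_coeff p b (ht ys) ^ p *\<^sub>Q v (state b k))"
  proof -
    have l: "length ys + p - k = Suc (length ys)" "length ys + p - p = length ys" using p by auto
    have "step k x = act (pos (Suc (length ys)) k) x" for x unfolding step_def l ..
    moreover have "step p x = act (pos (length ys) (Suc k)) x" for x unfolding step_def l p[symmetric] ..
    ultimately show ?thesis
      using act_middle[OF Sk[unfolded Sk_eq]] unfolding flip Sk_eq[symmetric] unfolding p[symmetric] by simp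
  qed
  have "[1..<Suc p] = [1..<k] @ [k, p]" using p k' by simp
  then have "dia (v (state b 0)) = foldr step [1..<k] (step k (step p (foldr step (rev [1..<p]) (v (state b 0)))))"
    by (simp add: dia_def del: upt_Suc)
  also have "\<dots> = A *\<^sub>Q foldr step [1..<k] (step k (step p (v (state b k))))"
    unfolding down step_scl foldr_step_scl ..
  also have "\<dots> = A *\<^sub>Q foldr step [1..<Suc k] (swap_coeff p b (ht ys) ^ p *\<^sub>Q v (state (\<not> b) k) + stay_coeff p b (ht ys) ^ p *\<^sub>Q v (state b k))"
    unfolding mid using k(2) by simp
  also have "\<dots> = (A * swap_coeff p b (ht ys) ^ p * (\<Prod>j\<in>{1..k}. swap_coeff p b (ht (base (\<not> b) j)) ^ j)) *\<^sub>Q v (state (\<not> b) 0)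
      + (A * stay_coeff p b (ht ys) ^ p * (\<Prod>j\<in>{1..k}. swap_coeff p (\<not> b) (ht (base b j)) ^ j)) *\<^sub>Q v (state b 0)"
    unfolding foldr_step_add foldr_step_scl go_up[OF sb k(1)] by (simp add: scl_add_right mult.assoc)
  finally show ?thesis unfolding kk A_def .
qed

lemma ht_base_plus_1: "j < p \<Longrightarrow> ht (base b j) + 1 = (if b then int p * (m + 1) - int j else int p * (m - 1) + int j)"
  by (simp add: ht_base ht_ys of_nat_diff algebra_simps)

lemma base_not_0:
  assumes "1 \<le> j" and "j < p"
  shows "\<not> int p dvd ht (base b j) + 1"
proof
  assume "int p dvd ht (base b j) + 1"
  then have "int p dvd int j" unfolding ht_base_plus_1[OF assms(2)]
    by (cases b) (simp_all add: dvd_diff_right_iff dvd_add_right_iff)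
  then show False using assms by (auto dest: zdvd_imp_le)
qed

lemma cong_0: "[axial b h = 0] (mod int p) \<longleftrightarrow> int p dvd h + 1"
  by (auto simp: axial_def cong_0_iff simp del: minus_add_distrib)

lemma stay0: "stay0 b"
  unfolding stay0_def stay_coeff_def cong_0 using base_not_0 by simp

text \<open>With q = h + 1 the generic product is (q^2 - 1)/q^2 times (-q)/(1 + q) times q/(1 - q),
  which is 1. If -q or q is 1 modulo \<open>p\<close>, the KLR normalisation omits the corresponding
  denominator, and q + 1 or 1 - q is left over. The hypothesis \<open>ne\<close> keeps 1 - q nonzero
  where it is a denominator.\<close>

lemma swap_pair:
  assumes nd: "\<not> int p dvd h + 1" and pos: "1 \<le> h + 1"
    and ne: "h + 1 \<noteq> 1 \<or> [h + 1 = 1] (mod int p)"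
  shows "swap_coeff p b h * swap_coeff p (\<not> b) h = (if [- (h + 1) = 1] (mod int p) then of_int (h + 1) + 1
     else if [h + 1 = 1] (mod int p) then 1 - of_int (h + 1) else 1)"
proof -
  define q :: rat where "q = of_int (h + 1)"
  have q: "q \<noteq> 0" "q + 1 \<noteq> 0" "1 + q \<noteq> 0" using pos unfolding q_def by linarith+
  have both: "\<not> ([- (h + 1) = 1] (mod int p) \<and> [h + 1 = 1] (mod int p))"
  proof
    assume "[- (h + 1) = 1] (mod int p) \<and> [h + 1 = 1] (mod int p)"
    then have "[- (h + 1) + (h + 1) = 1 + 1] (mod int p)" using cong_add by blast
    then have "int p dvd 2" by (simp add: cong_iff_dvd_diff)
    then show False using p3 by (auto dest: zdvd_imp_le)
  qed
  have o: "rat_of_int (axial True h) = - q" by (simp add: axial_def q_def)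
  have T: "swap_coeff p True h = (if [- (h + 1) = 1] (mod int p) then (q\<^sup>2 - 1) / q\<^sup>2 * (- q) else (q\<^sup>2 - 1) / q\<^sup>2 * (- q) / (1 + q))"
    unfolding swap_coeff_def Let_def o cong_0 using nd by (simp add: axial_def)
  have F: "swap_coeff p False h = (if [h + 1 = 1] (mod int p) then q else q / (1 - q))"
    unfolding swap_coeff_def Let_def using cong_0[of False h] nd by (simp add: axial_def q_def)
  have q1: "\<not> [h + 1 = 1] (mod int p) \<Longrightarrow> q \<noteq> 1"
    using ne unfolding q_def by (metis of_int_eq_1_iff)
  have "swap_coeff p True h * swap_coeff p False h = (if [- (h + 1) = 1] (mod int p) then q + 1
     else if [h + 1 = 1] (mod int p) then 1 - q else 1)"
  proof -
    have f: "q\<^sup>2 - 1 = (q - 1) * (q + 1)" by (simp add: power2_eq_square algebra_simps)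
    consider "[- (h + 1) = 1] (mod int p)" "\<not> [h + 1 = 1] (mod int p)"
      | "\<not> [- (h + 1) = 1] (mod int p)" "[h + 1 = 1] (mod int p)"
      | "\<not> [- (h + 1) = 1] (mod int p)" "\<not> [h + 1 = 1] (mod int p)" using both by blast
    then show ?thesis
    proof cases
      case 1
      then have "1 - q \<noteq> 0" using q1 by simp
      then have "(q - 1) * (q + 1) / q\<^sup>2 * (- q) * (q / (1 - q)) = q + 1"
        using q(1) by (simp add: power2_eq_square divide_simps) (simp add: algebra_simps)
      then show ?thesis using 1 unfolding T F f by simp
    next
      case 2
      have "(q - 1) * (q + 1) / q\<^sup>2 * (- q) / (1 + q) * q = 1 - q"
        using q by (simp add: power2_eq_square divide_simps) (simp add: algebra_simps)
      then show ?thesis using 2 unfolding T F f by simp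
    next
      case 3
      then have "1 - q \<noteq> 0" using q1 by simp
      then have "(q - 1) * (q + 1) / q\<^sup>2 * (- q) / (1 + q) * (q / (1 - q)) = 1"
        using q by (simp add: power2_eq_square divide_simps) (simp add: algebra_simps)
      then show ?thesis using 3 unfolding T F f by simp
    qed
  qed
  then show ?thesis unfolding q_def by (cases b) (simp_all add: mult.commute)
qed

lemma cong_mult_p: "[int p * a + x = y] (mod int p) \<longleftrightarrow> [x = y] (mod int p)"
  by (simp add: cong_def)

text \<open>The height plus one is -j or j modulo \<open>p\<close>, so the exceptional classes of
  \<open>swap_pair\<close> occur exactly for \<open>j = 1\<close> and \<open>j = p - 1\<close>.
  There 1 + q and 1 - q become multiples of \<open>p\<close>.\<close>

lemma base_pair:
  assumes j: "1 \<le> j" "j < p"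
  shows "swap_coeff p c (ht (base b j)) * swap_coeff p (\<not> c) (ht (base b j)) =
    (if j = 1 then (if b then of_nat p * (of_int m + 1) else - (of_nat p * (of_int m - 1)))
     else if j = p - 1 then (if b then - (of_nat p * of_int m) else of_nat p * of_int m) else 1)"
proof -
  let ?a = "ht (base b j) + 1"
  have p0: "0 < int p" using p3 by simp
  have j1: "[int j = 1] (mod int p) \<longleftrightarrow> j = 1"
    using cong_less_imp_eq_int[of "int j" "int p" 1] j p3 by auto
  have jm: "[- int j = 1] (mod int p) \<longleftrightarrow> j = p - 1"
  proof -
    have "[- int j = 1] (mod int p) \<longleftrightarrow> int p dvd int j + 1"
      by (metis add.commute cong_iff_dvd_diff cong_sym_eq diff_minus_eq_add)
    also have "\<dots> \<longleftrightarrow> j = p - 1"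
    proof
      assume "int p dvd int j + 1"
      then have "int p \<le> int j + 1" by (rule zdvd_imp_le) simp
      then show "j = p - 1" using j by simp
    next
      assume "j = p - 1"
      then show "int p dvd int j + 1" using j by (simp add: of_nat_diff)
    qed
    finally show ?thesis .
  qed
  have a1: "[- ?a = 1] (mod int p) \<longleftrightarrow> (if b then j = 1 else j = p - 1)"
  proof (cases b)
    case True
    have "- ?a = int p * (- (m + 1)) + int j" using ht_base_plus_1[OF j(2), of b] True by (simp add: algebra_simps)
    then show ?thesis using True j1 cong_mult_p by metis
  next
    case False
    have "- ?a = int p * (- (m - 1)) + - int j" using ht_base_plus_1[OF j(2), of b] False by (simp add: algebra_simps)
    then show ?thesis using False jm cong_mult_p by metis
  qed
  have a2: "[?a = 1] (mod int p) \<longleftrightarrow> (if b then j = p - 1 else j = 1)"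
  proof (cases b)
    case True
    have "?a = int p * (m + 1) + - int j" using ht_base_plus_1[OF j(2), of b] True by (simp add: algebra_simps)
    then show ?thesis using True jm cong_mult_p by metis
  next
    case False
    have "?a = int p * (m - 1) + int j" using ht_base_plus_1[OF j(2), of b] False by (simp add: algebra_simps)
    then show ?thesis using False j1 cong_mult_p by metis
  qed
  have pos: "1 \<le> ?a"
  proof -
    have "int p * 1 \<le> int p * m" "int p * 0 \<le> int p * (m - 1)" using m p0 by (intro mult_left_mono; simp)+
    moreover have "int p * (m + 1) = int p * m + int p" by (simp add: algebra_simps)
    moreover have "1 \<le> int j" "int j < int p" using j by simp_all
    ultimately show ?thesis unfolding ht_base_plus_1[OF j(2)] by (cases b; simp only: if_True if_False; linarith)
  qed
  have ne: "?a \<noteq> 1 \<or> [?a = 1] (mod int p)" by (cases "?a = 1") auto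
  have j1p: "j = 1 \<Longrightarrow> j \<noteq> p - 1" using p3 by auto
  have val: "of_int ?a = (if b then of_nat p * (of_int m + 1) - of_nat j else of_nat p * (of_int m - 1) + (of_nat j :: rat))"
    unfolding ht_base_plus_1[OF j(2)] by simp
  have jp: "j = p - 1 \<Longrightarrow> (of_nat j :: rat) = of_nat p - 1" using p3 by (simp add: of_nat_diff)
  show ?thesis
    unfolding swap_pair[OF base_not_0[OF j] pos ne] a1 a2 val
    using j1p jp by (cases b) (auto simp: algebra_simps)
qed

lemma prod_ends:
  fixes g :: "nat \<Rightarrow> rat"
  assumes "\<And>j. 1 \<le> j \<Longrightarrow> j < p \<Longrightarrow> j \<noteq> 1 \<Longrightarrow> j \<noteq> p - 1 \<Longrightarrow> g j = 1"
  shows "(\<Prod>j\<in>{1..<p}. g j ^ j) = g 1 * g (p - 1) ^ (p - 1)"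
proof -
  have "(\<Prod>j\<in>{1..<p}. g j ^ j) = (\<Prod>j\<in>{1, p - 1}. g j ^ j)"
    by (rule prod.mono_neutral_right) (use assms p3 in auto)
  then show ?thesis using p3 by (subst (asm) prod.insert) auto
qed

text \<open>Row \<open>j\<close> has \<open>j\<close> factors, so row \<open>p - 1\<close>
  contributes an even power and its sign disappears.\<close>

lemma prod_base:
  "(\<Prod>j\<in>{1..<p}. swap_coeff p c (ht (base b j)) ^ j) * (\<Prod>j\<in>{1..<p}. swap_coeff p (\<not> c) (ht (base b j)) ^ j)
    = (if b then of_nat p * (of_int m + 1) else - (of_nat p * (of_int m - 1))) * (of_nat p * of_int m) ^ (p - 1)"
proof -
  have "(\<Prod>j\<in>{1..<p}. swap_coeff p c (ht (base b j)) ^ j) * (\<Prod>j\<in>{1..<p}. swap_coeff p (\<not> c) (ht (base b j)) ^ j)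
    = (\<Prod>j\<in>{1..<p}. (swap_coeff p c (ht (base b j)) * swap_coeff p (\<not> c) (ht (base b j))) ^ j)"
    by (simp add: prod.distrib power_mult_distrib)
  also have "\<dots> = (swap_coeff p c (ht (base b 1)) * swap_coeff p (\<not> c) (ht (base b 1)))
     * (swap_coeff p c (ht (base b (p - 1))) * swap_coeff p (\<not> c) (ht (base b (p - 1)))) ^ (p - 1)"
    by (rule prod_ends) (simp add: base_pair)
  also have "\<dots> = (if b then of_nat p * (of_int m + 1) else - (of_nat p * (of_int m - 1)))
      * (if b then - (of_nat p * of_int m) else of_nat p * of_int m) ^ (p - 1)"
  proof -
    have "p - 1 \<noteq> 1" "1 \<le> p - 1" "p - 1 < p" "1 < p" using p3 by auto
    then show ?thesis using base_pair[of 1 c b] base_pair[of "p - 1" c b] by simp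
  qed
  also have "(if b then - (of_nat p * of_int m) else of_nat p * of_int m :: rat) ^ (p - 1) = (of_nat p * of_int m) ^ (p - 1)"
    using odd_p by (simp add: power_minus_even)
  finally show ?thesis .
qed

definition stay_val :: "bool \<Rightarrow> rat" where
  "stay_val b = (of_int m + (if b then 1 else - 1)) / of_int m"

definition swap_val :: "bool \<Rightarrow> rat" where
  "swap_val b = (\<Prod>j\<in>{1..<p}. swap_coeff p b (ht (base b j)) ^ j) * swap_coeff p b (ht ys) ^ p
       * (\<Prod>j\<in>{1..<p}. swap_coeff p b (ht (base (\<not> b) j)) ^ j)"

text \<open>With M = p m, the unswapped middle row gives 1/M^p up to sign and the flanks give
  M^(p-1) times p(m + 1) or -p(m - 1), so all powers of \<open>p\<close> cancel. If the down block
  comes first, the sign of the middle row survives, as \<open>p\<close> is odd, and cancels that of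
  the flanks.\<close>

lemma dia_v:
  assumes "state b 0 \<in> Paths n"
  shows "dia (v (state b 0)) = swap_val b *\<^sub>Q v (state (\<not> b) 0) + stay_val b *\<^sub>Q v (state b 0)"
proof -
  define M :: rat where "M = of_nat p * of_int m"
  have M: "M \<noteq> 0" using m p3 by (simp add: M_def)
  obtain k where p: "p = Suc k" using p3 by (cases p) auto
  have "stay_coeff p b (ht ys) = (if b then 1 / M else - (1 / M))"
    unfolding stay_coeff_def cong_0 by (simp add: ht_ys axial_def M_def)
  moreover have "(- (1 / M)) ^ p = - (1 / M ^ p)" using odd_p by (simp add: power_minus_odd power_one_over)
  ultimately have st: "stay_coeff p b (ht ys) ^ p = (if b then 1 else - 1) / M ^ p"
    by (simp add: power_one_over)
  have "(\<Prod>j\<in>{1..<p}. swap_coeff p b (ht (base b j)) ^ j) * stay_coeff p b (ht ys) ^ p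
       * (\<Prod>j\<in>{1..<p}. swap_coeff p (\<not> b) (ht (base b j)) ^ j)
     = ((if b then of_nat p * (of_int m + 1) else - (of_nat p * (of_int m - 1))) * M ^ (p - 1)) * ((if b then 1 else - 1) / M ^ p)"
    unfolding st M_def prod_base[of b b, symmetric] by (simp add: mult_ac)
  also have "\<dots> = (of_nat p * (of_int m + (if b then 1 else - 1))) * M ^ (p - 1) / M ^ p" by simp
  also have "\<dots> = (of_nat p * (of_int m + (if b then 1 else - 1))) / M" using M by (simp add: p)
  also have "\<dots> = stay_val b" using p3 by (simp add: stay_val_def M_def)
  finally show ?thesis using dia_state[OF assms stay0 stay0] unfolding swap_val_def by simp
qed

text \<open>Multiplying both directions brings together opposite coefficients at equal heights, so
  \<open>prod_base\<close> applies to either base. The value is one minus the square of the diagonal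
  entry 1/m, just what makes \<open>bigU\<close> minus \<open>e_idem\<close> an involution.\<close>

lemma swap_val: "swap_val b * swap_val (\<not> b) = 1 - 1 / (of_int m)\<^sup>2"
proof -
  define M :: rat where "M = of_nat p * of_int m"
  have "(1::rat) * 1 < of_nat p * of_int m" using m p3 by (intro mult_less_le_imp_less) auto
  then have "1 < M" by (simp add: M_def)
  then have M: "M \<noteq> 0" "1 + M \<noteq> 0" "1 - M \<noteq> 0" by auto
  have hM: "of_int (ht ys + 1) = M" by (simp add: ht_ys M_def)
  have T: "swap_coeff p True (ht ys) = (M\<^sup>2 - 1) / M\<^sup>2 / (1 + M)"
    unfolding swap_coeff_def Let_def cong_0 using hM by (simp add: ht_ys axial_def)
  have F: "swap_coeff p False (ht ys) = 1 / (1 - M)"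
    unfolding swap_coeff_def Let_def cong_0 using hM by (simp add: ht_ys axial_def)
  have "swap_coeff p True (ht ys) * swap_coeff p False (ht ys) = - (1 / M\<^sup>2)"
    unfolding T F using M by (simp add: power2_eq_square divide_simps) (simp add: algebra_simps)
  then have mid: "(swap_coeff p True (ht ys) * swap_coeff p False (ht ys)) ^ p = - (1 / (M\<^sup>2) ^ p)"
    using odd_p by (simp add: power_minus_odd power_one_over)
  obtain k where p: "p = Suc k" using p3 by (cases p) auto
  let ?P = "\<lambda>c b. (\<Prod>j\<in>{1..<p}. swap_coeff p c (ht (base b j)) ^ j)"
  have "swap_val True * swap_val False = (?P True True * ?P (\<not> True) True) * (?P True False * ?P (\<not> True) False)
      * (swap_coeff p True (ht ys) * swap_coeff p False (ht ys)) ^ p"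
    unfolding swap_val_def power_mult_distrib by (simp add: mult_ac)
  also have "\<dots> = (of_nat p * (of_int m + 1) * M ^ (p - 1)) * (- (of_nat p * (of_int m - 1)) * M ^ (p - 1)) * - (1 / (M\<^sup>2) ^ p)"
    unfolding prod_base mid M_def by simp
  also have "\<dots> = (of_nat p)\<^sup>2 * ((of_int m + 1) * (of_int m - 1)) * (M ^ k * M ^ k) / (M ^ p * M ^ p)"
    by (simp add: p power2_eq_square power_mult_distrib)
  also have "\<dots> = (of_nat p)\<^sup>2 * ((of_int m + 1) * (of_int m - 1)) / M\<^sup>2"
    using M by (simp add: p power2_eq_square)
  also have "\<dots> = 1 - 1 / (of_int m)\<^sup>2"
    using m p3 by (simp add: M_def power2_eq_square divide_simps) (simp add: algebra_simps)
  finally show ?thesis by (cases b) (simp_all add: mult.commute)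
qed

end

section \<open>Gluing of diagrams\<close>

definition pmatch :: "'a set \<Rightarrow> 'a set set \<Rightarrow> bool" where
  "pmatch X D \<longleftrightarrow> partition_on X D \<and> (\<forall>e\<in>D. card e = 2)"

definition nocross :: "('a \<Rightarrow> nat) \<Rightarrow> 'a set set \<Rightarrow> bool" where
  "nocross pos D \<longleftrightarrow> \<not> (\<exists>a b c d. {a, b} \<in> D \<and> {c, d} \<in> D \<and>
     pos a < pos c \<and> pos c < pos b \<and> pos b < pos d)"

lemma diagrams_iff: "D \<in> diagrams n \<longleftrightarrow> pmatch (points n) D \<and> nocross (boundary_pos n) D"
  by (auto simp: diagrams_def pmatch_def nocross_def noncrossing_def)

lemma pmatch_disjoint: "pmatch X D \<Longrightarrow> e \<in> D \<Longrightarrow> e' \<in> D \<Longrightarrow> e \<noteq> e' \<Longrightarrow> e \<inter> e' = {}"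
  unfolding pmatch_def partition_on_def disjoint_def by blast

lemma pmatch_strand:
  assumes "pmatch X D" and "e \<in> D"
  obtains a b where "e = {a, b}" and "a \<noteq> b" and "a \<in> X" and "b \<in> X"
proof -
  have "card e = 2" "e \<subseteq> X" using assms unfolding pmatch_def partition_on_def by auto
  then show ?thesis using that by (auto simp: card_2_iff)
qed

lemma pmatch_subset: "pmatch X D \<Longrightarrow> e \<in> D \<Longrightarrow> e \<subseteq> X"
  unfolding pmatch_def partition_on_def by blast

lemma pmatch_cover: "pmatch X D \<Longrightarrow> x \<in> X \<Longrightarrow> \<exists>e\<in>D. x \<in> e"
  unfolding pmatch_def partition_on_def by blast

lemma finite_pmatch: "pmatch X D \<Longrightarrow> finite X \<Longrightarrow> finite D"
  unfolding pmatch_def using finite_elements by blast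

lemma closed_strands:
  assumes "pmatch X D" and "\<And>a b. {a, b} \<in> D \<Longrightarrow> a \<in> K \<Longrightarrow> b \<in> K"
  shows "K \<inter> X = \<Union> {e \<in> D. e \<subseteq> K}"
proof
  show "K \<inter> X \<subseteq> \<Union> {e \<in> D. e \<subseteq> K}"
  proof
    fix x assume x: "x \<in> K \<inter> X"
    then obtain e where e: "e \<in> D" "x \<in> e" using pmatch_cover[OF assms(1)] by blast
    obtain a b where "e = {a, b}" using pmatch_strand[OF assms(1) e(1)] by blast
    then have "e \<subseteq> K" using e x assms(2)[of a b] assms(2)[of b a] by (auto simp: insert_commute)
    then show "x \<in> \<Union> {e \<in> D. e \<subseteq> K}" using e by blast
  qed
  show "\<Union> {e \<in> D. e \<subseteq> K} \<subseteq> K \<inter> X" using pmatch_subset[OF assms(1)] by blast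
qed

lemma card_closed_strands:
  assumes "pmatch X D" and "\<And>a b. {a, b} \<in> D \<Longrightarrow> a \<in> K \<Longrightarrow> b \<in> K" and "finite X"
  shows "card (K \<inter> X) = 2 * card {e \<in> D. e \<subseteq> K}"
proof -
  let ?E = "{e \<in> D. e \<subseteq> K}"
  have "card (\<Union> ?E) = sum card ?E"
  proof (rule card_Union_disjoint)
    show "pairwise disjnt ?E" using pmatch_disjoint[OF assms(1)] by (auto simp: pairwise_def disjnt_def)
    show "\<And>e. e \<in> ?E \<Longrightarrow> finite e"
      using pmatch_subset[OF assms(1)] finite_subset[OF _ assms(3)] by blast
  qed
  also have "\<dots> = (\<Sum>e\<in>?E. 2)" using assms(1) by (intro sum.cong) (auto simp: pmatch_def)
  finally show ?thesis using closed_strands[OF assms(1,2)] by simp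
qed

text \<open>Sending each point to the edge towards a neighbour closer to \<open>x\<close> is injective.\<close>

lemma connected_card:
  fixes G :: "'a set set"
  defines "E \<equiv> {(x, y). {x, y} \<in> G}"
  assumes "finite (E\<^sup>* `` {x})" and "finite G"
  shows "card (E\<^sup>* `` {x}) \<le> card {e \<in> G. e \<subseteq> E\<^sup>* `` {x}} + 1"
proof -
  let ?K = "E\<^sup>* `` {x}"
  define d where "d y = (LEAST k. (x, y) \<in> E ^^ k)" for y
  have d: "(x, y) \<in> E ^^ d y" if "y \<in> ?K" for y
    using that rtrancl_imp_relpow unfolding d_def by (metis Image_singleton_iff LeastI)
  have "\<exists>z. z \<in> ?K \<and> {z, y} \<in> G \<and> d z < d y" if y: "y \<in> ?K - {x}" for y
  proof -
    have "d y \<noteq> 0" using d[of y] y by (intro notI) auto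
    then obtain k where k: "d y = Suc k" by (cases "d y") auto
    then obtain z where z: "(x, z) \<in> E ^^ k" "(z, y) \<in> E" using d[of y] y by auto
    have "d z \<le> k" unfolding d_def using z(1) by (rule Least_le)
    moreover have "z \<in> ?K" using z(1) relpow_imp_rtrancl by blast
    ultimately show ?thesis using k z(2) by (auto simp: E_def)
  qed
  then obtain f where f: "\<And>y. y \<in> ?K - {x} \<Longrightarrow> f y \<in> ?K \<and> {f y, y} \<in> G \<and> d (f y) < d y" by metis
  have "inj_on (\<lambda>y. {f y, y}) (?K - {x})"
  proof (rule inj_onI)
    fix y z assume y: "y \<in> ?K - {x}" and z: "z \<in> ?K - {x}" and eq: "{f y, y} = {f z, z}"
    show "y = z"
    proof (rule ccontr)
      assume "y \<noteq> z"
      then have "f y = z" "f z = y" using eq by (auto simp: doubleton_eq_iff)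
      then show False using f[OF y] f[OF z] by simp
    qed
  qed
  then have "card (?K - {x}) \<le> card {e \<in> G. e \<subseteq> ?K}"
    by (rule card_inj_on_le) (use f assms(3) in auto)
  then show ?thesis using assms(2) by (simp add: card_Diff_singleton)
qed

text \<open>Two strands are linked on the boundary exactly when an odd number of the four
  comparisons of their ends holds. Parity replaces linking because it is additive over the strands
  of a component.\<close>

lemma two_strands_even:
  fixes pos :: "'a \<Rightarrow> nat"
  assumes "nocross pos D" and "{a, b} \<in> D" and "{c, d} \<in> D"
    and "pos a \<noteq> pos c" "pos a \<noteq> pos d" "pos b \<noteq> pos c" "pos b \<noteq> pos d"
  shows "even (of_bool (pos a < pos c) + of_bool (pos a < pos d)
    + (of_bool (pos b < pos c) + of_bool (pos b < pos d)) :: nat)"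
proof -
  have s: "{b, a} \<in> D" "{d, c} \<in> D" using assms by (simp_all add: insert_commute)
  have nc: "\<not> (pos a' < pos c' \<and> pos c' < pos b' \<and> pos b' < pos d')"
    if "{a', b'} \<in> D" "{c', d'} \<in> D" for a' b' c' d'
    using assms(1) that unfolding nocross_def by blast
  note n = nc[OF assms(2,3)] nc[OF assms(2) s(2)] nc[OF s(1) assms(3)] nc[OF s]
    nc[OF assms(3,2)] nc[OF assms(3) s(1)] nc[OF s(2) assms(2)] nc[OF s(2,1)]
  show ?thesis
    by (cases "pos a < pos c"; cases "pos a < pos d"; cases "pos b < pos c"; cases "pos b < pos d")
      (use n assms(4-7) in auto)
qed

lemma disjoint_components_even:
  fixes pos :: "'a \<Rightarrow> nat"
  assumes "pmatch X D" and "nocross pos D" and "inj_on pos X" and "finite X" and "P \<inter> Q = {}"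
    and "\<And>a b. {a, b} \<in> D \<Longrightarrow> a \<in> P \<Longrightarrow> b \<in> P" and "\<And>a b. {a, b} \<in> D \<Longrightarrow> a \<in> Q \<Longrightarrow> b \<in> Q"
  shows "even (\<Sum>x\<in>P \<inter> X. \<Sum>z\<in>Q \<inter> X. of_bool (pos x < pos z) :: nat)"
proof -
  let ?EP = "{e \<in> D. e \<subseteq> P}" and ?EQ = "{e \<in> D. e \<subseteq> Q}"
  have U: "sum f (\<Union> E) = (\<Sum>e\<in>E. sum f e)" if "E \<subseteq> D" for f :: "'a \<Rightarrow> nat" and E
  proof -
    have "\<forall>e\<in>E. finite e" using that pmatch_subset[OF assms(1)] finite_subset[OF _ assms(4)] by blast
    moreover have "\<forall>e\<in>E. \<forall>e'\<in>E. e \<noteq> e' \<longrightarrow> e \<inter> e' = {}" using that pmatch_disjoint[OF assms(1)] by blast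
    ultimately show ?thesis using sum.Union_disjoint[of E f] by simp
  qed
  have PX: "P \<inter> X = \<Union> ?EP" by (rule closed_strands[OF assms(1)]) (rule assms(6))
  have QX: "Q \<inter> X = \<Union> ?EQ" by (rule closed_strands[OF assms(1)]) (rule assms(7))
  have "(\<Sum>x\<in>P \<inter> X. \<Sum>z\<in>Q \<inter> X. of_bool (pos x < pos z) :: nat)
      = (\<Sum>e\<in>?EP. \<Sum>x\<in>e. \<Sum>e'\<in>?EQ. \<Sum>z\<in>e'. of_bool (pos x < pos z))"
    unfolding PX QX by (simp add: U)
  also have "\<dots> = (\<Sum>e\<in>?EP. \<Sum>e'\<in>?EQ. \<Sum>x\<in>e. \<Sum>z\<in>e'. of_bool (pos x < pos z))"
    by (rule sum.cong[OF refl]) (rule sum.swap)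
  also have "even \<dots>"
  proof (rule dvd_sum, rule dvd_sum)
    fix e e' assume e: "e \<in> ?EP" and e': "e' \<in> ?EQ"
    obtain a b where ab: "e = {a, b}" "a \<noteq> b" "a \<in> X" "b \<in> X" using pmatch_strand[OF assms(1)] e by blast
    obtain c d where cd: "e' = {c, d}" "c \<noteq> d" "c \<in> X" "d \<in> X" using pmatch_strand[OF assms(1)] e' by blast
    have ne: "a \<noteq> c" "a \<noteq> d" "b \<noteq> c" "b \<noteq> d" using e e' assms(5) ab cd by auto
    have "pos x \<noteq> pos z" if "x \<in> X" "z \<in> X" "x \<noteq> z" for x z
      using that assms(3) by (auto dest: inj_onD)
    then have "even (of_bool (pos a < pos c) + of_bool (pos a < pos d)
      + (of_bool (pos b < pos c) + of_bool (pos b < pos d)) :: nat)"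
      using two_strands_even[OF assms(2), of a b c d] e e' ab cd ne by auto
    then show "even (\<Sum>x\<in>e. \<Sum>z\<in>e'. of_bool (pos x < pos z) :: nat)"
      using ab cd by (simp del: sum_of_bool_eq)
  qed
  finally show ?thesis .
qed

definition shift :: "point set \<Rightarrow> point set" where
  "shift e = (\<lambda>(l, i). (Suc l, i)) ` e"

lemma stacked_eq: "stacked D1 D2 = D1 \<union> shift ` D2"
  by (simp add: stacked_def shift_def[abs_def])

lemma shift_pair [simp]: "shift {a, b} = {(Suc (fst a), snd a), (Suc (fst b), snd b)}"
  by (simp add: shift_def case_prod_beta)

lemma inj_shift_point: "inj (\<lambda>(l, i). (Suc l, i :: nat))"
  by (auto simp: inj_def)

lemma shift_points: "shift (points n) = {1, 2} \<times> {1..n}"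
  by (force simp: shift_def points_def)

lemma pmatch_shift:
  assumes "pmatch (points n) D"
  shows "pmatch ({1, 2} \<times> {1..n}) (shift ` D)"
proof -
  have "partition_on (shift (points n)) (shift ` D)"
  proof (rule partition_onI)
    have "\<Union> D = points n" using assms by (simp add: pmatch_def partition_on_def)
    moreover have "shift (\<Union> D) = \<Union> (shift ` D)" unfolding shift_def by blast
    ultimately show "\<Union> (shift ` D) = shift (points n)" by simp
    show "{} \<notin> shift ` D"
      using assms by (auto simp: shift_def pmatch_def partition_on_def)
    show "disjnt e e'" if e: "e \<in> shift ` D" "e' \<in> shift ` D" "e \<noteq> e'" for e e'
    proof -
      obtain f f' where f: "e = shift f" "e' = shift f'" "f \<in> D" "f' \<in> D" using e by blast
      then have "f \<inter> f' = {}" using pmatch_disjoint[OF assms] e(3) by blast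
      then show ?thesis unfolding disjnt_def f shift_def image_Int[OF inj_shift_point, symmetric] by simp
    qed
  qed
  moreover have "card (shift e) = card e" for e
    unfolding shift_def by (rule card_image) (rule inj_on_subset[OF inj_shift_point subset_UNIV])
  ultimately show ?thesis using assms unfolding pmatch_def shift_points by auto
qed

lemma nocross_shift:
  assumes "nocross (boundary_pos n) D"
  shows "nocross (\<lambda>(l, i). boundary_pos n (l - 1, i)) (shift ` D)"
proof -
  have lift: "\<exists>a' b'. {a', b'} \<in> D \<and> a = (Suc (fst a'), snd a') \<and> b = (Suc (fst b'), snd b')" if ab: "{a, b} \<in> shift ` D" for a b
  proof -
    obtain e where e: "e \<in> D" "{a, b} = (\<lambda>(l, i). (Suc l, i)) ` e" using ab by (auto simp: shift_def)
    obtain a' where a: "a' \<in> e" "a = (\<lambda>(l, i). (Suc l, i)) a'" using e(2) by blast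
    obtain b' where b: "b' \<in> e" "b = (\<lambda>(l, i). (Suc l, i)) b'" using e(2) by blast
    have "(\<lambda>(l, i). (Suc l, i)) ` e = (\<lambda>(l, i). (Suc l, i)) ` {a', b'}" using e(2) a b by simp
    then have "e = {a', b'}" by (simp only: inj_image_eq_iff[OF inj_shift_point])
    then show ?thesis using e a b by (auto simp: case_prod_beta)
  qed
  show ?thesis unfolding nocross_def
  proof
    let ?pos = "\<lambda>(l, i). boundary_pos n (l - 1, i)"
    assume "\<exists>a b c d. {a, b} \<in> shift ` D \<and> {c, d} \<in> shift ` D \<and> ?pos a < ?pos c \<and> ?pos c < ?pos b \<and> ?pos b < ?pos d"
    then obtain a b c d where 1: "{a, b} \<in> shift ` D" "{c, d} \<in> shift ` D"
      "?pos a < ?pos c" "?pos c < ?pos b" "?pos b < ?pos d" by blast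
    obtain a' b' where ab: "{a', b'} \<in> D" "a = (Suc (fst a'), snd a')" "b = (Suc (fst b'), snd b')"
      using lift[OF 1(1)] by blast
    obtain c' d' where cd: "{c', d'} \<in> D" "c = (Suc (fst c'), snd c')" "d = (Suc (fst d'), snd d')"
      using lift[OF 1(2)] by blast
    have "boundary_pos n a' < boundary_pos n c'" "boundary_pos n c' < boundary_pos n b'"
      "boundary_pos n b' < boundary_pos n d'" using 1(3-5) unfolding ab cd by simp_all
    then show False using assms ab(1) cd(1) unfolding nocross_def by blast
  qed
qed

lemma inj_boundary_pos: "inj_on (boundary_pos n) (points n)"
  by (auto simp: inj_on_def points_def boundary_pos_def)

section \<open>Components of two stacked diagrams\<close>

locale two_diagrams =
  fixes n :: nat and D1 D2 :: diagram
  assumes D1: "D1 \<in> diagrams n" and D2: "D2 \<in> diagrams n"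
begin

definition E :: "(point \<times> point) set" where
  "E = {(x, y). {x, y} \<in> stacked D1 D2}"

definition comp :: "point \<Rightarrow> point set" where
  "comp x = connected_in (stacked D1 D2) `` {x}"

definition outer :: "point set" where
  "outer = {0, 2} \<times> {1..n}"

lemma pm1: "pmatch ({0, 1} \<times> {1..n}) D1" and nc1: "nocross (boundary_pos n) D1"
  using D1 by (auto simp: diagrams_iff points_def)

lemma pm2: "pmatch ({1, 2} \<times> {1..n}) (shift ` D2)"
  and nc2: "nocross (\<lambda>(l, i). boundary_pos n (l - 1, i)) (shift ` D2)"
  using D2 pmatch_shift nocross_shift by (auto simp: diagrams_iff)

lemma conn_E: "connected_in (stacked D1 D2) = E\<^sup>*"
  by (simp add: connected_in_def E_def)

lemma sym_conn: "(x, y) \<in> E\<^sup>* \<Longrightarrow> (y, x) \<in> E\<^sup>*"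
proof -
  have "sym E" by (auto simp: sym_def E_def insert_commute)
  then show "(x, y) \<in> E\<^sup>* \<Longrightarrow> (y, x) \<in> E\<^sup>*" using sym_rtrancl unfolding sym_def by blast
qed

lemma comp_iff: "y \<in> comp x \<longleftrightarrow> (x, y) \<in> E\<^sup>*"
  by (simp add: comp_def conn_E)

lemma comp_refl [simp]: "x \<in> comp x"
  by (simp add: comp_iff)

lemma comp_eq: "y \<in> comp x \<Longrightarrow> comp y = comp x"
proof (rule Set.set_eqI)
  fix z assume "y \<in> comp x"
  then show "z \<in> comp y \<longleftrightarrow> z \<in> comp x" unfolding comp_iff by (meson rtrancl_trans sym_conn)
qed

lemma comp_disjoint: "comp x \<noteq> comp y \<Longrightarrow> comp x \<inter> comp y = {}"
  using comp_eq by blast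

lemma comp_closed: "{a, b} \<in> stacked D1 D2 \<Longrightarrow> a \<in> comp x \<Longrightarrow> b \<in> comp x"
  unfolding comp_iff by (rule rtrancl_into_rtrancl) (auto simp: E_def)

lemma stacked_subset: "{a, b} \<in> stacked D1 D2 \<Longrightarrow> a \<in> {0, 1, 2} \<times> {1..n} \<and> b \<in> {0, 1, 2} \<times> {1..n}"
proof -
  assume "{a, b} \<in> stacked D1 D2"
  then have "{a, b} \<subseteq> {0, 1} \<times> {1..n} \<or> {a, b} \<subseteq> {1, 2} \<times> {1..n}"
    unfolding stacked_eq using pmatch_subset[OF pm1] pmatch_subset[OF pm2] by blast
  then show ?thesis by auto
qed

lemma comp_subset: "comp x \<subseteq> insert x ({0, 1, 2} \<times> {1..n})"
proof
  fix y assume "y \<in> comp x"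
  then have "(x, y) \<in> E\<^sup>*" by (simp add: comp_iff)
  then show "y \<in> insert x ({0, 1, 2} \<times> {1..n})"
  proof (cases rule: rtranclE)
    case (step z)
    then show ?thesis using stacked_subset[of z y] by (auto simp: E_def)
  qed simp
qed

lemma finite_comp: "finite (comp x)"
  by (rule finite_subset[OF comp_subset]) simp

text \<open>Let a component have k_l points on level l. It contains (k_0 + k_1)/2 strands of the
  upper and (k_1 + k_2)/2 of the lower diagram, and connectedness bounds the number of points by the
  number of strands plus one. So k_0 + k_2 is at most 2; it is even and, because of
  \<open>x\<close>, not zero. The same counts give the equal parities.\<close>

lemma card_outer:
  assumes "x \<in> outer"
  shows "card (comp x \<inter> outer) = 2"
    and "\<And>l. l \<in> {0, 1, 2} \<Longrightarrow> even (card {i. (l, i) \<in> comp x}) \<longleftrightarrow> even (card {i. (0, i) \<in> comp x})"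
proof -
  let ?K = "comp x"
  define k where "k l = card {i. (l, i) \<in> ?K}" for l :: nat
  have sub: "?K \<subseteq> {0, 1, 2} \<times> {1..n}" using comp_subset[of x] assms by (auto simp: outer_def)
  have fin: "finite {i. (l, i) \<in> ?K}" for l
    by (rule finite_subset[of _ "{1..n}"]) (use sub in auto)
  have cl: "card ({l} \<times> {i. (l, i) \<in> ?K}) = k l" for l by (simp add: k_def card_cartesian_product)
  have un: "card (({l} \<times> {i. (l, i) \<in> ?K}) \<union> ({l'} \<times> {i. (l', i) \<in> ?K})) = k l + k l'" if "l \<noteq> l'" for l l'
    by (subst card_Un_disjoint) (use that fin cl in auto)
  have 1: "?K \<inter> ({0, 1} \<times> {1..n}) = ({0} \<times> {i. (0, i) \<in> ?K}) \<union> ({1} \<times> {i. (1, i) \<in> ?K})"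
    and 2: "?K \<inter> ({1, 2} \<times> {1..n}) = ({1} \<times> {i. (1, i) \<in> ?K}) \<union> ({2} \<times> {i. (2, i) \<in> ?K})"
    and 3: "?K \<inter> outer = ({0} \<times> {i. (0, i) \<in> ?K}) \<union> ({2} \<times> {i. (2, i) \<in> ?K})"
    using sub unfolding outer_def by auto
  have 4: "?K = (?K \<inter> ({0, 1} \<times> {1..n})) \<union> ({2} \<times> {i. (2, i) \<in> ?K})" using sub by auto
  have "card ?K = card (?K \<inter> ({0, 1} \<times> {1..n})) + k 2"
    by (subst 4, subst card_Un_disjoint) (use fin cl in \<open>auto simp: finite_comp\<close>)
  then have K: "card ?K = k 0 + k 1 + k 2" using un[of 0 1] unfolding 1 by simp
  have c1: "\<And>a b. {a, b} \<in> D1 \<Longrightarrow> a \<in> ?K \<Longrightarrow> b \<in> ?K"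
    and c2: "\<And>a b. {a, b} \<in> shift ` D2 \<Longrightarrow> a \<in> ?K \<Longrightarrow> b \<in> ?K"
    using comp_closed unfolding stacked_eq by blast+
  have e1: "k 0 + k 1 = 2 * card {e \<in> D1. e \<subseteq> ?K}"
    using card_closed_strands[OF pm1 c1] un[of 0 1] unfolding 1 by simp
  have e2: "k 1 + k 2 = 2 * card {e \<in> shift ` D2. e \<subseteq> ?K}"
    using card_closed_strands[OF pm2 c2] un[of 1 2] unfolding 2 by simp
  have fG: "finite (stacked D1 D2)"
    using finite_pmatch[OF pm1] finite_pmatch[OF pm2] by (simp add: stacked_eq)
  have "card ?K \<le> card {e \<in> stacked D1 D2. e \<subseteq> ?K} + 1"
    using connected_card[of "stacked D1 D2" x] fG finite_comp unfolding comp_def connected_in_def by blast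
  also have "{e \<in> stacked D1 D2. e \<subseteq> ?K} = {e \<in> D1. e \<subseteq> ?K} \<union> {e \<in> shift ` D2. e \<subseteq> ?K}"
    by (auto simp: stacked_eq)
  also have "card \<dots> \<le> card {e \<in> D1. e \<subseteq> ?K} + card {e \<in> shift ` D2. e \<subseteq> ?K}" by (rule card_Un_le)
  finally have le: "k 0 + k 2 \<le> 2" using K e1 e2 by linarith
  have ev: "even (k 0 + k 1)" "even (k 1 + k 2)" using e1 e2 by simp_all
  then have "even (k 0 + k 2)" by presburger
  moreover have "k 0 + k 2 \<noteq> 0"
  proof -
    have "x \<in> ?K \<inter> outer" using assms by simp
    then have "card (?K \<inter> outer) \<noteq> 0" using finite_comp by (metis card_eq_0_iff empty_iff finite_Int)
    then show ?thesis unfolding 3 using un[of 0 2] by simp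
  qed
  ultimately have "k 0 + k 2 = 2" using le by presburger
  then show "card (?K \<inter> outer) = 2" unfolding 3 using un[of 0 2] by simp
  show "even (card {i. (l, i) \<in> ?K}) \<longleftrightarrow> even (card {i. (0, i) \<in> ?K})" if "l \<in> {0, 1, 2}" for l
    using ev that unfolding k_def[symmetric] by (auto; presburger)
qed

definition down :: "point \<Rightarrow> point" where
  "down = (\<lambda>(l, i). (l div 2, i))"

lemma inj_down: "inj_on down outer"
  by (auto simp: inj_on_def down_def outer_def)

lemma down_outer: "down ` outer = points n"
  by (force simp: down_def outer_def points_def)

lemma outer_pair:
  assumes "x \<in> outer" and "y \<in> outer" and "x \<noteq> y" and "y \<in> comp x"
  shows "comp x \<inter> outer = {x, y}"
proof -
  have "{x, y} \<subseteq> comp x \<inter> outer" "card {x, y} = 2" using assms by auto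
  then show ?thesis using card_outer(1)[OF assms(1)] finite_comp
    by (metis card_subset_eq finite_Int)
qed

lemma glue_iff: "e \<in> glue D1 D2 \<longleftrightarrow> (\<exists>x y. x \<in> outer \<and> y \<in> outer \<and> x \<noteq> y \<and> y \<in> comp x \<and> e = {down x, down y})"
proof
  assume "e \<in> glue D1 D2"
  then obtain l i l' i' where e: "e = {(l div 2, i), (l' div 2, i')}" "l \<in> {0, 2}" "l' \<in> {0, 2}"
    "(l, i) \<noteq> (l', i')" "((l, i), (l', i')) \<in> E\<^sup>*" unfolding glue_def conn_E by blast
  have "(l', i') \<in> {0, 1, 2} \<times> {1..n}" using comp_subset[of "(l, i)"] e by (auto simp: comp_iff)
  moreover have "(l, i) \<in> {0, 1, 2} \<times> {1..n}"
    using comp_subset[of "(l', i')"] e sym_conn[OF e(5)] by (auto simp: comp_iff)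
  ultimately show "\<exists>x y. x \<in> outer \<and> y \<in> outer \<and> x \<noteq> y \<and> y \<in> comp x \<and> e = {down x, down y}"
    using e by (intro exI[of _ "(l, i)"] exI[of _ "(l', i')"]) (auto simp: outer_def comp_iff down_def)
next
  assume "\<exists>x y. x \<in> outer \<and> y \<in> outer \<and> x \<noteq> y \<and> y \<in> comp x \<and> e = {down x, down y}"
  then obtain l i l' i' where "(l, i) \<in> outer" "(l', i') \<in> outer" "(l, i) \<noteq> (l', i')"
    "((l, i), (l', i')) \<in> E\<^sup>*" "e = {(l div 2, i), (l' div 2, i')}" by (auto simp: comp_iff down_def)
  then show "e \<in> glue D1 D2"
    unfolding glue_def conn_E mem_Collect_eq
    by (intro exI[of _ l] exI[of _ i] exI[of _ l'] exI[of _ i']) (simp add: outer_def)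
qed

lemma glue_iff': "e \<in> glue D1 D2 \<longleftrightarrow> (\<exists>x\<in>outer. e = down ` (comp x \<inter> outer))"
proof
  assume "e \<in> glue D1 D2"
  then obtain x y where xy: "x \<in> outer" "y \<in> outer" "x \<noteq> y" "y \<in> comp x" "e = {down x, down y}"
    unfolding glue_iff by blast
  then have "e = down ` (comp x \<inter> outer)" using outer_pair[OF xy(1-4)] by simp
  then show "\<exists>x\<in>outer. e = down ` (comp x \<inter> outer)" using xy(1) by blast
next
  assume "\<exists>x\<in>outer. e = down ` (comp x \<inter> outer)"
  then obtain x where x: "x \<in> outer" "e = down ` (comp x \<inter> outer)" by blast
  obtain a b where ab: "comp x \<inter> outer = {a, b}" "a \<noteq> b" using card_outer(1)[OF x(1)] by (auto simp: card_2_iff)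
  have "x \<in> {a, b}" unfolding ab(1)[symmetric] using x(1) by simp
  moreover have "a \<in> comp x \<inter> outer" "b \<in> comp x \<inter> outer" unfolding ab(1) by simp_all
  ultimately obtain y where y: "y \<in> outer" "x \<noteq> y" "y \<in> comp x" using ab(2) by blast
  then have "e = {down x, down y}" using outer_pair[OF x(1) y] x(2) by simp
  then show "e \<in> glue D1 D2" unfolding glue_iff using x y by blast
qed

lemma pmatch_glue: "pmatch (points n) (glue D1 D2)"
proof -
  have "partition_on (points n) (glue D1 D2)"
  proof (rule partition_onI)
    show "\<Union> (glue D1 D2) = points n"
    proof
      show "\<Union> (glue D1 D2) \<subseteq> points n"
      proof
        fix z assume "z \<in> \<Union> (glue D1 D2)"
        then obtain x where "z \<in> down ` (comp x \<inter> outer)" using glue_iff' by blast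
        then show "z \<in> points n" using down_outer by blast
      qed
      show "points n \<subseteq> \<Union> (glue D1 D2)"
      proof
        fix z assume "z \<in> points n"
        then obtain x where x: "x \<in> outer" "z = down x" using down_outer by blast
        then have "z \<in> down ` (comp x \<inter> outer)" by simp
        then show "z \<in> \<Union> (glue D1 D2)" using glue_iff' x(1) by blast
      qed
    qed
    show "{} \<notin> glue D1 D2" by (auto simp: glue_iff)
    fix e e' assume e: "e \<in> glue D1 D2" "e' \<in> glue D1 D2" "e \<noteq> e'"
    obtain x where x: "x \<in> outer" "e = down ` (comp x \<inter> outer)" using e(1) glue_iff' by blast
    obtain y where y: "y \<in> outer" "e' = down ` (comp y \<inter> outer)" using e(2) glue_iff' by blast
    have "comp x \<noteq> comp y" using x y e(3) by blast
    then have "comp x \<inter> comp y = {}" by (rule comp_disjoint)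
    then have "down ` ((comp x \<inter> outer) \<inter> (comp y \<inter> outer)) = {}" by blast
    then show "disjnt e e'" unfolding disjnt_def x(2) y(2)
      using inj_on_image_Int[OF inj_down, of "comp x \<inter> outer" "comp y \<inter> outer"] by simp
  qed
  moreover have "card e = 2" if e: "e \<in> glue D1 D2" for e
  proof -
    obtain x y where xy: "x \<in> outer" "y \<in> outer" "x \<noteq> y" "e = {down x, down y}"
      using e unfolding glue_iff by blast
    then have "down x \<noteq> down y" using inj_down by (auto dest: inj_onD)
    then show ?thesis using xy by simp
  qed
  ultimately show ?thesis by (simp add: pmatch_def)
qed

lemma sum_two_levels:
  fixes f :: "point \<Rightarrow> nat"
  assumes "l \<noteq> l'" and "P \<subseteq> {0, 1, 2} \<times> {1..n}"
  shows "sum f (P \<inter> ({l, l'} \<times> {1..n})) = (\<Sum>i | (l, i) \<in> P. f (l, i)) + (\<Sum>i | (l', i) \<in> P. f (l', i))"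
proof -
  have fin: "finite {i. (k, i) \<in> P}" for k by (rule finite_subset[of _ "{1..n}"]) (use assms(2) in auto)
  have "P \<inter> ({l, l'} \<times> {1..n}) = (\<lambda>i. (l, i)) ` {i. (l, i) \<in> P} \<union> (\<lambda>i. (l', i)) ` {i. (l', i) \<in> P}"
    using assms(2) by auto
  also have "sum f \<dots> = sum f ((\<lambda>i. (l, i)) ` {i. (l, i) \<in> P}) + sum f ((\<lambda>i. (l', i)) ` {i. (l', i) \<in> P})"
    by (rule sum.union_disjoint) (use fin assms(1) in auto)
  finally show ?thesis by (simp add: sum.reindex inj_on_def)
qed

text \<open>Two disjoint components cross an even number of times inside each of the two diagrams;
  counting pairs of points mod 2 this forces their outer end points to be unlinked.\<close>

lemma nocross_glue: "nocross (boundary_pos n) (glue D1 D2)"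
  unfolding nocross_def
proof
  let ?bp = "boundary_pos n"
  assume "\<exists>a b c d. {a, b} \<in> glue D1 D2 \<and> {c, d} \<in> glue D1 D2 \<and>
     ?bp a < ?bp c \<and> ?bp c < ?bp b \<and> ?bp b < ?bp d"
  then obtain a b c d where ab: "{a, b} \<in> glue D1 D2" and cd: "{c, d} \<in> glue D1 D2"
    and lt: "?bp a < ?bp c" "?bp c < ?bp b" "?bp b < ?bp d" by blast
  obtain x where x: "x \<in> outer" "{a, b} = down ` (comp x \<inter> outer)" using ab glue_iff' by blast
  obtain y where y: "y \<in> outer" "{c, d} = down ` (comp y \<inter> outer)" using cd glue_iff' by blast
  define P where "P = comp x"
  define Q where "Q = comp y"
  have "{a, b} \<noteq> {c, d}" using lt by (auto simp: doubleton_eq_iff)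
  then have PQ: "P \<inter> Q = {}" using x y comp_disjoint unfolding P_def Q_def by metis
  have sub: "P \<subseteq> {0, 1, 2} \<times> {1..n}" "Q \<subseteq> {0, 1, 2} \<times> {1..n}"
    using comp_subset[of x] comp_subset[of y] x y by (auto simp: outer_def P_def Q_def)
  define p where "p l = card {i. (l, i) \<in> P}" for l :: nat
  define q where "q l = card {i. (l, i) \<in> Q}" for l :: nat
  define lt where "lt l = (\<Sum>i | (l, i) \<in> P. \<Sum>j | (l, j) \<in> Q. of_bool (i < j) :: nat)" for l :: nat
  define gt where "gt l = (\<Sum>i | (l, i) \<in> P. \<Sum>j | (l, j) \<in> Q. of_bool (j < i) :: nat)" for l :: nat
  have bd: "1 \<le> i \<and> i \<le> n" if "(l, i) \<in> P \<or> (l, i) \<in> Q" for l i using that sub by auto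
  \<comment> \<open>Along the boundary the top row precedes the whole bottom row, so pairs from
    different rows contribute \<open>p l * q l'\<close> in this order and nothing in the
    other.\<close>
  have top: "(\<Sum>i | (l, i) \<in> P. \<Sum>j | (l', j) \<in> Q. of_bool (i < 2 * n + 1 - j) :: nat) = p l * q l'" for l l'
  proof -
    have "(\<Sum>i | (l, i) \<in> P. \<Sum>j | (l', j) \<in> Q. of_bool (i < 2 * n + 1 - j) :: nat)
        = (\<Sum>i | (l, i) \<in> P. \<Sum>j | (l', j) \<in> Q. 1)"
    proof (intro sum.cong refl)
      fix i j assume "i \<in> {i. (l, i) \<in> P}" "j \<in> {j. (l', j) \<in> Q}"
      then have "i \<le> n" "j \<le> n" using bd[of l i] bd[of l' j] by auto
      then show "of_bool (i < 2 * n + 1 - j) = (1 :: nat)" by simp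
    qed
    then show ?thesis by (simp add: p_def q_def)
  qed
  have bot: "(\<Sum>i | (l, i) \<in> P. \<Sum>j | (l', j) \<in> Q. of_bool (2 * n + 1 - i < j) :: nat) = 0" for l l'
  proof (intro sum.neutral ballI)
    fix i j assume "i \<in> {i. (l, i) \<in> P}" "j \<in> {j. (l', j) \<in> Q}"
    then have "i \<le> n" "j \<le> n" using bd[of l i] bd[of l' j] by auto
    then show "of_bool (2 * n + 1 - i < j) = (0 :: nat)" by simp
  qed
  have rev: "(\<Sum>i | (l, i) \<in> P. \<Sum>j | (l, j) \<in> Q. of_bool (2 * n + 1 - i < 2 * n + 1 - j) :: nat) = gt l" for l
    unfolding gt_def
  proof (intro sum.cong refl)
    fix i j assume "i \<in> {i. (l, i) \<in> P}" "j \<in> {j. (l, j) \<in> Q}"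
    then have "i \<le> n" "j \<le> n" using bd[of l i] bd[of l j] by auto
    then have "2 * n + 1 - i < 2 * n + 1 - j \<longleftrightarrow> j < i" by linarith
    then show "of_bool (2 * n + 1 - i < 2 * n + 1 - j) = (of_bool (j < i) :: nat)" by simp
  qed
  have two: "(\<Sum>x\<in>P \<inter> ({l, l'} \<times> {1..n}). \<Sum>z\<in>Q \<inter> ({l, l'} \<times> {1..n}). f x z) =
      (\<Sum>i | (l, i) \<in> P. \<Sum>j | (l, j) \<in> Q. f (l, i) (l, j)) + (\<Sum>i | (l, i) \<in> P. \<Sum>j | (l', j) \<in> Q. f (l, i) (l', j))
      + ((\<Sum>i | (l', i) \<in> P. \<Sum>j | (l, j) \<in> Q. f (l', i) (l, j)) + (\<Sum>i | (l', i) \<in> P. \<Sum>j | (l', j) \<in> Q. f (l', i) (l', j)))"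
    if "l \<noteq> l'" for l l' and f :: "point \<Rightarrow> point \<Rightarrow> nat"
    by (simp only: sum_two_levels[OF that sub(1)] sum_two_levels[OF that sub(2)] sum.distrib)
  have l01: "(0::nat) \<noteq> 1" and l12: "(1::nat) \<noteq> 2" and l02: "(0::nat) \<noteq> 2"
    and d21: "(2::nat) - 1 = 1" and d22: "(2::nat) div 2 = 1" by simp_all
  have b0: "?bp (0, i) = i" and b1: "?bp (1, i) = 2 * n + 1 - i" for i by (simp_all add: boundary_pos_def)
  have cl: "\<And>a b. {a, b} \<in> D1 \<Longrightarrow> a \<in> P \<Longrightarrow> b \<in> P" "\<And>a b. {a, b} \<in> D1 \<Longrightarrow> a \<in> Q \<Longrightarrow> b \<in> Q"
    "\<And>a b. {a, b} \<in> shift ` D2 \<Longrightarrow> a \<in> P \<Longrightarrow> b \<in> P" "\<And>a b. {a, b} \<in> shift ` D2 \<Longrightarrow> a \<in> Q \<Longrightarrow> b \<in> Q"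
    using comp_closed unfolding stacked_eq P_def Q_def by blast+
  have "even (\<Sum>x\<in>P \<inter> ({0, 1} \<times> {1..n}). \<Sum>z\<in>Q \<inter> ({0, 1} \<times> {1..n}). of_bool (?bp x < ?bp z) :: nat)"
    by (rule disjoint_components_even[OF pm1 nc1 _ _ PQ cl(1,2)]) (use inj_boundary_pos in \<open>auto simp: points_def\<close>)
  then have A1: "even (lt 0 + p 0 * q 1 + (0 + gt 1))"
    by (simp only: two[OF l01] b0 b1 top bot rev lt_def)
  have "even (\<Sum>x\<in>P \<inter> ({1, 2} \<times> {1..n}). \<Sum>z\<in>Q \<inter> ({1, 2} \<times> {1..n}).
      of_bool ((\<lambda>(l, i). ?bp (l - 1, i)) x < (\<lambda>(l, i). ?bp (l - 1, i)) z) :: nat)"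
    by (rule disjoint_components_even[OF pm2 nc2 _ _ PQ cl(3,4)]) (auto simp: inj_on_def boundary_pos_def)
  then have A2: "even (lt 1 + p 1 * q 2 + (0 + gt 2))"
    by (simp only: two[OF l12] prod.case diff_self_eq_0 d21 b0 b1 top bot rev lt_def)
  have A3: "lt 1 + gt 1 = p 1 * q 1"
  proof -
    have "lt 1 + gt 1 = (\<Sum>i | (1, i) \<in> P. \<Sum>j | (1, j) \<in> Q. 1)"
      unfolding lt_def gt_def sum.distrib[symmetric]
    proof (intro sum.cong refl)
      fix i j assume "i \<in> {i. (1, i) \<in> P}" "j \<in> {i. (1, i) \<in> Q}"
      then have "i \<noteq> j" using PQ by blast
      then show "of_bool (i < j) + of_bool (j < i) = (1 :: nat)" by auto
    qed
    then show ?thesis by (simp add: p_def q_def)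
  qed
  have "(\<Sum>x\<in>P \<inter> outer. \<Sum>z\<in>Q \<inter> outer. of_bool (?bp (down x) < ?bp (down z)) :: nat) = lt 0 + p 0 * q 2 + (0 + gt 2)"
    unfolding outer_def
    by (simp only: two[OF l02] down_def prod.case div_0 d22 b0 b1 top bot rev lt_def)
  moreover have "(\<Sum>x\<in>P \<inter> outer. \<Sum>z\<in>Q \<inter> outer. of_bool (?bp (down x) < ?bp (down z)) :: nat)
      = (\<Sum>x\<in>{a, b}. \<Sum>z\<in>{c, d}. of_bool (?bp x < ?bp z))"
  proof -
    have "inj_on down (P \<inter> outer)" "inj_on down (Q \<inter> outer)" using inj_down by (auto simp: inj_on_def)
    then show ?thesis unfolding x y P_def[symmetric] Q_def[symmetric] by (simp add: sum.reindex)
  qed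
  moreover have "(\<Sum>x\<in>{a, b}. \<Sum>z\<in>{c, d}. of_bool (?bp x < ?bp z) :: nat) = 3"
  proof -
    have "a \<noteq> b" "c \<noteq> d" using \<open>?bp a < ?bp c\<close> \<open>?bp c < ?bp b\<close> \<open>?bp b < ?bp d\<close> by auto
    then show ?thesis using \<open>?bp a < ?bp c\<close> \<open>?bp c < ?bp b\<close> \<open>?bp b < ?bp d\<close> by (simp del: sum_of_bool_eq)
  qed
  ultimately have A4: "odd (lt 0 + p 0 * q 2 + gt 2)" by simp
  have par: "even (p 1) \<longleftrightarrow> even (p 0)" "even (p 2) \<longleftrightarrow> even (p 0)" "even (q 1) \<longleftrightarrow> even (q 0)" "even (q 2) \<longleftrightarrow> even (q 0)"
    using card_outer(2)[OF x(1), of 1] card_outer(2)[OF x(1), of 2] card_outer(2)[OF y(1), of 1]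
      card_outer(2)[OF y(1), of 2] unfolding p_def q_def P_def Q_def by blast+
  \<comment> \<open>\<open>A1\<close>, \<open>A2\<close> and \<open>A3\<close> added modulo 2, with
    all level counts replaced by those of level 0, contradict \<open>A4\<close>.\<close>
  have "even (lt 1 + gt 1) \<longleftrightarrow> even (p 1 * q 1)" using A3 by simp
  then show False using A1 A2 A4 par by auto
qed

lemma glue_diagram: "glue D1 D2 \<in> diagrams n"
  using pmatch_glue nocross_glue by (simp add: diagrams_iff)

end

section \<open>Colourings\<close>

text \<open>With two colours the zeta matrices of diagrams multiply exactly like the diagrams, a loop
  counting for 2, and they separate diagrams. This reduces identities between diagrams,
  associativity in particular, to identities between matrices.\<close>

definition Col :: "nat \<Rightarrow> (nat \<Rightarrow> bool) set" where
  "Col n = {1..n} \<rightarrow>\<^sub>E UNIV"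

definition agrees :: "'a set set \<Rightarrow> ('a \<Rightarrow> bool) \<Rightarrow> bool" where
  "agrees D c \<longleftrightarrow> (\<forall>a b. {a, b} \<in> D \<longrightarrow> c a = c b)"

definition colm :: "(nat \<Rightarrow> bool) \<Rightarrow> (nat \<Rightarrow> bool) \<Rightarrow> point \<Rightarrow> bool" where
  "colm x y = (\<lambda>(l, i). if l = 0 then x i else y i)"

text \<open>The 0-1 matrix of the diagram on the n-fold tensor power of a two-dimensional space;
  rows are colourings of the top points, columns those of the bottom points.\<close>

definition R :: "diagram \<Rightarrow> (nat \<Rightarrow> bool) \<Rightarrow> (nat \<Rightarrow> bool) \<Rightarrow> nat" where
  "R D x y = of_bool (agrees D (colm x y))"

lemma finite_Col [simp]: "finite (Col n)"
  by (simp add: Col_def finite_PiE)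

lemma shift_mem:
  assumes "{a, b} \<in> shift ` D"
  obtains a' b' where "{a', b'} \<in> D" and "a = (Suc (fst a'), snd a')" and "b = (Suc (fst b'), snd b')"
proof -
  obtain e where e: "e \<in> D" "{a, b} = (\<lambda>(l, i). (Suc l, i)) ` e" using assms by (auto simp: shift_def)
  obtain a' where a: "a' \<in> e" "a = (\<lambda>(l, i). (Suc l, i)) a'" using e(2) by blast
  obtain b' where b: "b' \<in> e" "b = (\<lambda>(l, i). (Suc l, i)) b'" using e(2) by blast
  have "(\<lambda>(l, i). (Suc l, i)) ` e = (\<lambda>(l, i). (Suc l, i)) ` {a', b'}" using e(2) a b by simp
  then have "e = {a', b'}" by (simp only: inj_image_eq_iff[OF inj_shift_point])
  then show ?thesis using that[of a' b'] e a b by (simp add: case_prod_beta)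
qed

context two_diagrams
begin

definition col3 :: "(nat \<Rightarrow> bool) \<Rightarrow> (nat \<Rightarrow> bool) \<Rightarrow> (nat \<Rightarrow> bool) \<Rightarrow> point \<Rightarrow> bool" where
  "col3 x m y = (\<lambda>(l, i). if l = 0 then x i else if l = 1 then m i else y i)"

lemma agrees_stacked:
  "agrees (stacked D1 D2) (col3 x m y) \<longleftrightarrow> agrees D1 (colm x m) \<and> agrees D2 (colm m y)"
proof -
  have 1: "col3 x m y a = colm x m a" if "a \<in> {0, 1} \<times> {1..n}" for a
    using that by (auto simp: col3_def colm_def)
  have 2: "col3 x m y (Suc (fst a), snd a) = colm m y a" for a
    by (simp add: col3_def colm_def case_prod_beta)
  have "agrees D1 (col3 x m y) \<longleftrightarrow> agrees D1 (colm x m)"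
  proof -
    have "col3 x m y a = colm x m a \<and> col3 x m y b = colm x m b" if "{a, b} \<in> D1" for a b
      using pmatch_subset[OF pm1 that] 1 by simp
    then show ?thesis unfolding agrees_def by blast
  qed
  moreover have "agrees (shift ` D2) (col3 x m y) \<longleftrightarrow> agrees D2 (colm m y)"
  proof
    assume a: "agrees (shift ` D2) (col3 x m y)"
    show "agrees D2 (colm m y)" unfolding agrees_def
    proof (intro allI impI)
      fix a b assume "{a, b} \<in> D2"
      then have "{(Suc (fst a), snd a), (Suc (fst b), snd b)} \<in> shift ` D2"
        unfolding shift_pair[symmetric] by (rule imageI)
      then show "colm m y a = colm m y b" using a unfolding agrees_def 2[symmetric] by blast
    qed
  next
    assume a: "agrees D2 (colm m y)"
    show "agrees (shift ` D2) (col3 x m y)" unfolding agrees_def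
    proof (intro allI impI)
      fix a b assume "{a, b} \<in> shift ` D2"
      then obtain a' b' where "{a', b'} \<in> D2" "a = (Suc (fst a'), snd a')" "b = (Suc (fst b'), snd b')"
        by (rule shift_mem)
      then show "col3 x m y a = col3 x m y b" using a 2 unfolding agrees_def by metis
    qed
  qed
  ultimately show ?thesis unfolding stacked_eq agrees_def by blast
qed

lemma agrees_comp: "agrees (stacked D1 D2) c \<longleftrightarrow> (\<forall>a b. b \<in> comp a \<longrightarrow> c a = c b)"
proof
  assume a: "agrees (stacked D1 D2) c"
  have "c a = c b" if "(a, b) \<in> E\<^sup>*" for a b
    using that
  proof (induction rule: rtrancl_induct)
    case (step y z)
    then have "{y, z} \<in> stacked D1 D2" by (simp add: E_def)
    then have "c y = c z" using a unfolding agrees_def by blast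
    then show ?case using step.IH by simp
  qed simp
  then show "\<forall>a b. b \<in> comp a \<longrightarrow> c a = c b" by (simp add: comp_iff)
next
  assume a: "\<forall>a b. b \<in> comp a \<longrightarrow> c a = c b"
  show "agrees (stacked D1 D2) c" unfolding agrees_def
    using a comp_closed comp_refl by blast
qed

lemma col3_down: "a \<in> outer \<Longrightarrow> col3 x m y a = colm x y (down a)"
  by (auto simp: outer_def col3_def colm_def down_def)

lemma agrees_glue: "agrees (glue D1 D2) (colm x y) \<longleftrightarrow>
   (\<forall>a\<in>outer. \<forall>b\<in>outer. b \<in> comp a \<longrightarrow> col3 x m y a = col3 x m y b)"
proof
  assume a: "agrees (glue D1 D2) (colm x y)"
  show "\<forall>a\<in>outer. \<forall>b\<in>outer. b \<in> comp a \<longrightarrow> col3 x m y a = col3 x m y b"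
  proof (intro ballI impI)
    fix u v assume uv: "u \<in> outer" "v \<in> outer" "v \<in> comp u"
    show "col3 x m y u = col3 x m y v"
    proof (cases "u = v")
      case False
      then have "{down u, down v} \<in> glue D1 D2" using glue_iff uv by blast
      then show ?thesis using a col3_down uv unfolding agrees_def by metis
    qed simp
  qed
next
  assume a: "\<forall>a\<in>outer. \<forall>b\<in>outer. b \<in> comp a \<longrightarrow> col3 x m y a = col3 x m y b"
  show "agrees (glue D1 D2) (colm x y)" unfolding agrees_def
  proof (intro allI impI)
    fix a b assume "{a, b} \<in> glue D1 D2"
    then obtain u v where uv: "u \<in> outer" "v \<in> outer" "v \<in> comp u" "{a, b} = {down u, down v}"
      using glue_iff by blast
    have "colm x y (down u) = colm x y (down v)" using a uv col3_down by metis
    then show "colm x y a = colm x y b" using uv(4) by (auto simp: doubleton_eq_iff)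
  qed
qed

definition LS :: "point set set" where
  "LS = {K. (\<exists>i\<in>{1..n}. K = comp (1, i)) \<and> K \<subseteq> {1} \<times> {1..n}}"

lemma loops_eq: "loops n D1 D2 = card LS"
  by (simp add: loops_def LS_def comp_def)

lemma finite_LS: "finite LS"
  by (rule finite_subset[of _ "(\<lambda>i. comp (1, i)) ` {1..n}"]) (auto simp: LS_def)

lemma not_loop:
  assumes "i \<in> {1..n}" and "comp (1, i) \<notin> LS"
  shows "\<exists>z. z \<in> comp (1, i) \<inter> outer"
proof -
  have "\<not> comp (1, i) \<subseteq> {1} \<times> {1..n}" using assms unfolding LS_def by blast
  then obtain z where z: "z \<in> comp (1, i)" "z \<notin> {1} \<times> {1..n}" by blast
  then have "z \<in> {0, 1, 2} \<times> {1..n}" using comp_subset[of "(1, i)"] assms(1) by auto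
  then have "z \<in> outer" using z(2) by (auto simp: outer_def)
  then show ?thesis using z by blast
qed

text \<open>A middle colouring fits if and only if the total colouring is constant on components.
  Components that reach the outer rows are determined there, loops are free; so the colourings
  correspond to two-valued functions on the loops.\<close>

lemma card_colourings:
  "card {m \<in> Col n. agrees (stacked D1 D2) (col3 x m y)} =
     (if agrees (glue D1 D2) (colm x y) then 2 ^ loops n D1 D2 else 0)"
proof (cases "agrees (glue D1 D2) (colm x y)")
  case False
  have "\<not> agrees (stacked D1 D2) (col3 x m y)" for m
    using False agrees_glue[of x y m] unfolding agrees_comp by blast
  then show ?thesis using False by simp
next
  case True
  let ?M = "{m \<in> Col n. agrees (stacked D1 D2) (col3 x m y)}"
  define pick where "pick K = (SOME i. (1::nat, i) \<in> K)" for K :: "point set"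
  \<comment> \<open>The middle colouring \<open>x\<close> is a dummy: \<open>c0\<close> matters at
    outer points only.\<close>
  define c0 where "c0 = col3 x x y"
  define F where "F m = (\<lambda>K\<in>LS. m (pick K))" for m :: "nat \<Rightarrow> bool"
  define g0 where "g0 g i = (if comp (1, i) \<in> LS then g (comp (1, i)) else c0 (SOME z. z \<in> comp (1, i) \<inter> outer))"
    for g :: "point set \<Rightarrow> bool" and i
  define G where "G g = (\<lambda>i\<in>{1..n}. g0 g i)" for g :: "point set \<Rightarrow> bool"
  have pick: "(1, pick (comp (1, i))) \<in> comp (1, i)" for i
    unfolding pick_def by (rule someI[of _ i]) simp
  have out: "(SOME z. z \<in> comp (1, i) \<inter> outer) \<in> comp (1, i) \<inter> outer" if "i \<in> {1..n}" "comp (1, i) \<notin> LS" for i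
    using not_loop[OF that] by (rule someI_ex)
  have c0_out: "col3 x m y z = c0 z" if "z \<in> outer" for z m
    using that col3_down unfolding c0_def by metis
  have c0_eq: "c0 a = c0 b" if "a \<in> outer" "b \<in> outer" "b \<in> comp a" for a b
    using True that agrees_glue[of x y x] unfolding c0_def by blast
  have agG: "agrees (stacked D1 D2) (col3 x (G g) y)" for g
    unfolding agrees_def
  proof (intro allI impI)
    fix a b assume ab: "{a, b} \<in> stacked D1 D2"
    have cab: "comp a = comp b" using comp_eq[OF comp_closed[OF ab comp_refl]] by simp
    have V: "a \<in> {0, 1, 2} \<times> {1..n}" "b \<in> {0, 1, 2} \<times> {1..n}" using stacked_subset[OF ab] by blast+
    have val: "col3 x (G g) y v = (if comp v \<in> LS then g (comp v) else c0 (SOME z. z \<in> comp v \<inter> outer))"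
      if "v \<in> {0, 1, 2} \<times> {1..n}" for v
    proof (cases "v \<in> outer")
      case True
      have "comp v \<notin> LS"
      proof
        assume "comp v \<in> LS"
        then have "v \<in> {1} \<times> {1..n}" unfolding LS_def using comp_refl by blast
        then show False using True by (auto simp: outer_def)
      qed
      moreover have "(SOME z. z \<in> comp v \<inter> outer) \<in> comp v \<inter> outer"
        by (rule someI[of _ v]) (simp add: True)
      then have "c0 v = c0 (SOME z. z \<in> comp v \<inter> outer)" using c0_eq[OF True] by blast
      moreover have "col3 x (G g) y v = c0 v" using c0_out[OF True] .
      ultimately show ?thesis by simp
    next
      case False
      obtain l i where li: "v = (l, i)" by (cases v)
      have v: "v = (1, i)" "i \<in> {1..n}" using that False unfolding li outer_def by auto
      then show ?thesis by (simp add: col3_def G_def g0_def)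
    qed
    show "col3 x (G g) y a = col3 x (G g) y b" using val[OF V(1)] val[OF V(2)] cab by simp
  qed
  have "bij_betw F ?M (LS \<rightarrow>\<^sub>E UNIV)"
  proof (rule bij_betw_byWitness[where f' = G])
    show "F ` ?M \<subseteq> LS \<rightarrow>\<^sub>E UNIV" by (auto simp: F_def)
    show "G ` (LS \<rightarrow>\<^sub>E UNIV) \<subseteq> ?M" using agG by (auto simp: G_def Col_def)
    show "\<forall>m\<in>?M. G (F m) = m"
    proof
      fix m assume m: "m \<in> ?M"
      then have const: "col3 x m y a = col3 x m y b" if "b \<in> comp a" for a b
        using that unfolding agrees_comp by blast
      have m1: "col3 x m y (1, j) = m j" for j by (simp add: col3_def)
      have "g0 (F m) i = m i" if i: "i \<in> {1..n}" for i
      proof (cases "comp (1, i) \<in> LS")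
        case True
        then have "g0 (F m) i = m (pick (comp (1, i)))" by (simp add: g0_def F_def)
        also have "\<dots> = m i" using const[OF pick[of i]] unfolding m1 by (rule sym)
        finally show ?thesis .
      next
        case False
        note o = out[OF i False]
        have "g0 (F m) i = c0 (SOME z. z \<in> comp (1, i) \<inter> outer)" using False by (simp add: g0_def)
        also have "\<dots> = col3 x m y (SOME z. z \<in> comp (1, i) \<inter> outer)" using c0_out o by blast
        also have "\<dots> = m i" using const[of _ "(1, i)"] o m1 by blast
        finally show ?thesis .
      qed
      moreover have "m \<in> extensional {1..n}" using m by (auto simp: Col_def PiE_def)
      ultimately show "G (F m) = m" unfolding G_def by (intro extensionalityI[of _ "{1..n}"]) auto
    qed
    show "\<forall>g\<in>LS \<rightarrow>\<^sub>E UNIV. F (G g) = g"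
    proof
      fix g assume g: "g \<in> LS \<rightarrow>\<^sub>E (UNIV :: bool set)"
      have "G g (pick K) = g K" if K: "K \<in> LS" for K
      proof -
        obtain i where i: "i \<in> {1..n}" "K = comp (1, i)" using K by (auto simp: LS_def)
        have p: "(1, pick K) \<in> K" using pick i(2) by simp
        then have "comp (1, pick K) = K" using comp_eq i(2) by simp
        moreover have "pick K \<in> {1..n}" using p K by (auto simp: LS_def)
        ultimately show ?thesis using K by (simp add: G_def g0_def)
      qed
      moreover have "g \<in> extensional LS" using g by (simp add: PiE_def)
      ultimately show "F (G g) = g" unfolding F_def by (intro extensionalityI[of _ LS]) auto
    qed
  qed
  then have "card ?M = card (LS \<rightarrow>\<^sub>E (UNIV :: bool set))" by (rule bij_betw_same_card)
  also have "\<dots> = 2 ^ card LS" using finite_LS by (simp add: card_PiE)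
  finally show ?thesis using True loops_eq by simp
qed

end

text \<open>Each loop can take either colour in the sum over the middle row; this is why two colours
  match the loop value 2.\<close>

lemma R_mult:
  assumes "D1 \<in> diagrams n" and "D2 \<in> diagrams n"
  shows "(\<Sum>m\<in>Col n. R D1 x m * R D2 m y) = 2 ^ loops n D1 D2 * R (glue D1 D2) x y"
proof -
  interpret two_diagrams n D1 D2 by unfold_locales (fact assms)+
  have "(\<Sum>m\<in>Col n. R D1 x m * R D2 m y) = (\<Sum>m\<in>Col n. of_bool (agrees (stacked D1 D2) (col3 x m y)))"
    unfolding agrees_stacked R_def by (intro sum.cong refl) simp
  also have "\<dots> = card {m \<in> Col n. agrees (stacked D1 D2) (col3 x m y)}"
  proof -
    have "Col n \<inter> {m. agrees (stacked D1 D2) (col3 x m y)} = {m \<in> Col n. agrees (stacked D1 D2) (col3 x m y)}"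
      by blast
    then show ?thesis by simp
  qed
  finally show ?thesis unfolding card_colourings R_def by simp
qed

lemma glue_diagram: "D1 \<in> diagrams n \<Longrightarrow> D2 \<in> diagrams n \<Longrightarrow> glue D1 D2 \<in> diagrams n"
  by (rule two_diagrams.glue_diagram) (rule two_diagrams.intro)

lemma R_set:
  assumes "\<And>e. e \<in> D \<Longrightarrow> card e = 2 \<and> e \<subseteq> points n"
  shows "R D (\<lambda>i\<in>{1..n}. (0, i) \<in> S) (\<lambda>i\<in>{1..n}. (1, i) \<in> S) = of_bool (\<forall>e\<in>D. e \<subseteq> S \<or> e \<inter> S = {})"
proof -
  let ?c = "colm (\<lambda>i\<in>{1..n}. (0, i) \<in> S) (\<lambda>i\<in>{1..n}. (1, i) \<in> S)"
  have c: "?c a \<longleftrightarrow> a \<in> S" if "a \<in> points n" for a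
    using that by (auto simp: colm_def points_def)
  have "agrees D ?c \<longleftrightarrow> (\<forall>e\<in>D. e \<subseteq> S \<or> e \<inter> S = {})"
  proof
    assume a: "agrees D ?c"
    show "\<forall>e\<in>D. e \<subseteq> S \<or> e \<inter> S = {}"
    proof
      fix e assume e: "e \<in> D"
      obtain u v where uv: "e = {u, v}" using assms[OF e] unfolding card_2_iff by blast
      have "u \<in> points n" "v \<in> points n" using assms[OF e] uv by auto
      then have "u \<in> S \<longleftrightarrow> v \<in> S" using a e uv c unfolding agrees_def by blast
      then show "e \<subseteq> S \<or> e \<inter> S = {}" using uv by auto
    qed
  next
    assume a: "\<forall>e\<in>D. e \<subseteq> S \<or> e \<inter> S = {}"
    show "agrees D ?c" unfolding agrees_def
    proof (intro allI impI)
      fix u v assume e: "{u, v} \<in> D"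
      then have "u \<in> points n" "v \<in> points n" using assms[OF e] by simp_all
      moreover have "u \<in> S \<longleftrightarrow> v \<in> S" using bspec[OF a e] by auto
      ultimately show "?c u = ?c v" using c by simp
    qed
  qed
  then show ?thesis by (simp add: R_def)
qed

text \<open>The empty colour class recovers the power of two. A strand of \<open>D\<close> as colour
  class traps every pair of \<open>D'\<close> meeting it, and a single point detects a strand
  missing from \<open>D'\<close>. As \<open>D'\<close> is just a set of pairs, a glued diagram can
  be identified with a set not yet known to be a matching.\<close>

lemma R_inj:
  assumes D: "pmatch (points n) D" and D': "\<And>e. e \<in> D' \<Longrightarrow> card e = 2 \<and> e \<subseteq> points n"
    and eq: "\<And>x y. x \<in> Col n \<Longrightarrow> y \<in> Col n \<Longrightarrow> 2 ^ a * R D x y = 2 ^ b * R D' x y"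
  shows "a = b" and "D = D'"
proof -
  have DD: "card e = 2 \<and> e \<subseteq> points n" if "e \<in> D" for e
    using that D pmatch_subset[OF D] by (auto simp: pmatch_def)
  have eqS: "2 ^ a * of_bool (\<forall>e\<in>D. e \<subseteq> S \<or> e \<inter> S = {}) = (2::nat) ^ b * of_bool (\<forall>e\<in>D'. e \<subseteq> S \<or> e \<inter> S = {})" for S
    using eq[of "\<lambda>i\<in>{1..n}. (0, i) \<in> S" "\<lambda>i\<in>{1..n}. (1, i) \<in> S"] R_set[of D n S] R_set[of D' n S] DD D'
    by (simp add: Col_def)
  have "(2::nat) ^ a = 2 ^ b" using eqS[of "{}"] by simp
  then show ab: "a = b" by simp
  have eqS': "(\<forall>e\<in>D. e \<subseteq> S \<or> e \<inter> S = {}) \<longleftrightarrow> (\<forall>e\<in>D'. e \<subseteq> S \<or> e \<inter> S = {})" for S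
    using eqS[of S] ab by (simp add: of_bool_eq_iff)
  have sub: "D' \<subseteq> D"
  proof
    fix e' assume e': "e' \<in> D'"
    have "e' \<noteq> {}" using D'[OF e'] by force
    then obtain z where z: "z \<in> e'" "z \<in> points n" using D'[OF e'] by blast
    obtain e where e: "e \<in> D" "z \<in> e" using pmatch_cover[OF D z(2)] by blast
    have "\<forall>f\<in>D. f \<subseteq> e \<or> f \<inter> e = {}" using pmatch_disjoint[OF D _ e(1)] by blast
    then have "\<forall>f\<in>D'. f \<subseteq> e \<or> f \<inter> e = {}" unfolding eqS' .
    then have "e' \<subseteq> e \<or> e' \<inter> e = {}" using e' by (rule bspec)
    then have "e' \<subseteq> e" using z(1) e(2) by auto
    then have "e' = e" using DD[OF e(1)] D'[OF e'] by (metis card.infinite card_subset_eq zero_neq_numeral)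
    then show "e' \<in> D" using e(1) by simp
  qed
  show "D = D'"
  proof
    show "D \<subseteq> D'"
    proof
      fix e assume e: "e \<in> D"
      obtain u v where uv: "e = {u, v}" "u \<noteq> v" using pmatch_strand[OF D e] by blast
      show "e \<in> D'"
      proof (rule ccontr)
        assume ne: "e \<notin> D'"
        have "\<forall>f\<in>D'. f \<subseteq> {u} \<or> f \<inter> {u} = {}"
        proof
          fix f assume f: "f \<in> D'"
          then have "f \<inter> e = {}" using pmatch_disjoint[OF D _ e, of f] sub ne by blast
          then show "f \<subseteq> {u} \<or> f \<inter> {u} = {}" using uv by blast
        qed
        then have "\<forall>f\<in>D. f \<subseteq> {u} \<or> f \<inter> {u} = {}" unfolding eqS' .
        then have "e \<subseteq> {u} \<or> e \<inter> {u} = {}" using e by (rule bspec)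
        then show False using uv by auto
      qed
    qed
  qed (rule sub)
qed

lemma diagram_strands: "D \<in> diagrams n \<Longrightarrow> e \<in> D \<Longrightarrow> card e = 2 \<and> e \<subseteq> points n"
  using pmatch_subset[of "points n" D e] by (auto simp: diagrams_iff pmatch_def)

lemma diagram_pmatch: "D \<in> diagrams n \<Longrightarrow> pmatch (points n) D"
  by (simp add: diagrams_iff)

lemma R_inj_diagrams:
  assumes "D \<in> diagrams n" and "D' \<in> diagrams n"
    and "\<And>x y. x \<in> Col n \<Longrightarrow> y \<in> Col n \<Longrightarrow> 2 ^ a * R D x y = 2 ^ b * R D' x y"
  shows "a = b \<and> D = D'"
proof
  note D' = diagram_strands[OF assms(2)]
  show "a = b" by (rule R_inj(1)[OF diagram_pmatch[OF assms(1)] D' assms(3)])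
  show "D = D'" by (rule R_inj(2)[OF diagram_pmatch[OF assms(1)] D' assms(3)])
qed

lemma glue_eqI:
  assumes "D1 \<in> diagrams n" and "D2 \<in> diagrams n" and D: "\<And>e. e \<in> D \<Longrightarrow> card e = 2 \<and> e \<subseteq> points n"
    and eq: "\<And>x y. x \<in> Col n \<Longrightarrow> y \<in> Col n \<Longrightarrow> (\<Sum>m\<in>Col n. R D1 x m * R D2 m y) = 2 ^ l * R D x y"
  shows "loops n D1 D2 = l" and "glue D1 D2 = D"
proof -
  note g = diagram_pmatch[OF glue_diagram[OF assms(1,2)]]
  have eq': "2 ^ loops n D1 D2 * R (glue D1 D2) x y = 2 ^ l * R D x y" if "x \<in> Col n" "y \<in> Col n" for x y
    using eq[OF that] unfolding R_mult[OF assms(1,2)] .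
  show "loops n D1 D2 = l" by (rule R_inj(1)[OF g D eq'])
  show "glue D1 D2 = D" by (rule R_inj(2)[OF g D eq'])
qed

text \<open>Associativity of matrix multiplication. Comparing exponents and diagrams together also
  yields the cocycle identity for loop numbers, which associativity of the algebra requires.\<close>

lemma glue_assoc:
  assumes "D1 \<in> diagrams n" and "D2 \<in> diagrams n" and "D3 \<in> diagrams n"
  shows "loops n D1 D2 + loops n (glue D1 D2) D3 = loops n D2 D3 + loops n D1 (glue D2 D3)
    \<and> glue (glue D1 D2) D3 = glue D1 (glue D2 D3)"
proof (rule R_inj_diagrams)
  note g = glue_diagram[OF assms(1,2)] glue_diagram[OF assms(2,3)]
  show "glue (glue D1 D2) D3 \<in> diagrams n" "glue D1 (glue D2 D3) \<in> diagrams n"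
    using g assms glue_diagram by blast+
  fix x y
  have "2 ^ (loops n D1 D2 + loops n (glue D1 D2) D3) * R (glue (glue D1 D2) D3) x y
      = 2 ^ loops n D1 D2 * (\<Sum>m\<in>Col n. R (glue D1 D2) x m * R D3 m y)"
    unfolding R_mult[OF g(1) assms(3)] by (simp add: power_add)
  also have "\<dots> = (\<Sum>m\<in>Col n. (\<Sum>m'\<in>Col n. R D1 x m' * R D2 m' m) * R D3 m y)"
    unfolding R_mult[OF assms(1,2)] by (simp add: sum_distrib_left mult.assoc)
  also have "\<dots> = (\<Sum>m\<in>Col n. \<Sum>m'\<in>Col n. R D1 x m' * (R D2 m' m * R D3 m y))"
    unfolding sum_distrib_right mult.assoc ..
  also have "\<dots> = (\<Sum>m'\<in>Col n. \<Sum>m\<in>Col n. R D1 x m' * (R D2 m' m * R D3 m y))"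
    by (rule sum.swap)
  also have "\<dots> = (\<Sum>m'\<in>Col n. R D1 x m' * (2 ^ loops n D2 D3 * R (glue D2 D3) m' y))"
    unfolding sum_distrib_left[symmetric] R_mult[OF assms(2,3)] ..
  also have "\<dots> = 2 ^ loops n D2 D3 * (\<Sum>m'\<in>Col n. R D1 x m' * R (glue D2 D3) m' y)"
    unfolding sum_distrib_left by (intro sum.cong refl) (simp only: mult.left_commute)
  also have "\<dots> = 2 ^ (loops n D2 D3 + loops n D1 (glue D2 D3)) * R (glue D1 (glue D2 D3)) x y"
    unfolding R_mult[OF assms(1) g(2)] by (simp add: power_add)
  finally show "2 ^ (loops n D1 D2 + loops n (glue D1 D2) D3) * R (glue (glue D1 D2) D3) x y
    = 2 ^ (loops n D2 D3 + loops n D1 (glue D2 D3)) * R (glue D1 (glue D2 D3)) x y" .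
qed

section \<open>Generators and half diagrams\<close>

definition udiag :: "nat \<Rightarrow> nat \<Rightarrow> diagram" where
  "udiag n i = {{(0, i), (0, Suc i)}, {(1, i), (1, Suc i)}} \<union> {{(0, j), (1, j)} | j. j \<in> {1..n} - {i, Suc i}}"

lemma tl_u_eq: "tl_u n i = diag_elem (udiag n i)"
  by (simp add: tl_u_def udiag_def)

lemma pmatch_involution:
  assumes "\<And>x. x \<in> X \<Longrightarrow> f x \<in> X \<and> f (f x) = x \<and> f x \<noteq> x"
  shows "pmatch X ((\<lambda>x. {x, f x}) ` X)"
proof -
  have "partition_on X ((\<lambda>x. {x, f x}) ` X)"
  proof (rule partition_onI)
    show "\<Union> ((\<lambda>x. {x, f x}) ` X) = X" using assms by blast
    show "{} \<notin> (\<lambda>x. {x, f x}) ` X" by blast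
    fix e e' assume "e \<in> (\<lambda>x. {x, f x}) ` X" "e' \<in> (\<lambda>x. {x, f x}) ` X" "e \<noteq> e'"
    then obtain x y where xy: "x \<in> X" "y \<in> X" "e = {x, f x}" "e' = {y, f y}" by blast
    show "disjnt e e'"
    proof (rule ccontr)
      assume "\<not> disjnt e e'"
      then have "x = y \<or> x = f y \<or> f x = y \<or> f x = f y" unfolding xy disjnt_def by blast
      then have "x = y \<or> x = f y" using assms xy(1,2) by metis
      then have "e = e'" unfolding xy using assms[OF xy(2)] by auto
      then show False using \<open>e \<noteq> e'\<close> by simp
    qed
  qed
  moreover have "card {x, f x} = 2" if "x \<in> X" for x using assms[OF that] by auto
  ultimately show ?thesis by (auto simp: pmatch_def)
qed

lemma id_diagram: "id_diagram n \<in> diagrams n"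
proof -
  have "id_diagram n = (\<lambda>x. {x, (1 - fst x, snd x)}) ` points n"
  proof
    show "id_diagram n \<subseteq> (\<lambda>x. {x, (1 - fst x, snd x)}) ` points n"
    proof
      fix e assume "e \<in> id_diagram n"
      then obtain j where "j \<in> {1..n}" "e = {(0, j), (1, j)}" by (auto simp: id_diagram_def)
      then show "e \<in> (\<lambda>x. {x, (1 - fst x, snd x)}) ` points n"
        by (intro image_eqI[of _ _ "(0, j)"]) (auto simp: points_def)
    qed
    show "(\<lambda>x. {x, (1 - fst x, snd x)}) ` points n \<subseteq> id_diagram n"
      by (auto simp: points_def id_diagram_def insert_commute)
  qed
  moreover have "pmatch (points n) ((\<lambda>x. {x, (1 - fst x, snd x)}) ` points n)"
    by (rule pmatch_involution) (auto simp: points_def)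
  moreover have "nocross (boundary_pos n) (id_diagram n)"
    unfolding nocross_def
  proof
    assume "\<exists>a b c d. {a, b} \<in> id_diagram n \<and> {c, d} \<in> id_diagram n \<and> boundary_pos n a < boundary_pos n c
      \<and> boundary_pos n c < boundary_pos n b \<and> boundary_pos n b < boundary_pos n d"
    then obtain a b c d where 1: "{a, b} \<in> id_diagram n" "{c, d} \<in> id_diagram n"
      and lt: "boundary_pos n a < boundary_pos n c" "boundary_pos n c < boundary_pos n b" "boundary_pos n b < boundary_pos n d"
      by blast
    \<comment> \<open>All strands have the same sum of end positions, so any two are nested.\<close>
    have s: "boundary_pos n a + boundary_pos n b = 2 * n + 1" if "{a, b} \<in> id_diagram n" for a b
      using that by (auto simp: id_diagram_def doubleton_eq_iff boundary_pos_def)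
    show False using s[OF 1(1)] s[OF 1(2)] lt by linarith
  qed
  ultimately show ?thesis by (simp add: diagrams_iff)
qed

lemma udiag_diagram:
  assumes "1 \<le> i" and "i < n"
  shows "udiag n i \<in> diagrams n"
proof -
  define f :: "point \<Rightarrow> point" where
    "f x = (if snd x = i then (fst x, Suc i) else if snd x = Suc i then (fst x, i) else (1 - fst x, snd x))" for x
  have "udiag n i = (\<lambda>x. {x, f x}) ` points n"
  proof
    show "udiag n i \<subseteq> (\<lambda>x. {x, f x}) ` points n"
    proof
      fix e assume "e \<in> udiag n i"
      then consider "e = {(0, i), (0, Suc i)}" | "e = {(1, i), (1, Suc i)}"
        | j where "j \<in> {1..n} - {i, Suc i}" "e = {(0, j), (1, j)}" unfolding udiag_def by blast
      then show "e \<in> (\<lambda>x. {x, f x}) ` points n"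
      proof cases
        case 1
        then show ?thesis using assms by (intro image_eqI[of _ _ "(0, i)"]) (auto simp: points_def f_def)
      next
        case 2
        then show ?thesis using assms by (intro image_eqI[of _ _ "(1, i)"]) (auto simp: points_def f_def)
      next
        case 3
        then show ?thesis by (intro image_eqI[of _ _ "(0, j)"]) (auto simp: points_def f_def)
      qed
    qed
    show "(\<lambda>x. {x, f x}) ` points n \<subseteq> udiag n i"
    proof
      fix e assume "e \<in> (\<lambda>x. {x, f x}) ` points n"
      then obtain x where x: "x \<in> points n" "e = {x, f x}" by blast
      obtain l j where xl: "x = (l, j)" by (cases x)
      have lj: "l = 0 \<or> l = 1" "j \<in> {1..n}" "e = {(l, j), f (l, j)}" using x unfolding xl points_def by auto
      consider "j = i" | "j = Suc i" | "j \<notin> {i, Suc i}" by blast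
      then show "e \<in> udiag n i"
      proof cases
        case 3
        then have "e = {(0, j), (1, j)}" using lj by (auto simp: f_def)
        then show ?thesis unfolding udiag_def using 3 lj(2) by blast
      qed (use lj in \<open>auto simp: f_def udiag_def\<close>)
    qed
  qed
  moreover have "pmatch (points n) ((\<lambda>x. {x, f x}) ` points n)"
    by (rule pmatch_involution) (use assms in \<open>auto simp: points_def f_def\<close>)
  moreover have "nocross (boundary_pos n) (udiag n i)"
    unfolding nocross_def
  proof
    let ?bp = "boundary_pos n"
    assume "\<exists>a b c d. {a, b} \<in> udiag n i \<and> {c, d} \<in> udiag n i \<and> ?bp a < ?bp c \<and> ?bp c < ?bp b \<and> ?bp b < ?bp d"
    then obtain a b c d where 1: "{a, b} \<in> udiag n i" "{c, d} \<in> udiag n i"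
      and lt: "?bp a < ?bp c" "?bp c < ?bp b" "?bp b < ?bp d" by blast
    \<comment> \<open>Strands join boundary neighbours or mirror positions; an end cannot lie inside
      the former, and two of the latter are nested.\<close>
    have s: "?bp b = Suc (?bp a) \<or> ?bp a + ?bp b = 2 * n + 1" if ab: "{a, b} \<in> udiag n i" and "?bp a < ?bp b" for a b
    proof -
      consider "{a, b} = {(0, i), (0, Suc i)}" | "{a, b} = {(1, i), (1, Suc i)}"
        | j where "j \<in> {1..n} - {i, Suc i}" "{a, b} = {(0, j), (1, j)}" using ab unfolding udiag_def by blast
      then show ?thesis
        by cases (use assms that(2) in \<open>auto simp: doubleton_eq_iff boundary_pos_def\<close>)
    qed
    have "?bp a < ?bp b" "?bp c < ?bp d" using lt by linarith+
    then show False using s[OF 1(1)] s[OF 1(2)] lt by linarith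
  qed
  ultimately show ?thesis by (simp add: diagrams_iff)
qed

lemma R_id: "x \<in> Col n \<Longrightarrow> y \<in> Col n \<Longrightarrow> R (id_diagram n) x y = of_bool (x = y)"
proof -
  assume xy: "x \<in> Col n" "y \<in> Col n"
  have "agrees (id_diagram n) (colm x y) \<longleftrightarrow> (\<forall>j\<in>{1..n}. x j = y j)"
  proof
    assume a: "agrees (id_diagram n) (colm x y)"
    show "\<forall>j\<in>{1..n}. x j = y j"
    proof
      fix j assume "j \<in> {1..n}"
      then have "{(0, j), (1, j)} \<in> id_diagram n" unfolding id_diagram_def by blast
      then have "colm x y (0, j) = colm x y (1, j)" using a unfolding agrees_def by blast
      then show "x j = y j" by (simp add: colm_def)
    qed
  next
    assume a: "\<forall>j\<in>{1..n}. x j = y j"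
    show "agrees (id_diagram n) (colm x y)" unfolding agrees_def
      using a by (auto simp: id_diagram_def doubleton_eq_iff colm_def)
  qed
  also have "\<dots> \<longleftrightarrow> x = y"
    using xy by (auto simp: Col_def PiE_def intro: extensionalityI)
  finally show ?thesis by (simp add: R_def)
qed

lemma R_u: "R (udiag n i) x y = of_bool (x i = x (Suc i) \<and> y i = y (Suc i) \<and> (\<forall>j\<in>{1..n} - {i, Suc i}. x j = y j))"
proof -
  have "agrees (udiag n i) (colm x y) \<longleftrightarrow> x i = x (Suc i) \<and> y i = y (Suc i) \<and> (\<forall>j\<in>{1..n} - {i, Suc i}. x j = y j)"
  proof
    assume a: "agrees (udiag n i) (colm x y)"
    have "{(0, i), (0, Suc i)} \<in> udiag n i" "{(1, i), (1, Suc i)} \<in> udiag n i" unfolding udiag_def by blast+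
    then have "colm x y (0, i) = colm x y (0, Suc i)" "colm x y (1, i) = colm x y (1, Suc i)"
      using a unfolding agrees_def by blast+
    moreover have "x j = y j" if j: "j \<in> {1..n} - {i, Suc i}" for j
    proof -
      have "{(0, j), (1, j)} \<in> udiag n i" unfolding udiag_def using j by blast
      then have "colm x y (0, j) = colm x y (1, j)" using a unfolding agrees_def by blast
      then show ?thesis by (simp add: colm_def)
    qed
    ultimately show "x i = x (Suc i) \<and> y i = y (Suc i) \<and> (\<forall>j\<in>{1..n} - {i, Suc i}. x j = y j)"
      by (simp add: colm_def)
  next
    assume a: "x i = x (Suc i) \<and> y i = y (Suc i) \<and> (\<forall>j\<in>{1..n} - {i, Suc i}. x j = y j)"
    show "agrees (udiag n i) (colm x y)" unfolding agrees_def
    proof (intro allI impI)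
      fix c d assume cd: "{c, d} \<in> udiag n i"
      consider "{c, d} = {(0, i), (0, Suc i)}" | "{c, d} = {(1, i), (1, Suc i)}"
        | j where "j \<in> {1..n} - {i, Suc i}" "{c, d} = {(0, j), (1, j)}" using cd unfolding udiag_def by blast
      then show "colm x y c = colm x y d"
        by cases (use a in \<open>auto simp: doubleton_eq_iff colm_def\<close>)
    qed
  qed
  then show ?thesis by (simp add: R_def)
qed

lemma R_u_sym: "R (udiag n i) x y = R (udiag n i) y x"
proof -
  have "(\<forall>j\<in>{1..n} - {i, Suc i}. x j = y j) \<longleftrightarrow> (\<forall>j\<in>{1..n} - {i, Suc i}. y j = x j)" by metis
  then show ?thesis unfolding R_u by (simp only: conj_left_commute)
qed

definition upd2 :: "(nat \<Rightarrow> bool) \<Rightarrow> nat \<Rightarrow> bool \<Rightarrow> nat \<Rightarrow> bool" where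
  "upd2 x i c = x(i := c, Suc i := c)"

lemma upd2_simps [simp]: "upd2 x i c i = c" "upd2 x i c (Suc i) = c"
  "j \<noteq> i \<Longrightarrow> j \<noteq> Suc i \<Longrightarrow> upd2 x i c j = x j"
  by (simp_all add: upd2_def)

lemma upd2_Col: "1 \<le> i \<Longrightarrow> i < n \<Longrightarrow> x \<in> Col n \<Longrightarrow> upd2 x i c \<in> Col n"
  by (auto simp: Col_def upd2_def PiE_def extensional_def)

text \<open>A row of the matrix of a generator has at most two nonzero entries, which differ in the
  common colour of the pair. This makes the Temperley-Lieb relations finite case checks on a few
  colours.\<close>

lemma sum_R_u:
  assumes i: "1 \<le> i" "i < n" and x: "x \<in> Col n"
  shows "(\<Sum>m\<in>Col n. R (udiag n i) x m * g m) = (if x i = x (Suc i) then g (upd2 x i True) + g (upd2 x i False) else 0)"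
proof (cases "x i = x (Suc i)")
  case True
  have R: "R (udiag n i) x m = of_bool (m = upd2 x i True \<or> m = upd2 x i False)" if m: "m \<in> Col n" for m
  proof -
    have "(m i = m (Suc i) \<and> (\<forall>j\<in>{1..n} - {i, Suc i}. x j = m j)) \<longleftrightarrow> m = upd2 x i (m i)"
    proof
      assume a: "m i = m (Suc i) \<and> (\<forall>j\<in>{1..n} - {i, Suc i}. x j = m j)"
      show "m = upd2 x i (m i)"
      proof (rule extensionalityI[of _ "{1..n}"])
        show "m \<in> extensional {1..n}" "upd2 x i (m i) \<in> extensional {1..n}"
          using m upd2_Col[OF i x] by (auto simp: Col_def PiE_def)
        fix j assume "j \<in> {1..n}"
        then show "m j = upd2 x i (m i) j" using a by (cases "j = i \<or> j = Suc i") auto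
      qed
    next
      assume a: "m = upd2 x i (m i)"
      have "m (Suc i) = m i" using arg_cong[OF a, of "\<lambda>f. f (Suc i)"] by simp
      moreover have "x j = m j" if "j \<in> {1..n} - {i, Suc i}" for j
        using arg_cong[OF a, of "\<lambda>f. f j"] that by simp
      ultimately show "m i = m (Suc i) \<and> (\<forall>j\<in>{1..n} - {i, Suc i}. x j = m j)" by simp
    qed
    moreover have "m = upd2 x i (m i) \<longleftrightarrow> m = upd2 x i True \<or> m = upd2 x i False"
    proof -
      have mi: "m i = c" if "m = upd2 x i c" for c using arg_cong[OF that, of "\<lambda>f. f i"] by simp
      show ?thesis by (metis (full_types) mi)
    qed
    ultimately show ?thesis using True by (simp add: R_u)
  qed
  have ne: "upd2 x i True \<noteq> upd2 x i False" by (metis upd2_simps(1))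
  have "(\<Sum>m\<in>Col n. R (udiag n i) x m * g m) = (\<Sum>m\<in>{upd2 x i True, upd2 x i False}. g m)"
    by (rule sum.mono_neutral_cong_right) (use upd2_Col[OF i x] R in auto)
  then show ?thesis using True ne by simp
next
  case False
  then show ?thesis by (simp add: R_u)
qed

lemma sum_R_u':
  assumes i: "1 \<le> i" "i < n" and y: "y \<in> Col n"
  shows "(\<Sum>m\<in>Col n. g m * R (udiag n i) m y) = (if y i = y (Suc i) then g (upd2 y i True) + g (upd2 y i False) else 0)"
  unfolding sum_R_u[OF assms, symmetric] by (intro sum.cong refl) (simp add: R_u_sym[of n i _ y] mult.commute)

lemma glue_id:
  assumes "D \<in> diagrams n"
  shows "loops n (id_diagram n) D = 0 \<and> glue (id_diagram n) D = D"
    and "loops n D (id_diagram n) = 0 \<and> glue D (id_diagram n) = D"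
proof -
  note d = diagram_strands[OF assms]
  have 1: "(\<Sum>m\<in>Col n. R (id_diagram n) x m * R D m y) = 2 ^ 0 * R D x y" if "x \<in> Col n" "y \<in> Col n" for x y
  proof -
    have "(\<Sum>m\<in>Col n. R (id_diagram n) x m * R D m y) = (\<Sum>m\<in>Col n. if m = x then R D x y else 0)"
      by (intro sum.cong refl) (auto simp: R_id that)
    then show ?thesis using that by simp
  qed
  have 2: "(\<Sum>m\<in>Col n. R D x m * R (id_diagram n) m y) = 2 ^ 0 * R D x y" if "x \<in> Col n" "y \<in> Col n" for x y
  proof -
    have "(\<Sum>m\<in>Col n. R D x m * R (id_diagram n) m y) = (\<Sum>m\<in>Col n. if m = y then R D x y else 0)"
      by (intro sum.cong refl) (auto simp: R_id that)
    then show ?thesis using that by simp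
  qed
  show "loops n (id_diagram n) D = 0 \<and> glue (id_diagram n) D = D"
    using glue_eqI[OF id_diagram assms d 1] by blast
  show "loops n D (id_diagram n) = 0 \<and> glue D (id_diagram n) = D"
    using glue_eqI[OF assms id_diagram d 2] by blast
qed

lemma R_u_upd2: "R (udiag n i) (upd2 x i c) y = of_bool (y i = y (Suc i) \<and> (\<forall>j\<in>{1..n} - {i, Suc i}. x j = y j))"
proof -
  have "(\<forall>j\<in>{1..n} - {i, Suc i}. upd2 x i c j = y j) \<longleftrightarrow> (\<forall>j\<in>{1..n} - {i, Suc i}. x j = y j)"
    by (rule ball_cong) simp_all
  then show ?thesis unfolding R_u upd2_simps(1,2) by simp
qed

lemma u_u_glue:
  assumes "1 \<le> i" and "i < n"
  shows "loops n (udiag n i) (udiag n i) = 1 \<and> glue (udiag n i) (udiag n i) = udiag n i"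
proof -
  note u = udiag_diagram[OF assms]
  have key: "(\<Sum>m\<in>Col n. R (udiag n i) x m * R (udiag n i) m y) = 2 ^ 1 * R (udiag n i) x y" if "x \<in> Col n" "y \<in> Col n" for x y
    unfolding sum_R_u[OF assms that(1)] R_u_upd2 unfolding R_u
    by (cases "\<forall>j\<in>{1..n} - {i, Suc i}. x j = y j") (simp_all only: if_True if_False simp_thms, simp_all)
  show ?thesis using glue_eqI[OF u u diagram_strands[OF u] key] by blast
qed

lemma triple_glue:
  assumes D: "D1 \<in> diagrams n" "D2 \<in> diagrams n" "D3 \<in> diagrams n" "D \<in> diagrams n"
    and eq: "\<And>x y. x \<in> Col n \<Longrightarrow> y \<in> Col n \<Longrightarrow>
      (\<Sum>m\<in>Col n. R D1 x m * (\<Sum>m'\<in>Col n. R D2 m m' * R D3 m' y)) = R D x y"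
  shows "loops n D2 D3 = 0 \<and> loops n D1 (glue D2 D3) = 0 \<and> glue D1 (glue D2 D3) = D"
proof -
  note g = glue_diagram[OF D(2,3)]
  have "loops n D2 D3 + loops n D1 (glue D2 D3) = 0 \<and> glue D1 (glue D2 D3) = D"
  proof (rule R_inj_diagrams[OF glue_diagram[OF D(1) g] D(4)])
    fix x y assume "x \<in> Col n" "y \<in> Col n"
    then have "R D x y = (\<Sum>m\<in>Col n. R D1 x m * (2 ^ loops n D2 D3 * R (glue D2 D3) m y))"
      using eq unfolding R_mult[OF D(2,3)] by simp
    also have "\<dots> = 2 ^ loops n D2 D3 * (\<Sum>m\<in>Col n. R D1 x m * R (glue D2 D3) m y)"
      unfolding sum_distrib_left by (intro sum.cong refl) (simp only: mult.left_commute)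
    also have "\<dots> = 2 ^ (loops n D2 D3 + loops n D1 (glue D2 D3)) * R (glue D1 (glue D2 D3)) x y"
      unfolding R_mult[OF D(1) g] by (simp add: power_add)
    finally show "2 ^ (loops n D2 D3 + loops n D1 (glue D2 D3)) * R (glue D1 (glue D2 D3)) x y = 2 ^ 0 * R D x y"
      by simp
  qed
  then show ?thesis by simp
qed

lemma u_up_glue:
  assumes "1 \<le> i" and "Suc i < n"
  shows "loops n (udiag n (Suc i)) (udiag n i) = 0 \<and> loops n (udiag n i) (glue (udiag n (Suc i)) (udiag n i)) = 0
    \<and> glue (udiag n i) (glue (udiag n (Suc i)) (udiag n i)) = udiag n i"
proof -
  have i: "i < n" "1 \<le> Suc i" using assms by auto
  have "(\<Sum>m\<in>Col n. R (udiag n i) x m * (\<Sum>m'\<in>Col n. R (udiag n (Suc i)) m m' * R (udiag n i) m' y)) = R (udiag n i) x y"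
    if x: "x \<in> Col n" and y: "y \<in> Col n" for x y
  proof -
    define P where "P \<longleftrightarrow> (\<forall>j\<in>{1..n} - {i, Suc i, Suc (Suc i)}. x j = y j)"
    have A: "(\<forall>j\<in>{1..n} - {i, Suc i}. upd2 (upd2 x i c) (Suc i) d j = y j) \<longleftrightarrow>
        d = y (Suc (Suc i)) \<and> (\<forall>j\<in>{1..n} - {i, Suc i, Suc (Suc i)}. x j = y j)" for c d
    proof
      assume a: "\<forall>j\<in>{1..n} - {i, Suc i}. upd2 (upd2 x i c) (Suc i) d j = y j"
      have "Suc (Suc i) \<in> {1..n} - {i, Suc i}" using assms by simp
      from bspec[OF a this] have "d = y (Suc (Suc i))" by simp
      moreover have "x j = y j" if "j \<in> {1..n} - {i, Suc i, Suc (Suc i)}" for j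
        using bspec[OF a, of j] that by simp
      ultimately show "d = y (Suc (Suc i)) \<and> (\<forall>j\<in>{1..n} - {i, Suc i, Suc (Suc i)}. x j = y j)" by blast
    next
      assume a: "d = y (Suc (Suc i)) \<and> (\<forall>j\<in>{1..n} - {i, Suc i, Suc (Suc i)}. x j = y j)"
      show "\<forall>j\<in>{1..n} - {i, Suc i}. upd2 (upd2 x i c) (Suc i) d j = y j"
      proof
        fix j assume j: "j \<in> {1..n} - {i, Suc i}"
        then show "upd2 (upd2 x i c) (Suc i) d j = y j" using a by (cases "j = Suc (Suc i)") auto
      qed
    qed
    have B: "(\<forall>j\<in>{1..n} - {i, Suc i}. x j = y j) \<longleftrightarrow> x (Suc (Suc i)) = y (Suc (Suc i)) \<and> (\<forall>j\<in>{1..n} - {i, Suc i, Suc (Suc i)}. x j = y j)"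
    proof -
      have "{1..n} - {i, Suc i} = insert (Suc (Suc i)) ({1..n} - {i, Suc i, Suc (Suc i)})" using assms by auto
      then show ?thesis by (simp only: ball_simps)
    qed
    have C: "upd2 (upd2 x i c) (Suc i) d i = c" "upd2 x i c (Suc (Suc i)) = x (Suc (Suc i))" for c d by simp_all
    show ?thesis
      unfolding sum_R_u[OF assms(1) i(1) x]
      unfolding sum_R_u[OF i(2) assms(2) upd2_Col[OF assms(1) i(1) x]]
      unfolding R_u A B C upd2_simps(1,2)
      unfolding P_def[symmetric]
      by (cases P; cases "x i"; cases "x (Suc i)"; cases "x (Suc (Suc i))";
        cases "y i"; cases "y (Suc i)"; cases "y (Suc (Suc i))") simp_all
  qed
  then show ?thesis by (rule triple_glue[OF udiag_diagram udiag_diagram udiag_diagram udiag_diagram, rotated 8]) (use assms in auto)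
qed

lemma u_down_glue:
  assumes "1 \<le> i" and "Suc i < n"
  shows "loops n (udiag n i) (udiag n (Suc i)) = 0 \<and> loops n (udiag n (Suc i)) (glue (udiag n i) (udiag n (Suc i))) = 0
    \<and> glue (udiag n (Suc i)) (glue (udiag n i) (udiag n (Suc i))) = udiag n (Suc i)"
proof -
  have i: "i < n" "1 \<le> Suc i" using assms by auto
  have "(\<Sum>m\<in>Col n. R (udiag n (Suc i)) x m * (\<Sum>m'\<in>Col n. R (udiag n i) m m' * R (udiag n (Suc i)) m' y)) = R (udiag n (Suc i)) x y"
    if x: "x \<in> Col n" and y: "y \<in> Col n" for x y
  proof -
    define P where "P \<longleftrightarrow> (\<forall>j\<in>{1..n} - {i, Suc i, Suc (Suc i)}. x j = y j)"
    have A: "(\<forall>j\<in>{1..n} - {Suc i, Suc (Suc i)}. upd2 (upd2 x (Suc i) c) i d j = y j) \<longleftrightarrow>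
        d = y i \<and> (\<forall>j\<in>{1..n} - {i, Suc i, Suc (Suc i)}. x j = y j)" for c d
    proof
      assume a: "\<forall>j\<in>{1..n} - {Suc i, Suc (Suc i)}. upd2 (upd2 x (Suc i) c) i d j = y j"
      have "i \<in> {1..n} - {Suc i, Suc (Suc i)}" using assms by simp
      from bspec[OF a this] have "d = y i" by simp
      moreover have "x j = y j" if "j \<in> {1..n} - {i, Suc i, Suc (Suc i)}" for j
        using bspec[OF a, of j] that by simp
      ultimately show "d = y i \<and> (\<forall>j\<in>{1..n} - {i, Suc i, Suc (Suc i)}. x j = y j)" by blast
    next
      assume a: "d = y i \<and> (\<forall>j\<in>{1..n} - {i, Suc i, Suc (Suc i)}. x j = y j)"
      show "\<forall>j\<in>{1..n} - {Suc i, Suc (Suc i)}. upd2 (upd2 x (Suc i) c) i d j = y j"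
      proof
        fix j assume j: "j \<in> {1..n} - {Suc i, Suc (Suc i)}"
        then show "upd2 (upd2 x (Suc i) c) i d j = y j" using a by (cases "j = i") auto
      qed
    qed
    have B: "(\<forall>j\<in>{1..n} - {Suc i, Suc (Suc i)}. x j = y j) \<longleftrightarrow> x i = y i \<and> (\<forall>j\<in>{1..n} - {i, Suc i, Suc (Suc i)}. x j = y j)"
    proof -
      have "{1..n} - {Suc i, Suc (Suc i)} = insert i ({1..n} - {i, Suc i, Suc (Suc i)})" using assms by auto
      then show ?thesis by (simp only: ball_simps)
    qed
    have C: "upd2 (upd2 x (Suc i) c) i d (Suc (Suc i)) = c" "upd2 x (Suc i) c i = x i" for c d by simp_all
    show ?thesis
      unfolding sum_R_u[OF i(2) assms(2) x]
      unfolding sum_R_u[OF assms(1) i(1) upd2_Col[OF i(2) assms(2) x]]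
      unfolding R_u A B C upd2_simps(1,2)
      unfolding P_def[symmetric]
      by (cases P; cases "x i"; cases "x (Suc i)"; cases "x (Suc (Suc i))";
        cases "y i"; cases "y (Suc i)"; cases "y (Suc (Suc i))") simp_all
  qed
  then show ?thesis by (rule triple_glue[OF udiag_diagram udiag_diagram udiag_diagram udiag_diagram, rotated 8]) (use assms in auto)
qed

lemma u_comm_glue:
  assumes "1 \<le> i" and "Suc i < j" and "j < n"
  shows "loops n (udiag n i) (udiag n j) = loops n (udiag n j) (udiag n i)
    \<and> glue (udiag n i) (udiag n j) = glue (udiag n j) (udiag n i)"
proof -
  have b: "i < n" "1 \<le> j" "1 \<le> i" "j < n" using assms by auto
  note u = udiag_diagram[OF b(3,1)] udiag_diagram[OF b(2,4)]
  define P where "P x y \<longleftrightarrow> (\<forall>k\<in>{1..n} - {i, Suc i, j, Suc j}. x k = y k)" for x y :: "nat \<Rightarrow> bool"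
  define Q where "Q x y \<longleftrightarrow> x i = x (Suc i) \<and> y i = y (Suc i) \<and> x j = x (Suc j) \<and> y j = y (Suc j)
    \<and> (\<forall>k\<in>{1..n} - {i, Suc i, j, Suc j}. x k = y k)" for x y :: "nat \<Rightarrow> bool"
  have key: "R (udiag n b) (upd2 x a c) y = of_bool (x b = x (Suc b) \<and> y b = y (Suc b) \<and> y a = c \<and> y (Suc a) = c
      \<and> (\<forall>k\<in>{1..n} - {a, Suc a, b, Suc b}. x k = y k))"
    if "1 \<le> a" "a < n" "b \<noteq> a" "b \<noteq> Suc a" "Suc b \<noteq> a" for a b c x y
  proof -
    have "(\<forall>k\<in>{1..n} - {b, Suc b}. upd2 x a c k = y k) \<longleftrightarrow> y a = c \<and> y (Suc a) = c \<and> (\<forall>k\<in>{1..n} - {a, Suc a, b, Suc b}. x k = y k)"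
    proof
      assume h: "\<forall>k\<in>{1..n} - {b, Suc b}. upd2 x a c k = y k"
      have "a \<in> {1..n} - {b, Suc b}" "Suc a \<in> {1..n} - {b, Suc b}" using that by auto
      then have "y a = c" "y (Suc a) = c" using h by (metis upd2_simps(1), metis upd2_simps(2))
      moreover have "x k = y k" if "k \<in> {1..n} - {a, Suc a, b, Suc b}" for k using bspec[OF h, of k] that by simp
      ultimately show "y a = c \<and> y (Suc a) = c \<and> (\<forall>k\<in>{1..n} - {a, Suc a, b, Suc b}. x k = y k)" by blast
    next
      assume h: "y a = c \<and> y (Suc a) = c \<and> (\<forall>k\<in>{1..n} - {a, Suc a, b, Suc b}. x k = y k)"
      show "\<forall>k\<in>{1..n} - {b, Suc b}. upd2 x a c k = y k"
      proof
        fix k assume k: "k \<in> {1..n} - {b, Suc b}"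
        then show "upd2 x a c k = y k" using h by (cases "k = a"; cases "k = Suc a") auto
      qed
    qed
    moreover have "upd2 x a c b = x b" "upd2 x a c (Suc b) = x (Suc b)" using that by simp_all
    ultimately show ?thesis by (simp add: R_u)
  qed
  have set_eq: "{1..n} - {j, Suc j, i, Suc i} = {1..n} - {i, Suc i, j, Suc j}" by blast
  have ij: "j \<noteq> i" "j \<noteq> Suc i" "Suc j \<noteq> i" "i \<noteq> j" "i \<noteq> Suc j" "Suc i \<noteq> j" using assms by auto
  have 1: "(\<Sum>m\<in>Col n. R (udiag n i) x m * R (udiag n j) m y) = of_bool (Q x y)" if "x \<in> Col n" for x y
    unfolding sum_R_u[OF b(3,1) that] unfolding key[OF b(3,1) ij(1-3)] Q_def
    unfolding P_def[symmetric]
    by (cases "P x y"; cases "x i"; cases "x (Suc i)"; cases "x j"; cases "x (Suc j)";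
        cases "y i"; cases "y (Suc i)"; cases "y j"; cases "y (Suc j)") simp_all
  have 2: "(\<Sum>m\<in>Col n. R (udiag n j) x m * R (udiag n i) m y) = of_bool (Q x y)" if "x \<in> Col n" for x y
    unfolding sum_R_u[OF b(2,4) that] unfolding key[OF b(2,4) ij(4-6)] Q_def set_eq
    unfolding P_def[symmetric]
    by (cases "P x y"; cases "x i"; cases "x (Suc i)"; cases "x j"; cases "x (Suc j)";
        cases "y i"; cases "y (Suc i)"; cases "y j"; cases "y (Suc j)") simp_all
  show ?thesis
  proof (rule R_inj_diagrams[OF glue_diagram[OF u] glue_diagram[OF u(2,1)]])
    fix x y assume "x \<in> Col n" "y \<in> Col n"
    then show "2 ^ loops n (udiag n i) (udiag n j) * R (glue (udiag n i) (udiag n j)) x y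
      = 2 ^ loops n (udiag n j) (udiag n i) * R (glue (udiag n j) (udiag n i)) x y"
      unfolding R_mult[OF u, symmetric] R_mult[OF u(2,1), symmetric] using 1 2 by simp
  qed
qed

section \<open>Standard tableaux as paths\<close>

primrec word :: "tableau \<Rightarrow> nat \<Rightarrow> bool list" where
  "word t 0 = []"
| "word t (Suc m) = (snd (t (Suc m)) = 1) # word t m"

text \<open>The inverse of \<open>word\<close>: the row of an entry is the number of steps of its
  kind up to and including it. The restriction matches the extensionality in
  \<open>Std\<close>.\<close>

definition tab :: "bool list \<Rightarrow> tableau" where
  "tab p = (\<lambda>i\<in>{1..length p}. let q = drop (length p - i) p in
     (count_list q (hd q), if hd q then 1 else 2))"

lemma tab_step: "tab (xs @ b # ys) (Suc (length ys)) = (Suc (count_list ys b), if b then 1 else 2)"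
  by (simp add: tab_def)

lemma length_word [simp]: "length (word t m) = m"
  by (induction m) simp_all

lemma word_tab': "word (tab (xs @ ys)) (length ys) = ys"
proof (induction ys arbitrary: xs)
  case (Cons b ys)
  have "word (tab ((xs @ [b]) @ ys)) (length ys) = ys" by (rule Cons.IH)
  then show ?case using tab_step[of xs b ys] by simp
qed simp

lemma word_tab: "p \<in> Paths n \<Longrightarrow> word (tab p) n = p"
  using word_tab'[of "[]" p] by (simp add: Paths_def)

lemma inj_tab: "inj_on tab (Paths n)"
  by (rule inj_on_inverseI[of _ "\<lambda>t. word t n"]) (rule word_tab)

lemma content_tab: "content (tab (xs @ b # ys)) (Suc (length ys)) = step_content b ys"
  by (simp add: content_def tab_step step_content_def)

lemma word_split: "m \<le> n \<Longrightarrow> \<exists>xs. word t n = xs @ word t m"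
proof (induction n)
  case (Suc n)
  show ?case
  proof (cases "m = Suc n")
    case False
    then obtain xs where "word t n = xs @ word t m" using Suc by auto
    then have "word t (Suc n) = ((snd (t (Suc n)) = 1) # xs) @ word t m" by simp
    then show ?thesis by blast
  qed simp
qed simp

lemma split_path:
  assumes "length p = n" and "i \<in> {1..n}"
  obtains xs b ys where "p = xs @ b # ys" and "i = Suc (length ys)"
proof -
  have "length (drop (n - i) p) = Suc (i - 1)" using assms by auto
  then obtain b ys where d: "drop (n - i) p = b # ys" "length ys = i - 1" by (metis length_Suc_conv)
  have "p = take (n - i) p @ b # ys" unfolding d(1)[symmetric] by simp
  moreover have "i = Suc (length ys)" using d(2) assms(2) by simp
  ultimately show ?thesis by (rule that)
qed

definition boxes :: "nat \<Rightarrow> nat \<Rightarrow> (nat \<times> nat) set" where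
  "boxes a b = {1..a} \<times> {1} \<union> {1..b} \<times> {2}"

lemma tab_Cons: "i \<in> {1..length p} \<Longrightarrow> tab (b # p) i = tab p i"
  by (auto simp: tab_def Suc_diff_le)

lemma tab_image: "tab p ` {1..length p} = boxes (count_list p True) (count_list p False)"
proof (induction p)
  case Nil
  then show ?case by (simp add: boxes_def)
next
  case (Cons b p)
  have "{1..length (b # p)} = insert (Suc (length p)) {1..length p}" by auto
  then have "tab (b # p) ` {1..length (b # p)} = insert (tab ([] @ b # p) (Suc (length p))) (tab (b # p) ` {1..length p})"
    by simp
  also have "tab (b # p) ` {1..length p} = tab p ` {1..length p}" by (rule image_cong[OF refl]) (rule tab_Cons)
  also have "\<dots> = boxes (count_list p True) (count_list p False)" by (rule Cons.IH)
  also have "insert (tab ([] @ b # p) (Suc (length p))) \<dots> = boxes (count_list (b # p) True) (count_list (b # p) False)"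
    unfolding tab_step by (cases b) (auto simp: boxes_def atLeastAtMostSuc_conv)
  finally show ?case .
qed

lemma count_True_False: "count_list p True + count_list p False = length p"
  by (induction p) auto

lemma tab_bij: "bij_betw (tab p) {1..length p} (boxes (count_list p True) (count_list p False))"
  unfolding bij_betw_def
proof
  have "card (boxes (count_list p True) (count_list p False)) = length p"
    unfolding boxes_def by (subst card_Un_disjoint) (auto simp: card_cartesian_product count_True_False)
  then show "inj_on (tab p) {1..length p}"
    unfolding tab_image[symmetric] by (intro eq_card_imp_inj_on) simp_all
qed (rule tab_image)

definition two_columns :: "nat \<Rightarrow> nat \<Rightarrow> shape" where
  "two_columns a b = (\<lambda>r. of_bool (r \<in> {1..a}) + of_bool (r \<in> {1..b}))"

lemma young_two_columns: "b \<le> a \<Longrightarrow> young_diagram (two_columns a b) = boxes a b"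
proof (rule Set.set_eqI)
  fix z :: "nat \<times> nat" assume ba: "b \<le> a"
  obtain r c where z: "z = (r, c)" by (cases z)
  show "z \<in> young_diagram (two_columns a b) \<longleftrightarrow> z \<in> boxes a b"
    using ba unfolding z by (auto simp: young_diagram_def two_columns_def boxes_def split: if_splits)
qed

lemma two_columns_Par2: "b \<le> a \<Longrightarrow> two_columns a b \<in> Par2 (a + b)"
proof -
  assume ba: "b \<le> a"
  have s: "{r. two_columns a b r \<noteq> 0} = {1..a}" using ba by (auto simp: two_columns_def)
  have "(\<Sum>r\<in>{1..a}. two_columns a b r) = (\<Sum>r\<in>{1..a}. of_bool (r \<in> {1..a})) + (\<Sum>r\<in>{1..a}. of_bool (r \<in> {1..b}))"
    unfolding two_columns_def by (rule sum.distrib)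
  also have "(\<Sum>r\<in>{1..a}. of_bool (r \<in> {1..a})) = (\<Sum>r\<in>{1..a}. 1::nat)" by (rule sum.cong) auto
  also have "(\<Sum>r\<in>{1..a}. of_bool (r \<in> {1..b})) = (\<Sum>r\<in>{1..b}. 1::nat)"
    by (rule sum.mono_neutral_cong_right) (use ba in auto)
  finally have "(\<Sum>r\<in>{1..a}. two_columns a b r) = a + b" by simp
  then show ?thesis unfolding Par2_def s using s by (auto simp: two_columns_def)
qed

lemma count_le: "valid p \<Longrightarrow> count_list p False \<le> count_list p True"
  using ht_nonneg[of p] ht_count[of p] by linarith

text \<open>Columns increase because counts of steps grow. A second-column entry comes after the
  first-column entry of its row, since the number of down steps never exceeds that of up
  steps.\<close>

lemma tab_Std:
  assumes p: "p \<in> Paths n"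
  shows "tab p \<in> Std n (two_columns (count_list p True) (count_list p False))"
proof -
  have l: "length p = n" and v: "valid p" using p by (simp_all add: Paths_def)
  have ext: "tab p \<in> extensional {1..n}" by (simp add: tab_def l)
  have mono: "count_list ys b \<le> count_list (zs @ ys) b" for ys zs :: "bool list" and b by simp
  have cmp: "\<exists>zs. q' = zs @ q" if h: "p = xs @ q" "p = xs' @ q'" "length q \<le> length q'" for xs q xs' q'
  proof -
    obtain us where "xs = xs' @ us \<and> us @ q = q' \<or> xs @ us = xs' \<and> q = us @ q'"
      using h(1,2) append_eq_append_conv2[of xs q xs' q'] by auto
    then show ?thesis using h(3) by auto
  qed
  have c1: "i < j" if i: "i \<in> {1..n}" and j: "j \<in> {1..n}" and eq: "snd (tab p i) = snd (tab p j)" and lt: "fst (tab p i) < fst (tab p j)" for i j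
  proof (rule ccontr)
    assume "\<not> i < j"
    obtain xs b ys where 1: "p = xs @ b # ys" "i = Suc (length ys)" using split_path[OF l i] by blast
    obtain xs' c zs where 2: "p = xs' @ c # zs" "j = Suc (length zs)" using split_path[OF l j] by blast
    have t: "tab p i = (Suc (count_list ys b), if b then 1 else 2)" "tab p j = (Suc (count_list zs c), if c then 1 else 2)"
      using tab_step 1 2 by metis+
    have bc: "b = c" using eq unfolding t by (simp split: if_splits)
    have "length (c # zs) \<le> length (b # ys)" using \<open>\<not> i < j\<close> 1 2 by simp
    then obtain ws where "b # ys = ws @ c # zs" using cmp[OF 2(1) 1(1)] by blast
    then have "count_list (c # zs) b \<le> count_list (b # ys) b" using mono[of "c # zs" b ws] by metis
    then show False using lt unfolding t using bc by simp
  qed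
  have c2: "i < j" if i: "i \<in> {1..n}" and j: "j \<in> {1..n}" and eq: "fst (tab p i) = fst (tab p j)" and lt: "snd (tab p i) < snd (tab p j)" for i j
  proof (rule ccontr)
    assume nij: "\<not> i < j"
    obtain xs b ys where 1: "p = xs @ b # ys" "i = Suc (length ys)" using split_path[OF l i] by blast
    obtain xs' c zs where 2: "p = xs' @ c # zs" "j = Suc (length zs)" using split_path[OF l j] by blast
    have t: "tab p i = (Suc (count_list ys b), if b then 1 else 2)" "tab p j = (Suc (count_list zs c), if c then 1 else 2)"
      using tab_step 1 2 by metis+
    have bc: "b" "\<not> c" using lt unfolding t by (simp_all split: if_splits)
    have "i \<noteq> j" using lt by auto
    then have "length (c # zs) \<le> length ys" using nij 1 2 by simp
    moreover have "p = (xs @ [b]) @ ys" using 1(1) by simp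
    ultimately obtain ws where w: "ys = ws @ c # zs" using cmp[OF 2(1)] by blast
    have "valid (c # zs)" using v 2(1) valid_appendD by blast
    then have "count_list (c # zs) False \<le> count_list (c # zs) True" by (rule count_le)
    also have "\<dots> \<le> count_list ys True" unfolding w by (rule mono)
    finally show False using eq bc unfolding t by simp
  qed
  show ?thesis unfolding Std_def young_two_columns[OF count_le[OF v]]
    using ext tab_bij[of p] l c1 c2 by blast
qed

lemma tab_StdPar2: "p \<in> Paths n \<Longrightarrow> tab p \<in> StdPar2 n"
proof -
  assume p: "p \<in> Paths n"
  have "count_list p False \<le> count_list p True" using p count_le by (simp add: Paths_def)
  moreover have "count_list p True + count_list p False = n" using count_True_False[of p] p by (simp add: Paths_def)
  ultimately have "two_columns (count_list p True) (count_list p False) \<in> Par2 n"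
    using two_columns_Par2[of "count_list p False" "count_list p True"] by simp
  then show ?thesis unfolding StdPar2_def using tab_Std[OF p] by blast
qed

lemma count_word: "count_list (word t m) b = card {j \<in> {1..m}. (snd (t j) = 1) = b}"
proof (induction m)
  case (Suc m)
  have "{j \<in> {1..Suc m}. (snd (t j) = 1) = b} = (if (snd (t (Suc m)) = 1) = b then insert (Suc m) {j \<in> {1..m}. (snd (t j) = 1) = b}
      else {j \<in> {1..m}. (snd (t j) = 1) = b})" by (auto simp: le_Suc_eq)
  then show ?case using Suc by simp
qed simp

section \<open>From standard tableaux back to paths\<close>

context
  fixes n :: nat and \<mu> :: shape and t :: tableau
  assumes mu: "\<mu> \<in> Par2 n" and t: "t \<in> Std n \<mu>"
begin

lemma Std_bij: "bij_betw t {1..n} (young_diagram \<mu>)"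
  using t by (simp add: Std_def)

lemma Std_row: "i \<in> {1..n} \<Longrightarrow> j \<in> {1..n} \<Longrightarrow> fst (t i) = fst (t j) \<Longrightarrow> snd (t i) < snd (t j) \<Longrightarrow> i < j"
  using t unfolding Std_def by blast

lemma Std_col: "i \<in> {1..n} \<Longrightarrow> j \<in> {1..n} \<Longrightarrow> snd (t i) = snd (t j) \<Longrightarrow> fst (t i) < fst (t j) \<Longrightarrow> i < j"
  using t unfolding Std_def by blast

lemma mu_mono: "r \<le> r' \<Longrightarrow> 1 \<le> r \<Longrightarrow> \<mu> r' \<le> \<mu> r"
proof (induction r' rule: dec_induct)
  case (step k)
  then have "\<mu> (Suc k) \<le> \<mu> k" using mu by (simp add: Par2_def)
  then show ?case using step by simp
qed simp

lemma Std_box: "i \<in> {1..n} \<Longrightarrow> 1 \<le> fst (t i) \<and> 1 \<le> snd (t i) \<and> snd (t i) \<le> \<mu> (fst (t i))"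
  using bij_betwE[OF Std_bij] by (fastforce simp: young_diagram_def)

lemma Std_snd: "i \<in> {1..n} \<Longrightarrow> snd (t i) = 1 \<or> snd (t i) = 2"
proof -
  assume "i \<in> {1..n}"
  moreover have "\<mu> (fst (t i)) \<le> 2" using mu by (simp add: Par2_def)
  ultimately show ?thesis using Std_box[of i] by linarith
qed

lemma Std_onto: "1 \<le> r \<Longrightarrow> 1 \<le> c \<Longrightarrow> c \<le> \<mu> r \<Longrightarrow> \<exists>j\<in>{1..n}. t j = (r, c)"
proof -
  assume "1 \<le> r" "1 \<le> c" "c \<le> \<mu> r"
  then have "(r, c) \<in> t ` {1..n}" using Std_bij unfolding bij_betw_def by (simp add: young_diagram_def)
  then show ?thesis by force
qed

text \<open>A column is filled without gaps from the top: the boxes above an entry belong to the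
  shape and hold exactly the smaller entries of that column.\<close>

lemma Std_fst:
  assumes i: "i \<in> {1..n}"
  shows "fst (t i) = card {j \<in> {1..i}. snd (t j) = snd (t i)}"
proof -
  let ?S = "{j \<in> {1..i}. snd (t j) = snd (t i)}"
  have Sn: "j \<in> {1..n}" if "j \<in> ?S" for j using that i by auto
  have inj: "inj_on (\<lambda>j. fst (t j)) ?S"
  proof (rule inj_onI)
    fix a b assume ab: "a \<in> ?S" "b \<in> ?S" "fst (t a) = fst (t b)"
    then have "t a = t b" by (simp add: prod_eq_iff)
    then show "a = b" using inj_onD[OF bij_betw_imp_inj_on[OF Std_bij]] Sn[OF ab(1)] Sn[OF ab(2)] by blast
  qed
  have "(\<lambda>j. fst (t j)) ` ?S = {1..fst (t i)}"
  proof
    show "(\<lambda>j. fst (t j)) ` ?S \<subseteq> {1..fst (t i)}"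
    proof
      fix r assume "r \<in> (\<lambda>j. fst (t j)) ` ?S"
      then obtain j where j: "j \<in> ?S" "r = fst (t j)" by blast
      have "\<not> fst (t i) < fst (t j)" using Std_col[OF i Sn[OF j(1)]] j(1) by auto
      then show "r \<in> {1..fst (t i)}" using Std_box[OF Sn[OF j(1)]] j(2) by simp
    qed
    show "{1..fst (t i)} \<subseteq> (\<lambda>j. fst (t j)) ` ?S"
    proof
      fix r assume r: "r \<in> {1..fst (t i)}"
      then have "snd (t i) \<le> \<mu> r" using Std_box[OF i] mu_mono[of r "fst (t i)"] by simp
      then obtain j where j: "j \<in> {1..n}" "t j = (r, snd (t i))" using Std_onto[of r "snd (t i)"] r Std_box[OF i] by auto
      have "j \<le> i"
      proof (cases "r = fst (t i)")
        case True
        then have "t j = t i" using j by simp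
        then have "j = i" using inj_onD[OF bij_betw_imp_inj_on[OF Std_bij]] i j(1) by blast
        then show ?thesis by simp
      next
        case False
        then show ?thesis using Std_col[OF j(1) i] j(2) r by simp
      qed
      then have "j \<in> ?S" using j by simp
      moreover have "r = fst (t j)" using j(2) by simp
      ultimately show "r \<in> (\<lambda>j. fst (t j)) ` ?S" by (rule rev_image_eqI)
    qed
  qed
  then have "card {1..fst (t i)} = card ?S" using card_image[OF inj] by metis
  then show ?thesis by simp
qed

lemma Std_fst_count: "i \<in> {1..n} \<Longrightarrow> fst (t i) = count_list (word t i) (snd (t i) = 1)"
proof -
  assume i: "i \<in> {1..n}"
  have eq: "{j \<in> {1..i}. (snd (t j) = 1) = (snd (t i) = 1)} = {j \<in> {1..i}. snd (t j) = snd (t i)}"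
  proof (rule Collect_cong, rule conj_cong[OF refl])
    fix j assume "j \<in> {1..i}"
    then have "j \<in> {1..n}" using i by auto
    then show "((snd (t j) = 1) = (snd (t i) = 1)) = (snd (t j) = snd (t i))" using Std_snd[of j] Std_snd[OF i] by auto
  qed
  show ?thesis unfolding count_word eq by (rule Std_fst[OF i])
qed

lemma Std_tab: "tab (word t n) = t"
proof (rule extensionalityI[of _ "{1..n}"])
  show "tab (word t n) \<in> extensional {1..n}" by (simp add: tab_def)
  show "t \<in> extensional {1..n}" using t by (simp add: Std_def)
  fix i assume i: "i \<in> {1..n}"
  obtain k where k: "i = Suc k" using i by (cases i) auto
  obtain xs where "word t n = xs @ word t i" using word_split[of i n t] i by auto
  then have w: "word t n = xs @ (snd (t i) = 1) # word t k" by (simp add: k)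
  have "tab (word t n) i = (Suc (count_list (word t k) (snd (t i) = 1)), if snd (t i) = 1 then 1 else 2)"
    unfolding w using tab_step[of xs "snd (t i) = 1" "word t k"] by (simp add: k)
  moreover have "count_list (word t i) (snd (t i) = 1) = Suc (count_list (word t k) (snd (t i) = 1))" by (simp add: k)
  ultimately show "tab (word t n) i = t i"
    using Std_fst_count[OF i] Std_snd[OF i] by (auto simp: prod_eq_iff)
qed

text \<open>An entry of the second column has a smaller left neighbour, so its row number is at most
  the number of first-column entries before it.\<close>

lemma Std_valid: "m \<le> n \<Longrightarrow> valid (word t m)"
proof (induction m)
  case (Suc m)
  then have v: "valid (word t m)" and i: "Suc m \<in> {1..n}" by auto
  show ?case
  proof (cases "snd (t (Suc m)) = 1")
    case True
    then show ?thesis using v by simp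
  next
    case False
    then have two: "snd (t (Suc m)) = 2" using Std_snd[OF i] by blast
    let ?r = "fst (t (Suc m))"
    obtain j where j: "j \<in> {1..n}" "t j = (?r, 1)" using Std_onto[of ?r 1] Std_box[OF i] by auto
    have jm: "j < Suc m" using Std_row[OF j(1) i] j(2) two by simp
    have "?r = count_list (word t j) True" using Std_fst_count[OF j(1)] j(2) by simp
    also have "\<dots> \<le> count_list (word t m) True"
      using word_split[of j m t] jm by auto
    finally have "count_list (word t (Suc m)) False \<le> count_list (word t (Suc m)) True"
      using Std_fst_count[OF i] two by simp
    then have "0 \<le> ht (word t (Suc m))" using ht_count[of "word t (Suc m)"] by linarith
    then show ?thesis using v by simp
  qed
qed simp

lemma Std_Paths: "word t n \<in> Paths n"
  using Std_valid[of n] by (simp add: Paths_def)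

lemma Std_count: "count_list (word t n) True = card {r. (r, 1) \<in> young_diagram \<mu>}"
proof -
  have "bij_betw (\<lambda>j. fst (t j)) {j \<in> {1..n}. snd (t j) = 1} {r. (r, 1) \<in> young_diagram \<mu>}"
    unfolding bij_betw_def
  proof
    show "inj_on (\<lambda>j. fst (t j)) {j \<in> {1..n}. snd (t j) = 1}"
    proof (rule inj_onI)
      fix a b assume ab: "a \<in> {j \<in> {1..n}. snd (t j) = 1}" "b \<in> {j \<in> {1..n}. snd (t j) = 1}" "fst (t a) = fst (t b)"
      then have "t a = t b" by (simp add: prod_eq_iff)
      then show "a = b" using inj_onD[OF bij_betw_imp_inj_on[OF Std_bij]] ab by blast
    qed
    show "(\<lambda>j. fst (t j)) ` {j \<in> {1..n}. snd (t j) = 1} = {r. (r, 1) \<in> young_diagram \<mu>}"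
    proof
      show "(\<lambda>j. fst (t j)) ` {j \<in> {1..n}. snd (t j) = 1} \<subseteq> {r. (r, 1) \<in> young_diagram \<mu>}"
      proof
        fix r assume "r \<in> (\<lambda>j. fst (t j)) ` {j \<in> {1..n}. snd (t j) = 1}"
        then obtain j where "j \<in> {1..n}" "snd (t j) = 1" "r = fst (t j)" by blast
        then show "r \<in> {r. (r, 1) \<in> young_diagram \<mu>}" using Std_box[of j] by (simp add: young_diagram_def)
      qed
      show "{r. (r, 1) \<in> young_diagram \<mu>} \<subseteq> (\<lambda>j. fst (t j)) ` {j \<in> {1..n}. snd (t j) = 1}"
      proof
        fix r assume "r \<in> {r. (r, 1) \<in> young_diagram \<mu>}"
        then obtain j where "j \<in> {1..n}" "t j = (r, 1)" using Std_onto[of r 1] by (auto simp: young_diagram_def)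
        then show "r \<in> (\<lambda>j. fst (t j)) ` {j \<in> {1..n}. snd (t j) = 1}" by (intro rev_image_eqI[of j]) simp_all
      qed
    qed
  qed
  then have "card {j \<in> {1..n}. snd (t j) = 1} = card {r. (r, 1) \<in> young_diagram \<mu>}" by (rule bij_betw_same_card)
  then show ?thesis using count_word[of t n True] by simp
qed

end

lemma Std_pr:
  assumes "\<mu> \<in> Par2 n" and "s \<in> Std n \<mu>" and "t \<in> Std n \<mu>"
  shows "pr n (word s n) (word t n)"
proof -
  have "count_list (word s n) True = count_list (word t n) True"
    using Std_count[OF assms(1,2)] Std_count[OF assms(1,3)] by simp
  moreover have "count_list (word s n) True + count_list (word s n) False = n"
    "count_list (word t n) True + count_list (word t n) False = n"
    using count_True_False[of "word s n"] count_True_False[of "word t n"] by simp_all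
  ultimately have "ht (word s n) = ht (word t n)"
    using ht_count[of "word s n"] ht_count[of "word t n"] by linarith
  then show ?thesis using Std_Paths[OF assms(1,2)] Std_Paths[OF assms(1,3)] by (simp add: pr_def)
qed

lemma StdPar2_tab:
  assumes "t \<in> StdPar2 n"
  shows "tab (word t n) = t" and "word t n \<in> Paths n"
  using assms Std_tab Std_Paths unfolding StdPar2_def by blast+

lemma StdPar2_eq: "StdPar2 n = tab ` Paths n"
proof
  show "StdPar2 n \<subseteq> tab ` Paths n"
  proof
    fix t assume "t \<in> StdPar2 n"
    from StdPar2_tab[OF this] show "t \<in> tab ` Paths n" by (intro image_eqI[of _ _ "word t n"]) simp_all
  qed
  show "tab ` Paths n \<subseteq> StdPar2 n" using tab_StdPar2 by blast
qed

section \<open>Exchanging adjacent entries\<close>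

lemma tab_at: "i \<in> {1..length p} \<Longrightarrow> drop (length p - i) p = q \<Longrightarrow> tab p i = (count_list q (hd q), if hd q then 1 else 2)"
  unfolding tab_def Let_def by simp

lemma tab_upper: "c \<noteq> b \<Longrightarrow> i \<in> {1..length (xs @ c # b # ys)} \<Longrightarrow> i \<noteq> Suc (length ys) \<Longrightarrow> i \<noteq> Suc (Suc (length ys)) \<Longrightarrow>
   tab (xs @ c # b # ys) i = tab (xs @ b # c # ys) i"
proof -
  assume cb: "c \<noteq> b" and i: "i \<in> {1..length (xs @ c # b # ys)}" "i \<noteq> Suc (length ys)" "i \<noteq> Suc (Suc (length ys))"
  let ?p = "xs @ c # b # ys" and ?q = "xs @ b # c # ys"
  consider "i \<le> length ys" | "i > Suc (Suc (length ys))" using i by linarith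
  then show "tab ?p i = tab ?q i"
  proof cases
    case 1
    have "drop (length ?p - i) ?p = drop (length ys - i) ys"
      "drop (length ?q - i) ?q = drop (length ys - i) ys"
      using 1 by (simp_all add: Suc_diff_le)
    moreover have "i \<in> {1..length ?q}" using i(1) by simp
    ultimately show ?thesis using tab_at[OF i(1)] tab_at[of i ?q] by simp
  next
    case 2
    define d where "d = length ?p - i"
    have d: "d < length xs" using 2 i by (simp add: d_def)
    have 3: "drop (length ?p - i) ?p = drop d xs @ c # b # ys"
      unfolding d_def[symmetric] using d by simp
    have 4: "drop (length ?q - i) ?q = drop d xs @ b # c # ys"
    proof -
      have "length ?q - i = d" by (simp add: d_def)
      then show ?thesis using d by (simp only:) simp
    qed
    have "i \<in> {1..length ?q}" using i(1) by simp
    moreover have "drop d xs \<noteq> []" using d by simp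
    ultimately show ?thesis unfolding tab_at[OF i(1) 3] by (simp add: tab_at[OF _ 4])
  qed
qed

lemma swap_tab_tab:
  assumes "c \<noteq> b"
  shows "swap_tab (Suc (length ys)) (tab (xs @ c # b # ys)) = tab (xs @ b # c # ys)"
proof
  fix i
  let ?k = "Suc (length ys)" and ?p = "xs @ c # b # ys" and ?q = "xs @ b # c # ys"
  have k0: "tab ?p ?k = (Suc (count_list ys b), if b then 1 else 2)" using tab_step[of "xs @ [c]" b ys] by simp
  have k1: "tab ?p (Suc ?k) = (Suc (count_list ys c), if c then 1 else 2)" using tab_step[of xs c "b # ys"] assms by simp
  have q0: "tab ?q ?k = (Suc (count_list ys c), if c then 1 else 2)" using tab_step[of "xs @ [b]" c ys] by simp
  have q1: "tab ?q (Suc ?k) = (Suc (count_list ys b), if b then 1 else 2)" using tab_step[of xs b "c # ys"] assms by simp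
  consider "i = ?k" | "i = Suc ?k" | "i \<noteq> ?k" "i \<noteq> Suc ?k" by blast
  then show "swap_tab ?k (tab ?p) i = tab ?q i"
  proof cases
    case 1
    then show ?thesis using k1 q0 by (simp add: swap_tab_def)
  next
    case 2
    then show ?thesis using k0 q1 by (simp add: swap_tab_def)
  next
    case 3
    then have "swap_tab ?k (tab ?p) i = tab ?p i" by (simp add: swap_tab_def)
    also have "\<dots> = tab ?q i"
    proof (cases "i \<in> {1..length ?p}")
      case True
      then show ?thesis using tab_upper[OF assms True] 3 by simp
    next
      case False
      then show ?thesis by (auto simp: tab_def)
    qed
    finally show ?thesis .
  qed
qed

lemma swap_same_not_StdPar2:
  assumes "xs @ b # b # ys \<in> Paths n"
  shows "swap_tab (Suc (length ys)) (tab (xs @ b # b # ys)) \<notin> StdPar2 n"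
proof
  let ?k = "Suc (length ys)" and ?p = "xs @ b # b # ys"
  assume a: "swap_tab ?k (tab ?p) \<in> StdPar2 n"
  then obtain \<mu> where mu: "\<mu> \<in> Par2 n" "swap_tab ?k (tab ?p) \<in> Std n \<mu>" by (auto simp: StdPar2_def)
  have k0: "tab ?p ?k = (Suc (count_list ys b), if b then 1 else 2)" using tab_step[of "xs @ [b]" b ys] by simp
  have k1: "tab ?p (Suc ?k) = (Suc (Suc (count_list ys b)), if b then 1 else 2)" using tab_step[of xs b "b # ys"] by simp
  have "swap_tab ?k (tab ?p) ?k = tab ?p (Suc ?k)" "swap_tab ?k (tab ?p) (Suc ?k) = tab ?p ?k"
    by (simp_all add: swap_tab_def)
  moreover have "?k \<in> {1..n}" "Suc ?k \<in> {1..n}" using assms by (auto simp: Paths_def)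
  ultimately have "Suc ?k < ?k" using Std_col[OF mu, of "Suc ?k" ?k] k0 k1 by simp
  then show False by simp
qed

lemma tab_not_StdPar2: "length p = n \<Longrightarrow> \<not> valid p \<Longrightarrow> tab p \<notin> StdPar2 n"
  using StdPar2_tab(2)[of "tab p" n] word_tab'[of "[]" p] by (auto simp: Paths_def)

lemma sum_shape: "(\<Sum>r=1..k. shape_upto t m r) = (\<Sum>i\<in>{1..m}. of_bool (fst (t i) \<in> {1..k}))"
proof -
  have "(\<Sum>r=1..k. shape_upto t m r) = (\<Sum>r=1..k. \<Sum>i\<in>{1..m}. of_bool (fst (t i) = r))"
    unfolding shape_upto_def by (intro sum.cong refl) (simp add: Int_def)
  also have "\<dots> = (\<Sum>i\<in>{1..m}. \<Sum>r=1..k. of_bool (fst (t i) = r))" by (rule sum.swap)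
  also have "\<dots> = (\<Sum>i\<in>{1..m}. of_bool (fst (t i) \<in> {1..k}))"
  proof (rule sum.cong[OF refl])
    fix i
    have "(\<Sum>r=1..k. of_bool (fst (t i) = r) :: nat) = (\<Sum>r=1..k. if fst (t i) = r then 1 else 0)" by (intro sum.cong) auto
    then show "(\<Sum>r=1..k. of_bool (fst (t i) = r)) = (of_bool (fst (t i) \<in> {1..k}) :: nat)" by (simp add: sum.delta')
  qed
  finally show ?thesis .
qed

text \<open>The truncated shapes agree except at \<open>m = ?k\<close>. There the peak has placed
  its entry at the bottom of the first column, the valley in a strictly higher row of the
  second.\<close>

lemma tab_less_raise:
  assumes p: "xs @ True # False # ys \<in> Paths n"
  shows "tab_less n (tab (xs @ False # True # ys)) (tab (xs @ True # False # ys))"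
    and "\<not> tab_less n (tab (xs @ True # False # ys)) (tab (xs @ False # True # ys))"
proof -
  let ?p = "xs @ True # False # ys" and ?q = "xs @ False # True # ys" and ?k = "Suc (length ys)"
  have n: "n = length xs + Suc ?k" using p by (auto simp: Paths_def)
  have "valid (False # ys)" using p valid_appendD[of "xs @ [True]" "False # ys"] by (simp add: Paths_def)
  then have cnt: "count_list ys False < count_list ys True" using count_le[of "False # ys"] by simp
  have p0: "tab ?p ?k = (Suc (count_list ys False), 2)" using tab_step[of "xs @ [True]" False ys] by simp
  have q0: "tab ?q ?k = (Suc (count_list ys True), 1)" using tab_step[of "xs @ [False]" True ys] by simp
  have same: "tab ?q i = tab ?p i" if "i \<in> {1..n}" "i \<noteq> ?k" "i \<noteq> Suc ?k" for i
    using tab_upper[of False True i xs ys] that by (simp add: n)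
  have sw: "tab ?q = tab ?p \<circ> Transposition.transpose ?k (Suc ?k)"
    using swap_tab_tab[of True False ys xs] by (simp add: swap_tab_def)
  define S where "S t m j = (\<Sum>i\<in>{1..m}. of_bool (fst (t i) \<in> {1..j}) :: nat)" for t :: tableau and m j
  have eqS: "S (tab ?q) m j = S (tab ?p) m j" if m: "m \<in> {1..n}" "m \<noteq> ?k" for m j
  proof (cases "m < ?k")
    case True
    then show ?thesis unfolding S_def using same m by (intro sum.cong refl) auto
  next
    case False
    then have "Transposition.transpose ?k (Suc ?k) ` {1..m} = {1..m}" using m by (intro transpose_image_eq) auto
    then have "bij_betw (Transposition.transpose ?k (Suc ?k)) {1..m} {1..m}"
      by (simp add: bij_betw_def inj_on_subset[OF inj_transpose])
    then show ?thesis unfolding S_def sw comp_def by (rule sum.reindex_bij_betw)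
  qed
  have Sk: "S t ?k j = S t (length ys) j + of_bool (fst (t ?k) \<in> {1..j})" for t j
    by (simp add: S_def)
  have Sl: "S (tab ?q) (length ys) j = S (tab ?p) (length ys) j" for j
    unfolding S_def using same n by (intro sum.cong refl) auto
  have le: "S (tab ?q) m j \<le> S (tab ?p) m j" if "m \<in> {1..n}" for m j
  proof (cases "m = ?k")
    case True
    then show ?thesis unfolding True Sk Sl p0 q0 using cnt by auto
  qed (use eqS[OF that] in simp)
  \<comment> \<open>The rows up to this one contain the new box of the valley but not that of the
    peak.\<close>
  have lt: "S (tab ?q) ?k (Suc (count_list ys False)) < S (tab ?p) ?k (Suc (count_list ys False))"
    unfolding Sk Sl p0 q0 using cnt by simp
  have tab_le: "tab_le n s t \<longleftrightarrow> (\<forall>m\<in>{1..n}. \<forall>j. S s m j \<le> S t m j)" for s t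
    unfolding tab_le_def dominated_by_def sum_shape S_def ..
  have "tab ?p \<noteq> tab ?q" using lt by auto
  then show "tab_less n (tab ?q) (tab ?p)" unfolding tab_less_def tab_le using le by metis
  have "?k \<in> {1..n}" using n by simp
  then show "\<not> tab_less n (tab ?p) (tab ?q)" unfolding tab_less_def tab_le using lt by (meson not_less)
qed

lemma axial_dist_tab: "axial_dist (tab (xs @ c # b # ys)) (Suc (length ys)) = (if c = b then 1 else axial b (ht ys))"
proof -
  have "content (tab (xs @ c # b # ys)) (Suc (length ys)) = step_content b ys"
    using content_tab[of "xs @ [c]" b ys] by simp
  moreover have "content (tab (xs @ c # b # ys)) (Suc (Suc (length ys))) = step_content c (b # ys)"
    using content_tab[of xs c "b # ys"] by simp
  ultimately show ?thesis unfolding axial_dist_def using ht_count[of ys] by (cases b; cases c) (simp_all add: step_content_def axial_def)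
qed

lemma klr_beta_tab:
  assumes p: "xs @ (\<not> b) # b # ys \<in> Paths n"
  shows "klr_beta p n (Suc (length ys)) (tab (xs @ (\<not> b) # b # ys)) =
    (if valid (xs @ b # (\<not> b) # ys) then swap_coeff p b (ht ys) else 0)"
proof -
  let ?q = "xs @ b # (\<not> b) # ys"
  have sw: "swap_tab (Suc (length ys)) (tab (xs @ (\<not> b) # b # ys)) = tab ?q" by (rule swap_tab_tab) simp
  have r: "axial_dist (tab (xs @ (\<not> b) # b # ys)) (Suc (length ys)) = axial b (ht ys)" by (simp add: axial_dist_tab)
  show ?thesis
  proof (cases "valid ?q")
    case True
    then have q: "?q \<in> Paths n" using p by (simp add: Paths_def)
    have std: "tab ?q \<in> StdPar2 n" using tab_StdPar2[OF q] .
    have "klr_alpha n (Suc (length ys)) (tab (xs @ (\<not> b) # b # ys)) =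
        (if b then ((of_int (axial b (ht ys)))\<^sup>2 - 1) / (of_int (axial b (ht ys)))\<^sup>2 else 1)"
      unfolding klr_alpha_def sw r Let_def using tab_less_raise[of xs ys n] p q by (cases b) auto
    then show ?thesis unfolding klr_beta_def sw r Let_def swap_coeff_def using True std by simp
  next
    case False
    then have "tab ?q \<notin> StdPar2 n" using tab_not_StdPar2[of ?q n] p by (simp add: Paths_def)
    then show ?thesis unfolding klr_beta_def sw Let_def using False by simp
  qed
qed

lemma klr_delta_tab: "klr_delta p (Suc (length ys)) (tab (xs @ (\<not> b) # b # ys))
    * (1 / of_int (axial_dist (tab (xs @ (\<not> b) # b # ys)) (Suc (length ys)))) = - stay_coeff p b (ht ys)"
  by (simp add: klr_delta_def axial_dist_tab stay_coeff_def)

section \<open>The diagram algebra as an algebra of operators\<close>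

lemma finite_diagrams [simp]: "finite (diagrams n)"
proof (rule finite_subset)
  show "diagrams n \<subseteq> Pow (Pow (points n))"
  proof
    fix D assume "D \<in> diagrams n"
    then show "D \<in> Pow (Pow (points n))" using diagram_strands by blast
  qed
  show "finite (Pow (Pow (points n)))" by (simp add: points_def)
qed

lemma TL_carrier: "x \<in> carrier (TLQ n) \<longleftrightarrow> (\<forall>D. D \<notin> diagrams n \<longrightarrow> x D = 0)"
  by (simp add: TL_def)

lemma TL_add: "x \<oplus>\<^bsub>TLQ n\<^esub> y = (\<lambda>D. x D + y D)"
  by (simp add: TL_def)

lemma TL_zero: "\<zero>\<^bsub>TLQ n\<^esub> = (\<lambda>D. 0)"
  by (simp add: TL_def)

lemma TL_smult: "c \<odot>\<^bsub>TLQ n\<^esub> x = (\<lambda>D. c * x D)"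
  by (simp add: TL_def)

lemma TL_one: "\<one>\<^bsub>TLQ n\<^esub> = diag_elem (id_diagram n)"
  by (simp add: TL_def)

lemma TL_mult: "(x \<otimes>\<^bsub>TLQ n\<^esub> y) D =
   (\<Sum>D1\<in>diagrams n. \<Sum>D2\<in>diagrams n. if glue D1 D2 = D then 2 ^ loops n D1 D2 * x D1 * y D2 else 0)"
proof -
  have "(x \<otimes>\<^bsub>TLQ n\<^esub> y) D = (\<Sum>z\<in>{z \<in> diagrams n \<times> diagrams n. glue (fst z) (snd z) = D}.
      2 ^ loops n (fst z) (snd z) * x (fst z) * y (snd z))"
  proof -
    have "{(D1, D2). (D1, D2) \<in> diagrams n \<times> diagrams n \<and> glue D1 D2 = D} = {z \<in> diagrams n \<times> diagrams n. glue (fst z) (snd z) = D}"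
      by auto
    then show ?thesis by (simp add: TL_def case_prod_beta)
  qed
  also have "\<dots> = (\<Sum>z\<in>diagrams n \<times> diagrams n. if glue (fst z) (snd z) = D then
      2 ^ loops n (fst z) (snd z) * x (fst z) * y (snd z) else 0)"
    by (rule sum.inter_filter) simp
  also have "\<dots> = (\<Sum>D1\<in>diagrams n. \<Sum>D2\<in>diagrams n. if glue D1 D2 = D then 2 ^ loops n D1 D2 * x D1 * y D2 else 0)"
    by (subst sum.cartesian_product) (simp add: case_prod_beta)
  finally show ?thesis .
qed

lemma TL_mult_closed: "x \<otimes>\<^bsub>TLQ n\<^esub> y \<in> carrier (TLQ n)"
  unfolding TL_carrier
proof (intro allI impI)
  fix D assume D: "D \<notin> diagrams n"
  have "glue D1 D2 \<noteq> D" if "D1 \<in> diagrams n" "D2 \<in> diagrams n" for D1 D2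
    using glue_diagram[OF that] D by auto
  then show "(x \<otimes>\<^bsub>TLQ n\<^esub> y) D = 0" unfolding TL_mult by (simp add: sum.neutral)
qed

text \<open>Pairing a product with an arbitrary function \<open>h\<close> removes the sum over the
  fibre of \<open>glue\<close>; in this form both bracketings of a triple product become the same
  triple sum.\<close>

lemma TL_mult_pairing: "(\<Sum>D\<in>diagrams n. h D * (x \<otimes>\<^bsub>TLQ n\<^esub> y) D) =
   (\<Sum>D1\<in>diagrams n. \<Sum>D2\<in>diagrams n. h (glue D1 D2) * (2 ^ loops n D1 D2 * x D1 * y D2))"
proof -
  have "(\<Sum>D\<in>diagrams n. h D * (x \<otimes>\<^bsub>TLQ n\<^esub> y) D) = (\<Sum>D\<in>diagrams n. \<Sum>D1\<in>diagrams n. \<Sum>D2\<in>diagrams n.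
      if D = glue D1 D2 then h (glue D1 D2) * (2 ^ loops n D1 D2 * x D1 * y D2) else 0)"
    unfolding TL_mult sum_distrib_left by (intro sum.cong refl) auto
  also have "\<dots> = (\<Sum>D1\<in>diagrams n. \<Sum>D\<in>diagrams n. \<Sum>D2\<in>diagrams n.
      if D = glue D1 D2 then h (glue D1 D2) * (2 ^ loops n D1 D2 * x D1 * y D2) else 0)"
    by (rule sum.swap)
  also have "\<dots> = (\<Sum>D1\<in>diagrams n. \<Sum>D2\<in>diagrams n. \<Sum>D\<in>diagrams n.
      if D = glue D1 D2 then h (glue D1 D2) * (2 ^ loops n D1 D2 * x D1 * y D2) else 0)"
    by (rule sum.cong[OF refl]) (rule sum.swap)
  also have "\<dots> = (\<Sum>D1\<in>diagrams n. \<Sum>D2\<in>diagrams n. h (glue D1 D2) * (2 ^ loops n D1 D2 * x D1 * y D2))"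
    by (intro sum.cong refl) (simp add: glue_diagram)
  finally show ?thesis .
qed

lemma TL_assoc: "(x \<otimes>\<^bsub>TLQ n\<^esub> y) \<otimes>\<^bsub>TLQ n\<^esub> z = x \<otimes>\<^bsub>TLQ n\<^esub> (y \<otimes>\<^bsub>TLQ n\<^esub> z)"
proof
  fix D
  let ?dg = "diagrams n"
  let ?t = "\<lambda>D1 D2 D3. if glue D1 (glue D2 D3) = D then
      2 ^ (loops n D2 D3 + loops n D1 (glue D2 D3)) * x D1 * y D2 * z D3 else 0"
  have "((x \<otimes>\<^bsub>TLQ n\<^esub> y) \<otimes>\<^bsub>TLQ n\<^esub> z) D =
     (\<Sum>E\<in>?dg. (\<Sum>D3\<in>?dg. if glue E D3 = D then 2 ^ loops n E D3 * z D3 else 0) * (x \<otimes>\<^bsub>TLQ n\<^esub> y) E)"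
    unfolding TL_mult[of n "x \<otimes>\<^bsub>TLQ n\<^esub> y"] sum_distrib_right by (intro sum.cong refl) simp
  also have "\<dots> = (\<Sum>D1\<in>?dg. \<Sum>D2\<in>?dg. (\<Sum>D3\<in>?dg. if glue (glue D1 D2) D3 = D then 2 ^ loops n (glue D1 D2) D3 * z D3 else 0)
      * (2 ^ loops n D1 D2 * x D1 * y D2))"
    by (rule TL_mult_pairing)
  also have "\<dots> = (\<Sum>D1\<in>?dg. \<Sum>D2\<in>?dg. \<Sum>D3\<in>?dg. ?t D1 D2 D3)"
    unfolding sum_distrib_right
  proof (intro sum.cong refl)
    fix D1 D2 D3 assume "D1 \<in> ?dg" "D2 \<in> ?dg" "D3 \<in> ?dg"
    note a = glue_assoc[OF this]
    have "(2::rat) ^ (loops n D2 D3 + loops n D1 (glue D2 D3)) = 2 ^ loops n D1 D2 * 2 ^ loops n (glue D1 D2) D3"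
      using a by (simp add: power_add[symmetric])
    then show "(if glue (glue D1 D2) D3 = D then 2 ^ loops n (glue D1 D2) D3 * z D3 else 0) * (2 ^ loops n D1 D2 * x D1 * y D2)
        = ?t D1 D2 D3" using a by (simp add: mult_ac)
  qed
  also have "\<dots> = (\<Sum>D1\<in>?dg. \<Sum>F\<in>?dg. (if glue D1 F = D then 2 ^ loops n D1 F * x D1 else 0) * (y \<otimes>\<^bsub>TLQ n\<^esub> z) F)"
  proof (rule sum.cong[OF refl])
    fix D1 assume D1: "D1 \<in> ?dg"
    show "(\<Sum>D2\<in>?dg. \<Sum>D3\<in>?dg. ?t D1 D2 D3) = (\<Sum>F\<in>?dg. (if glue D1 F = D then 2 ^ loops n D1 F * x D1 else 0) * (y \<otimes>\<^bsub>TLQ n\<^esub> z) F)"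
      unfolding TL_mult_pairing by (intro sum.cong refl) (simp add: power_add mult_ac)
  qed
  also have "\<dots> = (x \<otimes>\<^bsub>TLQ n\<^esub> (y \<otimes>\<^bsub>TLQ n\<^esub> z)) D"
    unfolding TL_mult[of n x] by (intro sum.cong refl) simp
  finally show "((x \<otimes>\<^bsub>TLQ n\<^esub> y) \<otimes>\<^bsub>TLQ n\<^esub> z) D = (x \<otimes>\<^bsub>TLQ n\<^esub> (y \<otimes>\<^bsub>TLQ n\<^esub> z)) D" .
qed

lemma diag_elem_mult:
  assumes "D1 \<in> diagrams n" and "D2 \<in> diagrams n"
  shows "diag_elem D1 \<otimes>\<^bsub>TLQ n\<^esub> diag_elem D2 = (\<lambda>D. 2 ^ loops n D1 D2 * diag_elem (glue D1 D2) D)"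
proof
  fix D
  have "(diag_elem D1 \<otimes>\<^bsub>TLQ n\<^esub> diag_elem D2) D = (\<Sum>E1\<in>diagrams n. if E1 = D1 then (\<Sum>E2\<in>diagrams n.
     if E2 = D2 then (if glue D1 D2 = D then 2 ^ loops n D1 D2 else 0) else 0) else 0)"
    unfolding TL_mult
  proof (rule sum.cong[OF refl])
    fix E1
    show "(\<Sum>E2\<in>diagrams n. if glue E1 E2 = D then 2 ^ loops n E1 E2 * diag_elem D1 E1 * diag_elem D2 E2 else 0)
      = (if E1 = D1 then (\<Sum>E2\<in>diagrams n. if E2 = D2 then (if glue D1 D2 = D then (2::rat) ^ loops n D1 D2 else 0) else 0) else 0)"
    proof (cases "E1 = D1")
      case True
      show ?thesis unfolding True by (simp only: simp_thms if_True) (intro sum.cong refl, auto simp: diag_elem_def)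
    next
      case False
      then have z: "diag_elem D1 E1 = (0::rat)" by (simp add: diag_elem_def)
      show ?thesis unfolding z if_not_P[OF False] by (intro sum.neutral ballI) simp
    qed
  qed
  then show "(diag_elem D1 \<otimes>\<^bsub>TLQ n\<^esub> diag_elem D2) D = 2 ^ loops n D1 D2 * diag_elem (glue D1 D2) D"
    using assms by (auto simp: diag_elem_def)
qed

lemma diag_elem_carrier: "D \<in> diagrams n \<Longrightarrow> diag_elem D \<in> carrier (TLQ n)"
  by (auto simp: TL_carrier diag_elem_def)

lemma TL_r_one: "x \<in> carrier (TLQ n) \<Longrightarrow> x \<otimes>\<^bsub>TLQ n\<^esub> \<one>\<^bsub>TLQ n\<^esub> = x"
proof
  fix D assume x: "x \<in> carrier (TLQ n)"
  have "(x \<otimes>\<^bsub>TLQ n\<^esub> \<one>\<^bsub>TLQ n\<^esub>) D = (\<Sum>D1\<in>diagrams n. if D1 = D then x D else 0)"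
    unfolding TL_mult TL_one
  proof (rule sum.cong[OF refl])
    fix D1 assume D1: "D1 \<in> diagrams n"
    have "(\<Sum>D2\<in>diagrams n. if glue D1 D2 = D then 2 ^ loops n D1 D2 * x D1 * diag_elem (id_diagram n) D2 else 0)
       = (\<Sum>D2\<in>diagrams n. if D2 = id_diagram n then (if D1 = D then x D else 0) else 0)"
      by (intro sum.cong refl) (use glue_id(2)[OF D1] in \<open>auto simp: diag_elem_def\<close>)
    then show "(\<Sum>D2\<in>diagrams n. if glue D1 D2 = D then 2 ^ loops n D1 D2 * x D1 * diag_elem (id_diagram n) D2 else 0)
       = (if D1 = D then x D else 0)" by (simp add: id_diagram)
  qed
  then show "(x \<otimes>\<^bsub>TLQ n\<^esub> \<one>\<^bsub>TLQ n\<^esub>) D = x D" using x by (auto simp: TL_carrier)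
qed

text \<open>Operators act on all functions, not only on those supported on diagrams of one size, so
  a single type serves every \<open>n\<close>. Unlike a record with a carrier it can be an instance
  of \<open>rat_algebra\<close>.\<close>

typedef lop = "{f :: (diagram \<Rightarrow> rat) \<Rightarrow> diagram \<Rightarrow> rat.
   (\<forall>x y. f (\<lambda>D. x D + y D) = (\<lambda>D. f x D + f y D)) \<and> (\<forall>c x. f (\<lambda>D. c * x D) = (\<lambda>D. c * f x D))}"
  by (rule exI[of _ "\<lambda>x. x"]) simp

setup_lifting type_definition_lop

instantiation lop :: rat_algebra
begin

lift_definition zero_lop :: lop is "\<lambda>x D. 0" by simp
lift_definition plus_lop :: "lop \<Rightarrow> lop \<Rightarrow> lop" is "\<lambda>f g x D. f x D + g x D" by (auto simp: algebra_simps)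
lift_definition minus_lop :: "lop \<Rightarrow> lop \<Rightarrow> lop" is "\<lambda>f g x D. f x D - g x D" by (auto simp: algebra_simps)
lift_definition uminus_lop :: "lop \<Rightarrow> lop" is "\<lambda>f x D. - f x D" by auto
lift_definition times_lop :: "lop \<Rightarrow> lop \<Rightarrow> lop" is "\<lambda>f g x. f (g x)" by auto
lift_definition scl_lop :: "rat \<Rightarrow> lop \<Rightarrow> lop" is "\<lambda>c f x D. c * f x D" by (auto simp: algebra_simps)

instance
  by standard (transfer; auto simp: algebra_simps)+

end

lift_definition Lam :: "nat \<Rightarrow> (diagram \<Rightarrow> rat) \<Rightarrow> lop" is "\<lambda>n x y. x \<otimes>\<^bsub>TLQ n\<^esub> y"
proof (intro conjI allI)
  fix n x y z
  show "x \<otimes>\<^bsub>TLQ n\<^esub> (\<lambda>D. y D + z D) = (\<lambda>D. (x \<otimes>\<^bsub>TLQ n\<^esub> y) D + (x \<otimes>\<^bsub>TLQ n\<^esub> z) D)"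
    unfolding TL_mult sum.distrib[symmetric] by (intro ext sum.cong refl) (simp add: algebra_simps)
next
  fix n x c y
  show "x \<otimes>\<^bsub>TLQ n\<^esub> (\<lambda>D. c * y D) = (\<lambda>D. c * (x \<otimes>\<^bsub>TLQ n\<^esub> y) D)"
    unfolding TL_mult sum_distrib_left by (intro ext sum.cong refl) simp
qed

lemma Lam_mult: "Lam n (x \<otimes>\<^bsub>TLQ n\<^esub> y) = Lam n x * Lam n y"
  by transfer (intro ext, simp add: TL_assoc)

lemma Lam_add: "Lam n (\<lambda>D. x D + y D) = Lam n x + Lam n y"
proof transfer
  fix n x y
  show "(\<lambda>z. (\<lambda>D. x D + y D) \<otimes>\<^bsub>TLQ n\<^esub> z) = (\<lambda>z D. (x \<otimes>\<^bsub>TLQ n\<^esub> z) D + (y \<otimes>\<^bsub>TLQ n\<^esub> z) D)"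
  proof (intro ext)
    fix z D
    show "((\<lambda>D. x D + y D) \<otimes>\<^bsub>TLQ n\<^esub> z) D = (x \<otimes>\<^bsub>TLQ n\<^esub> z) D + (y \<otimes>\<^bsub>TLQ n\<^esub> z) D"
      unfolding TL_mult sum.distrib[symmetric] by (intro sum.cong refl) (simp add: algebra_simps)
  qed
qed

lemma Lam_scl: "Lam n (\<lambda>D. c * x D) = c *\<^sub>Q Lam n x"
proof transfer
  fix n c x
  show "(\<lambda>z. (\<lambda>D. c * x D) \<otimes>\<^bsub>TLQ n\<^esub> z) = (\<lambda>z D. c * (x \<otimes>\<^bsub>TLQ n\<^esub> z) D)"
    by (intro ext, unfold TL_mult sum_distrib_left) (intro sum.cong refl, simp)
qed

text \<open>Evaluating the operator at the unit recovers the element.\<close>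

lemma Lam_inj: "x \<in> carrier (TLQ n) \<Longrightarrow> y \<in> carrier (TLQ n) \<Longrightarrow> Lam n x = Lam n y \<Longrightarrow> x = y"
  by (metis Lam.rep_eq TL_r_one)

text \<open>The projection onto functions supported on diagrams of size \<open>n\<close>, in general
  not the identity operator.\<close>

definition unit_op :: "nat \<Rightarrow> lop" where
  "unit_op n = Lam n \<one>\<^bsub>TLQ n\<^esub>"

lemma TL_abelian_group: "abelian_group (TLQ n)"
proof (rule abelian_groupI)
  fix x assume x: "x \<in> carrier (TLQ n)"
  show "\<exists>y\<in>carrier (TLQ n). y \<oplus>\<^bsub>TLQ n\<^esub> x = \<zero>\<^bsub>TLQ n\<^esub>"
    by (rule bexI[of _ "\<lambda>D. - x D"]) (use x in \<open>auto simp: TL_add TL_zero TL_carrier\<close>)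
qed (auto simp: TL_add TL_zero TL_carrier add.assoc add.commute)

lemma TL_minus:
  assumes "y \<in> carrier (TLQ n)"
  shows "x \<ominus>\<^bsub>TLQ n\<^esub> y = (\<lambda>D. x D - y D)"
proof -
  interpret abelian_group "TLQ n" by (rule TL_abelian_group)
  have "\<ominus>\<^bsub>TLQ n\<^esub> y = (\<lambda>D. - y D)"
    by (rule minus_equality) (use assms in \<open>auto simp: TL_add TL_zero TL_carrier\<close>)
  then show ?thesis by (simp add: a_minus_def TL_add)
qed

lemma Lam_minus: "y \<in> carrier (TLQ n) \<Longrightarrow> Lam n (x \<ominus>\<^bsub>TLQ n\<^esub> y) = Lam n x - Lam n y"
  using Lam_add[of n x "\<lambda>D. (-1) * y D"] Lam_scl[of n "-1" y] by (simp add: TL_minus scl_minus_left)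

lemma TL_minus_closed: "x \<in> carrier (TLQ n) \<Longrightarrow> y \<in> carrier (TLQ n) \<Longrightarrow> x \<ominus>\<^bsub>TLQ n\<^esub> y \<in> carrier (TLQ n)"
  by (auto simp: TL_minus TL_carrier)

lemma TL_smult_closed: "x \<in> carrier (TLQ n) \<Longrightarrow> c \<odot>\<^bsub>TLQ n\<^esub> x \<in> carrier (TLQ n)"
  by (auto simp: TL_smult TL_carrier)

lemma TL_add_closed: "x \<in> carrier (TLQ n) \<Longrightarrow> y \<in> carrier (TLQ n) \<Longrightarrow> x \<oplus>\<^bsub>TLQ n\<^esub> y \<in> carrier (TLQ n)"
  by (auto simp: TL_add TL_carrier)

lemma Lam_smult: "Lam n (c \<odot>\<^bsub>TLQ n\<^esub> x) = c *\<^sub>Q Lam n x"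
  by (simp add: TL_smult Lam_scl)

lemma Lam_plus: "Lam n (x \<oplus>\<^bsub>TLQ n\<^esub> y) = Lam n x + Lam n y"
  by (simp add: TL_add Lam_add)

lemma Lam_zero: "Lam n \<zero>\<^bsub>TLQ n\<^esub> = 0"
  using Lam_scl[of n 0 "\<lambda>D. 0"] by (simp add: TL_zero)

lemma TL_zero_closed: "\<zero>\<^bsub>TLQ n\<^esub> \<in> carrier (TLQ n)"
  by (simp add: TL_zero TL_carrier)

lemma Lam_finsum:
  assumes "finite A" and "\<And>a. a \<in> A \<Longrightarrow> f a \<in> carrier (TLQ n)"
  shows "finsum (TLQ n) f A \<in> carrier (TLQ n) \<and> Lam n (finsum (TLQ n) f A) = (\<Sum>a\<in>A. Lam n (f a))"
  using assms
proof (induction A rule: finite_induct)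
  case empty
  interpret abelian_group "TLQ n" by (rule TL_abelian_group)
  show ?case using Lam_zero by simp
next
  case (insert a A)
  interpret abelian_group "TLQ n" by (rule TL_abelian_group)
  have "finsum (TLQ n) f (insert a A) = f a \<oplus>\<^bsub>TLQ n\<^esub> finsum (TLQ n) f A"
    by (rule finsum_insert) (use insert in auto)
  then show ?case using insert by (simp add: Lam_plus TL_add_closed)
qed

lemma TL_one_closed: "\<one>\<^bsub>TLQ n\<^esub> \<in> carrier (TLQ n)"
  unfolding TL_one by (rule diag_elem_carrier) (rule id_diagram)

lemma Lam_list_prod: "Lam n (list_prod (TLQ n) xs) = foldr (\<lambda>x y. Lam n x * y) xs (unit_op n)"
  by (induction xs) (simp_all add: list_prod_def unit_op_def Lam_mult)

lemma list_prod_closed: "list_prod (TLQ n) xs \<in> carrier (TLQ n)"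
  by (cases xs) (simp_all add: list_prod_def TL_one_closed TL_mult_closed)

lemma unit_op_right: "x \<in> carrier (TLQ n) \<Longrightarrow> Lam n x * unit_op n = Lam n x"
  unfolding unit_op_def Lam_mult[symmetric] by (simp add: TL_r_one)

definition uop :: "nat \<Rightarrow> nat \<Rightarrow> lop" where
  "uop n k = Lam n (tl_u n k)"

lemma Lam_diag_mult:
  assumes "D1 \<in> diagrams n" and "D2 \<in> diagrams n"
  shows "Lam n (diag_elem D1) * Lam n (diag_elem D2) = 2 ^ loops n D1 D2 *\<^sub>Q Lam n (diag_elem (glue D1 D2))"
  unfolding Lam_mult[symmetric] diag_elem_mult[OF assms] Lam_scl ..

lemma unit_op_left:
  assumes "D \<in> diagrams n"
  shows "unit_op n * Lam n (diag_elem D) = Lam n (diag_elem D)"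
  unfolding unit_op_def TL_one using Lam_diag_mult[OF id_diagram assms] glue_id(1)[OF assms] by simp

lemma tl_relations_uop: "tl_relations n (uop n) (unit_op n)"
proof
  show "unit_op n * unit_op n = unit_op n"
    using unit_op_right[OF TL_one_closed] by (simp add: unit_op_def)
next
  fix k assume "1 \<le> k" "k < n"
  note u = udiag_diagram[OF this]
  show "unit_op n * uop n k = uop n k" unfolding uop_def tl_u_eq by (rule unit_op_left[OF u])
  show "uop n k * unit_op n = uop n k" unfolding uop_def tl_u_eq by (rule unit_op_right[OF diag_elem_carrier[OF u]])
  show "uop n k * uop n k = 2 *\<^sub>Q uop n k"
    unfolding uop_def tl_u_eq Lam_diag_mult[OF u u] using u_u_glue[OF \<open>1 \<le> k\<close> \<open>k < n\<close>] by simp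
next
  fix k assume k: "1 \<le> k" "Suc k < n"
  have u: "udiag n k \<in> diagrams n" "udiag n (Suc k) \<in> diagrams n" using k by (auto intro: udiag_diagram)
  show "uop n k * (uop n (Suc k) * uop n k) = uop n k"
    unfolding uop_def tl_u_eq Lam_diag_mult[OF u(2,1)] scl_mult_right Lam_diag_mult[OF u(1) glue_diagram[OF u(2,1)]]
    using u_up_glue[OF k] by simp
  show "uop n (Suc k) * (uop n k * uop n (Suc k)) = uop n (Suc k)"
    unfolding uop_def tl_u_eq Lam_diag_mult[OF u] scl_mult_right Lam_diag_mult[OF u(2) glue_diagram[OF u]]
    using u_down_glue[OF k] by simp
next
  fix k l assume kl: "1 \<le> k" "Suc k < l" "l < n"
  have u: "udiag n k \<in> diagrams n" "udiag n l \<in> diagrams n" using kl by (auto intro: udiag_diagram)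
  show "uop n k * uop n l = uop n l * uop n k"
    unfolding uop_def tl_u_eq Lam_diag_mult[OF u] Lam_diag_mult[OF u(2,1)] using u_comm_glue[OF kl] by simp
qed

section \<open>Half diagrams as a stack machine\<close>

text \<open>A half-diagram as an automaton reading a colouring: an up step pushes the colour of its
  point, a down step pops and demands equality, as its arc to the nearest vacant line does.
  \<open>None\<close> means a violated arc or an empty stack; the final stack lists the colours of
  the through lines from right to left.\<close>

fun run :: "bool list \<Rightarrow> (nat \<Rightarrow> bool) \<Rightarrow> bool list option" where
  "run [] x = Some []"
| "run (b # p) x = (case run p x of None \<Rightarrow> None | Some st \<Rightarrow>
     if b then Some (x (Suc (length p)) # st)
     else (case st of [] \<Rightarrow> None | c # st' \<Rightarrow> if x (Suc (length p)) = c then Some st' else None))"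

lemma run_cong: "(\<And>i. 1 \<le> i \<Longrightarrow> i \<le> length p \<Longrightarrow> x i = y i) \<Longrightarrow> run p x = run p y"
  by (induction p) (simp_all split: option.split list.split)

lemma run_upper:
  assumes "run p x = run q y" and "length p = length q"
    and "\<And>i. length p < i \<Longrightarrow> i \<le> length xs + length p \<Longrightarrow> x i = y i"
  shows "run (xs @ p) x = run (xs @ q) y"
  using assms
proof (induction xs)
  case (Cons b xs)
  have IH: "run (xs @ p) x = run (xs @ q) y" by (rule Cons.IH) (use Cons.prems in auto)
  have "x (Suc (length xs + length p)) = y (Suc (length xs + length p))" by (rule Cons.prems(3)) auto
  then show ?case using IH Cons.prems(2) by (simp split: option.split list.split)
qed simp

lemma run_replicate: "run (replicate j True @ p) x =
   (case run p x of None \<Rightarrow> None | Some st \<Rightarrow> Some (rev (map x [Suc (length p)..<Suc (length p + j)]) @ st))"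
  by (induction j) (auto simp: add.commute split: option.split)

lemma length_run: "run p x = Some st \<Longrightarrow> int (length st) = ht p"
  by (induction p arbitrary: st) (auto split: option.splits list.splits if_splits)

text \<open>The invariant behind the automaton: the stack holds the colours of the vacant lines in
  decreasing order, so its top belongs to \<open>Max V\<close>, and the tests passed so far are the
  arcs.\<close>

lemma half_diagram_run:
  assumes "valid (word t m)" and "half_diagram t m = (A, V)"
  shows "V \<subseteq> {1..m} \<and> A \<subseteq> {(i, j). 1 \<le> i \<and> i < j \<and> j \<le> m} \<and> int (card V) = ht (word t m) \<and>
    (\<forall>x. run (word t m) x = (if \<forall>(i, j)\<in>A. x i = x j then Some (map x (rev (sorted_list_of_set V))) else None))"
  using assms
proof (induction m arbitrary: A V)
  case 0
  then show ?case by simp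
next
  case (Suc m)
  obtain A' V' where AV: "half_diagram t m = (A', V')" by (cases "half_diagram t m")
  have v: "valid (word t m)" using Suc.prems by simp
  have IH: "V' \<subseteq> {1..m}" "A' \<subseteq> {(i, j). 1 \<le> i \<and> i < j \<and> j \<le> m}" "int (card V') = ht (word t m)"
    "\<And>x. run (word t m) x = (if \<forall>(i, j)\<in>A'. x i = x j then Some (map x (rev (sorted_list_of_set V'))) else None)"
    using Suc.IH[OF v AV] by blast+
  have fin: "finite V'" using IH(1) finite_subset by blast
  define l where "l = sorted_list_of_set V'"
  have l: "sorted l" "distinct l" "set l = V'" using fin by (simp_all add: l_def)
  show ?case
  proof (cases "snd (t (Suc m)) = 1")
    case True
    then have e: "A = A'" "V = insert (Suc m) V'" using Suc.prems(2) AV by auto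
    have "sorted (l @ [Suc m])" "distinct (l @ [Suc m])" "set (l @ [Suc m]) = V"
      using l IH(1) e by (auto simp: sorted_append)
    then have s: "sorted_list_of_set V = l @ [Suc m]" by (metis sorted_list_of_set.idem_if_sorted_distinct)
    have "Suc m \<notin> V'" using IH(1) by auto
    then have c: "card V = Suc (card V')" using fin e by simp
    have "V \<subseteq> {1..Suc m}" "A \<subseteq> {(i, j). 1 \<le> i \<and> i < j \<and> j \<le> Suc m}" using IH(1,2) e by auto
    moreover have "run (word t (Suc m)) x = (if \<forall>(i, j)\<in>A. x i = x j then Some (map x (rev (sorted_list_of_set V))) else None)" for x
      unfolding s e(1) using True IH(4)[of x] by (simp add: l_def)
    ultimately show ?thesis using c IH(3) True by simp
  next
    case False
    then have e: "A = insert (Max V', Suc m) A'" "V = V' - {Max V'}" using Suc.prems(2) AV by auto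
    have "0 \<le> ht (word t (Suc m))" using Suc.prems(1) by (simp del: ht.simps)
    then have "1 \<le> ht (word t m)" using False by simp
    then have ne: "V' \<noteq> {}" using IH(3) by auto
    then have "l \<noteq> []" using l(3) by auto
    then obtain l' M where lM: "l = l' @ [M]" by (metis append_butlast_last_id)
    have M: "Max V' = M" by (rule Max_eqI) (use fin l lM in \<open>auto simp: sorted_append\<close>)
    have "sorted l'" "distinct l'" "set l' = V" using l lM e M by (auto simp: sorted_append)
    then have s: "sorted_list_of_set V = l'" by (metis sorted_list_of_set.idem_if_sorted_distinct)
    have MV: "M \<in> V'" using l(3) lM by auto
    then have c: "card V = card V' - 1" "card V' \<noteq> 0" using e M fin by auto
    have "V \<subseteq> {1..Suc m}" "A \<subseteq> {(i, j). 1 \<le> i \<and> i < j \<and> j \<le> Suc m}" using IH(1,2) e M MV by auto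
    moreover have "run (word t (Suc m)) x = (if \<forall>(i, j)\<in>A. x i = x j then Some (map x (rev (sorted_list_of_set V))) else None)" for x
    proof -
      have "(\<forall>(i, j)\<in>A. x i = x j) \<longleftrightarrow> x M = x (Suc m) \<and> (\<forall>(i, j)\<in>A'. x i = x j)" by (simp add: e(1) M)
      moreover have "rev (sorted_list_of_set V') = M # rev l'" using lM by (simp add: l_def[symmetric])
      ultimately show ?thesis using False IH(4)[of x] by (simp add: s eq_commute)
    qed
    ultimately show ?thesis using c IH(3) False by (simp add: of_nat_diff)
  qed
qed

lemma agrees_union: "agrees (D \<union> D') c \<longleftrightarrow> agrees D c \<and> agrees D' c"
  unfolding agrees_def by blast

lemma agrees_pairs: "agrees {{f i j, g i j} | i j. P i j} c \<longleftrightarrow> (\<forall>i j. P i j \<longrightarrow> c (f i j) = c (g i j))"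
proof
  assume a: "agrees {{f i j, g i j} | i j. P i j} c"
  show "\<forall>i j. P i j \<longrightarrow> c (f i j) = c (g i j)" using a unfolding agrees_def by blast
next
  assume a: "\<forall>i j. P i j \<longrightarrow> c (f i j) = c (g i j)"
  show "agrees {{f i j, g i j} | i j. P i j} c" unfolding agrees_def
  proof (intro allI impI)
    fix u v assume "{u, v} \<in> {{f i j, g i j} | i j. P i j}"
    then obtain i j where ij: "{u, v} = {f i j, g i j}" "P i j" by blast
    then have "(u = f i j \<and> v = g i j) \<or> (u = g i j \<and> v = f i j)" by (simp add: doubleton_eq_iff)
    then show "c u = c v" using a ij(2) by metis
  qed
qed

definition cell :: "nat \<Rightarrow> bool list \<Rightarrow> bool list \<Rightarrow> diagram" where
  "cell n p q = cup_cap n (tab p) (tab q)"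

lemma cell_strands_R:
  assumes pq: "pr n p q"
  shows "\<And>e. e \<in> cell n p q \<Longrightarrow> card e = 2 \<and> e \<subseteq> points n"
    and "R (cell n p q) x y = of_bool (run p x = run q y \<and> run p x \<noteq> None)"
proof -
  have P: "p \<in> Paths n" "q \<in> Paths n" "ht p = ht q" using pq by (simp_all add: pr_def)
  obtain A V where AV: "half_diagram (tab p) n = (A, V)" by (cases "half_diagram (tab p) n")
  obtain B W where BW: "half_diagram (tab q) n = (B, W)" by (cases "half_diagram (tab q) n")
  have v: "valid (word (tab p) n)" "valid (word (tab q) n)"
    unfolding word_tab[OF P(1)] word_tab[OF P(2)] using P by (simp_all add: Paths_def)
  note a = half_diagram_run[OF v(1) AV, unfolded word_tab[OF P(1)]]
  note b = half_diagram_run[OF v(2) BW, unfolded word_tab[OF P(2)]]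
  let ?ls = "sorted_list_of_set V" and ?lt = "sorted_list_of_set W"
  have fin: "finite V" "finite W" using a b finite_subset[OF _ finite_atLeastAtMost] by blast+
  have len: "length ?ls = length ?lt" using a b P(3) by simp
  have cell: "cell n p q = {{(0, i), (0, j)} | i j. (i, j) \<in> A} \<union> {{(1, i), (1, j)} | i j. (i, j) \<in> B}
     \<union> {{(0, i), (1, j)} | i j. (i, j) \<in> set (zip ?ls ?lt)}"
    by (simp add: cell_def cup_cap_def AV BW)
  show "card e = 2 \<and> e \<subseteq> points n" if e: "e \<in> cell n p q" for e
  proof -
    consider i j where "(i, j) \<in> A" "e = {(0, i), (0, j)}" | i j where "(i, j) \<in> B" "e = {(1, i), (1, j)}"
      | i j where "(i, j) \<in> set (zip ?ls ?lt)" "e = {(0, i), (1, j)}" using e unfolding cell by blast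
    then show ?thesis
    proof cases
      case 1
      then have "1 \<le> i \<and> i < j \<and> j \<le> n" using a by blast
      then show ?thesis using 1 by (auto simp: points_def)
    next
      case 2
      then have "1 \<le> i \<and> i < j \<and> j \<le> n" using b by blast
      then show ?thesis using 2 by (auto simp: points_def)
    next
      case 3
      have "i \<in> V" "j \<in> W" using set_zip_leftD[OF 3(1)] set_zip_rightD[OF 3(1)] fin by simp_all
      then have "i \<in> {1..n}" "j \<in> {1..n}" using a b by blast+
      then show ?thesis using 3 by (auto simp: points_def)
    qed
  qed
  have z: "(\<forall>i j. (i, j) \<in> set (zip ?ls ?lt) \<longrightarrow> x i = y j) \<longleftrightarrow> map x ?ls = map y ?lt"
  proof -
    have "map x ?ls = map y ?lt \<longleftrightarrow> list_all2 (\<lambda>i j. x i = y j) ?ls ?lt"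
      unfolding list.rel_eq[symmetric] by (simp add: list_all2_map1 list_all2_map2)
    also have "\<dots> \<longleftrightarrow> (\<forall>i j. (i, j) \<in> set (zip ?ls ?lt) \<longrightarrow> x i = y j)"
      unfolding list_all2_iff using len by auto
    finally show ?thesis by simp
  qed
  have "agrees (cell n p q) (colm x y) \<longleftrightarrow> (\<forall>(i, j)\<in>A. x i = x j) \<and> (\<forall>(i, j)\<in>B. y i = y j) \<and> map x ?ls = map y ?lt"
    unfolding cell agrees_union agrees_pairs z[symmetric] by (auto simp: colm_def)
  moreover have "run p x = (if \<forall>(i, j)\<in>A. x i = x j then Some (map x (rev ?ls)) else None)" using a by blast
  moreover have "run q y = (if \<forall>(i, j)\<in>B. y i = y j then Some (map y (rev ?lt)) else None)" using b by blast
  ultimately show "R (cell n p q) x y = of_bool (run p x = run q y \<and> run p x \<noteq> None)"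
    by (auto simp: R_def rev_map[symmetric])
qed

text \<open>At a valley the pop forces the inserted colour to be the top of the stack and the push
  restores it. So one of the two colours survives, and what remains, equality at the two points, is
  the test made at a peak.\<close>

lemma run_valley:
  assumes v: "valid (xs @ True # False # ys)" and k: "k = Suc (length ys)"
  shows "(if x k = x (Suc k) then of_bool (run (xs @ True # False # ys) (upd2 x k True) = s \<and> s \<noteq> None)
      + of_bool (run (xs @ True # False # ys) (upd2 x k False) = s \<and> s \<noteq> None) else 0)
    = (of_bool (run (xs @ False # True # ys) x = s \<and> s \<noteq> None) :: nat)"
proof -
  have ry: "run ys (upd2 x k c) = run ys x" for c by (rule run_cong) (simp add: k)
  have None_up: "run (zs @ p) z = None" if "run p z = None" for zs p z
    using that by (induction zs) simp_all
  have len: "length (True # False # ys) = length (False # True # ys)" by simp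
  have up: "run (xs @ True # False # ys) (upd2 x k c) = run (xs @ False # True # ys) x"
    if "run (True # False # ys) (upd2 x k c) = run (False # True # ys) x" for c
    by (rule run_upper[OF that len]) (simp add: k)
  show ?thesis
  proof (cases "run ys x")
    case None
    then have "run (xs @ True # False # ys) (upd2 x k c) = None" for c by (intro None_up) (simp add: ry)
    moreover have "run (xs @ False # True # ys) x = None" by (intro None_up) (simp add: None)
    ultimately show ?thesis by auto
  next
    case (Some st)
    have "valid (False # ys)" using v valid_appendD[of "xs @ [True]" "False # ys"] by simp
    then have "st \<noteq> []" using length_run[OF Some] by auto
    then obtain d st' where st: "st = d # st'" by (cases st) auto
    have wrong: "run (xs @ True # False # ys) (upd2 x k (\<not> d)) = None"
      by (intro None_up) (simp add: ry[unfolded k] Some st k)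
    show ?thesis
    proof (cases "x k = x (Suc k)")
      case True
      have "run (True # False # ys) (upd2 x k d) = run (False # True # ys) x"
        using True by (simp add: ry[unfolded k] Some st k)
      then have right: "run (xs @ True # False # ys) (upd2 x k d) = run (xs @ False # True # ys) x" by (rule up)
      show ?thesis using True wrong right by (cases d) auto
    next
      case False
      then have "run (xs @ False # True # ys) x = None" by (intro None_up) (simp add: Some k)
      then show ?thesis using False by auto
    qed
  qed
qed

lemma cell_left_glue:
  assumes p: "pr n (xs @ True # False # ys) a" and C: "cell n (xs @ True # False # ys) a \<in> diagrams n"
  shows "loops n (udiag n (Suc (length ys))) (cell n (xs @ True # False # ys) a) = 0 \<and>
    glue (udiag n (Suc (length ys))) (cell n (xs @ True # False # ys) a) = cell n (xs @ False # True # ys) a"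
proof -
  let ?k = "Suc (length ys)" and ?p = "xs @ True # False # ys" and ?q = "xs @ False # True # ys"
  have k: "1 \<le> ?k" "?k < n" using p by (auto simp: pr_def Paths_def)
  have v: "valid ?p" using p by (simp add: pr_def Paths_def)
  note q = pr_raise[OF p]
  have key: "(\<Sum>m\<in>Col n. R (udiag n ?k) x m * R (cell n ?p a) m y) = 2 ^ 0 * R (cell n ?q a) x y" if "x \<in> Col n" "y \<in> Col n" for x y
  proof -
    have e: "(r = run a y \<and> r \<noteq> None) = (r = run a y \<and> run a y \<noteq> None)" for r by auto
    show ?thesis unfolding sum_R_u[OF k that(1)] cell_strands_R(2)[OF p] cell_strands_R(2)[OF q] e
      using run_valley[OF v refl, of x "run a y"] by (simp only: power_0 mult_1)
  qed
  show ?thesis using glue_eqI[OF udiag_diagram[OF k] C cell_strands_R(1)[OF q] key] by blast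
qed

lemma cell_right_glue:
  assumes p: "pr n a (xs @ True # False # ys)" and C: "cell n a (xs @ True # False # ys) \<in> diagrams n"
  shows "loops n (cell n a (xs @ True # False # ys)) (udiag n (Suc (length ys))) = 0 \<and>
    glue (cell n a (xs @ True # False # ys)) (udiag n (Suc (length ys))) = cell n a (xs @ False # True # ys)"
proof -
  let ?k = "Suc (length ys)" and ?p = "xs @ True # False # ys" and ?q = "xs @ False # True # ys"
  have k: "1 \<le> ?k" "?k < n" using p by (auto simp: pr_def Paths_def)
  have v: "valid ?p" using p by (simp add: pr_def Paths_def)
  note q = pr_sym[OF pr_raise[OF pr_sym[OF p]]]
  have key: "(\<Sum>m\<in>Col n. R (cell n a ?p) x m * R (udiag n ?k) m y) = 2 ^ 0 * R (cell n a ?q) x y" if "x \<in> Col n" "y \<in> Col n" for x y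
  proof -
    have e: "(run a x = r \<and> run a x \<noteq> None) = (r = run a x \<and> run a x \<noteq> None)" for r by auto
    show ?thesis unfolding sum_R_u'[OF k that(2)] cell_strands_R(2)[OF p] cell_strands_R(2)[OF q] e
      using run_valley[OF v refl, of y "run a x"] by (simp only: power_0 mult_1)
  qed
  show ?thesis using glue_eqI[OF C udiag_diagram[OF k] cell_strands_R(1)[OF q] key] by blast
qed

lemma low_Paths: "j + 2 * m = n \<Longrightarrow> low m j \<in> Paths n"
  by (simp add: Paths_def)

lemma cell_top: "cell n (replicate n True) (replicate n True) = id_diagram n"
proof -
  have p: "pr n (replicate n True) (replicate n True)"
    using low_Paths[of n 0 n] by (simp add: pr_def)
  have "2 ^ 0 * R (id_diagram n) x y = 2 ^ 0 * R (cell n (replicate n True) (replicate n True)) x y" if xy: "x \<in> Col n" "y \<in> Col n" for x y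
  proof -
    have "map x [1..<Suc n] = map y [1..<Suc n] \<longleftrightarrow> (\<forall>i\<in>{1..n}. x i = y i)" by (auto simp del: upt_Suc)
    also have "\<dots> \<longleftrightarrow> x = y" using xy by (auto simp: Col_def PiE_def intro: extensionalityI)
    finally have "map x [1..<Suc n] = map y [1..<Suc n] \<longleftrightarrow> x = y" .
    then show ?thesis unfolding cell_strands_R(2)[OF p] R_id[OF xy]
      using run_replicate[of n "[]" x] run_replicate[of n "[]" y] by (simp del: upt_Suc)
  qed
  then show ?thesis using R_inj(2)[OF diagram_pmatch[OF id_diagram] cell_strands_R(1)[OF p]] by metis
qed

lemma cell_low_glue:
  assumes n: "j + 2 * Suc m = n" and C: "cell n (low m (j + 2)) (low m (j + 2)) \<in> diagrams n"
  shows "loops n (udiag n (Suc (2 * m))) (cell n (low m (j + 2)) (low m (j + 2))) = 0 \<and>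
    glue (udiag n (Suc (2 * m))) (cell n (low m (j + 2)) (low m (j + 2))) = cell n (low (Suc m) j) (low (Suc m) j)"
proof -
  let ?k = "Suc (2 * m)" and ?l = "low m 0"
  have k: "1 \<le> ?k" "?k < n" using n by auto
  have p: "pr n (low m (j + 2)) (low m (j + 2))" using low_Paths[of "j + 2" m n] n by (simp add: pr_def)
  have q: "pr n (low (Suc m) j) (low (Suc m) j)" using low_Paths[OF n] by (simp add: pr_def)
  have lp: "low m (j + 2) = replicate j True @ True # True # ?l"
    unfolding low_eq_append[of m "j + 2"] replicate_add by (simp add: numeral_2_eq_2)
  have lq: "low (Suc m) j = replicate j True @ False # True # ?l" by (simp add: low_def)
  have len: "length ?l = 2 * m" by simp
  have key: "(\<Sum>z\<in>Col n. R (udiag n ?k) x z * R (cell n (low m (j + 2)) (low m (j + 2))) z y) = 2 ^ 0 * R (cell n (low (Suc m) j) (low (Suc m) j)) x y"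
    if xy: "x \<in> Col n" "y \<in> Col n" for x y
  proof -
    let ?up = "\<lambda>z. rev (map z [Suc (Suc ?k)..<Suc (Suc ?k) + j])"
    have st: "st = []" if "run ?l z = Some st" for z st using length_run[OF that] by simp
    have rl: "run ?l (upd2 x ?k c) = run ?l x" for c by (rule run_cong) simp
    have ux: "?up (upd2 x ?k c) = ?up x" for c
    proof -
      have "upd2 x ?k c i = x i" if "i \<in> set [Suc (Suc ?k)..<Suc (Suc ?k) + j]" for i
      proof -
        have "Suc (Suc ?k) \<le> i" using that unfolding set_upt by simp
        then show ?thesis by (intro upd2_simps(3)) linarith+
      qed
      then have "map (upd2 x ?k c) [Suc (Suc ?k)..<Suc (Suc ?k) + j] = map x [Suc (Suc ?k)..<Suc (Suc ?k) + j]"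
        by (intro map_cong refl)
      then show ?thesis by (simp only:)
    qed
    have rp: "run (low m (j + 2)) z = (case run ?l z of None \<Rightarrow> None | Some st \<Rightarrow> Some (?up z @ [z (Suc ?k), z ?k]))" for z
      unfolding lp run_replicate using st by (auto split: option.split simp del: upt_Suc)
    have rq: "run (low (Suc m) j) z = (case run ?l z of None \<Rightarrow> None | Some st \<Rightarrow> if z (Suc ?k) = z ?k then Some (?up z) else None)" for z
      unfolding lq run_replicate using st by (auto split: option.split simp del: upt_Suc)
    have app: "(?up x @ [c, c] = ?up y @ [d, d']) \<longleftrightarrow> ?up x = ?up y \<and> c = d \<and> c = d'" for c d d'
      by (subst append_eq_append_conv) auto
    show ?thesis
      unfolding sum_R_u[OF k xy(1)] cell_strands_R(2)[OF p] cell_strands_R(2)[OF q] rp rq rl upd2_simps(1,2) ux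
      using app by (cases "run ?l x"; cases "run ?l y"; cases "x ?k"; cases "x (Suc ?k)"; cases "y ?k"; cases "y (Suc ?k)") (simp_all del: upt_Suc)
  qed
  show ?thesis using glue_eqI[OF udiag_diagram[OF k] C cell_strands_R(1)[OF q] key] by blast
qed

lemma cell_low_diagram: "j + 2 * m = n \<Longrightarrow> cell n (low m j) (low m j) \<in> diagrams n"
proof (induction m arbitrary: j)
  case 0
  then show ?case using cell_top id_diagram by simp
next
  case (Suc m)
  have C: "cell n (low m (j + 2)) (low m (j + 2)) \<in> diagrams n" by (rule Suc.IH) (use Suc.prems in simp)
  have "1 \<le> Suc (2 * m)" "Suc (2 * m) < n" using Suc.prems by auto
  from glue_diagram[OF udiag_diagram[OF this] C] show ?case using cell_low_glue[OF Suc.prems C] by simp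
qed

text \<open>By \<open>path_induct\<close> on both labels, every cup-cap set is glued together from
  the identity and generators. Gluing preserves diagrams, so noncrossing never has to be checked on
  half-diagrams.\<close>

lemma cell_diagram: "pr n p q \<Longrightarrow> cell n p q \<in> diagrams n"
proof -
  assume pq: "pr n p q"
  have low: "cell n (low m j) q \<in> diagrams n" if jm: "j + 2 * m = n" and q: "q \<in> Paths n" "ht q = int j" for m j q
    using q
  proof (induction q rule: path_induct)
    case (low m' j')
    then have "m' = m" "j' = j" using jm by auto
    then show ?case using cell_low_diagram[OF jm] by simp
  next
    case (raise xs ys)
    have h: "ht (xs @ True # False # ys) = int j" using raise.prems by (simp add: ht_append)
    have pa: "pr n (low m j) (xs @ True # False # ys)" using raise.hyps h low_Paths[OF jm] by (simp add: pr_def)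
    have C: "cell n (low m j) (xs @ True # False # ys) \<in> diagrams n" by (rule raise.IH[OF h])
    have "1 \<le> Suc (length ys)" "Suc (length ys) < n" using raise.hyps by (auto simp: Paths_def)
    from glue_diagram[OF C udiag_diagram[OF this]] show ?case using cell_right_glue[OF pa C] by simp
  qed
  have "p \<in> Paths n" using pq by (simp add: pr_def)
  then show ?thesis using pq
  proof (induction p rule: path_induct)
    case (low m j)
    then show ?case using \<open>\<And>q m j. j + 2 * m = n \<Longrightarrow> q \<in> Paths n \<Longrightarrow> ht q = int j \<Longrightarrow> cell n (low m j) q \<in> diagrams n\<close>
      by (simp add: pr_def)
  next
    case (raise xs ys)
    have pa: "pr n (xs @ True # False # ys) q" using raise.prems raise.hyps by (simp add: pr_def ht_append)
    have C: "cell n (xs @ True # False # ys) q \<in> diagrams n" by (rule raise.IH[OF pa])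
    have "1 \<le> Suc (length ys)" "Suc (length ys) < n" using raise.hyps by (auto simp: Paths_def)
    from glue_diagram[OF udiag_diagram[OF this] C] show ?case using cell_left_glue[OF pa C] by simp
  qed
qed

lemma tl_cellular_uop: "tl_cellular n (uop n) (unit_op n) (\<lambda>p q. Lam n (diag_elem (cell n p q)))"
proof (rule tl_cellular.intro[OF tl_relations_uop], unfold_locales)
  fix xs ys a assume p: "pr n (xs @ True # False # ys) a"
  have "1 \<le> Suc (length ys)" "Suc (length ys) < n" using p by (auto simp: Paths_def pr_def)
  note u = udiag_diagram[OF this]
  show "Lam n (diag_elem (cell n (xs @ False # True # ys) a)) =
      uop n (Suc (length ys)) * Lam n (diag_elem (cell n (xs @ True # False # ys) a))"
    unfolding uop_def tl_u_eq Lam_diag_mult[OF u cell_diagram[OF p]] using cell_left_glue[OF p cell_diagram[OF p]] by simp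
next
  fix s xs ys assume p: "pr n s (xs @ True # False # ys)"
  have "1 \<le> Suc (length ys)" "Suc (length ys) < n" using p by (auto simp: Paths_def pr_def)
  note u = udiag_diagram[OF this]
  show "Lam n (diag_elem (cell n s (xs @ False # True # ys))) =
      Lam n (diag_elem (cell n s (xs @ True # False # ys))) * uop n (Suc (length ys))"
    unfolding uop_def tl_u_eq Lam_diag_mult[OF cell_diagram[OF p] u] using cell_right_glue[OF p cell_diagram[OF p]] by simp
next
  show "Lam n (diag_elem (cell n (replicate n True) (replicate n True))) = unit_op n"
    unfolding cell_top unit_op_def TL_one ..
next
  fix j m assume n: "j + 2 * Suc m = n"
  have C: "cell n (low m (j + 2)) (low m (j + 2)) \<in> diagrams n" by (rule cell_low_diagram) (use n in simp)
  have "1 \<le> Suc (2 * m)" "Suc (2 * m) < n" using n by auto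
  note u = udiag_diagram[OF this]
  show "Lam n (diag_elem (cell n (low (Suc m) j) (low (Suc m) j))) =
     uop n (Suc (2 * m)) * Lam n (diag_elem (cell n (low m (j + 2)) (low m (j + 2))))"
    unfolding uop_def tl_u_eq Lam_diag_mult[OF u C] using cell_low_glue[OF n C] by simp
qed

section \<open>Seminormal idempotents and the seminormal basis\<close>

interpretation tlc: tl_cellular n "uop n" "unit_op n" "\<lambda>p q. Lam n (diag_elem (cell n p q))" for n
  by (rule tl_cellular_uop)

abbreviation mu :: "nat \<Rightarrow> bool list \<Rightarrow> bool list \<Rightarrow> lop" where
  "mu n \<equiv> tl_relations.e (uop n) (unit_op n)"

abbreviation jm :: "nat \<Rightarrow> nat \<Rightarrow> lop" where
  "jm n \<equiv> tl_relations.L (uop n) (unit_op n)"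

section \<open>Transpositions and Jucys-Murphy elements as operators\<close>

definition sop :: "nat \<Rightarrow> nat \<Rightarrow> lop" where
  "sop n k = uop n k - unit_op n"

definition sprod :: "nat \<Rightarrow> nat list \<Rightarrow> lop \<Rightarrow> lop" where
  "sprod n ks y = foldr (\<lambda>k y. sop n k * y) ks y"

lemma sprod_simps [simp]: "sprod n [] y = y" "sprod n (k # ks) y = sop n k * sprod n ks y"
  by (simp_all add: sprod_def)

lemma sprod_append: "sprod n (ks @ ls) y = sprod n ks (sprod n ls y)"
  by (simp add: sprod_def)

lemma sprod_mult: "sprod n ks (x * y) = sprod n ks x * y"
  by (induction ks) (simp_all add: mult.assoc)

lemma sprod_commute:
  assumes "\<And>k. k \<in> set ks \<Longrightarrow> sop n k * a = a * sop n k"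
  shows "sprod n ks (a * y) = a * sprod n ks y"
  using assms
proof (induction ks)
  case (Cons k ks)
  have ka: "sop n k * a = a * sop n k" using Cons.prems by simp
  have "sprod n ks (a * y) = a * sprod n ks y" using Cons by simp
  then have "sprod n (k # ks) (a * y) = (sop n k * a) * sprod n ks y" by (simp only: sprod_simps mult.assoc)
  then show ?case unfolding ka by (simp only: sprod_simps mult.assoc)
qed simp

lemma unit_sop: "1 \<le> k \<Longrightarrow> k < n \<Longrightarrow> unit_op n * sop n k = sop n k \<and> sop n k * unit_op n = sop n k"
  using tlc.I_u[of k n] tlc.u_I[of k n] tlc.I_I[of n] by (simp add: sop_def left_diff_distrib right_diff_distrib)

lemma sop_commute: "1 \<le> k \<Longrightarrow> Suc k < l \<Longrightarrow> l < n \<Longrightarrow> sop n k * sop n l = sop n l * sop n k"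
  using tlc.u_comm[of k l n] tlc.I_u[of k n] tlc.u_I[of k n] tlc.I_u[of l n] tlc.u_I[of l n]
  by (simp add: sop_def left_diff_distrib right_diff_distrib)

text \<open>Both sides expand to u + v - u v - v u - I, the cubic terms being absorbed by the
  Temperley-Lieb relations.\<close>

lemma sop_braid:
  assumes "1 \<le> k" and "Suc k < n"
  shows "sop n k * (sop n (Suc k) * (sop n k * y)) = sop n (Suc k) * (sop n k * (sop n (Suc k) * y))"
proof -
  let ?u = "uop n k" and ?v = "uop n (Suc k)" and ?I = "unit_op n"
  have k: "k < n" "1 \<le> Suc k" using assms by auto
  have I: "?I * ?u = ?u" "?u * ?I = ?u" "?I * ?v = ?v" "?v * ?I = ?v" "?I * ?I = ?I"
    using tlc.I_u[OF assms(1) k(1)] tlc.u_I[OF assms(1) k(1)] tlc.I_u[OF k(2) assms(2)] tlc.u_I[OF k(2) assms(2)]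
      tlc.I_I[of n] .
  have two: "2 *\<^sub>Q x = x + x" for x :: lop using scl_add_left[of 1 1 x] by simp
  have uu: "?u * ?u = ?u + ?u" "?v * ?v = ?v + ?v"
    using tlc.u_u[OF assms(1) k(1)] tlc.u_u[OF k(2) assms(2)] unfolding two .
  have uvu: "?u * (?v * ?u) = ?u" "?v * (?u * ?v) = ?v"
    using tlc.u_up[OF assms] tlc.u_down[OF assms] .
  have I3: "?I * (?u * ?v) = ?u * ?v" "?I * (?v * ?u) = ?v * ?u" by (simp_all only: mult.assoc[symmetric] I)
  have L: "sop n k * (sop n (Suc k) * sop n k) = ?u + ?v - ?u * ?v - ?v * ?u - ?I"
    unfolding sop_def left_diff_distrib right_diff_distrib I I3 uu uvu by (simp add: algebra_simps)
  have R: "sop n (Suc k) * (sop n k * sop n (Suc k)) = ?u + ?v - ?u * ?v - ?v * ?u - ?I"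
    unfolding sop_def left_diff_distrib right_diff_distrib I I3 uu uvu by (simp add: algebra_simps)
  have "sop n k * (sop n (Suc k) * sop n k) = sop n (Suc k) * (sop n k * sop n (Suc k))" unfolding L R ..
  then have "(sop n k * (sop n (Suc k) * sop n k)) * y = (sop n (Suc k) * (sop n k * sop n (Suc k))) * y" by simp
  then show ?thesis by (simp only: mult.assoc)
qed

text \<open>The conjugation (j, i + 1) = s_i (j, i) s_i on operators: a braid move at the turning
  point of the word, after which \<open>sop n i\<close> commutes past the smaller generators on
  either side.\<close>

lemma transp_word_conj:
  assumes "1 \<le> j" and "j < i" and "i < n"
  shows "sprod n (transp_word j (Suc i)) (unit_op n) = sop n i * (sprod n (transp_word j i) (unit_op n) * sop n i)"
proof -
  obtain i' where i: "i = Suc i'" using assms(2) by (cases i) auto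
  let ?I = "unit_op n" and ?a = "sop n i"
  have j: "j \<le> i'" using assms i by simp
  have w1: "transp_word j i = [j..<i'] @ [i'] @ rev [j..<i']" using j by (simp add: transp_word_def i)
  have w2: "transp_word j (Suc i) = [j..<i'] @ [i', i, i'] @ rev [j..<i']" using j by (simp add: transp_word_def i)
  have i1: "1 \<le> i'" "Suc i' < n" "1 \<le> i" using assms i by auto
  have comm: "sop n k * ?a = ?a * sop n k" if "k \<in> set [j..<i']" for k
    by (rule sop_commute) (use that assms i in auto)
  have comm': "sop n k * ?a = ?a * sop n k" if "k \<in> set (rev [j..<i'])" for k using comm that by simp
  let ?R = "sprod n (rev [j..<i']) ?I"
  have aR: "?a * ?R = ?R * ?a"
  proof -
    have Ia: "?I * ?a = ?a" "?a * ?I = ?a" using unit_sop[OF i1(3) assms(3)] by auto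
    have "?a * ?R = sprod n (rev [j..<i']) (?a * ?I)" using sprod_commute[OF comm', of "rev [j..<i']" ?I] by simp
    also have "\<dots> = sprod n (rev [j..<i']) (?I * ?a)" unfolding Ia ..
    finally show ?thesis unfolding sprod_mult .
  qed
  have w1': "sprod n (transp_word j i) ?I = sprod n [j..<i'] (sop n i' * ?R)"
    unfolding w1 sprod_append by simp
  have "sprod n (transp_word j (Suc i)) ?I = sprod n [j..<i'] (sop n i' * (?a * (sop n i' * ?R)))"
    unfolding w2 sprod_append by simp
  also have "\<dots> = sprod n [j..<i'] (?a * (sop n i' * (?a * ?R)))"
    unfolding i sop_braid[OF i1(1,2)] ..
  also have "\<dots> = ?a * sprod n [j..<i'] (sop n i' * (?a * ?R))" by (rule sprod_commute[OF comm])
  also have "sop n i' * (?a * ?R) = (sop n i' * ?R) * ?a" unfolding aR by (simp only: mult.assoc)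
  also have "sprod n [j..<i'] ((sop n i' * ?R) * ?a) = sprod n (transp_word j i) ?I * ?a"
    unfolding w1' by (rule sprod_mult)
  finally show ?thesis .
qed

lemma Lam_Phi_word:
  assumes "\<And>k. k \<in> set ks \<Longrightarrow> 1 \<le> k \<and> k < n"
  shows "Lam n (Phi_word n ks) = sprod n ks (unit_op n)"
proof -
  have s: "Lam n (tl_u n k \<ominus>\<^bsub>TLQ n\<^esub> \<one>\<^bsub>TLQ n\<^esub>) = sop n k" for k
    unfolding Lam_minus[OF TL_one_closed] by (simp add: sop_def uop_def unit_op_def)
  show ?thesis unfolding Phi_word_def Lam_list_prod sprod_def by (simp add: foldr_map comp_def s)
qed

lemma JM_eq:
  assumes "1 \<le> i" and "i \<le> n"
  shows "JM n i \<in> carrier (TLQ n) \<and> Lam n (JM n i) = jm n i"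
proof -
  have cl: "Phi_word n ks \<in> carrier (TLQ n)" for ks unfolding Phi_word_def by (rule list_prod_closed)
  have fs: "JM n i \<in> carrier (TLQ n) \<and> Lam n (JM n i) = (\<Sum>j\<in>{1..<i}. Lam n (Phi_word n (transp_word j i)))" for i
    unfolding JM_def by (rule Lam_finsum) (simp_all add: cl)
  have W: "Lam n (Phi_word n (transp_word j i)) = sprod n (transp_word j i) (unit_op n)" if "1 \<le> j" "j < i" "i \<le> n" for j i
    by (rule Lam_Phi_word) (use that in \<open>auto simp: transp_word_def\<close>)
  have S: "(\<Sum>j\<in>{1..<i}. sprod n (transp_word j i) (unit_op n)) = jm n i" if "1 \<le> i" "i \<le> n" for i
    using that
  proof (induction i rule: dec_induct)
    case base
    then show ?case by simp
  next
    case (step i)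
    have i: "1 \<le> i" "i < n" using step by auto
    have "(\<Sum>j\<in>{1..<Suc i}. sprod n (transp_word j (Suc i)) (unit_op n)) =
       (\<Sum>j\<in>{1..<i}. sprod n (transp_word j (Suc i)) (unit_op n)) + sprod n (transp_word i (Suc i)) (unit_op n)"
      using i(1) by (simp add: sum.atLeastLessThan_Suc)
    also have "sprod n (transp_word i (Suc i)) (unit_op n) = sop n i"
      using unit_sop[OF i] by (simp add: transp_word_def)
    also have "(\<Sum>j\<in>{1..<i}. sprod n (transp_word j (Suc i)) (unit_op n))
        = (\<Sum>j\<in>{1..<i}. sop n i * (sprod n (transp_word j i) (unit_op n) * sop n i))"
      by (rule sum.cong[OF refl]) (rule transp_word_conj, use i in auto)
    also have "\<dots> = sop n i * (jm n i * sop n i)"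
      using step.IH i by (simp add: sum_distrib_left[symmetric] sum_distrib_right[symmetric])
    finally show ?case using i(1) by (simp add: sop_def mult.assoc)
  qed
  have "(\<Sum>j\<in>{1..<i}. Lam n (Phi_word n (transp_word j i))) = (\<Sum>j\<in>{1..<i}. sprod n (transp_word j i) (unit_op n))"
    by (rule sum.cong[OF refl]) (use W assms in auto)
  then show ?thesis using fs[of i] S[OF assms] by simp
qed

lemma mu_mult: "pr n p q \<Longrightarrow> pr n r s \<Longrightarrow> mu n p q * mu n r s = (if q = r then mu n p s else 0)"
  by (rule tlc.mult_e[OF order_refl])

lemma jm_mu:
  assumes "pr n p z" and "i \<in> {1..n}"
  shows "jm n i * mu n p z = of_int (content (tab p) i) *\<^sub>Q mu n p z"
proof -
  have l: "length p = n" using assms(1) by (simp add: pr_def Paths_def)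
  obtain xs b ys where p: "p = xs @ b # ys" "i = Suc (length ys)" by (rule split_path[OF l assms(2)])
  show ?thesis using tlc.L_e[OF order_refl, of n xs b ys z] assms(1) content_tab[of xs b ys] unfolding p by simp
qed

text \<open>At the earliest difference the contents are -T and 1 - F, with T up and F down steps
  before it. Equality would mean F = T + 1, which a valid path excludes.\<close>

lemma contents_separate:
  assumes "p \<in> Paths n" and "q \<in> Paths n" and "p \<noteq> q"
  shows "\<exists>i\<in>{1..n}. content (tab p) i \<noteq> content (tab q) i"
proof -
  have "\<exists>xs xs' b ys. p = xs @ b # ys \<and> q = xs' @ (\<not> b) # ys" if "length p = length q" "p \<noteq> q" for p q :: "bool list"
    using that
  proof (induction p q rule: list_induct2)
    case (Cons b p c q)
    show ?case
    proof (cases "p = q")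
      case True
      then have "b # p = [] @ b # p" "c # q = [] @ (\<not> b) # p" using Cons.prems by auto
      then show ?thesis by blast
    next
      case False
      then obtain xs xs' d ys where "p = xs @ d # ys" "q = xs' @ (\<not> d) # ys" using Cons.IH by blast
      then have "b # p = (b # xs) @ d # ys" "c # q = (c # xs') @ (\<not> d) # ys" by simp_all
      then show ?thesis by blast
    qed
  qed simp
  moreover have "length p = length q" using assms by (simp add: Paths_def)
  ultimately obtain xs xs' b ys where pq: "p = xs @ b # ys" "q = xs' @ (\<not> b) # ys" using assms(3) by blast
  have "valid (b # ys)" using assms(1) pq(1) valid_appendD unfolding Paths_def by blast
  then have "count_list ys False \<le> count_list ys True" using count_le[of ys] by simp
  then have "step_content b ys \<noteq> step_content (\<not> b) ys" by (cases b) (simp_all add: step_content_def)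
  moreover have "Suc (length ys) \<in> {1..n}" using assms(1) pq(1) by (auto simp: Paths_def)
  moreover have "content (tab p) (Suc (length ys)) = step_content b ys"
    "content (tab q) (Suc (length ys)) = step_content (\<not> b) ys" unfolding pq by (rule content_tab)+
  ultimately show ?thesis by metis
qed

lemma finite_contents: "finite (contents n)"
proof -
  have "contents n = (\<lambda>(p, i). content (tab p) i) ` (Paths n \<times> {1..n})"
    unfolding contents_def StdPar2_eq by force
  then show ?thesis by simp
qed

lemma foldr_Lam_mult: "foldr (\<lambda>x y. Lam n x * y) xs a * m = foldr (\<lambda>x y. Lam n x * y) xs (a * m)"
  by (induction xs) (simp_all add: mult.assoc)

lemma foldr_Lam_fixed: "(\<And>x. x \<in> set xs \<Longrightarrow> Lam n x * m = m) \<Longrightarrow> foldr (\<lambda>x y. Lam n x * y) xs m = m"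
  by (induction xs) simp_all

lemma foldr_Lam_multiple:
  assumes "\<And>x. x \<in> set xs \<Longrightarrow> \<exists>c. Lam n x * m = c *\<^sub>Q m"
  shows "\<exists>c. foldr (\<lambda>x y. Lam n x * y) xs m = c *\<^sub>Q m"
  using assms
proof (induction xs)
  case Nil
  have "foldr (\<lambda>x y. Lam n x * y) [] m = 1 *\<^sub>Q m" by simp
  then show ?case by blast
next
  case (Cons x xs)
  obtain c where "foldr (\<lambda>x y. Lam n x * y) xs m = c *\<^sub>Q m" using Cons by auto
  moreover obtain d where "Lam n x * m = d *\<^sub>Q m" using Cons.prems[of x] by auto
  ultimately have "foldr (\<lambda>x y. Lam n x * y) (x # xs) m = (c * d) *\<^sub>Q m" by simp
  then show ?case by blast
qed

lemma foldr_Lam_zero: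
  assumes "\<And>x. x \<in> set xs \<Longrightarrow> \<exists>c. Lam n x * m = c *\<^sub>Q m" and "z \<in> set xs" and "Lam n z * m = 0"
  shows "foldr (\<lambda>x y. Lam n x * y) xs m = 0"
  using assms
proof (induction xs)
  case (Cons x xs)
  show ?case
  proof (cases "z \<in> set xs")
    case True
    then have "foldr (\<lambda>x y. Lam n x * y) xs m = 0" using Cons by auto
    then show ?thesis by simp
  next
    case False
    then have "x = z" using Cons.prems by simp
    moreover obtain c where "foldr (\<lambda>x y. Lam n x * y) xs m = c *\<^sub>Q m"
      using foldr_Lam_multiple[of xs n m] Cons.prems(1) by auto
    ultimately show ?thesis using Cons.prems(3) by simp
  qed
qed simp

lemma mu_complete: "x * unit_op n = x \<Longrightarrow> x = (\<Sum>p\<in>Paths n. x * mu n p p)"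
  by (metis sum_distrib_left tlc.sum_e[OF order_refl])

lemma idem_carrier: "idem n t \<in> carrier (TLQ n)"
  unfolding idem_def by (rule list_prod_closed)

text \<open>On each diagonal unit all factors of the product are scalars and can be evaluated one
  after the other: each is 1 at \<open>p\<close>, and at any other path one of them vanishes by
  \<open>contents_separate\<close>. Completeness of the units then identifies the operator.\<close>

lemma Lam_idem:
  assumes p: "p \<in> Paths n"
  shows "Lam n (idem n (tab p)) = mu n p p"
proof -
  define g where "g i c = inverse (of_int (content (tab p) i - c)) \<odot>\<^bsub>TLQ n\<^esub>
        (JM n i \<ominus>\<^bsub>TLQ n\<^esub> (of_int c \<odot>\<^bsub>TLQ n\<^esub> \<one>\<^bsub>TLQ n\<^esub>))" for i c
  define zs where "zs = [g i c. c \<leftarrow> sorted_list_of_set (contents n), i \<leftarrow> [1..<Suc n], c \<noteq> content (tab p) i]"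
  have set_zs: "z \<in> set zs \<longleftrightarrow> (\<exists>c\<in>contents n. \<exists>i\<in>{1..n}. c \<noteq> content (tab p) i \<and> z = g i c)" for z
    unfolding zs_def using finite_contents[of n] by (auto simp del: upt_Suc simp: atLeastLessThanSuc_atLeastAtMost)
  have idem: "Lam n (idem n (tab p)) = foldr (\<lambda>x y. Lam n x * y) zs (unit_op n)"
    unfolding idem_def zs_def g_def Lam_list_prod ..
  have Lg: "Lam n (g i c) * mu n q q = ((of_int (content (tab q) i) - of_int c) / of_int (content (tab p) i - c)) *\<^sub>Q mu n q q"
    if i: "i \<in> {1..n}" and q: "q \<in> Paths n" for i c q
  proof -
    have "Lam n (JM n i) = jm n i" using JM_eq i by simp
    then have "Lam n (g i c) = inverse (of_int (content (tab p) i - c)) *\<^sub>Q (jm n i - of_int c *\<^sub>Q unit_op n)"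
      unfolding g_def Lam_smult Lam_minus[OF TL_smult_closed[OF TL_one_closed]] by (simp add: unit_op_def)
    then show ?thesis
      using jm_mu[OF pr_refl[OF q] i] tlc.I_e[OF order_refl pr_refl[OF q]]
      by (simp add: left_diff_distrib scl_diff_left[symmetric] divide_inverse mult.commute)
  qed
  have mult: "\<exists>c. Lam n z * mu n q q = c *\<^sub>Q mu n q q" if z: "z \<in> set zs" and q: "q \<in> Paths n" for z q
  proof -
    obtain c i where ci: "i \<in> {1..n}" "z = g i c" using z set_zs by blast
    show ?thesis unfolding ci(2) Lg[OF ci(1) q] by blast
  qed
  have I: "unit_op n * mu n q q = mu n q q" if "q \<in> Paths n" for q
    using tlc.I_e[OF order_refl pr_refl[OF that]] .
  have "Lam n (idem n (tab p)) * mu n q q = (if q = p then mu n p p else 0)" if q: "q \<in> Paths n" for q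
  proof (cases "q = p")
    case True
    have "Lam n z * mu n p p = mu n p p" if z: "z \<in> set zs" for z
    proof -
      obtain c i where ci: "i \<in> {1..n}" "c \<noteq> content (tab p) i" "z = g i c" using z set_zs by blast
      have "of_int (content (tab p) i) - of_int c \<noteq> (0::rat)" using ci(2) by simp
      then show ?thesis unfolding ci(3) Lg[OF ci(1) p] by simp
    qed
    then show ?thesis unfolding idem foldr_Lam_mult True I[OF p] using foldr_Lam_fixed by simp
  next
    case False
    obtain i where i: "i \<in> {1..n}" "content (tab p) i \<noteq> content (tab q) i"
      using contents_separate[OF p q] False by auto
    have "content (tab q) i \<in> contents n" unfolding contents_def using tab_StdPar2[OF q] i(1) by blast
    then have "g i (content (tab q) i) \<in> set zs" using set_zs i by metis
    moreover have "Lam n (g i (content (tab q) i)) * mu n q q = 0" unfolding Lg[OF i(1) q] by simp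
    ultimately have "foldr (\<lambda>x y. Lam n x * y) zs (mu n q q) = 0" using foldr_Lam_zero mult[OF _ q] by blast
    then show ?thesis unfolding idem foldr_Lam_mult I[OF q] using False by simp
  qed
  then have "(\<Sum>q\<in>Paths n. Lam n (idem n (tab p)) * mu n q q) = (\<Sum>q\<in>Paths n. if q = p then mu n p p else 0)"
    by (intro sum.cong refl)
  then have "(\<Sum>q\<in>Paths n. Lam n (idem n (tab p)) * mu n q q) = mu n p p" using p by (simp add: sum.delta)
  then show ?thesis using mu_complete[OF unit_op_right[OF idem_carrier]] by metis
qed

lemma f_basis_carrier: "f_basis n s t \<in> carrier (TLQ n)"
  unfolding f_basis_def by (rule TL_mult_closed)

definition Fop :: "nat \<Rightarrow> bool list \<Rightarrow> bool list \<Rightarrow> lop" where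
  "Fop n p q = Lam n (f_basis n (tab p) (tab q))"

lemma Fop_mu:
  "\<exists>x y. (\<forall>p q. pr n p q \<longrightarrow> Fop n p q = (x p * y q) *\<^sub>Q mu n p q) \<and>
     (\<forall>p\<in>Paths n. x p \<noteq> 0 \<and> y p \<noteq> 0)"
proof -
  obtain x y where xy: "\<And>s a. pr n s a \<Longrightarrow> mu n s s * (Lam n (diag_elem (cell n s a)) * mu n a a) = (x s * y a) *\<^sub>Q mu n s a"
    "\<And>s. s \<in> Paths n \<Longrightarrow> x s \<noteq> 0" "\<And>a. a \<in> Paths n \<Longrightarrow> y a \<noteq> 0"
    using tlc.cell_compress[of n] by blast
  have "Fop n p q = (x p * y q) *\<^sub>Q mu n p q" if pq: "pr n p q" for p q
  proof -
    have P: "p \<in> Paths n" "q \<in> Paths n" using pq by (simp_all add: pr_def)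
    show ?thesis unfolding Fop_def f_basis_def Lam_mult Lam_idem[OF P(1)] Lam_idem[OF P(2)] mult.assoc
      using xy(1)[OF pq] unfolding cell_def .
  qed
  then show ?thesis using xy(2,3) by blast
qed

lemma Lam_sum: "finite A \<Longrightarrow> Lam n (\<lambda>D. \<Sum>i\<in>A. f i D) = (\<Sum>i\<in>A. Lam n (f i))"
proof (induction A rule: finite_induct)
  case empty
  show ?case using Lam_zero[of n] by (simp add: TL_zero)
next
  case (insert a A)
  then show ?case by (simp add: Lam_add)
qed

section \<open>Existence and action of the KLR elements\<close>

lemma swap_std_pr:
  assumes p: "p \<in> Paths n" and k: "1 \<le> k" "k < n" and std: "swap_tab k (tab p) \<in> StdPar2 n"
  obtains q where "swap_tab k (tab p) = tab q" and "pr n q p"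
proof -
  have "length p = n" "Suc k \<in> {1..n}" using p k by (auto simp: Paths_def)
  then obtain xs c zs where 1: "p = xs @ c # zs" "Suc k = Suc (length zs)" by (rule split_path)
  then obtain b ys where 2: "zs = b # ys" using k(1) by (cases zs) auto
  have kk: "k = Suc (length ys)" using 1 2 by simp
  have pe: "p = xs @ c # b # ys" using 1 2 by simp
  have cb: "c \<noteq> b"
  proof
    assume "c = b"
    then show False using swap_same_not_StdPar2[of xs b ys n] p std unfolding pe kk by simp
  qed
  let ?q = "xs @ b # c # ys"
  have sw: "swap_tab k (tab p) = tab ?q" unfolding pe kk by (rule swap_tab_tab[OF cb])
  have l: "length ?q = n" using p unfolding pe by (simp add: Paths_def)
  then have "valid ?q" using tab_not_StdPar2 std unfolding sw by blast
  then have "pr n ?q p" using p l unfolding pe by (simp add: pr_def Paths_def ht_append)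
  then show ?thesis using that sw by blast
qed

text \<open>\<open>klr_psi\<close> is a definite description, so this unlocks its defining
  equations. Uniqueness holds because an element is determined by its products with the diagonal
  units, which are multiples of basis elements. For existence, the prescribed images of the diagonal
  basis elements, divided by \<open>x p * y p\<close>, are added up.\<close>

lemma klr_psi_unique_ex:
  assumes k: "1 \<le> k" "k < n"
  shows "\<exists>!x. x \<in> carrier (TLQ n) \<and>
     (\<forall>\<mu>\<in>Par2 n. \<forall>s\<in>Std n \<mu>. \<forall>a\<in>Std n \<mu>.
        x \<otimes>\<^bsub>TLQ n\<^esub> f_basis n s a =
          (klr_beta P n k s \<odot>\<^bsub>TLQ n\<^esub> f_basis n (swap_tab k s) a) \<ominus>\<^bsub>TLQ n\<^esub>
          ((klr_delta P k s * (1 / of_int (axial_dist s k))) \<odot>\<^bsub>TLQ n\<^esub> f_basis n s a))"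
    (is "\<exists>!x. ?Q x")
proof -
  obtain x y where F: "\<And>p q. pr n p q \<Longrightarrow> Fop n p q = (x p * y q) *\<^sub>Q mu n p q"
    and x0: "\<And>p. p \<in> Paths n \<Longrightarrow> x p \<noteq> 0" and y0: "\<And>q. q \<in> Paths n \<Longrightarrow> y q \<noteq> 0"
    using Fop_mu[of n] by blast
  define \<beta> where "\<beta> p = klr_beta P n k (tab p)" for p
  define \<delta> where "\<delta> p = klr_delta P k (tab p) * (1 / of_int (axial_dist (tab p) k))" for p
  define G where "G p a = f_basis n (swap_tab k (tab p)) (tab a)" for p a
  define X where "X = (\<lambda>D. \<Sum>p\<in>Paths n. (\<beta> p / (x p * y p)) * G p p D + (- \<delta> p / (x p * y p)) * f_basis n (tab p) (tab p) D)"
  have Xc: "X \<in> carrier (TLQ n)"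
    using f_basis_carrier unfolding TL_carrier X_def G_def by (simp add: sum.neutral)
  have LX: "Lam n X = (\<Sum>p\<in>Paths n. (\<beta> p / (x p * y p)) *\<^sub>Q Lam n (G p p) + (- \<delta> p / (x p * y p)) *\<^sub>Q Fop n p p)"
    unfolding X_def Lam_sum[OF finite_Paths] Lam_add Lam_scl Fop_def ..
  have rhs: "Lam n ((\<beta> p \<odot>\<^bsub>TLQ n\<^esub> G p a) \<ominus>\<^bsub>TLQ n\<^esub> (\<delta> p \<odot>\<^bsub>TLQ n\<^esub> f_basis n (tab p) (tab a)))
      = \<beta> p *\<^sub>Q Lam n (G p a) - \<delta> p *\<^sub>Q Fop n p a" for p a
    unfolding Lam_minus[OF TL_smult_closed[OF f_basis_carrier]] Lam_smult Fop_def ..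
  \<comment> \<open>If the swapped tableau is not standard, \<open>G\<close> carries no information,
    but its coefficient is 0 by definition.\<close>
  have \<beta>G: "\<beta> p *\<^sub>Q (Lam n (G p p) * mu n p a) = (\<beta> p * (y p / y a)) *\<^sub>Q Lam n (G p a)" if pa: "pr n p a" for p a
  proof (cases "swap_tab k (tab p) \<in> StdPar2 n")
    case False
    then have "\<beta> p = 0" by (simp add: \<beta>_def klr_beta_def Let_def)
    then show ?thesis by simp
  next
    case True
    have p: "p \<in> Paths n" "a \<in> Paths n" using pa by (simp_all add: pr_def)
    obtain q where q: "swap_tab k (tab p) = tab q" "pr n q p" by (rule swap_std_pr[OF p(1) k True])
    have qa: "pr n q a" using pr_trans[OF q(2) pa] .
    have "Lam n (G p p) = (x q * y p) *\<^sub>Q mu n q p" "Lam n (G p a) = (x q * y a) *\<^sub>Q mu n q a"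
      using F[OF q(2)] F[OF qa] by (simp_all add: G_def q(1) Fop_def)
    then show ?thesis using mu_mult[OF q(2) pa] y0[OF p(2)] by (simp add: mult.commute)
  qed
  have act: "Lam n X * Fop n p a = \<beta> p *\<^sub>Q Lam n (G p a) - \<delta> p *\<^sub>Q Fop n p a" if pa: "pr n p a" for p a
  proof -
    have p: "p \<in> Paths n" "a \<in> Paths n" using pa by (simp_all add: pr_def)
    have G0: "\<beta> r *\<^sub>Q (Lam n (G r r) * mu n p a) = 0" if r: "r \<in> Paths n" "r \<noteq> p" for r
    proof (cases "swap_tab k (tab r) \<in> StdPar2 n")
      case False
      then show ?thesis by (simp add: \<beta>_def klr_beta_def Let_def)
    next
      case True
      obtain q where q: "swap_tab k (tab r) = tab q" "pr n q r" by (rule swap_std_pr[OF r(1) k True])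
      have "Lam n (G r r) = (x q * y r) *\<^sub>Q mu n q r" using F[OF q(2)] by (simp add: G_def q(1) Fop_def)
      then show ?thesis using mu_mult[OF q(2) pa] r(2) by simp
    qed
    have "Lam n X * mu n p a = (\<Sum>r\<in>Paths n. (1 / (x r * y r)) *\<^sub>Q (\<beta> r *\<^sub>Q (Lam n (G r r) * mu n p a))
        + (- \<delta> r / (x r * y r)) *\<^sub>Q (Fop n r r * mu n p a))"
      unfolding LX sum_distrib_right distrib_right by simp
    also have "\<dots> = (\<Sum>r\<in>Paths n. if r = p then (1 / (x p * y p)) *\<^sub>Q ((\<beta> p * (y p / y a)) *\<^sub>Q Lam n (G p a))
        + (- \<delta> p) *\<^sub>Q mu n p a else 0)"
    proof (rule sum.cong[OF refl])
      fix r assume r: "r \<in> Paths n"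
      have Fr: "Fop n r r * mu n p a = (x r * y r) *\<^sub>Q (if r = p then mu n r a else 0)"
        unfolding F[OF pr_refl[OF r]] scl_mult_left mu_mult[OF pr_refl[OF r] pa] ..
      show "(1 / (x r * y r)) *\<^sub>Q (\<beta> r *\<^sub>Q (Lam n (G r r) * mu n p a)) + (- \<delta> r / (x r * y r)) *\<^sub>Q (Fop n r r * mu n p a)
        = (if r = p then (1 / (x p * y p)) *\<^sub>Q ((\<beta> p * (y p / y a)) *\<^sub>Q Lam n (G p a)) + (- \<delta> p) *\<^sub>Q mu n p a else 0)"
      proof (cases "r = p")
        case True
        show ?thesis unfolding Fr unfolding True \<beta>G[OF pa] using x0[OF p(1)] y0[OF p(1)] by simp
      next
        case False
        show ?thesis unfolding Fr G0[OF r False] using False by simp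
      qed
    qed
    also have "\<dots> = (\<beta> p / (x p * y a)) *\<^sub>Q Lam n (G p a) + (- \<delta> p) *\<^sub>Q mu n p a"
      using p(1) y0[OF p(1)] by (simp add: sum.delta)
    finally have M: "Lam n X * mu n p a = (\<beta> p / (x p * y a)) *\<^sub>Q Lam n (G p a) + (- \<delta> p) *\<^sub>Q mu n p a" .
    show ?thesis unfolding F[OF pa] scl_mult_right M
      using x0[OF p(1)] y0[OF p(2)] by (simp add: scl_add_right scl_diff_right scl_minus_left mult.commute)
  qed
  have Q: "?Q z \<longleftrightarrow> z \<in> carrier (TLQ n) \<and> (\<forall>p a. pr n p a \<longrightarrow> Lam n z * Fop n p a = \<beta> p *\<^sub>Q Lam n (G p a) - \<delta> p *\<^sub>Q Fop n p a)" for z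
  proof -
    have one: "z \<otimes>\<^bsub>TLQ n\<^esub> f_basis n (tab p) (tab a) =
          (\<beta> p \<odot>\<^bsub>TLQ n\<^esub> G p a) \<ominus>\<^bsub>TLQ n\<^esub> (\<delta> p \<odot>\<^bsub>TLQ n\<^esub> f_basis n (tab p) (tab a))
        \<longleftrightarrow> Lam n z * Fop n p a = \<beta> p *\<^sub>Q Lam n (G p a) - \<delta> p *\<^sub>Q Fop n p a" for p a
    proof
      assume "z \<otimes>\<^bsub>TLQ n\<^esub> f_basis n (tab p) (tab a) = (\<beta> p \<odot>\<^bsub>TLQ n\<^esub> G p a) \<ominus>\<^bsub>TLQ n\<^esub> (\<delta> p \<odot>\<^bsub>TLQ n\<^esub> f_basis n (tab p) (tab a))"
      from arg_cong[OF this, of "Lam n"] show "Lam n z * Fop n p a = \<beta> p *\<^sub>Q Lam n (G p a) - \<delta> p *\<^sub>Q Fop n p a"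
        unfolding rhs Lam_mult Fop_def .
    next
      assume h: "Lam n z * Fop n p a = \<beta> p *\<^sub>Q Lam n (G p a) - \<delta> p *\<^sub>Q Fop n p a"
      show "z \<otimes>\<^bsub>TLQ n\<^esub> f_basis n (tab p) (tab a) = (\<beta> p \<odot>\<^bsub>TLQ n\<^esub> G p a) \<ominus>\<^bsub>TLQ n\<^esub> (\<delta> p \<odot>\<^bsub>TLQ n\<^esub> f_basis n (tab p) (tab a))"
      proof (rule Lam_inj[OF TL_mult_closed])
        show "(\<beta> p \<odot>\<^bsub>TLQ n\<^esub> G p a) \<ominus>\<^bsub>TLQ n\<^esub> (\<delta> p \<odot>\<^bsub>TLQ n\<^esub> f_basis n (tab p) (tab a)) \<in> carrier (TLQ n)"
          unfolding G_def by (intro TL_minus_closed TL_smult_closed f_basis_carrier)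
        show "Lam n (z \<otimes>\<^bsub>TLQ n\<^esub> f_basis n (tab p) (tab a)) = Lam n ((\<beta> p \<odot>\<^bsub>TLQ n\<^esub> G p a) \<ominus>\<^bsub>TLQ n\<^esub> (\<delta> p \<odot>\<^bsub>TLQ n\<^esub> f_basis n (tab p) (tab a)))"
          using h unfolding rhs Lam_mult Fop_def .
      qed
    qed
    show ?thesis
    proof (rule conj_cong[OF refl], rule iffI)
      assume h: "\<forall>\<mu>\<in>Par2 n. \<forall>s\<in>Std n \<mu>. \<forall>a\<in>Std n \<mu>. z \<otimes>\<^bsub>TLQ n\<^esub> f_basis n s a =
          (klr_beta P n k s \<odot>\<^bsub>TLQ n\<^esub> f_basis n (swap_tab k s) a) \<ominus>\<^bsub>TLQ n\<^esub>
          ((klr_delta P k s * (1 / of_int (axial_dist s k))) \<odot>\<^bsub>TLQ n\<^esub> f_basis n s a)"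
      show "\<forall>p a. pr n p a \<longrightarrow> Lam n z * Fop n p a = \<beta> p *\<^sub>Q Lam n (G p a) - \<delta> p *\<^sub>Q Fop n p a"
      proof (intro allI impI)
        fix p a assume pa: "pr n p a"
        have P: "p \<in> Paths n" "a \<in> Paths n" "ht p = ht a" using pa by (simp_all add: pr_def)
        have c: "count_list p True + count_list p False = n" "count_list a True + count_list a False = n"
          using count_True_False[of p] count_True_False[of a] P by (simp_all add: Paths_def)
        have ab: "count_list a True = count_list p True" "count_list a False = count_list p False"
          using c ht_count[of p] ht_count[of a] P(3) by linarith+
        have "count_list p False \<le> count_list p True" using count_le P(1) by (simp add: Paths_def)
        then have mu: "two_columns (count_list p True) (count_list p False) \<in> Par2 n" using two_columns_Par2 c(1) by metis
        have "z \<otimes>\<^bsub>TLQ n\<^esub> f_basis n (tab p) (tab a) =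
          (\<beta> p \<odot>\<^bsub>TLQ n\<^esub> G p a) \<ominus>\<^bsub>TLQ n\<^esub> (\<delta> p \<odot>\<^bsub>TLQ n\<^esub> f_basis n (tab p) (tab a))"
          unfolding \<beta>_def \<delta>_def G_def
          using bspec[OF bspec[OF bspec[OF h mu] tab_Std[OF P(1)]], of "tab a"] tab_Std[OF P(2)] unfolding ab by blast
        then show "Lam n z * Fop n p a = \<beta> p *\<^sub>Q Lam n (G p a) - \<delta> p *\<^sub>Q Fop n p a" unfolding one .
      qed
    next
      assume h: "\<forall>p a. pr n p a \<longrightarrow> Lam n z * Fop n p a = \<beta> p *\<^sub>Q Lam n (G p a) - \<delta> p *\<^sub>Q Fop n p a"
      show "\<forall>\<mu>\<in>Par2 n. \<forall>s\<in>Std n \<mu>. \<forall>a\<in>Std n \<mu>. z \<otimes>\<^bsub>TLQ n\<^esub> f_basis n s a =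
          (klr_beta P n k s \<odot>\<^bsub>TLQ n\<^esub> f_basis n (swap_tab k s) a) \<ominus>\<^bsub>TLQ n\<^esub>
          ((klr_delta P k s * (1 / of_int (axial_dist s k))) \<odot>\<^bsub>TLQ n\<^esub> f_basis n s a)"
      proof (intro ballI)
        fix \<mu> s a assume m: "\<mu> \<in> Par2 n" "s \<in> Std n \<mu>" "a \<in> Std n \<mu>"
        have "z \<otimes>\<^bsub>TLQ n\<^esub> f_basis n (tab (word s n)) (tab (word a n)) =
          (\<beta> (word s n) \<odot>\<^bsub>TLQ n\<^esub> G (word s n) (word a n)) \<ominus>\<^bsub>TLQ n\<^esub>
          (\<delta> (word s n) \<odot>\<^bsub>TLQ n\<^esub> f_basis n (tab (word s n)) (tab (word a n)))"
          unfolding one using h Std_pr[OF m] by blast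
        then show "z \<otimes>\<^bsub>TLQ n\<^esub> f_basis n s a =
          (klr_beta P n k s \<odot>\<^bsub>TLQ n\<^esub> f_basis n (swap_tab k s) a) \<ominus>\<^bsub>TLQ n\<^esub>
          ((klr_delta P k s * (1 / of_int (axial_dist s k))) \<odot>\<^bsub>TLQ n\<^esub> f_basis n s a)"
          unfolding \<beta>_def \<delta>_def G_def Std_tab[OF m(1,2)] Std_tab[OF m(1,3)] .
      qed
    qed
  qed
  show ?thesis
  proof (rule ex1I[of _ X])
    show "?Q X" unfolding Q using Xc act by blast
    fix z assume "?Q z"
    then have z: "z \<in> carrier (TLQ n)" "\<And>p a. pr n p a \<Longrightarrow> Lam n z * Fop n p a = \<beta> p *\<^sub>Q Lam n (G p a) - \<delta> p *\<^sub>Q Fop n p a"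
      unfolding Q by blast+
    have "Lam n z * mu n p p = Lam n X * mu n p p" if p: "p \<in> Paths n" for p
    proof -
      have "(x p * y p) *\<^sub>Q (Lam n z * mu n p p) = (x p * y p) *\<^sub>Q (Lam n X * mu n p p)"
        using z(2)[OF pr_refl[OF p]] act[OF pr_refl[OF p]] unfolding F[OF pr_refl[OF p]] by simp
      then show ?thesis using scl_cancel x0[OF p] y0[OF p] by (metis mult_eq_0_iff)
    qed
    then have "(\<Sum>p\<in>Paths n. Lam n z * mu n p p) = (\<Sum>p\<in>Paths n. Lam n X * mu n p p)" by (intro sum.cong refl)
    then have "Lam n z = Lam n X"
      using mu_complete[OF unit_op_right[OF z(1)]] mu_complete[OF unit_op_right[OF Xc]] by metis
    then show "z = X" by (rule Lam_inj[OF z(1) Xc])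
  qed
qed

definition psiop :: "nat \<Rightarrow> nat \<Rightarrow> nat \<Rightarrow> lop" where
  "psiop P n k = Lam n (klr_psi P n k)"

lemma klr_psi_spec:
  assumes k: "1 \<le> k" "k < n"
  shows "klr_psi P n k \<in> carrier (TLQ n)"
    and "pr n p a \<Longrightarrow> psiop P n k * Fop n p a = klr_beta P n k (tab p) *\<^sub>Q Lam n (f_basis n (swap_tab k (tab p)) (tab a))
      - (klr_delta P k (tab p) * (1 / of_int (axial_dist (tab p) k))) *\<^sub>Q Fop n p a"
proof -
  note th = theI'[OF klr_psi_unique_ex[OF k, of P], folded klr_psi_def]
  show "klr_psi P n k \<in> carrier (TLQ n)" using th by blast
  assume pa: "pr n p a"
  have P: "p \<in> Paths n" "a \<in> Paths n" "ht p = ht a" using pa by (simp_all add: pr_def)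
  have c: "count_list p True + count_list p False = n" "count_list a True + count_list a False = n"
    using count_True_False[of p] count_True_False[of a] P by (simp_all add: Paths_def)
  have ab: "count_list a True = count_list p True" "count_list a False = count_list p False"
    using c ht_count[of p] ht_count[of a] P(3) by linarith+
  have "count_list p False \<le> count_list p True" using count_le P(1) by (simp add: Paths_def)
  then have mu: "two_columns (count_list p True) (count_list p False) \<in> Par2 n" using two_columns_Par2 c(1) by metis
  have "klr_psi P n k \<otimes>\<^bsub>TLQ n\<^esub> f_basis n (tab p) (tab a) =
          (klr_beta P n k (tab p) \<odot>\<^bsub>TLQ n\<^esub> f_basis n (swap_tab k (tab p)) (tab a)) \<ominus>\<^bsub>TLQ n\<^esub>
          ((klr_delta P k (tab p) * (1 / of_int (axial_dist (tab p) k))) \<odot>\<^bsub>TLQ n\<^esub> f_basis n (tab p) (tab a))"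
    using bspec[OF bspec[OF bspec[OF conjunct2[OF th] mu] tab_Std[OF P(1)]], of "tab a"] tab_Std[OF P(2)] unfolding ab by blast
  from arg_cong[OF this, of "Lam n"] show "psiop P n k * Fop n p a = klr_beta P n k (tab p) *\<^sub>Q Lam n (f_basis n (swap_tab k (tab p)) (tab a))
      - (klr_delta P k (tab p) * (1 / of_int (axial_dist (tab p) k))) *\<^sub>Q Fop n p a"
    unfolding Lam_mult Lam_minus[OF TL_smult_closed[OF f_basis_carrier]] Lam_smult Fop_def psiop_def .
qed

text \<open>One column of the seminormal basis, extended by zero as \<open>klr_action\<close>
  requires.\<close>

definition vop :: "nat \<Rightarrow> bool list \<Rightarrow> bool list \<Rightarrow> lop" where
  "vop n a p = (if pr n p a then Fop n p a else 0)"

lemma klr_action_vop: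
  assumes "odd P" and "3 \<le> P"
  shows "klr_action P n (vop n a) (psiop P n)"
proof
  show "odd P" "3 \<le> P" by fact+
  show "vop n a q = 0" if "\<not> valid q" for q using that by (simp add: vop_def pr_def Paths_def)
next
  fix xs b ys assume p: "xs @ b # b # ys \<in> Paths n"
  let ?k = "Suc (length ys)"
  have k: "1 \<le> ?k" "?k < n" using p by (auto simp: Paths_def)
  show "psiop P n ?k * vop n a (xs @ b # b # ys) = 0"
  proof (cases "pr n (xs @ b # b # ys) a")
    case True
    have "klr_beta P n ?k (tab (xs @ b # b # ys)) = 0"
      using swap_same_not_StdPar2[OF p] by (simp add: klr_beta_def Let_def)
    moreover have "klr_delta P ?k (tab (xs @ b # b # ys)) = 0"
    proof -
      have "\<not> [1 = 0] (mod int P)" using assms(2) by (simp add: cong_0_iff)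
      then show ?thesis by (simp add: klr_delta_def axial_dist_tab)
    qed
    ultimately show ?thesis using klr_psi_spec(2)[OF k True] True by (simp add: vop_def)
  qed (simp add: vop_def)
next
  fix xs b ys assume p: "xs @ (\<not> b) # b # ys \<in> Paths n"
  let ?k = "Suc (length ys)" and ?p = "xs @ (\<not> b) # b # ys" and ?q = "xs @ b # (\<not> b) # ys"
  have k: "1 \<le> ?k" "?k < n" using p by (auto simp: Paths_def)
  have sw: "swap_tab ?k (tab ?p) = tab ?q" by (rule swap_tab_tab) simp
  show "psiop P n ?k * vop n a ?p = swap_coeff P b (ht ys) *\<^sub>Q vop n a ?q + stay_coeff P b (ht ys) *\<^sub>Q vop n a ?p"
  proof (cases "pr n ?p a")
    case True
    have "psiop P n ?k * Fop n ?p a = (if valid ?q then swap_coeff P b (ht ys) else 0) *\<^sub>Q Fop n ?q a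
        - (- stay_coeff P b (ht ys)) *\<^sub>Q Fop n ?p a"
      using klr_psi_spec(2)[OF k True, of P] unfolding sw klr_beta_tab[OF p] klr_delta_tab Fop_def[of n ?q] .
    moreover have "pr n ?q a \<longleftrightarrow> valid ?q" using True by (simp add: pr_def Paths_def ht_append)
    ultimately show ?thesis using True by (simp add: vop_def scl_minus_left)
  next
    case False
    have "ht ?q = ht ?p" by (simp add: ht_append)
    then have "\<not> pr n ?q a" using False p unfolding pr_def by metis
    then show ?thesis using False by (simp add: vop_def)
  qed
qed

section \<open>The residue class of the one-column tableau\<close>

text \<open>After T up and F down steps the next entry has content -T or 1 - F, against -(T + F) in
  the one-column tableau. The differences F and T + 1 have to be divisible by
  \<open>p\<close>.\<close>

primrec cls :: "nat \<Rightarrow> bool list \<Rightarrow> bool" where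
  "cls p [] = True"
| "cls p (b # q) = (cls p q \<and> (if b then p dvd count_list q False else p dvd count_list q True + 1))"

definition blocks :: "nat \<Rightarrow> bool list \<Rightarrow> bool list" where
  "blocks p bs = concat (map (replicate p) bs)"

lemma blocks_simps [simp]: "blocks p [] = []" "blocks p (b # bs) = replicate p b @ blocks p bs"
  by (simp_all add: blocks_def)

lemma blocks_append: "blocks p (bs @ cs) = blocks p bs @ blocks p cs"
  by (simp add: blocks_def)

lemma length_blocks [simp]: "length (blocks p bs) = p * length bs"
  by (induction bs) simp_all

lemma ht_blocks: "ht (blocks p bs) = int p * ht bs"
  by (induction bs) (simp_all add: ht_append algebra_simps)

lemma count_replicate: "count_list (replicate k c) b = (if c = b then k else 0)"
  by (induction k) auto

lemma count_blocks: "count_list (blocks p bs) b = p * count_list bs b"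
  by (induction bs) (auto simp: count_list_append count_replicate)

lemma cls_cong:
  "cls p q \<longleftrightarrow> (\<forall>xs b ys. q = xs @ b # ys \<longrightarrow> (if b then p dvd count_list ys False else p dvd count_list ys True + 1))"
proof (induction q)
  case (Cons c q)
  have AB: "(\<forall>xs b ys. c # q = xs @ b # ys \<longrightarrow> (if b then p dvd count_list ys False else p dvd count_list ys True + 1)) \<longleftrightarrow>
    (if c then p dvd count_list q False else p dvd count_list q True + 1) \<and>
    (\<forall>xs b ys. q = xs @ b # ys \<longrightarrow> (if b then p dvd count_list ys False else p dvd count_list ys True + 1))"
    (is "?A \<longleftrightarrow> ?B \<and> ?C")
  proof
    assume A: ?A
    have ?B using A[rule_format, of "[]" c q] by simp
    moreover have ?C
    proof (intro allI impI)
      fix xs b ys assume "q = xs @ b # ys"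
      then have "c # q = (c # xs) @ b # ys" by simp
      then show "if b then p dvd count_list ys False else p dvd count_list ys True + 1" using A by blast
    qed
    ultimately show "?B \<and> ?C" ..
  next
    assume BC: "?B \<and> ?C"
    show ?A
    proof (intro allI impI)
      fix xs b ys assume e: "c # q = xs @ b # ys"
      show "if b then p dvd count_list ys False else p dvd count_list ys True + 1"
      proof (cases xs)
        case Nil
        then have "c = b" "q = ys" using e by simp_all
        then show ?thesis using conjunct1[OF BC] by (simp only:)
      next
        case (Cons x xs')
        then have "q = xs' @ b # ys" using e by simp
        then show ?thesis using BC by blast
      qed
    qed
  qed
  show ?case unfolding cls.simps Cons.IH by (rule trans[OF conj_commute AB[symmetric]])
qed simp

lemma col_class_tab:
  assumes q: "q \<in> Paths n"
  shows "tab q \<in> col_class p n \<longleftrightarrow> cls p q"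
proof -
  have l: "length q = n" using q by (simp add: Paths_def)
  have one: "[content (tab q) i = content (one_column n) i] (mod int p) \<longleftrightarrow>
      (if b then p dvd count_list ys False else p dvd count_list ys True + 1)"
    if e: "q = xs @ b # ys" "i = Suc (length ys)" for i xs b ys
  proof -
    have len: "count_list ys True + count_list ys False = length ys" by (rule count_True_False)
    have i: "i \<in> {1..n}" using e l by simp
    have c1: "content (one_column n) i = - int (length ys)" using i by (simp add: content_def one_column_def e(2))
    have c2: "content (tab q) i = step_content b ys" unfolding e by (rule content_tab)
    show ?thesis
    proof (cases b)
      case True
      have "step_content b ys - - int (length ys) = int (count_list ys False)"
        using True len by (simp add: step_content_def)
      then show ?thesis using True unfolding c1 c2 cong_iff_dvd_diff by (simp only: if_True int_dvd_int_iff)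
    next
      case False
      have "step_content b ys - - int (length ys) = int (count_list ys True + 1)"
        using False len by (simp add: step_content_def)
      then show ?thesis using False unfolding c1 c2 cong_iff_dvd_diff by (simp only: if_False int_dvd_int_iff)
    qed
  qed
  have "tab q \<in> col_class p n \<longleftrightarrow> (\<forall>i\<in>{1..n}. [content (tab q) i = content (one_column n) i] (mod int p))"
    using tab_StdPar2[OF q] by (simp add: col_class_def)
  also have "\<dots> \<longleftrightarrow> cls p q"
  proof
    assume h: "\<forall>i\<in>{1..n}. [content (tab q) i = content (one_column n) i] (mod int p)"
    show "cls p q" unfolding cls_cong
    proof (intro allI impI)
      fix xs b ys assume e: "q = xs @ b # ys"
      then have "Suc (length ys) \<in> {1..n}" using l by simp
      then show "if b then p dvd count_list ys False else p dvd count_list ys True + 1" using h one[OF e refl] by blast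
    qed
  next
    assume h: "cls p q"
    show "\<forall>i\<in>{1..n}. [content (tab q) i = content (one_column n) i] (mod int p)"
    proof
      fix i assume i: "i \<in> {1..n}"
      obtain xs b ys where e: "q = xs @ b # ys" "i = Suc (length ys)" by (rule split_path[OF l i])
      show "[content (tab q) i = content (one_column n) i] (mod int p)"
        using h e(1) unfolding one[OF e] cls_cong by blast
    qed
  qed
  finally show ?thesis .
qed

lemma cls_replicate:
  assumes "cls p W" and "p dvd count_list W True + 1" and "p dvd count_list W False" and "k \<le> p"
  shows "cls p (replicate k b @ W)"
proof (cases b)
  case True
  then show ?thesis using assms by (induction k) (simp_all add: count_list_append count_replicate)
next
  case False
  then show ?thesis using assms by (induction k) (simp_all add: count_list_append count_replicate)
qed

lemma count_block_word:
  assumes "1 \<le> p"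
  shows "count_list (blocks p bs @ replicate (p - 1) True) True + 1 = p * (count_list bs True + 1)"
    and "count_list (blocks p bs @ replicate (p - 1) True) False = p * count_list bs False"
  using assms by (simp_all add: count_list_append count_replicate count_blocks algebra_simps)

lemma cls_block_word:
  assumes "1 \<le> p"
  shows "cls p (blocks p bs @ replicate (p - 1) True)"
proof (induction bs)
  case Nil
  have "cls p (replicate k True)" for k by (induction k) (simp_all add: count_replicate)
  then show ?case by simp
next
  case (Cons b bs)
  have "cls p (replicate p b @ (blocks p bs @ replicate (p - 1) True))"
    by (rule cls_replicate[OF Cons]) (use count_block_word[OF assms, of bs] in simp_all)
  then show ?case by simp
qed

lemma cls_blockform:
  assumes "r \<le> p" and "1 \<le> p"
  shows "cls p (replicate r c @ blocks p bs @ replicate (p - 1) True)"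
  by (rule cls_replicate[OF cls_block_word[OF assms(2)]]) (use count_block_word[OF assms(2), of bs] assms(1) in simp_all)

lemma ht_block_word: "1 \<le> p \<Longrightarrow> ht (blocks p bs @ replicate (p - 1) True) = int p * (ht bs + 1) - 1"
  by (simp add: ht_append ht_blocks of_nat_diff algebra_simps)

lemma valid_blocks:
  assumes "1 \<le> p" and "valid (blocks p bs @ replicate (p - 1) True)"
  shows "valid bs"
  using assms(2)
proof (induction bs)
  case (Cons b bs)
  have "0 \<le> ht (blocks p (b # bs) @ replicate (p - 1) True)" using ht_nonneg[OF Cons.prems] .
  then have "0 < int p * (ht (b # bs) + 1)" unfolding ht_block_word[OF assms(1)] by simp
  then have "0 < ht (b # bs) + 1" by (simp only: zero_less_mult_iff) auto
  moreover have "valid (replicate p b @ (blocks p bs @ replicate (p - 1) True))" using Cons.prems by simp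
  then have "valid bs" using Cons.IH valid_appendD by blast
  ultimately show ?case by simp
qed simp

text \<open>Within so few steps the number of up steps plus one stays below \<open>p\<close>, so no
  down step is admissible.\<close>

lemma cls_short:
  assumes "cls p q" and "valid q" and "length q < p"
  shows "q = replicate (length q) True"
  using assms
proof (induction q)
  case (Cons b q)
  have q: "q = replicate (length q) True" using Cons by simp
  then have c: "count_list q True = length q" using count_replicate[of "length q" True True] by metis
  show ?case
  proof (cases b)
    case True
    then show ?thesis using q by simp
  next
    case False
    then have "p dvd length q + 1" using Cons.prems(1) c by simp
    then show ?thesis using Cons.prems(3) by (auto dest: dvd_imp_le)
  qed
qed simp

text \<open>Inside a block, after r' steps in direction c with 0 < r' < p, the count deciding about
  the opposite step is r' modulo \<open>p\<close>; so the direction cannot change. It is free only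
  at lengths p - 1 modulo \<open>p\<close>.\<close>

lemma cls_structure:
  assumes p: "2 \<le> p" and "cls p q" and "valid q" and "length q = (p - 1) + p * N + r" and "r < p"
  shows "\<exists>c bs. length bs = N \<and> q = replicate r c @ blocks p bs @ replicate (p - 1) True"
  using assms(2-)
proof (induction q arbitrary: N r)
  case Nil
  then show ?case using p by simp
next
  case (Cons b q)
  have q: "cls p q" "valid q" using Cons.prems by simp_all
  have bq: "if b then p dvd count_list q False else p dvd count_list q True + 1" using conjunct2[OF Cons.prems(1)[unfolded cls.simps]] .
  show ?case
  proof (cases r)
    case (Suc r')
    obtain c bs where cb: "length bs = N" "q = replicate r' c @ blocks p bs @ replicate (p - 1) True"
    proof -
      have "length q = p - 1 + p * N + r'" "r' < p" using Cons.prems(3,4) Suc by simp_all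
      then show ?thesis using Cons.IH[OF q] that by blast
    qed
    show ?thesis
    proof (cases "r' = 0")
      case True
      then have "b # q = replicate r b @ blocks p bs @ replicate (p - 1) True" using cb Suc by simp
      then show ?thesis using cb(1) by blast
    next
      case False
      have "count_list q True + 1 = (if c then r' else 0) + p * (count_list bs True + 1)"
        "count_list q False = (if c then 0 else r') + p * count_list bs False"
        unfolding cb(2) count_list_append[of "replicate r' c"] using count_block_word[of p bs] p
        by (simp_all add: count_replicate)
      moreover have "\<not> p dvd r'" using False Cons.prems Suc by (auto dest: dvd_imp_le)
      ultimately have "b = c" using bq by (cases b; cases c) (simp_all add: dvd_add_left_iff)
      then have "b # q = replicate r b @ blocks p bs @ replicate (p - 1) True" using cb Suc by simp
      then show ?thesis using cb(1) by blast
    qed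
  next
    case 0
    show ?thesis
    proof (cases N)
      case 0
      then have "length (b # q) = p - 1" using Cons.prems \<open>r = 0\<close> by simp
      moreover have "b # q = replicate (length (b # q)) True"
        by (rule cls_short[OF Cons.prems(1,2)]) (use calculation p in simp)
      ultimately have "b # q = replicate r b @ blocks p [] @ replicate (p - 1) True" using \<open>r = 0\<close> by simp
      then show ?thesis using 0 by blast
    next
      case (Suc N')
      \<comment> \<open>The step \<open>b\<close> completes a block; without it the remainder is
        \<open>p - 1\<close>.\<close>
      have "length q = p - 1 + p * N' + (p - 1)" using Cons.prems \<open>r = 0\<close> Suc p by simp
      then obtain c bs where cb: "length bs = N'" "q = replicate (p - 1) c @ blocks p bs @ replicate (p - 1) True"
      proof -
        have "p - 1 < p" using p by simp
        then show ?thesis using Cons.IH[OF q \<open>length q = _\<close>] that by blast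
      qed
      have "count_list q True + 1 = (if c then p - 1 else 0) + p * (count_list bs True + 1)"
        "count_list q False = (if c then 0 else p - 1) + p * count_list bs False"
        unfolding cb(2) count_list_append[of "replicate (p - 1) c"] using count_block_word[of p bs] p
        by (simp_all add: count_replicate)
      moreover have "\<not> p dvd p - 1" using p by (auto dest: dvd_imp_le)
      ultimately have "b = c" using bq by (cases b; cases c) (simp_all add: dvd_add_left_iff)
      moreover have "replicate p b = b # replicate (p - 1) b" using p by (metis Suc_diff_1 replicate_Suc not_numeral_le_zero not_gr_zero)
      ultimately have "b # q = replicate r b @ blocks p (b # bs) @ replicate (p - 1) True" using cb \<open>r = 0\<close> by simp
      moreover have "length (b # bs) = N" using cb Suc by simp
      ultimately show ?thesis by blast
    qed
  qed
qed

text \<open>The condition in \<open>f_map\<close> fixes the direction of every step, and a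
  two-column tableau is determined by its word; so the described tableau is unique.\<close>

lemma f_map_blocks:
  assumes p: "1 \<le> p" and q: "q \<in> Paths n" "q = replicate r c @ blocks p bs @ replicate (p - 1) True"
  shows "f_map p (length bs) (tab q) = tab bs"
proof -
  have "valid (blocks p bs @ replicate (p - 1) True)" using q valid_appendD by (auto simp: Paths_def)
  then have bs: "bs \<in> Paths (length bs)" using valid_blocks[OF p] by (simp add: Paths_def)
  have key: "snd (tab bs j) = 1 \<longleftrightarrow> (\<forall>b\<in>block p j. snd (tab q b) = 1)" if j: "j \<in> {1..length bs}" for j
  proof -
    obtain cs d ds where e: "bs = cs @ d # ds" "j = Suc (length ds)" by (rule split_path[OF refl j])
    have 1: "snd (tab bs j) = (if d then 1 else 2)" unfolding e by (simp add: tab_step)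
    have 2: "snd (tab q i) = (if d then 1 else 2)" if i: "i \<in> block p j" for i
    proof -
      define t where "t = i - j * p"
      have t: "t < p" "i = j * p + t" using i p by (auto simp: block_def t_def)
      let ?Y = "replicate t d @ blocks p ds @ replicate (p - 1) True"
      have "replicate p d = replicate (p - Suc t) d @ d # replicate t d"
        using t(1) by (simp flip: replicate_Suc replicate_add)
      then have "q = (replicate r c @ blocks p cs @ replicate (p - Suc t) d) @ d # ?Y"
        unfolding q(2) e(1) by (simp add: blocks_append)
      moreover have "i = Suc (length ?Y)" using t p e(2) by (simp add: algebra_simps)
      ultimately show ?thesis by (simp only: tab_step snd_conv)
    qed
    have "j * p \<in> block p j" using p by (simp add: block_def)
    then show ?thesis using 1 2 by (cases d) auto
  qed
  show ?thesis unfolding f_map_def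
  proof (rule the_equality)
    show "tab bs \<in> StdPar2 (length bs) \<and> (\<forall>j\<in>{1..length bs}. snd (tab bs j) = 1 \<longleftrightarrow> (\<forall>b\<in>block p j. snd (tab q b) = 1))"
      using tab_StdPar2[OF bs] key by blast
    fix v assume v: "v \<in> StdPar2 (length bs) \<and> (\<forall>j\<in>{1..length bs}. snd (v j) = 1 \<longleftrightarrow> (\<forall>b\<in>block p j. snd (tab q b) = 1))"
    have "word v m = word (tab bs) m" if "m \<le> length bs" for m
      using that
    proof (induction m)
      case (Suc m)
      have "snd (v (Suc m)) = 1 \<longleftrightarrow> snd (tab bs (Suc m)) = 1" using v key[of "Suc m"] Suc.prems by simp
      then show ?case using Suc by simp
    qed simp
    then have "word v (length bs) = bs" using word_tab[OF bs] by simp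
    then show "v = tab bs" using StdPar2_tab(1) v by metis
  qed
qed

context klr_action
begin

text \<open>The diamond as an operator over a base of length \<open>l\<close>, kept apart from
  \<open>klr_diamond\<close> so that it can also be applied to two equal blocks.\<close>

definition diamond :: "nat \<Rightarrow> 'a \<Rightarrow> 'a" where
  "diamond l x = foldr (\<lambda>j y. act (pos (l + p - j) j) y) ([1..<Suc p] @ rev [1..<p]) x"

lemma foldr_act_0: "foldr (\<lambda>j y. act (pos (l + p - j) j) y) ks 0 = 0"
  by (induction ks) simp_all

lemma diamond_0: "diamond l 0 = 0"
  unfolding diamond_def by (rule foldr_act_0)

text \<open>The first factor to act is the single generator at the boundary of the blocks, where the
  two steps coincide.\<close>

lemma diamond_same:
  assumes "xs @ replicate p b @ replicate p b @ ys \<in> Paths n"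
  shows "diamond (length ys) (v (xs @ replicate p b @ replicate p b @ ys)) = 0"
proof -
  obtain k where p: "p = Suc k" using p3 by (cases p) auto
  let ?Y = "replicate k b @ ys"
  have e: "xs @ replicate p b @ replicate p b @ ys = (xs @ replicate k b) @ b # b # ?Y"
    unfolding p by (simp add: replicate_append_same[symmetric])
  have "psi (Suc (length ?Y)) * v ((xs @ replicate k b) @ b # b # ?Y) = 0"
    by (rule psi_same) (use assms e in simp)
  then have s: "act (pos (length ys + p - 1) 1) (v (xs @ replicate p b @ replicate p b @ ys)) = 0"
    unfolding e by (simp add: p pos_Suc add.commute)
  have "rev [1..<p] = rev [2..<p] @ [1]" using p3 by (simp add: upt_conv_Cons numeral_2_eq_2)
  then show ?thesis unfolding diamond_def using s by (simp add: foldr_act_0 del: upt_Suc)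
qed

end

context klr_diamond
begin

lemma diamond_v:
  assumes "state b 0 \<in> Paths n"
  shows "diamond (length ys) (v (state b 0)) = swap_val b *\<^sub>Q v (state (\<not> b) 0) + stay_val b *\<^sub>Q v (state b 0)"
  using dia_v[OF assms] unfolding dia_def diamond_def step_def[abs_def] .

end

section \<open>The small Jucys-Murphy elements\<close>

lemma e_idem:
  "e_idem p n \<in> carrier (TLQ n) \<and> Lam n (e_idem p n) = (\<Sum>q | q \<in> Paths n \<and> cls p q. mu n q q)"
proof -
  let ?A = "{q. q \<in> Paths n \<and> cls p q}"
  have fin: "finite ?A" by simp
  have "col_class p n \<subseteq> tab ` Paths n" unfolding StdPar2_eq[symmetric] by (auto simp: col_class_def)
  then have cc: "col_class p n = tab ` ?A" using col_class_tab[of _ n p] by blast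
  have inj: "inj_on tab ?A" by (rule inj_on_subset[OF inj_tab]) blast
  have "(\<Sum>s\<in>col_class p n. Lam n (idem n s)) = (\<Sum>q\<in>?A. Lam n (idem n (tab q)))"
    unfolding cc by (simp add: sum.reindex[OF inj])
  also have "\<dots> = (\<Sum>q\<in>?A. mu n q q)" by (rule sum.cong[OF refl]) (simp add: Lam_idem)
  finally show ?thesis
    using Lam_finsum[of "col_class p n" "idem n" n] fin idem_carrier unfolding e_idem_def cc by simp
qed

lemma e_idem_mu:
  assumes "pr n q a"
  shows "Lam n (e_idem p n) * mu n q a = (if cls p q then mu n q a else 0)"
proof -
  let ?A = "{q. q \<in> Paths n \<and> cls p q}"
  have q: "q \<in> Paths n" using assms by (simp add: pr_def)
  have "Lam n (e_idem p n) * mu n q a = (\<Sum>r\<in>?A. mu n r r * mu n q a)"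
    using e_idem[of p n] by (simp add: sum_distrib_right)
  also have "\<dots> = (\<Sum>r\<in>?A. if r = q then mu n q a else 0)"
  proof (rule sum.cong[OF refl])
    fix r assume "r \<in> ?A"
    then have "r \<in> Paths n" by simp
    then show "mu n r r * mu n q a = (if r = q then mu n q a else 0)"
      using mu_mult[OF pr_refl assms, of r] by simp
  qed
  also have "\<dots> = (if cls p q then mu n q a else 0)" using q by (simp add: sum.delta)
  finally show ?thesis .
qed

lemma e_idem_vop: "Lam n (e_idem p n) * vop n a q = (if cls p q then vop n a q else 0)"
proof (cases "pr n q a")
  case True
  obtain x y where "Fop n q a = (x q * y a) *\<^sub>Q mu n q a" using Fop_mu[of n] True by blast
  then show ?thesis using e_idem_mu[OF True, of p] True by (simp add: vop_def)
qed (simp add: vop_def)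

lemma frakL_Suc:
  assumes "i \<noteq> 0"
  shows "Lam n (frakL p n (Suc i)) = (Lam n (bigU p n i) - Lam n (e_idem p n)) * Lam n (frakL p n i)
      * (Lam n (bigU p n i) - Lam n (e_idem p n)) + (Lam n (bigU p n i) - Lam n (e_idem p n))"
  using assms e_idem[of p n] by (simp add: Let_def Lam_plus Lam_mult Lam_minus)

lemma frakL_carrier: "frakL p n i \<in> carrier (TLQ n)"
proof (induction i)
  case (Suc i)
  show ?case using e_idem[of p n]
    by (simp add: Let_def TL_zero_closed TL_add_closed TL_mult_closed TL_minus_closed bigU_def list_prod_closed)
qed (simp add: TL_zero_closed)

section \<open>The small Temperley-Lieb generators on block paths\<close>

locale class_action =
  fixes p n N r :: nat and a :: "bool list"
  assumes p_odd: "odd p" and p_ge: "3 \<le> p" and n: "n = (p - 1) + (p * N + r)" and r: "r < p"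
begin

sublocale klr_action p n "vop n a" "psiop p n"
  by (rule klr_action_vop[OF p_odd p_ge])

abbreviation E :: lop where
  "E \<equiv> Lam n (e_idem p n)"

text \<open>The general form of a class path by \<open>cls_structure\<close>. The incomplete last
  block lies beyond all steps touched by the elements \<open>bigU\<close>.\<close>

definition shp :: "bool \<Rightarrow> bool list \<Rightarrow> bool list" where
  "shp c bs = replicate r c @ blocks p bs @ replicate (p - 1) True"

lemma E_shp: "E * vop n a (shp c bs) = vop n a (shp c bs)"
  using cls_blockform[of r p c bs] r p_ge unfolding e_idem_vop shp_def by simp

text \<open>\<open>list_prod\<close> ends in the unit, which the last factor absorbs; an empty
  product would leave the projection \<open>unit_op n\<close> in front of \<open>y\<close>.\<close>

lemma act_prod:
  assumes "ks \<noteq> []" and "\<And>k. k \<in> set ks \<Longrightarrow> 1 \<le> k \<and> k < n"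
  shows "foldr (\<lambda>x y. Lam n x * y) (map (klr_psi p n) ks) (unit_op n) * y = act ks y"
  using assms
proof (induction ks)
  case (Cons k ks)
  have u: "Lam n (klr_psi p n k) * unit_op n = psiop p n k"
    using Cons.prems(2)[of k] unit_op_right[OF klr_psi_spec(1)] by (simp add: psiop_def)
  show ?case
  proof (cases "ks = []")
    case True
    then show ?thesis using u by simp
  next
    case False
    have "foldr (\<lambda>x y. Lam n x * y) (map (klr_psi p n) ks) (unit_op n) * y = act ks y"
      by (rule Cons.IH[OF False]) (use Cons.prems(2) in simp)
    moreover have "Lam n (klr_psi p n k) = psiop p n k" by (simp add: psiop_def)
    ultimately show ?thesis by (simp add: mult.assoc)
  qed
qed simp

lemma Psi_act:
  assumes j: "1 \<le> j" "j \<le> p" and i: "1 \<le> i" "Suc i \<le> N"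
  shows "Lam n (Psi p n i j) * y = act (pos (i * p - 1 + p - j) j) y"
proof -
  have ip: "1 \<le> i * p" using i p_ge by simp
  have "p * (i + 1) \<le> p * N" using i by (intro mult_le_mono) simp_all
  then have N: "i * p + p \<le> p * N" by (simp add: algebra_simps)
  \<comment> \<open>The number of steps before the two blocks is \<open>i * p - 1\<close>, and
    \<open>p - j\<close> further steps lie below the zigzag of row \<open>j\<close>.\<close>
  have pos: "pos (i * p - 1 + p - j) j = map (\<lambda>m. (i + 1) * p - 1 + 1 + 2 * m - j) [0..<j]"
    unfolding pos_def
  proof (rule map_cong[OF refl])
    fix m
    have "(i + 1) * p = i * p + p" by simp
    then show "Suc (i * p - 1 + p - j + 2 * m) = (i + 1) * p - 1 + 1 + 2 * m - j" using ip j by linarith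
  qed
  have range: "1 \<le> k \<and> k < n" if k: "k \<in> set (pos (i * p - 1 + p - j) j)" for k
  proof -
    obtain m where m: "m < j" "k = Suc (i * p - 1 + p - j + 2 * m)" using k by (auto simp: pos_def)
    then show ?thesis using ip j N n p_ge by linarith
  qed
  have ne: "pos (i * p - 1 + p - j) j \<noteq> []" using j(1) by (simp add: pos_def)
  have "Psi p n i j = list_prod (TLQ n) (map (klr_psi p n) (pos (i * p - 1 + p - j) j))"
    unfolding pos Psi_def Let_def by (simp add: comp_def)
  then show ?thesis using act_prod[OF ne range] by (simp add: Lam_list_prod)
qed

lemma bigU_act:
  assumes i: "1 \<le> i" "Suc i \<le> N"
  shows "Lam n (bigU p n i) * x = E * diamond (i * p - 1) (E * x)"
proof -
  have F: "foldr (\<lambda>x y. Lam n x * y) (map (Psi p n i) js) z = foldr (\<lambda>j y. act (pos (i * p - 1 + p - j) j) y) js z"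
    if "\<And>j. j \<in> set js \<Longrightarrow> 1 \<le> j \<and> j \<le> p" for js z
    using that by (induction js) (simp_all add: Psi_act[OF _ _ i])
  have "Lam n (bigU p n i) = E * foldr (\<lambda>x y. Lam n x * y) (map (Psi p n i) ([1..<Suc p] @ rev [1..<p])) E"
    using unit_op_right[of "e_idem p n" n] e_idem[of p n] unfolding bigU_def Lam_list_prod by (simp del: upt_Suc)
  also have "\<dots> * x = E * foldr (\<lambda>x y. Lam n x * y) (map (Psi p n i) ([1..<Suc p] @ rev [1..<p])) (E * x)"
    unfolding mult.assoc foldr_Lam_mult ..
  also have "\<dots> = E * diamond (i * p - 1) (E * x)"
    unfolding diamond_def by (subst F) auto
  finally show ?thesis .
qed

lemma bigU_same:
  assumes i: "Suc (length bs) < N" and l: "length cs + length bs + 2 = N"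
    and q: "valid (shp c (cs @ b # b # bs))"
  shows "Lam n (bigU p n (Suc (length bs))) * vop n a (shp c (cs @ b # b # bs)) = 0"
proof -
  let ?ys = "blocks p bs @ replicate (p - 1) True" and ?xs = "replicate r c @ blocks p cs"
  have e: "shp c (cs @ b # b # bs) = ?xs @ replicate p b @ replicate p b @ ?ys"
    by (simp add: shp_def blocks_append)
  have len: "length ?ys = Suc (length bs) * p - 1" using p_ge by (simp add: algebra_simps)
  have "length (shp c (cs @ b # b # bs)) = n" unfolding n l[symmetric] shp_def using p_ge by (simp add: algebra_simps)
  then have P: "?xs @ replicate p b @ replicate p b @ ?ys \<in> Paths n" using q unfolding e Paths_def by simp
  show ?thesis
    using bigU_act[of "Suc (length bs)"] i E_shp[of c "cs @ b # b # bs"] diamond_same[OF P]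
    unfolding len e by simp
qed

text \<open>Subtracting \<open>e_idem\<close> turns the diagonal entries 1 + 1/m and 1 - 1/m into
  1/m and -1/m, with m = ht bs + 1, and \<open>swap_val\<close> makes the result an involution. If
  the exchanged blocks form no path, the second vector is zero and \<open>d = 1\<close> gives the
  claim.\<close>

lemma bigU_swap:
  assumes i: "Suc (length bs) < N" and l: "length cs + length bs + 2 = N"
    and q: "valid (shp c (cs @ (\<not> b) # b # bs))" and bs: "valid bs"
  defines "d \<equiv> (if b then rat_of_int (ht bs + 1) else - rat_of_int (ht bs + 1))"
    and "S \<equiv> Lam n (bigU p n (Suc (length bs))) - E"
    and "v1 \<equiv> vop n a (shp c (cs @ (\<not> b) # b # bs))"
    and "v2 \<equiv> vop n a (shp c (cs @ b # (\<not> b) # bs))"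
  shows "d \<noteq> 0 \<and> (\<exists>s. S * v1 = (1 / d) *\<^sub>Q v1 + s *\<^sub>Q v2) \<and> S * (S * v1) = v1"
proof -
  let ?ys = "blocks p bs @ replicate (p - 1) True" and ?xs = "replicate r c @ blocks p cs"
  define m where "m = ht bs + 1"
  have m1: "1 \<le> m" using ht_nonneg[OF bs] by (simp add: m_def)
  have hys: "ht ?ys = int p * m - 1" unfolding m_def by (rule ht_block_word) (use p_ge in simp)
  have e: "shp c (cs @ x # y # bs) = ?xs @ replicate p x @ replicate p y @ ?ys" for x y
    by (simp add: shp_def blocks_append)
  have len: "length ?ys = Suc (length bs) * p - 1" using p_ge by (simp add: algebra_simps)
  have ls: "length (shp c (cs @ x # y # bs)) = n" for x y
    unfolding n l[symmetric] shp_def using p_ge by (simp add: algebra_simps)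
  have v1': "valid (?xs @ replicate p (\<not> b) @ replicate p b @ ?ys)" using q unfolding e .
  have vys: "valid ?ys"
    using valid_appendD[of "?xs @ replicate p (\<not> b) @ replicate p b" ?ys] v1' by simp
  interpret D: klr_diamond p n "vop n a" "psiop p n" ?xs ?ys m
  proof
    show "1 \<le> m" by (rule m1)
    show "ht ?ys = int p * m - 1" by (rule hys)
    show "valid ?ys" by (rule vys)
    show "valid (?xs @ q')" if "valid q'" "ht q' = ht ?ys" for q'
      by (rule valid_append_cong[OF v1' that(1)]) (use that(2) in \<open>simp add: ht_append\<close>)
    show "length ?xs + 2 * p + length ?ys = n" using ls[of b b] unfolding e by simp
  qed
  have st: "D.state b' 0 = shp c (cs @ (\<not> b') # b' # bs)" for b' unfolding e D.state_def by simp
  have U: "S * vop n a (D.state b' 0) = D.swap_val b' *\<^sub>Q vop n a (D.state (\<not> b') 0) + (D.stay_val b' - 1) *\<^sub>Q vop n a (D.state b' 0)"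
    if "D.state b' 0 \<in> Paths n" for b'
  proof -
    have Es: "E * vop n a (D.state b'' 0) = vop n a (D.state b'' 0)" for b'' unfolding st by (rule E_shp)
    have "Lam n (bigU p n (Suc (length bs))) * vop n a (D.state b' 0) = E * diamond (length ?ys) (E * vop n a (D.state b' 0))"
      unfolding len by (rule bigU_act) (use i in simp_all)
    also have "\<dots> = D.swap_val b' *\<^sub>Q vop n a (D.state (\<not> b') 0) + D.stay_val b' *\<^sub>Q vop n a (D.state b' 0)"
      unfolding Es D.diamond_v[OF that] distrib_left scl_mult_right ..
    finally show ?thesis unfolding S_def left_diff_distrib Es by (simp add: scl_diff_left)
  qed
  have m0: "rat_of_int m \<noteq> 0" using m1 by simp
  have d: "d = (if b then rat_of_int m else - rat_of_int m)" by (simp add: d_def m_def)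
  have d0: "d \<noteq> 0" using m0 d by simp
  have stay: "D.stay_val b - 1 = 1 / d" "D.stay_val (\<not> b) - 1 = - (1 / d)"
    using m0 unfolding d D.stay_val_def by (cases b; simp add: diff_divide_distrib add_divide_distrib)+
  have b1: "D.state b 0 \<in> Paths n" using q ls unfolding st Paths_def by simp
  have vv: "v1 = vop n a (D.state b 0)" "v2 = vop n a (D.state (\<not> b) 0)" unfolding v1_def v2_def st by simp_all
  have S1: "S * v1 = D.swap_val b *\<^sub>Q v2 + (1 / d) *\<^sub>Q v1" using U[OF b1] unfolding vv stay .
  have "S * (S * v1) = v1"
  proof (cases "D.state (\<not> b) 0 \<in> Paths n")
    case True
    have S2: "S * v2 = D.swap_val (\<not> b) *\<^sub>Q v1 + (- (1 / d)) *\<^sub>Q v2"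
      using U[OF True] unfolding vv stay by simp
    have "S * (S * v1) = (D.swap_val b * D.swap_val (\<not> b) + 1 / d * (1 / d)) *\<^sub>Q v1"
      unfolding S1 distrib_left scl_mult_right S2 by (simp add: scl_add_right scl_diff_right scl_add_left scl_minus_left mult.commute)
    also have "D.swap_val b * D.swap_val (\<not> b) + 1 / d * (1 / d) = 1"
      unfolding D.swap_val d by (simp add: power2_eq_square)
    finally show ?thesis by simp
  next
    case False
    \<comment> \<open>The exchanged order can fail only if it starts with a down block at the lowest
      level, that is, for \<open>m = 1\<close>.\<close>
    have bT: "b"
    proof (rule ccontr)
      assume "\<not> b"
      then show False using False D.state_Paths[of 0 True] p_ge by simp
    qed
    have "m = 1"
    proof (rule ccontr)
      assume "m \<noteq> 1"
      then have "int p * 2 \<le> int p * m" using m1 by (intro mult_left_mono) auto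
      then have h: "int p \<le> ht ?ys" using hys p_ge by linarith
      have 1: "valid (replicate p False @ ?ys)" by (rule valid_replicate[OF vys]) (use h in simp)
      have 2: "valid (replicate p True @ replicate p False @ ?ys)" by (rule valid_replicate[OF 1]) simp
      have "valid (?xs @ replicate p True @ replicate p False @ ?ys)" by (rule D.valid_xs[OF 2]) (simp add: ht_append)
      then show False using False bT ls unfolding st e Paths_def by (simp add: e[symmetric])
    qed
    then have "d = 1" using bT d by simp
    moreover have "v2 = 0" unfolding vv(2) using False by (simp add: vop_def pr_def)
    ultimately show ?thesis using S1 by simp
  qed
  then show ?thesis using d0 S1 by (metis add.commute)
qed

text \<open>The argument of \<open>L_e\<close> on block paths. It covers all lists of length
  \<open>N\<close>, the vector being zero where there is no path, so the induction hypothesis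
  applies to the exchanged blocks directly.\<close>

lemma frakL_vop:
  assumes "1 \<le> i" and "i \<le> N" and "length bs = N"
  shows "Lam n (frakL p n i) * vop n a (shp c bs) = of_int (content (tab bs) i) *\<^sub>Q vop n a (shp c bs)"
  using assms
proof (induction i arbitrary: bs rule: dec_induct)
  case base
  show ?case
  proof (cases "valid (shp c bs)")
    case True
    have i: "1 \<in> {1..N}" using base by simp
    obtain xs b ys where e: "bs = xs @ b # ys" "1 = Suc (length ys)" by (rule split_path[OF base(2) i])
    have "valid (blocks p bs @ replicate (p - 1) True)" using True valid_appendD unfolding shp_def by blast
    then have "valid bs" using valid_blocks[of p bs] p_ge by simp
    then have "valid (b # ys)" using valid_appendD unfolding e(1) by blast
    then have "b" using e(2) by (cases b) simp_all
    then have "content (tab bs) 1 = 0" using content_tab[of xs b ys] e by (simp add: step_content_def)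
    then show ?thesis using Lam_zero[of n] by simp
  next
    case False
    then show ?thesis by (simp add: v_invalid)
  qed
next
  case (step i)
  show ?case
  proof (cases "valid (shp c bs)")
    case False
    then show ?thesis by (simp add: v_invalid)
  next
    case True
    have "Suc i \<in> {1..N}" using step.prems by simp
    then obtain cs c2 zs where e1: "bs = cs @ c2 # zs" "Suc i = Suc (length zs)" by (rule split_path[OF step.prems(2)])
    obtain b ys where e2: "zs = b # ys" using e1(2) step.hyps by (cases zs) auto
    have e: "bs = cs @ c2 # b # ys" "i = Suc (length ys)" using e1 e2 by simp_all
    have l: "Suc (length ys) < N" "length cs + length ys + 2 = N" using step.prems e by simp_all
    have "valid (blocks p bs @ replicate (p - 1) True)" using True valid_appendD unfolding shp_def by blast
    then have "valid bs" using valid_blocks[of p bs] p_ge by simp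
    then have vys: "valid ys" using valid_appendD[of "cs @ [c2, b]" ys] unfolding e by simp
    have ci: "content (tab bs) i = step_content b ys" using content_tab[of "cs @ [c2]" b ys] unfolding e by simp
    have cSi: "content (tab bs) (Suc i) = step_content c2 (b # ys)" using content_tab[of cs c2 "b # ys"] unfolding e by simp
    let ?S = "Lam n (bigU p n (Suc (length ys))) - E" and ?v = "vop n a (shp c bs)"
    have L: "Lam n (frakL p n (Suc i)) = ?S * Lam n (frakL p n i) * ?S + ?S"
      unfolding e(2) by (rule frakL_Suc) simp
    have Lv: "Lam n (frakL p n i) * ?v = of_int (step_content b ys) *\<^sub>Q ?v"
      using step.IH step.prems unfolding ci[symmetric] by simp
    show ?thesis
    proof (cases "c2 = b")
      case same: True
      have "Lam n (bigU p n (Suc (length ys))) * ?v = 0"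
        unfolding e(1) same by (rule bigU_same[OF l]) (use True e(1) same in simp)
      then have S: "?S * ?v = - ?v" unfolding left_diff_distrib E_shp by simp
      have "(?S * Lam n (frakL p n i) * ?S + ?S) * ?v = (of_int (step_content b ys) + (-1)) *\<^sub>Q ?v"
        by (rule jm_step[OF _ _ Lv, where d = "-1" and x = 0]) (use S in \<open>simp_all add: scl_minus_left\<close>)
      moreover have "step_content c2 (b # ys) = step_content b ys + (-1)" using same by (simp add: step_content_def)
      ultimately show ?thesis unfolding L cSi by simp
    next
      case False
      then have c2: "c2 = (\<not> b)" by auto
      let ?d = "if b then rat_of_int (ht ys + 1) else - rat_of_int (ht ys + 1)"
      let ?bs' = "cs @ b # (\<not> b) # ys"
      have vb: "valid (shp c (cs @ (\<not> b) # b # ys))" using True unfolding e(1) c2 .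
      obtain s where d0: "?d \<noteq> 0" and S: "?S * ?v = (1 / ?d) *\<^sub>Q ?v + s *\<^sub>Q vop n a (shp c ?bs')"
        and SS: "?S * (?S * ?v) = ?v"
        using bigU_swap[OF l vb vys] unfolding e(1) c2 by blast
      have diff: "rat_of_int (step_content c2 (b # ys)) = of_int (step_content b ys) + ?d"
        unfolding c2 using ht_count[of ys] by (cases b) (simp_all add: step_content_def)
      have "content (tab ?bs') i = step_content (\<not> b) ys"
        using content_tab[of "cs @ [b]" "\<not> b" ys] unfolding e(2) by simp
      moreover have "step_content (\<not> b) ys = step_content c2 (b # ys)"
        unfolding c2 by (cases b) (simp_all add: step_content_def)
      moreover have "length ?bs' = N" using l(2) by simp
      ultimately have "Lam n (frakL p n i) * vop n a (shp c ?bs') = (of_int (step_content b ys) + ?d) *\<^sub>Q vop n a (shp c ?bs')"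
        using step.IH[of ?bs'] step.prems unfolding diff[symmetric] by simp
      then have Lx: "Lam n (frakL p n i) * (s *\<^sub>Q vop n a (shp c ?bs')) = (of_int (step_content b ys) + ?d) *\<^sub>Q (s *\<^sub>Q vop n a (shp c ?bs'))"
        by (simp only: scl_mult_right scl_scl mult.commute)
      show ?thesis unfolding L cSi diff by (rule jm_step[OF SS S Lv Lx d0])
    qed
  qed
qed

end

text \<open>Beyond the first element the recursion ends on the right in \<open>bigU\<close> minus
  \<open>e_idem\<close>, and both have a rightmost factor \<open>e_idem\<close>, which kills units
  outside the class.\<close>

lemma frakL_not_cls:
  assumes q: "q \<in> Paths n" "\<not> cls p q" and n: "class_action p n N r" and i: "i \<le> N"
  shows "Lam n (frakL p n i) * mu n q q = 0"
proof (cases "i \<le> 1")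
  case True
  then have "i = 0 \<or> i = 1" by auto
  then show ?thesis using Lam_zero[of n] by auto
next
  case False
  then obtain k where k: "i = Suc k" "1 \<le> k" by (cases i) auto
  interpret class_action p n N r q by (rule n)
  have E: "E * mu n q q = 0" using e_idem_mu[OF pr_refl[OF q(1)], of p] q(2) by simp
  have "Lam n (bigU p n k) * mu n q q = 0"
    using bigU_act[of k "mu n q q"] k i by (simp add: E diamond_0)
  then have "(Lam n (bigU p n k) - E) * mu n q q = 0" using E by (simp add: left_diff_distrib)
  moreover have "k \<noteq> 0" using k(2) by simp
  note frakL_Suc[OF this, of n p]
  ultimately show ?thesis unfolding k(1) by (simp only: distrib_right mult.assoc mult_zero_right add_0_left)
qed

theorem theorem6p8:
  fixes p n n1 n2 r0 i :: nat and \<mu> :: shape and t a s :: tableau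
  assumes "prime p" and "odd p" and "n \<ge> p"
    and "n = (p - 1) + n1" and "n1 = p * n2 + r0" and "r0 < p" and "n2 > 1"
    and "\<mu> \<in> Par2 n" and "t \<in> Std n \<mu>" and "a \<in> Std n \<mu>"
    and "t \<in> col_class p n" and "a \<in> col_class p n"
    and "s = f_map p n2 t"
    and "i \<in> {1..n2}"
  shows "frakL p n i \<otimes>\<^bsub>TLQ n\<^esub> f_basis n t a = of_int (content s i) \<odot>\<^bsub>TLQ n\<^esub> f_basis n t a
       \<and> f_basis n a t \<otimes>\<^bsub>TLQ n\<^esub> frakL p n i = of_int (content s i) \<odot>\<^bsub>TLQ n\<^esub> f_basis n a t"
proof -
  have p3: "3 \<le> p" using prime_ge_2_nat[OF assms(1)] assms(2) by (cases "p = 2") auto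
  have CA: "class_action p n n2 r0"
    by (rule class_action.intro) (use assms(2,4,5,6) p3 in simp_all)
  define q where "q = word t n"
  define b where "b = word a n"
  have tab: "t = tab q" "a = tab b" using Std_tab[OF assms(8,9)] Std_tab[OF assms(8,10)] by (simp_all add: q_def b_def)
  have qb: "pr n q b" "pr n b q" using Std_pr[OF assms(8,9,10)] Std_pr[OF assms(8,10,9)] by (simp_all add: q_def b_def)
  then have P: "q \<in> Paths n" "b \<in> Paths n" by (simp_all add: pr_def)
  have form: "\<exists>c bs. length bs = n2 \<and> r = replicate r0 c @ blocks p bs @ replicate (p - 1) True"
    if "r \<in> Paths n" "cls p r" for r
    by (rule cls_structure) (use that assms(4,5,6) p3 in \<open>simp_all add: Paths_def\<close>)
  have "cls p q" using assms(11) col_class_tab[OF P(1)] unfolding tab by blast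
  then obtain c bs where bs: "length bs = n2" "q = replicate r0 c @ blocks p bs @ replicate (p - 1) True"
    using form[OF P(1)] by blast
  have s: "s = tab bs" unfolding assms(13) tab bs(1)[symmetric] by (rule f_map_blocks[OF _ P(1) bs(2)]) (use p3 in simp)
  have L: "Lam n (frakL p n i) * Fop n r d = of_int (content (tab ds) i) *\<^sub>Q Fop n r d"
    if "pr n r d" "r = replicate r0 k @ blocks p ds @ replicate (p - 1) True" "length ds = n2" for r d k ds
  proof -
    interpret class_action p n n2 r0 d by (rule CA)
    have "1 \<le> i" "i \<le> n2" using assms(14) by simp_all
    from frakL_vop[OF this that(3), of k] show ?thesis
      using that(1) unfolding shp_def that(2)[symmetric] by (simp add: vop_def)
  qed
  obtain x y where F: "\<And>r d. pr n r d \<Longrightarrow> Fop n r d = (x r * y d) *\<^sub>Q mu n r d"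
    and xy: "\<And>r. r \<in> Paths n \<Longrightarrow> x r \<noteq> 0 \<and> y r \<noteq> 0" using Fop_mu[of n] by blast
  have diag: "Lam n (frakL p n i) * mu n r r = of_int (content (tab ds) i) *\<^sub>Q mu n r r"
    if r: "r \<in> Paths n" "r = replicate r0 k @ blocks p ds @ replicate (p - 1) True" "length ds = n2" for r k ds
  proof (rule scl_cancel)
    show "x r * y r \<noteq> 0" using xy[OF r(1)] by simp
    show "(x r * y r) *\<^sub>Q (Lam n (frakL p n i) * mu n r r) = (x r * y r) *\<^sub>Q (of_int (content (tab ds) i) *\<^sub>Q mu n r r)"
      using L[OF pr_refl[OF r(1)] r(2,3)] unfolding F[OF pr_refl[OF r(1)]] by (simp add: mult.commute)
  qed
  \<comment> \<open>This prepares the right action: the left eigenvalue on a diagonal unit is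
    inserted behind \<open>mu n b q\<close>, and multiplication of units leaves only the term
    \<open>r = q\<close>.\<close>
  have off: "mu n b q * (Lam n (frakL p n i) * mu n r r) = (if r = q then of_int (content s i) *\<^sub>Q mu n b q else 0)"
    if r: "r \<in> Paths n" for r
  proof (cases "cls p r")
    case True
    obtain k ds where ds: "length ds = n2" "r = replicate r0 k @ blocks p ds @ replicate (p - 1) True"
      using form[OF r True] by blast
    show ?thesis
    proof (cases "r = q")
      case True
      show ?thesis unfolding True diag[OF P(1) bs(2,1)] s
        using mu_mult[OF qb(2) pr_refl[OF P(1)]] by simp
    next
      case False
      show ?thesis unfolding diag[OF r ds(2,1)] using mu_mult[OF qb(2) pr_refl[OF r]] False by simp
    qed
  next
    case False
    then have "r \<noteq> q" using \<open>cls p q\<close> by blast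
    then show ?thesis using frakL_not_cls[OF r False CA, of i] assms(14) by simp
  qed
  have "mu n b q * Lam n (frakL p n i) = (\<Sum>r\<in>Paths n. mu n b q * (Lam n (frakL p n i) * mu n r r))"
    using mu_complete[OF unit_op_right[OF frakL_carrier[of p n i]]] by (metis sum_distrib_left)
  also have "\<dots> = (\<Sum>r\<in>Paths n. if r = q then of_int (content s i) *\<^sub>Q mu n b q else 0)"
    by (rule sum.cong[OF refl off])
  also have "\<dots> = of_int (content s i) *\<^sub>Q mu n b q" using P(1) by (simp add: sum.delta)
  finally have R: "mu n b q * Lam n (frakL p n i) = of_int (content s i) *\<^sub>Q mu n b q" .
  show ?thesis
  proof
    show "frakL p n i \<otimes>\<^bsub>TLQ n\<^esub> f_basis n t a = of_int (content s i) \<odot>\<^bsub>TLQ n\<^esub> f_basis n t a"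
    proof (rule Lam_inj[OF TL_mult_closed TL_smult_closed[OF f_basis_carrier]])
      show "Lam n (frakL p n i \<otimes>\<^bsub>TLQ n\<^esub> f_basis n t a) = Lam n (of_int (content s i) \<odot>\<^bsub>TLQ n\<^esub> f_basis n t a)"
        using L[OF qb(1) bs(2,1)] unfolding Lam_mult Lam_smult tab s Fop_def .
    qed
    show "f_basis n a t \<otimes>\<^bsub>TLQ n\<^esub> frakL p n i = of_int (content s i) \<odot>\<^bsub>TLQ n\<^esub> f_basis n a t"
    proof (rule Lam_inj[OF TL_mult_closed TL_smult_closed[OF f_basis_carrier]])
      have "Fop n b q * Lam n (frakL p n i) = of_int (content s i) *\<^sub>Q Fop n b q"
        unfolding F[OF qb(2)] scl_mult_left R by (simp add: mult.commute)
      then show "Lam n (f_basis n a t \<otimes>\<^bsub>TLQ n\<^esub> frakL p n i) = Lam n (of_int (content s i) \<odot>\<^bsub>TLQ n\<^esub> f_basis n a t)"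
        unfolding Lam_mult Lam_smult tab Fop_def .
    qed
  qed
qed

end
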